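(* Let $(M^{2n+1},T^{1,0})$ be a CR manifold. Then, with the morphisms specified in the context, $$0\to H_R^0(M;\mathbb R)\to H_R^{0,0}(M)\to H_R^0(M;\mathscr P)\to H_R^1(M;\mathbb R)\to H_R^{0,1}(M)\to H_R^1(M;\mathscr P)\to H_R^2(M;\mathbb R)\to\cdots$$ is a CR invariant (i.e. independent of any choice of contact form) long exact sequence.
   Context: CR manifolds. A CR manifold $(M^{2n+1},T^{1,0})$ is a connected real $(2n+1)$-manifold with a complex rank $n$ distribution $T^{1,0}\subset TM\otimes\mathbb C$ such that, with $T^{0,1}:=\overline{T^{1,0}}$, one has $T^{1,0}\cap T^{0,1}=\{0\}$, $[T^{1,0},T^{1,0}]\subset T^{1,0}$, and, for every real one-form $\theta$ on an open set $U$ with $\ker\theta=H|_U$, where $H:=\operatorname{Re}(T^{1,0}\oplus T^{0,1})$, the Levi form $L(Z,W):=-i\,d\theta(Z,\overline W)$ is a nondegenerate hermitian form on $T^{1,0}|_U$. Such a $\theta$ is called a local contact form; its Reeb vector field $T$ is determined by $\theta(T)=1$, $d\theta(T,\cdot)=0$. Rumin complex. Let $\mathscr A^k$ be the sheaf of smooth real $k$-forms. For $k\le n$ put $\mathscr R^k:=\{\omega\in\mathscr A^k:\theta\wedge\omega\wedge d\theta^{n+1-k}=0,\ \theta\wedge d\omega\wedge d\theta^{n-k}=0\}$; for $k\ge n+1$ put $\mathscr R^k:=\{\omega\in\mathscr A^k:\theta\wedge\omega=0,\ \theta\wedge d\omega=0\}$, $\theta$ any local contact form (the choice is irrelevant).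 Then $d(\mathscr R^k)\subset\mathscr R^{k+1}$. Let $\mathcal R^k$ be the global sections ($0$ outside $0\le k\le2n+1$) and $H_R^k(M;\mathbb R)$ the $k$-th cohomology of $(\mathcal R^\bullet,d)$. Bigrading. Let $\mathscr R^k_{\mathbb C}:=\mathscr R^k\otimes\mathbb C$, $H_{\mathbb C}:=H\otimes\mathbb C$ and $\Lambda^{p,q}:=\Lambda^p(T^{1,0})^*\otimes\Lambda^q(T^{0,1})^*$. For $p\in\{0,\dots,n+1\}$, $q\in\{0,\dots,n\}$ put $\mathscr R^{p,q}:=\{\omega\in\mathscr R^{p+q}_{\mathbb C}:\omega|_{H_{\mathbb C}}\text{ is a section of }\Lambda^{p,q}\}$ if $p+q\le n$, and $\mathscr R^{p,q}:=\{\omega\in\mathscr R^{p+q}_{\mathbb C}:(T\lrcorner\omega)|_{H_{\mathbb C}}\text{ is a section of }\Lambda^{p-1,q}\}$ if $p+q\ge n+1$; put $\mathscr R^{p,q}=0$ for other $p,q$. Then $\mathscr R^k_{\mathbb C}=\bigoplus_{p+q=k}\mathscr R^{p,q}$, with projections $\pi^{p,q}$. Set $\bar\partial_b:=\pi^{p,q+1}\circ d$ on $\mathscr R^{p,q}$; $\bar\partial_b^2=0$. Let $\mathcal R^{p,q}$ be the global sections of $\mathscr R^{p,q}$ and $H_R^{p,q}(M):=\ker(\bar\partial_b\colon\mathcal R^{p,q}\to\mathcal R^{p,q+1})/\operatorname{im}(\bar\partial_b\colon\mathcal R^{p,q-1}\to\mathcal R^{p,q})$. CR pluriharmonic complex.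 For $0\le k\le 2n$ put $\mathscr S^0:=\mathscr R^0$; $\mathscr S^k:=\operatorname{Re}\bigoplus_{j=1}^k\mathscr R^{j,k+1-j}$ (the real forms in this sum) for $1\le k\le n-1$; $\mathscr S^k:=\mathscr R^{k+1}$ for $k\ge n$. Define $D\colon\mathscr S^k\to\mathscr S^{k+1}$ by $D:=i\,d\bar\partial_b$ for $k=0$ and $D:=d$ for $k\ge1$. Let $\mathcal S^k$ be the global sections ($0$ outside $0\le k\le2n$) and $H_R^k(M;\mathscr P):=\ker(D\colon\mathcal S^k\to\mathcal S^{k+1})/\operatorname{im}(D\colon\mathcal S^{k-1}\to\mathcal S^k)$. ($\mathscr P:=\ker(D\colon\mathscr S^0\to\mathscr S^1)$ is the sheaf of CR pluriharmonic functions.) Morphisms. $H_R^k(M;\mathbb R)\to H_R^{0,k}(M)$ is $[\omega]\mapsto[i\pi^{0,k}\omega]$. $H_R^{0,k}(M)\to H_R^k(M;\mathscr P)$ is $f\mapsto\operatorname{Re}f$ if $k=0$ and $[\omega]\mapsto[-\operatorname{Im}d\omega]$ if $k\ge1$. $H_R^k(M;\mathscr P)\to H_R^{k+1}(M;\mathbb R)$ is $u\mapsto[-\operatorname{Im}\bar\partial_bu]$ if $k=0$ and $[\omega]\mapsto[\omega]$ if $k\ge1$. These are well-defined. *)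

theory Defs
  imports
    "HOL-Analysis.Analysis"
    "HOL-Algebra.Exact_Sequence"
    "HOL-Combinatorics.Permutations"
    "HOL-Library.Function_Algebras"
begin

section \<open>Smooth functions and smooth manifolds\<close>

text \<open>\<open>Ck_on k S\<close> and \<open>smooth_on S\<close> are only used for open \<open>S\<close>.\<close>

fun Ck_on :: "nat \<Rightarrow> 'a::euclidean_space set \<Rightarrow> ('a \<Rightarrow> 'b::real_normed_vector) \<Rightarrow> bool" where
  "Ck_on 0 S f \<longleftrightarrow> continuous_on S f"
| "Ck_on (Suc k) S f \<longleftrightarrow>
     f differentiable_on S \<and> (\<forall>v. Ck_on k S (\<lambda>x. frechet_derivative f (at x) v))"

definition smooth_on :: "'a::euclidean_space set \<Rightarrow> ('a \<Rightarrow> 'b::real_normed_vector) \<Rightarrow> bool" where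
  "smooth_on S f \<longleftrightarrow> (\<forall>k. Ck_on k S f)"

text \<open>A chart is a pair of its domain and its coordinate map; the values of the coordinate map
  outside the domain are irrelevant. The manifold is the whole type \<open>'m\<close>.\<close>

type_synonym ('m, 'd) chart = "'m set \<times> ('m \<Rightarrow> real ^ 'd)"

definition chart_inv :: "('m, 'd::finite) chart \<Rightarrow> real ^ 'd \<Rightarrow> 'm" where
  "chart_inv c = inv_into (fst c) (snd c)"

definition smooth_atlas ::
    "('m::{t2_space, second_countable_topology}, 'd::finite) chart set \<Rightarrow> bool" where
  "smooth_atlas A \<longleftrightarrow>
     (\<Union>c\<in>A. fst c) = UNIV \<and>
     (\<forall>c\<in>A. open (fst c) \<and> open (snd c ` fst c) \<and>
            homeomorphism (fst c) (snd c ` fst c) (snd c) (chart_inv c)) \<and>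
     (\<forall>c\<in>A. \<forall>c'\<in>A. smooth_on (snd c ` (fst c \<inter> fst c')) (snd c' \<circ> chart_inv c))"


section \<open>Complexified tangent vectors in coordinates\<close>

text \<open>In a chart \<open>c\<close> around \<open>p\<close>, the space $T_pM\otimes\mathbb C$ is \<open>complex ^ 'd\<close>. Every tensorial
  object below is a family indexed by the charts \<open>c\<close> of the atlas and the points \<open>p\<close> in the domain
  of \<open>c\<close>, transforming by the complexified Jacobians \<open>jac\<close> of the coordinate changes.\<close>

definition cvec :: "real ^ 'd::finite \<Rightarrow> complex ^ 'd" where
  "cvec v = (\<chi> i. complex_of_real (v $ i))"

definition vRe :: "complex ^ 'd::finite \<Rightarrow> real ^ 'd" where
  "vRe v = (\<chi> i. Re (v $ i))"

definition vIm :: "complex ^ 'd::finite \<Rightarrow> real ^ 'd" where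
  "vIm v = (\<chi> i. Im (v $ i))"

definition vcnj :: "complex ^ 'd::finite \<Rightarrow> complex ^ 'd" where
  "vcnj v = (\<chi> i. cnj (v $ i))"

definition jac :: "('m, 'd::finite) chart \<Rightarrow> ('m, 'd) chart \<Rightarrow> 'm \<Rightarrow> complex ^ 'd \<Rightarrow> complex ^ 'd" where
  "jac c c' p v =
     (let J = frechet_derivative (snd c' \<circ> chart_inv c) (at (snd c p))
      in cvec (J (vRe v)) + \<i> *s cvec (J (vIm v)))"

text \<open>The derivative at \<open>p\<close> of a complex function on \<open>'m\<close> along the complex vector whose
  components in the chart \<open>c\<close> are \<open>v\<close>.\<close>

definition ddir :: "('m, 'd::finite) chart \<Rightarrow> ('m \<Rightarrow> complex) \<Rightarrow> 'm \<Rightarrow> complex ^ 'd \<Rightarrow> complex" where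
  "ddir c f p v =
     (let D = frechet_derivative (f \<circ> chart_inv c) (at (snd c p))
      in D (vRe v) + \<i> * D (vIm v))"

definition smooth_in :: "('m, 'd::finite) chart \<Rightarrow> 'm set \<Rightarrow> ('m \<Rightarrow> 'b::real_normed_vector) \<Rightarrow> bool" where
  "smooth_in c V f \<longleftrightarrow> smooth_on (snd c ` V) (f \<circ> chart_inv c)"

definition bracket ::
    "('m, 'd::finite) chart \<Rightarrow> ('m \<Rightarrow> complex ^ 'd) \<Rightarrow> ('m \<Rightarrow> complex ^ 'd) \<Rightarrow> 'm \<Rightarrow> complex ^ 'd" where
  "bracket c Z W p = (\<chi> i. ddir c (\<lambda>q. W q $ i) p (Z p) - ddir c (\<lambda>q. Z q $ i) p (W p))"


section \<open>Exterior algebra at a point\<close>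

text \<open>Alternating forms are functions on lists of vectors; a $k$-form vanishes on all lists whose
  length is not $k$.\<close>

definition alt_forms :: "nat \<Rightarrow> ((complex ^ 'd::finite) list \<Rightarrow> complex) set" where
  "alt_forms k = {\<alpha>.
     (\<forall>vs. length vs \<noteq> k \<longrightarrow> \<alpha> vs = 0) \<and>
     (\<forall>vs i. length vs = k \<and> i < k \<longrightarrow> Vector_Spaces.linear (*s) (*) (\<lambda>v. \<alpha> (vs[i := v]))) \<and>
     (\<forall>vs i j. length vs = k \<and> i < j \<and> j < k \<and> vs ! i = vs ! j \<longrightarrow> \<alpha> vs = 0)}"

text \<open>If \<open>\<alpha>\<close> and \<open>\<beta>\<close> are homogeneous of degrees $a$ and $b$, only the summand \<open>k = a\<close> on lists of
  length $a+b$ is nonzero, and this is the usual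
  $\frac1{a!b!}\sum_\sigma \mathrm{sgn}(\sigma)\,\alpha(v_{\sigma(1)},\dots)\,\beta(\dots,v_{\sigma(a+b)})$.\<close>

definition wedge :: "('v list \<Rightarrow> complex) \<Rightarrow> ('v list \<Rightarrow> complex) \<Rightarrow> 'v list \<Rightarrow> complex" where
  "wedge \<alpha> \<beta> vs =
     (\<Sum>k\<le>length vs.
        (\<Sum>\<sigma> | \<sigma> permutes {..<length vs}.
           of_int (sign \<sigma>) * \<alpha> (map (\<lambda>i. vs ! \<sigma> i) [0..<k])
                           * \<beta> (map (\<lambda>i. vs ! \<sigma> i) [k..<length vs]))
        / (fact k * fact (length vs - k)))"

definition wedge_one :: "'v list \<Rightarrow> complex" where
  "wedge_one vs = (if vs = [] then 1 else 0)"

primrec wedge_power :: "('v list \<Rightarrow> complex) \<Rightarrow> nat \<Rightarrow> 'v list \<Rightarrow> complex" where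
  "wedge_power \<alpha> 0 = wedge_one"
| "wedge_power \<alpha> (Suc m) = wedge \<alpha> (wedge_power \<alpha> m)"

text \<open>For complementary subspaces \<open>V\<close>, \<open>W\<close> of some $X \subseteq \mathbb C^d$: the space
  $\Lambda^pV^*\otimes\Lambda^qW^*$ inside the forms on $X$, where $V^*$ (resp. $W^*$) is the space of
  covectors annihilating \<open>W\<close> (resp. \<open>V\<close>); elements are given by forms on the ambient space, to be
  restricted to $X$. For \<open>p < 0\<close> it is zero.\<close>

definition Lambda_pq ::
    "(complex ^ 'd::finite) set \<Rightarrow> (complex ^ 'd) set \<Rightarrow> int \<Rightarrow> int \<Rightarrow> ((complex ^ 'd) list \<Rightarrow> complex) set" where
  "Lambda_pq V W p q =
     module.span (\<lambda>a \<alpha> vs. a * \<alpha> vs)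
       {foldr wedge (as @ bs) wedge_one | as bs.
          int (length as) = p \<and> int (length bs) = q \<and>
          (\<forall>\<alpha>\<in>set as. \<alpha> \<in> alt_forms 1 \<and> (\<forall>w\<in>W. \<alpha> [w] = 0)) \<and>
          (\<forall>\<beta>\<in>set bs. \<beta> \<in> alt_forms 1 \<and> (\<forall>v\<in>V. \<beta> [v] = 0))}"


section \<open>Differential forms\<close>

type_synonym ('m, 'd) form = "('m, 'd) chart \<Rightarrow> 'm \<Rightarrow> (complex ^ 'd) list \<Rightarrow> complex"

text \<open>Smooth complex-valued \<open>k\<close>-forms on the open set \<open>U\<close>, extended by zero.\<close>

definition forms :: "('m, 'd::finite) chart set \<Rightarrow> 'm set \<Rightarrow> nat \<Rightarrow> ('m, 'd) form set" where
  "forms A U k = {\<omega>.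
     (\<forall>c p. c \<notin> A \<or> p \<notin> U \<inter> fst c \<longrightarrow> \<omega> c p = 0) \<and>
     (\<forall>c\<in>A. \<forall>p\<in>U \<inter> fst c. \<omega> c p \<in> alt_forms k) \<and>
     (\<forall>c\<in>A. \<forall>c'\<in>A. \<forall>p\<in>U \<inter> fst c \<inter> fst c'. \<forall>vs. \<omega> c p vs = \<omega> c' p (map (jac c c' p) vs)) \<and>
     (\<forall>c\<in>A. \<forall>vs. smooth_in c (U \<inter> fst c) (\<lambda>p. \<omega> c p vs))}"

text \<open>The coordinate formula
  $d\omega(v_0,\dots,v_k)=\sum_i(-1)^i\,v_i\bigl(\omega(v_0,\dots,\widehat{v_i},\dots,v_k)\bigr)$ for constant
  $v_i$. For a form on \<open>U\<close> extended by zero it is meaningful at the points of \<open>U\<close>.\<close>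

definition ext_d :: "('m, 'd::finite) form \<Rightarrow> ('m, 'd) form" where
  "ext_d \<omega> c p vs =
     (if p \<in> fst c
      then \<Sum>i<length vs. (-1) ^ i * ddir c (\<lambda>q. \<omega> c q (take i vs @ drop (Suc i) vs)) p (vs ! i)
      else 0)"

definition fscale :: "complex \<Rightarrow> ('m, 'd::finite) form \<Rightarrow> ('m, 'd) form" where
  "fscale a \<omega> c p vs = a * \<omega> c p vs"

definition fcnj :: "('m, 'd::finite) form \<Rightarrow> ('m, 'd) form" where
  "fcnj \<omega> c p vs = cnj (\<omega> c p (map vcnj vs))"

definition fRe :: "('m, 'd::finite) form \<Rightarrow> ('m, 'd) form" where
  "fRe \<omega> = fscale (1 / 2) (\<omega> + fcnj \<omega>)"

definition fIm :: "('m, 'd::finite) form \<Rightarrow> ('m, 'd) form" where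
  "fIm \<omega> = fscale (1 / (2 * \<i>)) (\<omega> - fcnj \<omega>)"

text \<open>Real forms are identified with their complex multilinear extensions.\<close>

definition real_form :: "('m, 'd::finite) form \<Rightarrow> bool" where
  "real_form \<omega> \<longleftrightarrow> fcnj \<omega> = \<omega>"


section \<open>CR manifolds\<close>

text \<open>\<open>T c p\<close> is the fibre of $T^{1,0}$ at \<open>p\<close> in the chart \<open>c\<close>.\<close>

type_synonym ('m, 'd) distribution = "('m, 'd) chart \<Rightarrow> 'm \<Rightarrow> (complex ^ 'd) set"

definition T01 :: "('m, 'd::finite) distribution \<Rightarrow> ('m, 'd) distribution" where
  "T01 T c p = vcnj ` T c p"

definition HC :: "('m, 'd::finite) distribution \<Rightarrow> ('m, 'd) distribution" where
  "HC T c p = {Z + W | Z W. Z \<in> T c p \<and> W \<in> T01 T c p}"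

definition HR :: "('m, 'd::finite) distribution \<Rightarrow> ('m, 'd) chart \<Rightarrow> 'm \<Rightarrow> (real ^ 'd) set" where
  "HR T c p = {v. cvec v \<in> HC T c p}"

definition contact_form ::
    "('m::topological_space, 'd::finite) chart set \<Rightarrow> ('m, 'd) distribution \<Rightarrow> 'm set \<Rightarrow> ('m, 'd) form \<Rightarrow> bool" where
  "contact_form A T U \<theta> \<longleftrightarrow>
     open U \<and> \<theta> \<in> forms A U 1 \<and> real_form \<theta> \<and>
     (\<forall>c\<in>A. \<forall>p\<in>U \<inter> fst c. {v. \<theta> c p [cvec v] = 0} = HR T c p)"

definition levi ::
    "('m, 'd::finite) form \<Rightarrow> ('m, 'd) chart \<Rightarrow> 'm \<Rightarrow> complex ^ 'd \<Rightarrow> complex ^ 'd \<Rightarrow> complex" where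
  "levi \<theta> c p Z W = - \<i> * ext_d \<theta> c p [Z, vcnj W]"

definition smooth_distribution ::
    "nat \<Rightarrow> ('m::topological_space, 'd::finite) chart set \<Rightarrow> ('m, 'd) distribution \<Rightarrow> bool" where
  "smooth_distribution n A T \<longleftrightarrow>
     (\<forall>c\<in>A. \<forall>p\<in>fst c. vec.subspace (T c p) \<and> vec.dim (T c p) = n) \<and>
     (\<forall>c\<in>A. \<forall>c'\<in>A. \<forall>p\<in>fst c \<inter> fst c'. jac c c' p ` T c p = T c' p) \<and>
     (\<forall>c\<in>A. \<forall>p\<in>fst c. \<exists>V Z. open V \<and> p \<in> V \<and> V \<subseteq> fst c \<and>
        (\<forall>i<n. smooth_in c V (Z i)) \<and>
        (\<forall>q\<in>V. vec.span ((\<lambda>i. Z i q) ` {..<n}) = T c q))"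

definition cr_manifold ::
    "nat \<Rightarrow> ('m::{t2_space, second_countable_topology}, 'd::finite) chart set \<Rightarrow> ('m, 'd) distribution \<Rightarrow> bool" where
  "cr_manifold n A T \<longleftrightarrow>
     CARD('d) = 2 * n + 1 \<and> connected (UNIV :: 'm set) \<and> smooth_atlas A \<and>
     smooth_distribution n A T \<and>
     (\<forall>c\<in>A. \<forall>p\<in>fst c. T c p \<inter> T01 T c p = {0}) \<and>
     (\<forall>c\<in>A. \<forall>V Z W. open V \<and> V \<subseteq> fst c \<and> smooth_in c V Z \<and> smooth_in c V W \<and>
        (\<forall>p\<in>V. Z p \<in> T c p \<and> W p \<in> T c p) \<longrightarrow> (\<forall>p\<in>V. bracket c Z W p \<in> T c p)) \<and>
     (\<forall>U \<theta>. contact_form A T U \<theta> \<longrightarrow> (\<forall>c\<in>A. \<forall>p\<in>U \<inter> fst c.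
        (\<forall>Z\<in>T c p. \<forall>W\<in>T c p. levi \<theta> c p W Z = cnj (levi \<theta> c p Z W)) \<and>
        (\<forall>Z\<in>T c p. (\<forall>W\<in>T c p. levi \<theta> c p Z W = 0) \<longrightarrow> Z = 0)))"

definition reeb :: "('m, 'd::finite) form \<Rightarrow> ('m, 'd) chart \<Rightarrow> 'm \<Rightarrow> real ^ 'd" where
  "reeb \<theta> c p = (THE v. \<theta> c p [cvec v] = 1 \<and> (\<forall>w. ext_d \<theta> c p [cvec v, w] = 0))"

text \<open>A choice of contact forms: local contact forms \<open>(U, \<theta>)\<close> whose domains cover the manifold
  (for instance a single global one, or all of them). All of the following is defined relative to
  such a choice \<open>C\<close>.\<close>

definition contact_choice ::
    "('m::topological_space, 'd::finite) chart set \<Rightarrow> ('m, 'd) distribution \<Rightarrow> ('m set \<times> ('m, 'd) form) set \<Rightarrow> bool" where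
  "contact_choice A T C \<longleftrightarrow> (\<forall>(U, \<theta>)\<in>C. contact_form A T U \<theta>) \<and> (\<Union>(U, \<theta>)\<in>C. U) = UNIV"


section \<open>The bigraded Rumin complex (global sections)\<close>

definition rumin ::
    "nat \<Rightarrow> ('m, 'd::finite) chart set \<Rightarrow> ('m set \<times> ('m, 'd) form) set \<Rightarrow> nat \<Rightarrow> ('m, 'd) form set" where
  "rumin n A C k =
     (if k \<le> n then
        {\<omega> \<in> forms A UNIV k. real_form \<omega> \<and> (\<forall>(U, \<theta>)\<in>C. \<forall>c\<in>A. \<forall>p\<in>U \<inter> fst c.
           wedge (\<theta> c p) (wedge (\<omega> c p) (wedge_power (ext_d \<theta> c p) (n + 1 - k))) = 0 \<and>
           wedge (\<theta> c p) (wedge (ext_d \<omega> c p) (wedge_power (ext_d \<theta> c p) (n - k))) = 0)}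
      else if k \<le> 2 * n + 1 then
        {\<omega> \<in> forms A UNIV k. real_form \<omega> \<and> (\<forall>(U, \<theta>)\<in>C. \<forall>c\<in>A. \<forall>p\<in>U \<inter> fst c.
           wedge (\<theta> c p) (\<omega> c p) = 0 \<and> wedge (\<theta> c p) (ext_d \<omega> c p) = 0)}
      else {0})"

definition ruminC ::
    "nat \<Rightarrow> ('m, 'd::finite) chart set \<Rightarrow> ('m set \<times> ('m, 'd) form) set \<Rightarrow> nat \<Rightarrow> ('m, 'd) form set" where
  "ruminC n A C k = {\<alpha> + fscale \<i> \<beta> | \<alpha> \<beta>. \<alpha> \<in> rumin n A C k \<and> \<beta> \<in> rumin n A C k}"

text \<open>The restriction of \<open>\<alpha>\<close> to $H_{\mathbb C}$ at \<open>p\<close> lies in $\Lambda^{a,b}$.\<close>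

definition has_type ::
    "('m, 'd::finite) distribution \<Rightarrow> ('m, 'd) chart \<Rightarrow> 'm \<Rightarrow> int \<Rightarrow> int \<Rightarrow> ((complex ^ 'd) list \<Rightarrow> complex) \<Rightarrow> bool" where
  "has_type T c p a b \<alpha> \<longleftrightarrow>
     (\<exists>\<eta>\<in>Lambda_pq (T c p) (T01 T c p) a b. \<forall>vs. set vs \<subseteq> HC T c p \<longrightarrow> \<alpha> vs = \<eta> vs)"

definition rumin_pq ::
    "nat \<Rightarrow> ('m, 'd::finite) chart set \<Rightarrow> ('m, 'd) distribution \<Rightarrow> ('m set \<times> ('m, 'd) form) set
      \<Rightarrow> nat \<Rightarrow> nat \<Rightarrow> ('m, 'd) form set" where
  "rumin_pq n A T C p q =
     (if p \<le> n + 1 \<and> q \<le> n then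
        if p + q \<le> n then
          {\<omega> \<in> ruminC n A C (p + q). \<forall>c\<in>A. \<forall>x\<in>fst c. has_type T c x (int p) (int q) (\<omega> c x)}
        else
          {\<omega> \<in> ruminC n A C (p + q). \<forall>(U, \<theta>)\<in>C. \<forall>c\<in>A. \<forall>x\<in>U \<inter> fst c.
             has_type T c x (int p - 1) (int q) (\<lambda>vs. \<omega> c x (cvec (reeb \<theta> c x) # vs))}
      else {0})"

text \<open>The projection of \<open>\<omega>\<close> (of degree $p+q$) to its $(p,q)$-component.\<close>

definition proj_pq ::
    "nat \<Rightarrow> ('m, 'd::finite) chart set \<Rightarrow> ('m, 'd) distribution \<Rightarrow> ('m set \<times> ('m, 'd) form) set
      \<Rightarrow> nat \<Rightarrow> nat \<Rightarrow> ('m, 'd) form \<Rightarrow> ('m, 'd) form" where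
  "proj_pq n A T C p q \<omega> =
     (THE \<eta>. \<exists>f. (\<forall>a\<le>p + q. f a \<in> rumin_pq n A T C a (p + q - a)) \<and>
                \<omega> = (\<Sum>a\<le>p + q. f a) \<and> \<eta> = f p)"

definition dbar ::
    "nat \<Rightarrow> ('m, 'd::finite) chart set \<Rightarrow> ('m, 'd) distribution \<Rightarrow> ('m set \<times> ('m, 'd) form) set
      \<Rightarrow> nat \<Rightarrow> nat \<Rightarrow> ('m, 'd) form \<Rightarrow> ('m, 'd) form" where
  "dbar n A T C p q \<omega> = proj_pq n A T C p (q + 1) (ext_d \<omega>)"


section \<open>The CR pluriharmonic complex (global sections)\<close>

definition crp ::
    "nat \<Rightarrow> ('m, 'd::finite) chart set \<Rightarrow> ('m, 'd) distribution \<Rightarrow> ('m set \<times> ('m, 'd) form) set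
      \<Rightarrow> nat \<Rightarrow> ('m, 'd) form set" where
  "crp n A T C k =
     (if k = 0 then rumin n A C 0
      else if k < n then
        {\<omega>. real_form \<omega> \<and>
            (\<exists>f. (\<forall>j\<in>{1..k}. f j \<in> rumin_pq n A T C j (k + 1 - j)) \<and> \<omega> = (\<Sum>j=1..k. f j))}
      else if k \<le> 2 * n then rumin n A C (k + 1)
      else {0})"

definition crp_d ::
    "nat \<Rightarrow> ('m, 'd::finite) chart set \<Rightarrow> ('m, 'd) distribution \<Rightarrow> ('m set \<times> ('m, 'd) form) set
      \<Rightarrow> nat \<Rightarrow> ('m, 'd) form \<Rightarrow> ('m, 'd) form" where
  "crp_d n A T C k \<omega> = (if k = 0 then fscale \<i> (ext_d (dbar n A T C 0 0 \<omega>)) else ext_d \<omega>)"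


section \<open>Cohomology\<close>

text \<open>The real cohomology spaces are quotients \<open>Z / B\<close> of cocycles by coboundaries. The library's
  factor groups are written multiplicatively, so \<open>add_group Z\<close> is the additive group of \<open>Z\<close>.\<close>

definition add_group :: "'f::ab_group_add set \<Rightarrow> 'f monoid" where
  "add_group Z = \<lparr>carrier = Z, monoid.mult = (+), one = 0\<rparr>"

definition cohomology :: "'f::ab_group_add set \<Rightarrow> 'f set \<Rightarrow> 'f set monoid" where
  "cohomology Z B = add_group Z Mod B"

definition cls :: "'f::ab_group_add set \<Rightarrow> 'f \<Rightarrow> 'f set" where
  "cls B \<omega> = B #>\<^bsub>add_group UNIV\<^esub> \<omega>"

text \<open>The map $[\omega]\mapsto[f\,\omega]$ into a quotient by \<open>B'\<close>; it is meaningful under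
  \<open>induces_linear_map Z B Z' B' f\<close>.\<close>

definition induced :: "'f::ab_group_add set \<Rightarrow> ('f \<Rightarrow> 'f) \<Rightarrow> 'f set \<Rightarrow> 'f set" where
  "induced B' f X = the_elem ((\<lambda>\<omega>. cls B' (f \<omega>)) ` X)"

definition real_subspace :: "('m, 'd::finite) form set \<Rightarrow> bool" where
  "real_subspace = module.subspace (\<lambda>r :: real. fscale (of_real r))"

definition induces_linear_map ::
    "('m, 'd::finite) form set \<Rightarrow> ('m, 'd) form set \<Rightarrow> ('m, 'd) form set \<Rightarrow> ('m, 'd) form set
      \<Rightarrow> (('m, 'd) form \<Rightarrow> ('m, 'd) form) \<Rightarrow> bool" where
  "induces_linear_map Z B Z' B' f \<longleftrightarrow>
     real_subspace Z \<and> real_subspace B \<and> B \<subseteq> Z \<and>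
     real_subspace Z' \<and> real_subspace B' \<and> B' \<subseteq> Z' \<and>
     (\<forall>\<omega>\<in>Z. \<forall>\<eta>\<in>Z. f (\<omega> + \<eta>) = f \<omega> + f \<eta>) \<and>
     (\<forall>r :: real. \<forall>\<omega>\<in>Z. f (fscale (of_real r) \<omega>) = fscale (of_real r) (f \<omega>)) \<and>
     f ` Z \<subseteq> Z' \<and> f ` B \<subseteq> B'"

definition rumin_Z ::
    "nat \<Rightarrow> ('m, 'd::finite) chart set \<Rightarrow> ('m set \<times> ('m, 'd) form) set \<Rightarrow> nat \<Rightarrow> ('m, 'd) form set" where
  "rumin_Z n A C k = {\<omega> \<in> rumin n A C k. ext_d \<omega> = 0}"

definition rumin_B ::
    "nat \<Rightarrow> ('m, 'd::finite) chart set \<Rightarrow> ('m set \<times> ('m, 'd) form) set \<Rightarrow> nat \<Rightarrow> ('m, 'd) form set" where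
  "rumin_B n A C k = (case k of 0 \<Rightarrow> {0} | Suc j \<Rightarrow> ext_d ` rumin n A C j)"

definition dolb_Z ::
    "nat \<Rightarrow> ('m, 'd::finite) chart set \<Rightarrow> ('m, 'd) distribution \<Rightarrow> ('m set \<times> ('m, 'd) form) set
      \<Rightarrow> nat \<Rightarrow> nat \<Rightarrow> ('m, 'd) form set" where
  "dolb_Z n A T C p q = {\<omega> \<in> rumin_pq n A T C p q. dbar n A T C p q \<omega> = 0}"

definition dolb_B ::
    "nat \<Rightarrow> ('m, 'd::finite) chart set \<Rightarrow> ('m, 'd) distribution \<Rightarrow> ('m set \<times> ('m, 'd) form) set
      \<Rightarrow> nat \<Rightarrow> nat \<Rightarrow> ('m, 'd) form set" where
  "dolb_B n A T C p q = (case q of 0 \<Rightarrow> {0} | Suc j \<Rightarrow> dbar n A T C p j ` rumin_pq n A T C p j)"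

definition crp_Z ::
    "nat \<Rightarrow> ('m, 'd::finite) chart set \<Rightarrow> ('m, 'd) distribution \<Rightarrow> ('m set \<times> ('m, 'd) form) set
      \<Rightarrow> nat \<Rightarrow> ('m, 'd) form set" where
  "crp_Z n A T C k = {\<omega> \<in> crp n A T C k. crp_d n A T C k \<omega> = 0}"

definition crp_B ::
    "nat \<Rightarrow> ('m, 'd::finite) chart set \<Rightarrow> ('m, 'd) distribution \<Rightarrow> ('m set \<times> ('m, 'd) form) set
      \<Rightarrow> nat \<Rightarrow> ('m, 'd) form set" where
  "crp_B n A T C k = (case k of 0 \<Rightarrow> {0} | Suc j \<Rightarrow> crp_d n A T C j ` crp n A T C j)"

text \<open>$H_R^k(M;\mathbb R)$, $H_R^{p,q}(M)$ and $H_R^k(M;\mathscr P)$.\<close>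

definition H_rumin ::
    "nat \<Rightarrow> ('m, 'd::finite) chart set \<Rightarrow> ('m set \<times> ('m, 'd) form) set \<Rightarrow> nat \<Rightarrow> ('m, 'd) form set monoid" where
  "H_rumin n A C k = cohomology (rumin_Z n A C k) (rumin_B n A C k)"

definition H_dolb ::
    "nat \<Rightarrow> ('m, 'd::finite) chart set \<Rightarrow> ('m, 'd) distribution \<Rightarrow> ('m set \<times> ('m, 'd) form) set
      \<Rightarrow> nat \<Rightarrow> nat \<Rightarrow> ('m, 'd) form set monoid" where
  "H_dolb n A T C p q = cohomology (dolb_Z n A T C p q) (dolb_B n A T C p q)"

definition H_crp ::
    "nat \<Rightarrow> ('m, 'd::finite) chart set \<Rightarrow> ('m, 'd) distribution \<Rightarrow> ('m set \<times> ('m, 'd) form) set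
      \<Rightarrow> nat \<Rightarrow> ('m, 'd) form set monoid" where
  "H_crp n A T C k = cohomology (crp_Z n A T C k) (crp_B n A T C k)"


section \<open>The morphisms of the sequence\<close>

text \<open>On representatives: $H_R^k(M;\mathbb R)\to H_R^{0,k}(M)\to H_R^k(M;\mathscr P)\to
  H_R^{k+1}(M;\mathbb R)$.\<close>

definition rep1 ::
    "nat \<Rightarrow> ('m, 'd::finite) chart set \<Rightarrow> ('m, 'd) distribution \<Rightarrow> ('m set \<times> ('m, 'd) form) set
      \<Rightarrow> nat \<Rightarrow> ('m, 'd) form \<Rightarrow> ('m, 'd) form" where
  "rep1 n A T C k \<omega> = fscale \<i> (proj_pq n A T C 0 k \<omega>)"

definition rep2 :: "nat \<Rightarrow> ('m, 'd::finite) form \<Rightarrow> ('m, 'd) form" where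
  "rep2 k \<omega> = (if k = 0 then fRe \<omega> else - fIm (ext_d \<omega>))"

definition rep3 ::
    "nat \<Rightarrow> ('m, 'd::finite) chart set \<Rightarrow> ('m, 'd) distribution \<Rightarrow> ('m set \<times> ('m, 'd) form) set
      \<Rightarrow> nat \<Rightarrow> ('m, 'd) form \<Rightarrow> ('m, 'd) form" where
  "rep3 n A T C k \<omega> = (if k = 0 then - fIm (dbar n A T C 0 0 \<omega>) else \<omega>)"

definition mor1 ::
    "nat \<Rightarrow> ('m, 'd::finite) chart set \<Rightarrow> ('m, 'd) distribution \<Rightarrow> ('m set \<times> ('m, 'd) form) set
      \<Rightarrow> nat \<Rightarrow> ('m, 'd) form set \<Rightarrow> ('m, 'd) form set" where
  "mor1 n A T C k = induced (dolb_B n A T C 0 k) (rep1 n A T C k)"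

definition mor2 ::
    "nat \<Rightarrow> ('m, 'd::finite) chart set \<Rightarrow> ('m, 'd) distribution \<Rightarrow> ('m set \<times> ('m, 'd) form) set
      \<Rightarrow> nat \<Rightarrow> ('m, 'd) form set \<Rightarrow> ('m, 'd) form set" where
  "mor2 n A T C k = induced (crp_B n A T C k) (rep2 k)"

definition mor3 ::
    "nat \<Rightarrow> ('m, 'd::finite) chart set \<Rightarrow> ('m, 'd) distribution \<Rightarrow> ('m set \<times> ('m, 'd) form) set
      \<Rightarrow> nat \<Rightarrow> ('m, 'd) form set \<Rightarrow> ('m, 'd) form set" where
  "mor3 n A T C k = induced (rumin_B n A C (k + 1)) (rep3 n A T C k)"

end

theory Submission
  imports Defs
begin

text \<open>On $H$ the form $d\theta$ is determined by $H$ up to a factor, so the conditions defining Rumin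
  forms do not depend on $\theta$. A Rumin form is determined by its symbol: its restriction to $H$ in
  degree at most $n$, the contraction with a transversal vector above. This is the injectivity of the
  Lefschetz maps on $H$; conversely, by their surjectivity, multiplying $T^{1,0}$ by a number $t\neq 0$
  acts not only on symbols but on Rumin forms, and averaging over roots of unity $t$ yields the
  components of type $(p,q)$.

  Let $P$ be the projection to $\mathscr R^{0,k}$. Exactness is a diagram chase that only uses the
  following facts: $Pd=PdP$ (integrability of $T^{0,1}$); $P\overline\omega=0$ for
  $\omega\in\mathscr R^{0,k}$ with $k\ge 1$; $\mathscr S^k$ consists of the real forms in
  $\mathscr R^{k+1}$ with $P\omega=0$ if $k\ge 1$; and $\omega=2\,\mathrm{Re}\,P\omega$ for real
  $\omega\in\mathscr R^1$.\<close>

section \<open>Smooth functions\<close>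

text \<open>Types (p,q) are visible only on symbols. A symbol splits pointwise, but in degrees 1 to
  n the rest of a Rumin form involves first derivatives of its symbol. Hence the components cannot
  be cut out by algebra: a rescaled form must be corrected by a multiple of the contact form with
  smooth coefficients. This is why the Lefschetz equation is solved smoothly over a frame and not
  just at each point. Two facts make it work. By integrability d\<theta> has type (1,1) on H, so
  that rescaling T^{1,0} by t multiplies it by t and respects the Rumin conditions on symbols. And
  lifts are unique, so local lifts agree on overlaps and patch without a partition of unity. The
  chase treats degrees 0 and 1 apart because S^0 consists of functions and its differential has
  order two. The constants in the witnesses mostly come from P Im \<eta> = P\<eta> / (2\<i>), valid
  when P kills the conjugate of \<eta>.\<close>

lemma fd_eqI: "(f has_derivative f') (at x) \<Longrightarrow> frechet_derivative f (at x) = f'"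
  using frechet_derivative_at by metis

text \<open>Derivatives at a point of an open set see only nearby values. Functions read in a chart
  have arbitrary values off the chart domain, so computations in charts need this local form of
  substitution.\<close>

lemma Ck_on_cong:
  assumes "open S" "\<And>x. x \<in> S \<Longrightarrow> f x = g x" "Ck_on k S f"
  shows "Ck_on k S g"
  using assms(2,3)
proof (induction k arbitrary: f g)
  case 0
  then show ?case by (simp cong: continuous_on_cong)
next
  case (Suc k)
  have d: "(g has_derivative frechet_derivative f (at x)) (at x)" if "x \<in> S" for x
  proof -
    have "f differentiable (at x)"
      using Suc.prems that assms(1) by (simp add: differentiable_on_eq_differentiable_at)
    then have "(f has_derivative frechet_derivative f (at x)) (at x)"
      by (simp add: frechet_derivative_works)
    then show ?thesis
      using has_derivative_transform_within_open[OF _ assms(1) that] Suc.prems(1) by blast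
  qed
  have "g differentiable_on S"
    using d assms(1) by (auto simp: differentiable_on_eq_differentiable_at differentiable_def)
  moreover have "Ck_on k S (\<lambda>x. frechet_derivative g (at x) v)" for v
    by (rule Suc.IH[of "\<lambda>x. frechet_derivative f (at x) v"])
      (use Suc.prems(2) fd_eqI[OF d] in auto)
  ultimately show ?case by simp
qed

text \<open>Working form of the recursive step: the derivative is any explicit formula
  \<open>f'\<close>, so that an induction hypothesis can be applied to that formula instead of
  \<open>frechet_derivative\<close>.\<close>

lemma Ck_on_SucI:
  assumes "open S" "\<And>x. x \<in> S \<Longrightarrow> (f has_derivative f' x) (at x)"
    and "\<And>v. Ck_on k S (\<lambda>x. f' x v)"
  shows "Ck_on (Suc k) S f"
proof -
  have "f differentiable_on S"
    using assms by (auto simp: differentiable_on_eq_differentiable_at differentiable_def)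
  moreover have "Ck_on k S (\<lambda>x. frechet_derivative f (at x) v)" for v
    by (rule Ck_on_cong[OF assms(1) _ assms(3)[of v]]) (use fd_eqI[OF assms(2)] in auto)
  ultimately show ?thesis by simp
qed

lemma Ck_on_SucD:
  assumes "open S" "Ck_on (Suc k) S f" "x \<in> S"
  shows "(f has_derivative frechet_derivative f (at x)) (at x)"
  using assms by (simp add: differentiable_on_eq_differentiable_at frechet_derivative_works)

lemma Ck_on_Suc_imp: "Ck_on (Suc k) S f \<Longrightarrow> Ck_on k S f"
proof (induction k arbitrary: f)
  case 0
  then show ?case by (simp add: differentiable_imp_continuous_on)
next
  case (Suc k)
  then show ?case by (metis Ck_on.simps(2))
qed

lemma Ck_on_subset:
  assumes "Ck_on k S f" "S' \<subseteq> S" shows "Ck_on k S' f"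
  using assms(1)
proof (induction k arbitrary: f)
  case 0 then show ?case using assms(2) continuous_on_subset by auto
next
  case (Suc k) then show ?case using assms(2) differentiable_on_subset by auto
qed

lemma Ck_on_const: "Ck_on k S (\<lambda>_. c)"
  by (induction k arbitrary: c) (auto simp: frechet_derivative_const)

lemma Ck_on_bounded_linear:
  assumes "open S" "bounded_linear h" "Ck_on k S f"
  shows "Ck_on k S (\<lambda>x. h (f x))"
  using assms(3)
proof (induction k arbitrary: f)
  case 0
  then show ?case
    using bounded_linear.continuous_on[OF assms(2)] by auto
next
  case (Suc k)
  show ?case
  proof (rule Ck_on_SucI[OF assms(1)])
    show "((\<lambda>x. h (f x)) has_derivative (\<lambda>v. h (frechet_derivative f (at x) v))) (at x)"
      if "x \<in> S" for x
      using bounded_linear.has_derivative[OF assms(2) Ck_on_SucD[OF assms(1) Suc.prems that]] .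
    show "Ck_on k S (\<lambda>x. h (frechet_derivative f (at x) v))" for v
      using Suc by simp
  qed
qed

lemma Ck_on_add:
  assumes "open S" "Ck_on k S f" "Ck_on k S g"
  shows "Ck_on k S (\<lambda>x. f x + g x)"
  using assms(2,3)
proof (induction k arbitrary: f g)
  case 0 then show ?case by (simp add: continuous_on_add)
next
  case (Suc k)
  show ?case
    by (rule Ck_on_SucI[OF assms(1) has_derivative_add[OF Ck_on_SucD[OF assms(1) Suc.prems(1)]
         Ck_on_SucD[OF assms(1) Suc.prems(2)]] Suc.IH]) (use Suc.prems in auto)
qed

text \<open>The product rule leaves one factor undifferentiated in each term; that factor is used
  only at the lower order, hence the appeal to \<open>Ck_on_Suc_imp\<close>.\<close>

lemma Ck_on_bilinear:
  assumes "open S" "bounded_bilinear h" "Ck_on k S f" "Ck_on k S g"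
  shows "Ck_on k S (\<lambda>x. h (f x) (g x))"
  using assms(3,4)
proof (induction k arbitrary: f g)
  case 0 then show ?case using bounded_bilinear.continuous_on[OF assms(2)] by auto
next
  case (Suc k)
  show ?case
  proof (rule Ck_on_SucI[OF assms(1)])
    show "((\<lambda>x. h (f x) (g x)) has_derivative
        (\<lambda>v. h (f x) (frechet_derivative g (at x) v) + h (frechet_derivative f (at x) v) (g x))) (at x)"
      if "x \<in> S" for x
      using bounded_bilinear.FDERIV[OF assms(2) Ck_on_SucD[OF assms(1) Suc.prems(1) that]
          Ck_on_SucD[OF assms(1) Suc.prems(2) that]] .
    show "Ck_on k S (\<lambda>x. h (f x) (frechet_derivative g (at x) v) + h (frechet_derivative f (at x) v) (g x))" for v
      using Suc.prems Ck_on_Suc_imp[OF Suc.prems(1)] Ck_on_Suc_imp[OF Suc.prems(2)]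
      by (intro Ck_on_add[OF assms(1)] Suc.IH) auto
  qed
qed

text \<open>The derivative of 1/f is built from f' and 1/f itself, so the induction on the order
  closes with the same f.\<close>

lemma Ck_on_inverse:
  fixes f :: "'a::euclidean_space \<Rightarrow> 'b::real_normed_field"
  assumes "open S" "Ck_on k S f" "\<And>x. x \<in> S \<Longrightarrow> f x \<noteq> 0"
  shows "Ck_on k S (\<lambda>x. inverse (f x))"
  using assms(2)
proof (induction k)
  case 0 then show ?case using assms(3) by (auto intro!: continuous_on_inverse)
next
  case (Suc k)
  note bm = bounded_bilinear_mult
  have i: "Ck_on k S (\<lambda>x. inverse (f x))" using Suc Ck_on_Suc_imp by blast
  show ?case
  proof (rule Ck_on_SucI[OF assms(1)])
    show "((\<lambda>x. inverse (f x)) has_derivative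
        (\<lambda>v. - (inverse (f x) * frechet_derivative f (at x) v * inverse (f x)))) (at x)"
      if "x \<in> S" for x
      by (rule Deriv.has_derivative_inverse[OF assms(3)[OF that] Ck_on_SucD[OF assms(1) Suc.prems that]])
    show "Ck_on k S (\<lambda>x. - (inverse (f x) * frechet_derivative f (at x) v * inverse (f x)))" for v
      using Suc.prems by (intro Ck_on_bounded_linear[OF assms(1) bounded_linear_minus[OF bounded_linear_ident]]
         Ck_on_bilinear[OF assms(1) bm] i) auto
  qed
qed

lemma Ck_on_sum:
  assumes "open S" "\<And>i. i \<in> I \<Longrightarrow> Ck_on k S (f i)"
  shows "Ck_on k S (\<lambda>x. \<Sum>i\<in>I. f i x)"
  using assms(2) by (induction I rule: infinite_finite_induct) (auto intro!: Ck_on_const Ck_on_add[OF assms(1)])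

lemma Ck_on_compose:
  fixes f :: "'a::euclidean_space \<Rightarrow> 'b::euclidean_space"
  assumes "open S" "open S'" "Ck_on k S f" "Ck_on k S' g" "f ` S \<subseteq> S'"
  shows "Ck_on k S (\<lambda>x. g (f x))"
  using assms(3,4)
proof (induction k arbitrary: g)
  case 0 then show ?case using assms(5) continuous_on_compose2[of S' g S f] by auto
next
  case (Suc k)
  \<comment> \<open>The vector to which g' is applied varies with x, whereas smoothness is stated
    for fixed directions. Expanding it in the basis gives a sum of products to which the induction
    hypothesis applies.\<close>
  have l: "frechet_derivative g (at (f x)) w = (\<Sum>b\<in>Basis. (w \<bullet> b) *\<^sub>R frechet_derivative g (at (f x)) b)"
    if "x \<in> S" for x w
  proof -
    have "f x \<in> S'" using that assms(5) by auto
    then have "linear (frechet_derivative g (at (f x)))"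
      using Ck_on_SucD[OF assms(2) Suc.prems(2)] has_derivative_bounded_linear bounded_linear.linear by blast
    then show ?thesis
      by (subst euclidean_representation[of w, symmetric]) (simp add: linear_sum linear_cmul)
  qed
  show ?case
  proof (rule Ck_on_SucI[OF assms(1)])
    show "((\<lambda>x. g (f x)) has_derivative
        (\<lambda>v. frechet_derivative g (at (f x)) (frechet_derivative f (at x) v))) (at x)"
      if "x \<in> S" for x
    proof -
      have "f x \<in> S'" using that assms(5) by auto
      then show ?thesis
      using has_derivative_compose[OF Ck_on_SucD[OF assms(1) Suc.prems(1) that]] Ck_on_SucD[OF assms(2) Suc.prems(2)]
        by blast
    qed
    have "Ck_on k S (\<lambda>x. (\<Sum>b\<in>Basis. (frechet_derivative f (at x) v \<bullet> b) *\<^sub>R frechet_derivative g (at (f x)) b))" for v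
    proof (intro Ck_on_sum[OF assms(1)] Ck_on_bilinear[OF assms(1) bounded_bilinear_scaleR])
      fix b :: 'b assume "b \<in> Basis"
      show "Ck_on k S (\<lambda>x. frechet_derivative f (at x) v \<bullet> b)"
        using Suc.prems by (intro Ck_on_bounded_linear[OF assms(1) bounded_linear_inner_left]) auto
      show "Ck_on k S (\<lambda>x. frechet_derivative g (at (f x)) b)"
        using Suc.prems Ck_on_Suc_imp[OF Suc.prems(1)] by (intro Suc.IH) auto
    qed
    then show "Ck_on k S (\<lambda>x. frechet_derivative g (at (f x)) (frechet_derivative f (at x) v))" for v
      by (rule Ck_on_cong[OF assms(1), rotated]) (use l in auto)
  qed
qed

lemma smooth_on_diff:
  assumes "open S" "smooth_on S f" "x \<in> S"
  shows "(f has_derivative frechet_derivative f (at x)) (at x)"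
  using assms Ck_on_SucD unfolding smooth_on_def by blast

lemma smooth_on_fd: "smooth_on S f \<Longrightarrow> smooth_on S (\<lambda>x. frechet_derivative f (at x) v)"
  unfolding smooth_on_def by (metis Ck_on.simps(2))

section \<open>Symmetry of second derivatives\<close>

lemma second_difference_mvt:
  fixes f :: "'a::euclidean_space \<Rightarrow> real"
  assumes S: "open S" "Ck_on (Suc (Suc 0)) S f" and h: "h > 0"
    and P: "\<And>s t. 0 \<le> s \<Longrightarrow> s \<le> h \<Longrightarrow> 0 \<le> t \<Longrightarrow> t \<le> h \<Longrightarrow> x + s *\<^sub>R v + t *\<^sub>R w \<in> S"
  shows "\<exists>s t. 0 \<le> s \<and> s \<le> h \<and> 0 \<le> t \<and> t \<le> h \<and>
     f (x + h *\<^sub>R v + h *\<^sub>R w) - f (x + h *\<^sub>R v) - f (x + h *\<^sub>R w) + f x =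
     h * h * frechet_derivative (\<lambda>x. frechet_derivative f (at x) v) (at (x + s *\<^sub>R v + t *\<^sub>R w)) w"
proof -
  let ?D = "\<lambda>y. frechet_derivative f (at y) v"
  have C1: "Ck_on (Suc 0) S ?D" using S(2) by simp
  have line: "((\<lambda>s. g (u + s *\<^sub>R a)) has_real_derivative frechet_derivative g (at (u + s *\<^sub>R a)) a) (at s)"
    if "Ck_on (Suc 0) S g" "u + s *\<^sub>R a \<in> S" for g :: "'a \<Rightarrow> real" and u a s
  proof -
    note gd = Ck_on_SucD[OF S(1) that]
    have "((\<lambda>s. u + s *\<^sub>R a) has_derivative (\<lambda>r. r *\<^sub>R a)) (at s)"
      by (auto intro!: derivative_eq_intros)
    from has_derivative_compose[OF this gd]
    have "((\<lambda>s. g (u + s *\<^sub>R a)) has_derivative (\<lambda>r. frechet_derivative g (at (u + s *\<^sub>R a)) (r *\<^sub>R a))) (at s)"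
      by simp
    moreover have "frechet_derivative g (at (u + s *\<^sub>R a)) (r *\<^sub>R a) = frechet_derivative g (at (u + s *\<^sub>R a)) a * r" for r
      using linear_cmul[OF bounded_linear.linear[OF has_derivative_bounded_linear[OF gd]]] by simp
    ultimately show ?thesis by (simp add: has_field_derivative_def)
  qed
  \<comment> \<open>Mean value theorem along v for the increment of f in the direction h w; a second
    application along w then reaches the mixed derivative.\<close>
  have "((\<lambda>s. f ((x + h *\<^sub>R w) + s *\<^sub>R v) - f (x + s *\<^sub>R v)) has_real_derivative
      (?D ((x + h *\<^sub>R w) + s *\<^sub>R v) - ?D (x + s *\<^sub>R v))) (at s)" if "0 \<le> s" "s \<le> h" for s
    using that h P[of s h] P[of s 0] Ck_on_Suc_imp[OF S(2)]
    by (intro DERIV_diff line) (auto simp: algebra_simps)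
  from MVT2[OF h this] obtain s where s: "s > 0" "s < h"
    "f (x + h *\<^sub>R v + h *\<^sub>R w) - f (x + h *\<^sub>R v) - (f (x + h *\<^sub>R w) - f x) =
      h * (?D ((x + h *\<^sub>R w) + s *\<^sub>R v) - ?D (x + s *\<^sub>R v))"
    by (auto simp: algebra_simps)
  have "((\<lambda>t. ?D ((x + s *\<^sub>R v) + t *\<^sub>R w)) has_real_derivative
      frechet_derivative ?D (at ((x + s *\<^sub>R v) + t *\<^sub>R w)) w) (at t)" if "0 \<le> t" "t \<le> h" for t
    using that s P[of s t] C1 by (intro line) auto
  from MVT2[OF h this] obtain t where "t > 0" "t < h"
    "?D ((x + s *\<^sub>R v) + h *\<^sub>R w) - ?D (x + s *\<^sub>R v) =
      h * frechet_derivative ?D (at ((x + s *\<^sub>R v) + t *\<^sub>R w)) w" by auto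
  then show ?thesis using s by (intro exI[of _ s] exI[of _ t]) (simp add: algebra_simps)
qed

text \<open>The second difference over a parallelogram is symmetric in v and w, and by
  \<open>second_difference_mvt\<close> it is h^2 times either mixed derivative at some point of the
  parallelogram. As the parallelogram shrinks, continuity forces equality.\<close>

lemma second_derivative_symmetric_real:
  fixes f :: "'a::euclidean_space \<Rightarrow> real"
  assumes S: "open S" "Ck_on (Suc (Suc 0)) S f" and x: "x \<in> S"
  shows "frechet_derivative (\<lambda>x. frechet_derivative f (at x) v) (at x) w =
         frechet_derivative (\<lambda>x. frechet_derivative f (at x) w) (at x) v" (is "?A v w x = ?A w v x")
proof (rule ccontr)
  assume ne: "?A v w x \<noteq> ?A w v x"
  \<comment> \<open>Half the gap: two numbers closer than \<open>e\<close> to the respective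
    derivatives cannot coincide.\<close>
  define e where "e = \<bar>?A v w x - ?A w v x\<bar> / 2"
  have e: "e > 0" using ne by (simp add: e_def)
  have "isCont (?A v w) x" "isCont (?A w v) x"
    using S x by (auto simp: continuous_on_eq_continuous_at)
  then obtain d1 d2 where d: "d1 > 0" "\<And>y. dist y x < d1 \<Longrightarrow> dist (?A v w y) (?A v w x) < e"
      "d2 > 0" "\<And>y. dist y x < d2 \<Longrightarrow> dist (?A w v y) (?A w v x) < e"
    unfolding continuous_at_eps_delta using e by metis
  obtain d3 where d3: "d3 > 0" "\<And>y. dist y x < d3 \<Longrightarrow> y \<in> S"
    using S(1) x by (auto simp: open_dist)
  define r where "r = min d1 (min d2 d3)"
  \<comment> \<open>The summand 1 keeps the denominator positive for v = w = 0; the parallelogram of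
    side \<open>h\<close> fits into the ball of radius \<open>r\<close>.\<close>
  define h where "h = r / (norm v + norm w + 1)"
  have r: "r > 0" using d d3 by (simp add: r_def)
  have np: "norm v + norm w + 1 > 0" by (smt (verit) norm_ge_zero)
  have h: "h > 0" using r np by (simp add: h_def)
  have hb: "h * (norm v + norm w) < r"
  proof -
    have "h * (norm v + norm w + 1) = r" using np by (simp add: h_def)
    then show ?thesis using h by (simp add: algebra_simps)
  qed
  have ball: "dist (x + s *\<^sub>R v + t *\<^sub>R w) x < r" if "0 \<le> s" "s \<le> h" "0 \<le> t" "t \<le> h" for s t v' w'
  proof -
    have "dist (x + s *\<^sub>R v + t *\<^sub>R w) x \<le> s * norm v + t * norm w"
      unfolding dist_norm using norm_triangle_ineq[of "s *\<^sub>R v" "t *\<^sub>R w"] that by simp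
    also have "\<dots> \<le> h * norm v + h * norm w" using that by (intro add_mono mult_right_mono) auto
    finally show ?thesis using hb by (simp add: algebra_simps)
  qed
  have ball': "dist (x + s *\<^sub>R w + t *\<^sub>R v) x < r" if "0 \<le> s" "s \<le> h" "0 \<le> t" "t \<le> h" for s t
    using ball[OF that(3,4,1,2)] by (simp add: algebra_simps)
  obtain s t where st: "0 \<le> s" "s \<le> h" "0 \<le> t" "t \<le> h"
     "f (x + h *\<^sub>R v + h *\<^sub>R w) - f (x + h *\<^sub>R v) - f (x + h *\<^sub>R w) + f x = h * h * ?A v w (x + s *\<^sub>R v + t *\<^sub>R w)"
    using second_difference_mvt[OF S h, of x v w] ball d3(2) unfolding r_def by auto
  obtain s' t' where st': "0 \<le> s'" "s' \<le> h" "0 \<le> t'" "t' \<le> h"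
     "f (x + h *\<^sub>R w + h *\<^sub>R v) - f (x + h *\<^sub>R w) - f (x + h *\<^sub>R v) + f x = h * h * ?A w v (x + s' *\<^sub>R w + t' *\<^sub>R v)"
    using second_difference_mvt[OF S h, of x w v] ball' d3(2) unfolding r_def by auto
  have "h * h * ?A v w (x + s *\<^sub>R v + t *\<^sub>R w) = h * h * ?A w v (x + s' *\<^sub>R w + t' *\<^sub>R v)"
    using st(5) st'(5) by (simp add: algebra_simps)
  then have eq: "?A v w (x + s *\<^sub>R v + t *\<^sub>R w) = ?A w v (x + s' *\<^sub>R w + t' *\<^sub>R v)" using h by simp
  have "dist (?A v w (x + s *\<^sub>R v + t *\<^sub>R w)) (?A v w x) < e"
    using ball[OF st(1-4)] d(2) by (auto simp: r_def)
  moreover have "dist (?A w v (x + s' *\<^sub>R w + t' *\<^sub>R v)) (?A w v x) < e"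
    using ball'[OF st'(1-4)] d(4) by (auto simp: r_def)
  ultimately show False using eq unfolding e_def dist_real_def by (simp add: abs_if field_simps split: if_splits)
qed

lemma smooth_on_frechet_linear_image:
  assumes "open S" "bounded_linear h" "smooth_on S f" "x \<in> S"
  shows "frechet_derivative (\<lambda>x. h (f x)) (at x) v = h (frechet_derivative f (at x) v)"
  using fd_eqI[OF bounded_linear.has_derivative[OF assms(2) smooth_on_diff[OF assms(1,3,4)]]] by simp

lemma frechet_derivative_cong:
  assumes "open S" "\<And>y. y \<in> S \<Longrightarrow> f y = g y" "x \<in> S"
  shows "frechet_derivative f (at x) = frechet_derivative g (at x)"
proof -
  have "(f has_derivative D) (at x) \<longleftrightarrow> (g has_derivative D) (at x)" for D
    using has_derivative_transform_within_open[OF _ assms(1,3)] assms(2) by metis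
  then show ?thesis unfolding frechet_derivative_def by simp
qed

text \<open>The mean value theorem concerns real-valued functions, hence the detour through real and
  imaginary parts.\<close>

lemma second_derivative_symmetric:
  fixes f :: "'a::euclidean_space \<Rightarrow> complex"
  assumes S: "open S" "smooth_on S f" and x: "x \<in> S"
  shows "frechet_derivative (\<lambda>x. frechet_derivative f (at x) v) (at x) w =
         frechet_derivative (\<lambda>x. frechet_derivative f (at x) w) (at x) v"
proof -
  have *: "h (frechet_derivative (\<lambda>x. frechet_derivative f (at x) v) (at x) w) =
         h (frechet_derivative (\<lambda>x. frechet_derivative f (at x) w) (at x) v)"
    if h: "bounded_linear h" for h :: "complex \<Rightarrow> real"
  proof -
    have "Ck_on (Suc (Suc 0)) S (\<lambda>x. h (f x))"
      using S(2) Ck_on_bounded_linear[OF S(1) h] unfolding smooth_on_def by blast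
    note sym = second_derivative_symmetric_real[OF S(1) this x, of v w]
    have "h (frechet_derivative (\<lambda>x. frechet_derivative f (at x) v) (at x) w) =
         frechet_derivative (\<lambda>x. frechet_derivative (\<lambda>x. h (f x)) (at x) v) (at x) w" for v w
      unfolding smooth_on_frechet_linear_image[OF S(1) h smooth_on_fd[OF S(2)] x, symmetric]
      using frechet_derivative_cong[OF S(1) _ x, of "\<lambda>x. h (frechet_derivative f (at x) v)"
           "\<lambda>x. frechet_derivative (\<lambda>x. h (f x)) (at x) v"]
        smooth_on_frechet_linear_image[OF S(1) h S(2)] by auto
    then show ?thesis using sym by simp
  qed
  show ?thesis
    using *[OF bounded_linear_Re] *[OF bounded_linear_Im] by (simp add: complex_eq_iff)
qed

lemma smooth_on_cong: "open S \<Longrightarrow> (\<And>x. x \<in> S \<Longrightarrow> f x = g x) \<Longrightarrow> smooth_on S f \<Longrightarrow> smooth_on S g"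
  unfolding smooth_on_def using Ck_on_cong by blast

lemma smooth_on_bounded_linear: "open S \<Longrightarrow> bounded_linear h \<Longrightarrow> smooth_on S f \<Longrightarrow> smooth_on S (\<lambda>x. h (f x))"
  unfolding smooth_on_def using Ck_on_bounded_linear by blast

lemma smooth_on_bilinear:
  "open S \<Longrightarrow> bounded_bilinear h \<Longrightarrow> smooth_on S f \<Longrightarrow> smooth_on S g \<Longrightarrow> smooth_on S (\<lambda>x. h (f x) (g x))"
  unfolding smooth_on_def using Ck_on_bilinear by blast

lemma smooth_on_add: "open S \<Longrightarrow> smooth_on S f \<Longrightarrow> smooth_on S g \<Longrightarrow> smooth_on S (\<lambda>x. f x + g x)"
  unfolding smooth_on_def using Ck_on_add by blast

lemma smooth_on_inverse:
  fixes f :: "'a::euclidean_space \<Rightarrow> 'b::real_normed_field"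
  shows "open S \<Longrightarrow> smooth_on S f \<Longrightarrow> (\<And>x. x \<in> S \<Longrightarrow> f x \<noteq> 0) \<Longrightarrow> smooth_on S (\<lambda>x. inverse (f x))"
  unfolding smooth_on_def using Ck_on_inverse by blast

lemma smooth_on_compose:
  fixes f :: "'a::euclidean_space \<Rightarrow> 'b::euclidean_space"
  shows "open S \<Longrightarrow> open S' \<Longrightarrow> smooth_on S f \<Longrightarrow> smooth_on S' g \<Longrightarrow> f ` S \<subseteq> S' \<Longrightarrow> smooth_on S (\<lambda>x. g (f x))"
  unfolding smooth_on_def using Ck_on_compose by blast

lemma smooth_on_const: "smooth_on S (\<lambda>_. c)"
  unfolding smooth_on_def using Ck_on_const by blast

lemma smooth_on_subset: "smooth_on S f \<Longrightarrow> S' \<subseteq> S \<Longrightarrow> smooth_on S' f"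
  unfolding smooth_on_def using Ck_on_subset by blast

lemma smooth_on_continuous: "smooth_on S f \<Longrightarrow> continuous_on S f"
  unfolding smooth_on_def using Ck_on.simps(1) by blast

text \<open>For patching: a glued form is smooth because near every point it agrees with one of its
  pieces.\<close>

lemma Ck_on_local:
  assumes "open S" "\<And>x. x \<in> S \<Longrightarrow> \<exists>S'. open S' \<and> x \<in> S' \<and> Ck_on k S' f"
  shows "Ck_on k S f"
  using assms(2)
proof (induction k arbitrary: f)
  case 0
  then show ?case unfolding Ck_on.simps
    by (metis assms(1) continuous_at_imp_continuous_on continuous_on_eq_continuous_at)
next
  case (Suc k)
  show ?case unfolding Ck_on.simps
  proof (intro conjI allI)
    show "f differentiable_on S"
      using Suc.prems assms(1)
      by (metis Ck_on.simps(2) differentiable_on_eq_differentiable_at)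
    show "Ck_on k S (\<lambda>x. frechet_derivative f (at x) v)" for v
      using Suc.prems by (intro Suc.IH) (metis Ck_on.simps(2))
  qed
qed

lemma smooth_on_local:
  assumes "open S" "\<And>x. x \<in> S \<Longrightarrow> \<exists>S'. open S' \<and> x \<in> S' \<and> smooth_on S' f"
  shows "smooth_on S f"
  unfolding smooth_on_def using Ck_on_local[OF assms(1)] assms(2) unfolding smooth_on_def by metis

section \<open>Calculus in charts\<close>

lemma vRe_nth [simp]: "vRe v $ i = Re (v $ i)" by (simp add: vRe_def)
lemma vIm_nth [simp]: "vIm v $ i = Im (v $ i)" by (simp add: vIm_def)
lemma cvec_nth [simp]: "cvec v $ i = of_real (v $ i)" by (simp add: cvec_def)
lemma vcnj_nth [simp]: "vcnj v $ i = cnj (v $ i)" by (simp add: vcnj_def)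

lemma vcnj_vcnj [simp]: "vcnj (vcnj v) = v" by (simp add: vec_eq_iff)
lemma vcnj_add: "vcnj (v + w) = vcnj v + vcnj w" by (simp add: vec_eq_iff)
lemma vcnj_smult: "vcnj (a *s v) = cnj a *s vcnj v" by (simp add: vec_eq_iff)
lemma vcnj_cvec [simp]: "vcnj (cvec v) = cvec v" by (simp add: vec_eq_iff)
lemma vcnj_0 [simp]: "vcnj 0 = 0" by (simp add: vec_eq_iff)

lemma vRe_vIm_eq: "v = cvec (vRe v) + \<i> *s cvec (vIm v)"
  by (simp add: vec_eq_iff complex_eq)

locale smooth_manifold =
  fixes A :: "('m::{t2_space, second_countable_topology}, 'd::finite) chart set"
  assumes atlas: "smooth_atlas A"
begin

text \<open>Frames, contact forms and overlaps live on smaller sets than a whole chart domain; local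
  statements are therefore made on such pairs.\<close>

definition chd :: "('m, 'd) chart \<Rightarrow> 'm set \<Rightarrow> bool" where
  "chd c V \<longleftrightarrow> c \<in> A \<and> open V \<and> V \<subseteq> fst c"

lemma chart_cover: "\<exists>c\<in>A. p \<in> fst c"
  using atlas unfolding smooth_atlas_def by blast

lemma chart_open: "c \<in> A \<Longrightarrow> open (fst c)"
  using atlas unfolding smooth_atlas_def by blast

lemma chd_fst: "c \<in> A \<Longrightarrow> chd c (fst c)"
  using chart_open by (simp add: chd_def)

lemma chd_Int: "chd c V \<Longrightarrow> open W \<Longrightarrow> chd c (V \<inter> W)"
  by (auto simp: chd_def)

lemma chd_subset: "chd c V \<Longrightarrow> open W \<Longrightarrow> W \<subseteq> V \<Longrightarrow> chd c W"
  by (auto simp: chd_def)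

lemma chd_overlap: "c \<in> A \<Longrightarrow> c' \<in> A \<Longrightarrow> chd c (fst c \<inter> fst c')"
  by (simp add: chd_def chart_open open_Int)

lemma chart_homeo: "c \<in> A \<Longrightarrow> homeomorphism (fst c) (snd c ` fst c) (snd c) (chart_inv c)"
  using atlas unfolding smooth_atlas_def by blast

lemma chart_inv_chart: "c \<in> A \<Longrightarrow> p \<in> fst c \<Longrightarrow> chart_inv c (snd c p) = p"
  using chart_homeo homeomorphism_apply1 by metis

lemma chd_image_open:
  assumes "chd c V" shows "open (snd c ` V)"
proof -
  have c: "c \<in> A" "open V" "V \<subseteq> fst c" using assms by (auto simp: chd_def)
  have "openin (top_of_set (fst c)) V" using c chart_open[of c] by (simp add: openin_open_eq)
  then have "openin (top_of_set (snd c ` fst c)) (snd c ` V)"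
    using homeomorphism_imp_open_map[OF chart_homeo[OF c(1)]] by blast
  moreover have "open (snd c ` fst c)" using atlas c unfolding smooth_atlas_def by blast
  ultimately show ?thesis using openin_open_trans by blast
qed

lemma smooth_transition:
  "c \<in> A \<Longrightarrow> c' \<in> A \<Longrightarrow> smooth_on (snd c ` (fst c \<inter> fst c')) (snd c' \<circ> chart_inv c)"
  using atlas unfolding smooth_atlas_def by blast

lemma smooth_in_const: "smooth_in c V (\<lambda>_. a)"
  by (simp add: smooth_in_def smooth_on_const comp_def)

lemma smooth_in_subset: "smooth_in c V f \<Longrightarrow> W \<subseteq> V \<Longrightarrow> smooth_in c W f"
  unfolding smooth_in_def using smooth_on_subset by (metis image_mono)

lemma smooth_in_cong:
  assumes "chd c V" "\<And>p. p \<in> V \<Longrightarrow> f p = g p" "smooth_in c V f"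
  shows "smooth_in c V g"
  using assms smooth_on_cong[OF chd_image_open[OF assms(1)], of "f \<circ> chart_inv c" "g \<circ> chart_inv c"]
  unfolding smooth_in_def chd_def by (force simp: chart_inv_chart)

lemma smooth_in_bounded_linear:
  "chd c V \<Longrightarrow> bounded_linear h \<Longrightarrow> smooth_in c V f \<Longrightarrow> smooth_in c V (\<lambda>p. h (f p))"
  using smooth_on_bounded_linear[OF chd_image_open] unfolding smooth_in_def comp_def by blast

lemma smooth_in_bilinear:
  "chd c V \<Longrightarrow> bounded_bilinear h \<Longrightarrow> smooth_in c V f \<Longrightarrow> smooth_in c V g \<Longrightarrow> smooth_in c V (\<lambda>p. h (f p) (g p))"
  using smooth_on_bilinear[OF chd_image_open] unfolding smooth_in_def comp_def by blast

lemma smooth_in_add: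
  "chd c V \<Longrightarrow> smooth_in c V f \<Longrightarrow> smooth_in c V g \<Longrightarrow> smooth_in c V (\<lambda>p. f p + g p)"
  using smooth_on_add[OF chd_image_open] unfolding smooth_in_def comp_def by blast

lemma smooth_in_mult:
  fixes f g :: "'m \<Rightarrow> complex"
  shows "chd c V \<Longrightarrow> smooth_in c V f \<Longrightarrow> smooth_in c V g \<Longrightarrow> smooth_in c V (\<lambda>p. f p * g p)"
  by (rule smooth_in_bilinear[OF _ bounded_bilinear_mult])

lemma smooth_in_sum:
  assumes "chd c V" "\<And>i. i \<in> I \<Longrightarrow> smooth_in c V (f i)"
  shows "smooth_in c V (\<lambda>p. \<Sum>i\<in>I. f i p)"
  using assms(2)
  by (induction I rule: infinite_finite_induct) (auto intro!: smooth_in_const smooth_in_add[OF assms(1)])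

lemma smooth_in_prod:
  fixes f :: "'i \<Rightarrow> 'm \<Rightarrow> complex"
  assumes "chd c V" "\<And>i. i \<in> I \<Longrightarrow> smooth_in c V (f i)"
  shows "smooth_in c V (\<lambda>p. \<Prod>i\<in>I. f i p)"
  using assms(2)
  by (induction I rule: infinite_finite_induct) (auto intro!: smooth_in_const smooth_in_mult[OF assms(1)])

lemma smooth_in_divide:
  fixes f g :: "'m \<Rightarrow> complex"
  assumes "chd c V" "smooth_in c V f" "smooth_in c V g" "\<And>p. p \<in> V \<Longrightarrow> g p \<noteq> 0"
  shows "smooth_in c V (\<lambda>p. f p / g p)"
proof -
  have "smooth_in c V (\<lambda>p. inverse (g p))"
    using smooth_on_inverse[OF chd_image_open[OF assms(1)], of "g \<circ> chart_inv c"] assms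
    unfolding smooth_in_def chd_def by (force simp: comp_def chart_inv_chart)
  then show ?thesis
    using smooth_in_mult[OF assms(1,2)] by (simp add: divide_inverse)
qed

lemma smooth_in_cnj: "chd c V \<Longrightarrow> smooth_in c V f \<Longrightarrow> smooth_in c V (\<lambda>p. cnj (f p))"
  by (rule smooth_in_bounded_linear[OF _ bounded_linear_cnj])

lemma smooth_in_local:
  assumes "chd c V" "\<And>p. p \<in> V \<Longrightarrow> \<exists>W. open W \<and> p \<in> W \<and> W \<subseteq> V \<and> smooth_in c W f"
  shows "smooth_in c V f"
  unfolding smooth_in_def
proof (rule smooth_on_local[OF chd_image_open[OF assms(1)]])
  fix x assume "x \<in> snd c ` V"
  then obtain p where p: "p \<in> V" "x = snd c p" by auto
  from assms(2)[OF p(1)] obtain W where W: "open W" "p \<in> W" "W \<subseteq> V" "smooth_in c W f" by auto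
  then have "chd c W" using assms(1) chd_subset by blast
  then show "\<exists>S'. open S' \<and> x \<in> S' \<and> smooth_on S' (f \<circ> chart_inv c)"
    using W p chd_image_open unfolding smooth_in_def by (metis imageI)
qed

lemma smooth_in_continuous:
  assumes "chd c V" "smooth_in c V f"
  shows "continuous_on V f"
proof -
  have "continuous_on (snd c ` V) (f \<circ> chart_inv c)"
    using assms(2) smooth_on_continuous unfolding smooth_in_def by blast
  moreover have "continuous_on V (snd c)"
    using chart_homeo[of c] assms(1) unfolding chd_def homeomorphism_def by (metis continuous_on_subset)
  ultimately have "continuous_on V ((f \<circ> chart_inv c) \<circ> snd c)" by (rule continuous_on_compose[rotated])
  then show ?thesis
    by (rule continuous_on_eq) (use assms(1) in \<open>auto simp: chd_def chart_inv_chart subset_iff\<close>)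
qed

lemma bounded_linear_vec_nth_complex: "bounded_linear (\<lambda>x::complex^'d. x $ i)"
  by (rule bounded_linear_vec_nth)

lemma smooth_in_vec_iff:
  fixes Z :: "'m \<Rightarrow> complex ^ 'd"
  assumes "chd c V"
  shows "smooth_in c V Z \<longleftrightarrow> (\<forall>i. smooth_in c V (\<lambda>p. Z p $ i))"
proof
  assume "smooth_in c V Z"
  then show "\<forall>i. smooth_in c V (\<lambda>p. Z p $ i)"
    using smooth_in_bounded_linear[OF assms bounded_linear_vec_nth_complex] by blast
next
  assume a: "\<forall>i. smooth_in c V (\<lambda>p. Z p $ i)"
  have "bounded_linear (\<lambda>z::complex. z *s axis i (1::complex) :: complex ^ 'd)" for i
    by (rule linear_conv_bounded_linear[THEN iffD1]) (auto intro!: linearI simp: vec_eq_iff algebra_simps)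
  then have "smooth_in c V (\<lambda>p. \<Sum>i\<in>UNIV. Z p $ i *s axis i 1)"
    using a by (intro smooth_in_sum[OF assms]) (auto intro: smooth_in_bounded_linear[OF assms])
  then show "smooth_in c V Z" by (simp add: basis_expansion)
qed

lemma ddir_diff_at:
  assumes "chd c V" "smooth_in c V f" "p \<in> V"
  shows "((f \<circ> chart_inv c) has_derivative frechet_derivative (f \<circ> chart_inv c) (at (snd c p))) (at (snd c p))"
  using smooth_on_diff[OF chd_image_open[OF assms(1)]] assms unfolding smooth_in_def by blast

lemma ddir_eqI:
  assumes "((f \<circ> chart_inv c) has_derivative D) (at (snd c p))"
  shows "ddir c f p v = D (vRe v) + \<i> * D (vIm v)"
  unfolding ddir_def Let_def using fd_eqI[OF assms] by simp

lemma ddir_cong: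
  assumes "chd c V" "\<And>q. q \<in> V \<Longrightarrow> f q = g q" "p \<in> V"
  shows "ddir c f p v = ddir c g p v"
proof -
  have "frechet_derivative (f \<circ> chart_inv c) (at (snd c p)) = frechet_derivative (g \<circ> chart_inv c) (at (snd c p))"
    by (rule frechet_derivative_cong[OF chd_image_open[OF assms(1)]])
       (use assms in \<open>auto simp: chd_def chart_inv_chart subset_iff\<close>)
  then show ?thesis unfolding ddir_def by simp
qed

lemma ddir_const [simp]: "ddir c (\<lambda>_. a) p v = 0"
  by (subst ddir_eqI[of _ _ "\<lambda>_. 0"]) (auto simp: comp_def)

lemma ddir_add:
  assumes "chd c V" "smooth_in c V f" "smooth_in c V g" "p \<in> V"
  shows "ddir c (\<lambda>q. f q + g q) p v = ddir c f p v + ddir c g p v"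
proof -
  have "((\<lambda>q. f q + g q) \<circ> chart_inv c has_derivative (\<lambda>h.
      frechet_derivative (f \<circ> chart_inv c) (at (snd c p)) h +
      frechet_derivative (g \<circ> chart_inv c) (at (snd c p)) h)) (at (snd c p))"
    using has_derivative_add[OF ddir_diff_at[OF assms(1,2,4)] ddir_diff_at[OF assms(1,3,4)]]
    by (simp add: comp_def)
  from ddir_eqI[OF this] show ?thesis by (simp add: ddir_def Let_def algebra_simps)
qed

lemma ddir_mult:
  assumes "chd c V" "smooth_in c V f" "smooth_in c V g" "p \<in> V"
  shows "ddir c (\<lambda>q. f q * g q) p v = ddir c f p v * g p + f p * ddir c g p v"
proof -
  have p: "p \<in> fst c" "c \<in> A" using assms by (auto simp: chd_def)
  have "((\<lambda>q. f q * g q) \<circ> chart_inv c has_derivative (\<lambda>h. (f \<circ> chart_inv c) (snd c p) *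
      frechet_derivative (g \<circ> chart_inv c) (at (snd c p)) h +
      frechet_derivative (f \<circ> chart_inv c) (at (snd c p)) h * (g \<circ> chart_inv c) (snd c p))) (at (snd c p))"
    using has_derivative_mult[OF ddir_diff_at[OF assms(1,2,4)] ddir_diff_at[OF assms(1,3,4)]]
    by (simp add: comp_def)
  from ddir_eqI[OF this] show ?thesis
    using p by (simp add: ddir_def Let_def algebra_simps chart_inv_chart)
qed

lemma ddir_cmult:
  assumes "chd c V" "smooth_in c V f" "p \<in> V"
  shows "ddir c (\<lambda>q. a * f q) p v = a * ddir c f p v"
  using ddir_mult[OF assms(1) smooth_in_const assms(2,3)] by simp

lemma ddir_sum:
  assumes "chd c V" "\<And>i. i \<in> I \<Longrightarrow> smooth_in c V (f i)" "p \<in> V"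
  shows "ddir c (\<lambda>q. \<Sum>i\<in>I. f i q) p v = (\<Sum>i\<in>I. ddir c (f i) p v)"
  using assms(2)
proof (induction I rule: infinite_finite_induct)
  case (insert i I)
  then show ?case
    by (simp add: ddir_add[OF assms(1) _ smooth_in_sum[OF assms(1)] assms(3)])
qed auto

text \<open>\<open>ddir\<close> extends a real derivative complex linearly, so conjugating the
  function is compensated by conjugating the direction. This makes d commute with complex
  conjugation of forms.\<close>

lemma ddir_cnj:
  assumes "chd c V" "smooth_in c V f" "p \<in> V"
  shows "ddir c (\<lambda>q. cnj (f q)) p v = cnj (ddir c f p (vcnj v))"
proof -
  let ?D = "frechet_derivative (f \<circ> chart_inv c) (at (snd c p))"
  have l: "linear ?D"
    using ddir_diff_at[OF assms] has_derivative_bounded_linear bounded_linear.linear by blast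
  have "vRe (vcnj v) = vRe v" "vIm (vcnj v) = - vIm v" by (auto simp: vec_eq_iff)
  moreover have "((\<lambda>q. cnj (f q)) \<circ> chart_inv c has_derivative (\<lambda>h. cnj (?D h))) (at (snd c p))"
    using bounded_linear.has_derivative[OF bounded_linear_cnj ddir_diff_at[OF assms]]
    by (simp add: comp_def)
  note ddir_eqI[OF this]
  ultimately show ?thesis
    by (simp add: ddir_def Let_def linear_neg[OF l])
qed

lemma ddir_linear:
  assumes "chd c V" "smooth_in c V f" "p \<in> V"
  shows "Vector_Spaces.linear (*s) (*) (ddir c f p)"
proof -
  let ?D = "frechet_derivative (f \<circ> chart_inv c) (at (snd c p))"
  have l: "linear ?D"
    using ddir_diff_at[OF assms] has_derivative_bounded_linear bounded_linear.linear by blast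
  show ?thesis
    unfolding Vector_Spaces.linear_iff
  proof (intro conjI allI)
    show "vector_space ((*s) :: complex \<Rightarrow> complex ^ 'd \<Rightarrow> _)" by (rule vec.vector_space_axioms)
    show "vector_space ((*) :: complex \<Rightarrow> _)" by (simp add: vector_space_def algebra_simps)
    show "ddir c f p (x + y) = ddir c f p x + ddir c f p y" for x y
    proof -
      have "vRe (x + y) = vRe x + vRe y" "vIm (x + y) = vIm x + vIm y" by (auto simp: vec_eq_iff)
      then show ?thesis by (simp add: ddir_def Let_def linear_add[OF l] algebra_simps)
    qed
    show "ddir c f p (a *s x) = a * ddir c f p x" for a x
    proof -
      have "vRe (a *s x) = Re a *\<^sub>R vRe x - Im a *\<^sub>R vIm x" "vIm (a *s x) = Re a *\<^sub>R vIm x + Im a *\<^sub>R vRe x"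
        by (auto simp: vec_eq_iff)
      then have "?D (vRe (a *s x)) = of_real (Re a) * ?D (vRe x) - of_real (Im a) * ?D (vIm x)"
        "?D (vIm (a *s x)) = of_real (Re a) * ?D (vIm x) + of_real (Im a) * ?D (vRe x)"
        by (simp_all only: linear_add[OF l] linear_diff[OF l] linear_cmul[OF l] scaleR_conv_of_real[where 'a = complex])
      then have "ddir c f p (a *s x) = (of_real (Re a) + \<i> * of_real (Im a)) * ?D (vRe x) +
         (of_real (Re a) + \<i> * of_real (Im a)) * (\<i> * ?D (vIm x))"
        unfolding ddir_def Let_def by (simp add: algebra_simps)
      also have "\<dots> = a * ddir c f p x" unfolding complex_eq[symmetric] by (simp add: ddir_def Let_def algebra_simps)
      finally show ?thesis .
    qed
  qed
qed

lemma smooth_in_ddir: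
  assumes "chd c V" "smooth_in c V f"
  shows "smooth_in c V (\<lambda>p. ddir c f p v)"
proof -
  have o: "open (snd c ` V)" by (rule chd_image_open[OF assms(1)])
  have F: "smooth_on (snd c ` V) (f \<circ> chart_inv c)" using assms(2) by (simp add: smooth_in_def)
  have "smooth_on (snd c ` V) (\<lambda>x. frechet_derivative (f \<circ> chart_inv c) (at x) (vRe v) +
      \<i> * frechet_derivative (f \<circ> chart_inv c) (at x) (vIm v))"
    by (intro smooth_on_add[OF o] smooth_on_fd F smooth_on_bounded_linear[OF o bounded_linear_mult_right])
  then show ?thesis unfolding smooth_in_def
    by (rule smooth_on_cong[OF o, rotated])
       (use assms in \<open>auto simp: ddir_def Let_def chart_inv_chart chd_def subset_iff\<close>)
qed

text \<open>For real directions the second summand in \<open>ddir\<close> is zero, so the iterated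
  derivative is a second Frechet derivative, to which the symmetry theorem applies.\<close>

lemma ddir_ddir_real:
  assumes "chd c V" "smooth_in c V f" "p \<in> V"
  shows "ddir c (\<lambda>q. ddir c f q (cvec v)) p (cvec w) =
     frechet_derivative (\<lambda>x. frechet_derivative (f \<circ> chart_inv c) (at x) v) (at (snd c p)) w"
proof -
  have o: "open (snd c ` V)" by (rule chd_image_open[OF assms(1)])
  have *: "ddir c g q (cvec u) = frechet_derivative (g \<circ> chart_inv c) (at (snd c q)) u"
    if "smooth_in c V g" "q \<in> V" for g q u
  proof -
    have l: "linear (frechet_derivative (g \<circ> chart_inv c) (at (snd c q)))"
      using ddir_diff_at[OF assms(1) that] has_derivative_bounded_linear bounded_linear.linear by blast
    have "vRe (cvec u) = u" "vIm (cvec u) = 0" by (auto simp: vec_eq_iff)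
    then show ?thesis by (simp add: ddir_def Let_def linear_0[OF l])
  qed
  have "ddir c (\<lambda>q. ddir c f q (cvec v)) p (cvec w) =
      frechet_derivative ((\<lambda>q. ddir c f q (cvec v)) \<circ> chart_inv c) (at (snd c p)) w"
    by (rule *[OF smooth_in_ddir[OF assms(1,2)] assms(3)])
  also have "\<dots> = frechet_derivative (\<lambda>x. frechet_derivative (f \<circ> chart_inv c) (at x) v) (at (snd c p)) w"
    by (subst frechet_derivative_cong[OF o, where g = "\<lambda>x. frechet_derivative (f \<circ> chart_inv c) (at x) v"])
       (use assms in \<open>auto simp: * chart_inv_chart chd_def subset_iff\<close>)
  finally show ?thesis .
qed

lemma ddir_add_vec:
  assumes "chd c V" "smooth_in c V f" "p \<in> V"
  shows "ddir c f p (v + w) = ddir c f p v + ddir c f p w"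
    and "ddir c f p (a *s v) = a * ddir c f p v"
  using ddir_linear[OF assms] by (auto simp: Vector_Spaces.linear_iff)

text \<open>Both directions are split into real and imaginary parts, where second derivatives are
  symmetric. This is the source of d d = 0 and of the symmetry of derivatives of Jacobians.\<close>

lemma ddir_commute:
  assumes "chd c V" "smooth_in c V f" "p \<in> V"
  shows "ddir c (\<lambda>q. ddir c f q v) p w = ddir c (\<lambda>q. ddir c f q w) p v"
proof -
  note dd = ddir_add_vec[OF assms(1,2)] ddir_add_vec[OF assms(1) smooth_in_ddir[OF assms(1,2)] assms(3)]
  have sym: "ddir c (\<lambda>q. ddir c f q (cvec v)) p (cvec w) = ddir c (\<lambda>q. ddir c f q (cvec w)) p (cvec v)" for v w
    unfolding ddir_ddir_real[OF assms]
    using second_derivative_symmetric[OF chd_image_open[OF assms(1)], of "f \<circ> chart_inv c" "snd c p"] assms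
    by (auto simp: smooth_in_def)
  have exp: "ddir c (\<lambda>q. ddir c f q (a + \<i> *s b)) p w = ddir c (\<lambda>q. ddir c f q a) p w + \<i> * ddir c (\<lambda>q. ddir c f q b) p w" for a b w
  proof -
    have "ddir c (\<lambda>q. ddir c f q (a + \<i> *s b)) p w = ddir c (\<lambda>q. ddir c f q a + \<i> * ddir c f q b) p w"
      by (rule ddir_cong[OF assms(1) _ assms(3)]) (simp add: dd)
    also have "\<dots> = ddir c (\<lambda>q. ddir c f q a) p w + \<i> * ddir c (\<lambda>q. ddir c f q b) p w"
      by (subst ddir_add[OF assms(1) smooth_in_ddir[OF assms(1,2)] _ assms(3)])
         (auto intro!: smooth_in_mult[OF assms(1)] smooth_in_const smooth_in_ddir[OF assms(1,2)]
            simp: ddir_cmult[OF assms(1) smooth_in_ddir[OF assms(1,2)] assms(3)])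
    finally show ?thesis .
  qed
  show ?thesis
    apply (subst (1 2) vRe_vIm_eq[of v], subst (1 2) vRe_vIm_eq[of w])
    unfolding exp dd by (simp add: sym algebra_simps)
qed

section \<open>Jacobians of the coordinate changes\<close>

lemma smooth_in_chart:
  assumes "c \<in> A" "c' \<in> A"
  shows "smooth_in c (fst c \<inter> fst c') (\<lambda>q. complex_of_real (snd c' q $ i))"
proof -
  have o: "open (snd c ` (fst c \<inter> fst c'))"
    by (rule chd_image_open[OF chd_overlap[OF assms]])
  have "bounded_linear (\<lambda>x :: real ^ 'd. complex_of_real (x $ i))"
    by (intro bounded_linear_compose[OF bounded_linear_of_real] bounded_linear_vec_nth)
  from smooth_on_bounded_linear[OF o this smooth_transition[OF assms]]
  show ?thesis by (simp add: smooth_in_def comp_def)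
qed

lemma smooth_in_change:
  assumes "chd c V" "chd c' V" "smooth_in c' V f"
  shows "smooth_in c V f"
proof -
  have c: "c \<in> A" "c' \<in> A" "V \<subseteq> fst c" "V \<subseteq> fst c'" using assms by (auto simp: chd_def)
  have "smooth_on (snd c ` V) (snd c' \<circ> chart_inv c)"
    by (rule smooth_on_subset[OF smooth_transition[OF c(1,2)]]) (use c in auto)
  moreover have "(snd c' \<circ> chart_inv c) ` (snd c ` V) \<subseteq> snd c' ` V"
    using c by (auto simp: chart_inv_chart subset_iff)
  ultimately have "smooth_on (snd c ` V) (\<lambda>x. (f \<circ> chart_inv c') ((snd c' \<circ> chart_inv c) x))"
    using smooth_on_compose[OF chd_image_open[OF assms(1)] chd_image_open[OF assms(2)]] assms(3)
    unfolding smooth_in_def by blast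
  then show ?thesis unfolding smooth_in_def
    by (rule smooth_on_cong[OF chd_image_open[OF assms(1)], rotated])
       (use c in \<open>auto simp: chart_inv_chart subset_iff\<close>)
qed

lemma transition_diff:
  assumes "c \<in> A" "c' \<in> A" "p \<in> fst c" "p \<in> fst c'"
  shows "((snd c' \<circ> chart_inv c) has_derivative frechet_derivative (snd c' \<circ> chart_inv c) (at (snd c p))) (at (snd c p))"
  using smooth_on_diff[OF chd_image_open[OF chd_overlap[OF assms(1,2)]] smooth_transition[OF assms(1,2)]] assms
  by blast

lemma ddir_chain:
  assumes "chd c V" "chd c' V" "smooth_in c' V f" "p \<in> V"
  shows "ddir c f p v = ddir c' f p (jac c c' p v)"
proof -
  have c: "c \<in> A" "c' \<in> A" "V \<subseteq> fst c" "V \<subseteq> fst c'" using assms by (auto simp: chd_def)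
  then have p: "p \<in> fst c" "p \<in> fst c'" using assms by auto
  let ?J = "frechet_derivative (snd c' \<circ> chart_inv c) (at (snd c p))"
  let ?D = "frechet_derivative (f \<circ> chart_inv c') (at (snd c' p))"
  have e: "(snd c' \<circ> chart_inv c) (snd c p) = snd c' p" using p c by (simp add: chart_inv_chart)
  have "((\<lambda>x. (f \<circ> chart_inv c') ((snd c' \<circ> chart_inv c) x)) has_derivative (\<lambda>x. ?D (?J x))) (at (snd c p))"
    by (rule has_derivative_compose[OF transition_diff[OF c(1,2) p]])
       (unfold e, rule ddir_diff_at[OF assms(2-4)])
  then have "((f \<circ> chart_inv c) has_derivative (\<lambda>x. ?D (?J x))) (at (snd c p))"
    by (rule has_derivative_transform_within_open[OF _ chd_image_open[OF assms(1)]])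
       (use c assms in \<open>auto simp: chart_inv_chart subset_iff\<close>)
  then have "ddir c f p v = ?D (?J (vRe v)) + \<i> * ?D (?J (vIm v))" by (rule ddir_eqI)
  moreover have "vRe (jac c c' p v) = ?J (vRe v)" "vIm (jac c c' p v) = ?J (vIm v)"
    by (simp_all add: jac_def Let_def vec_eq_iff)
  ultimately show ?thesis by (simp add: ddir_def Let_def)
qed

text \<open>Reads the Jacobian as derivatives of the coordinate functions of \<open>c'\<close>, so
  that linearity, smoothness, reality and the cocycle rule reduce to properties of
  \<open>ddir\<close>.\<close>

lemma jac_nth:
  assumes "c \<in> A" "c' \<in> A" "p \<in> fst c" "p \<in> fst c'"
  shows "jac c c' p v $ i = ddir c (\<lambda>q. complex_of_real (snd c' q $ i)) p v"
proof -
  have "bounded_linear (\<lambda>x :: real ^ 'd. complex_of_real (x $ i))"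
    by (intro bounded_linear_compose[OF bounded_linear_of_real] bounded_linear_vec_nth)
  from bounded_linear.has_derivative[OF this transition_diff[OF assms]]
  have "((\<lambda>q. complex_of_real (snd c' q $ i)) \<circ> chart_inv c has_derivative
     (\<lambda>x. complex_of_real (frechet_derivative (snd c' \<circ> chart_inv c) (at (snd c p)) x $ i))) (at (snd c p))"
    by (simp add: comp_def)
  from ddir_eqI[OF this] show ?thesis by (simp add: jac_def Let_def)
qed

lemma smooth_in_jac:
  assumes "c \<in> A" "c' \<in> A"
  shows "smooth_in c (fst c \<inter> fst c') (\<lambda>p. jac c c' p v $ i)"
proof -
  have "chd c (fst c \<inter> fst c')" using chd_overlap assms by blast
  show ?thesis
    by (rule smooth_in_cong[OF \<open>chd c _\<close> _ smooth_in_ddir[OF \<open>chd c _\<close> smooth_in_chart[OF assms]]])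
       (simp add: jac_nth[OF assms])
qed

lemma jac_linear:
  assumes "c \<in> A" "c' \<in> A" "p \<in> fst c" "p \<in> fst c'"
  shows "jac c c' p (v + w) = jac c c' p v + jac c c' p w" "jac c c' p (a *s v) = a *s jac c c' p v"
proof -
  have "chd c (fst c \<inter> fst c')" "p \<in> fst c \<inter> fst c'" using assms chd_overlap by auto
  note d = ddir_add_vec[OF this(1) smooth_in_chart[OF assms(1,2)] this(2)]
  show "jac c c' p (v + w) = jac c c' p v + jac c c' p w" "jac c c' p (a *s v) = a *s jac c c' p v"
    by (simp_all add: vec_eq_iff jac_nth[OF assms] d)
qed

lemma jac_vcnj:
  assumes "c \<in> A" "c' \<in> A" "p \<in> fst c" "p \<in> fst c'"
  shows "jac c c' p (vcnj v) = vcnj (jac c c' p v)"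
proof -
  have "chd c (fst c \<inter> fst c')" "p \<in> fst c \<inter> fst c'" using assms chd_overlap by auto
  from ddir_cnj[OF this(1) smooth_in_chart[OF assms(1,2)] this(2), of _ "vcnj v"]
  show ?thesis by (simp add: vec_eq_iff jac_nth[OF assms])
qed

lemma jac_cocycle:
  assumes "c \<in> A" "c' \<in> A" "c'' \<in> A" "p \<in> fst c" "p \<in> fst c'" "p \<in> fst c''"
  shows "jac c' c'' p (jac c c' p v) = jac c c'' p v"
proof -
  let ?V = "fst c \<inter> fst c' \<inter> fst c''"
  have V: "chd c ?V" "chd c' ?V" "p \<in> ?V" using assms by (simp_all add: chd_def chart_open open_Int) auto
  have "smooth_in c' ?V (\<lambda>q. complex_of_real (snd c'' q $ i))" for i
    by (rule smooth_in_subset[OF smooth_in_chart[OF assms(2,3)]]) auto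
  from ddir_chain[OF V(1,2) this V(3)] show ?thesis
    by (simp add: vec_eq_iff jac_nth assms)
qed

lemma jac_self:
  assumes "c \<in> A" "p \<in> fst c"
  shows "jac c c p v = v"
proof -
  have "((\<lambda>x. x) has_derivative (\<lambda>x. x)) (at (snd c p))" by simp
  then have "((snd c \<circ> chart_inv c) has_derivative (\<lambda>x. x)) (at (snd c p))"
    by (rule has_derivative_transform_within_open[OF _ chd_image_open[OF chd_fst[OF assms(1)]]])
       (use assms in \<open>auto simp: chart_inv_chart\<close>)
  from fd_eqI[OF this] show ?thesis unfolding jac_def Let_def
    using vRe_vIm_eq[of v, symmetric] by simp
qed

lemma jac_inverse:
  assumes "c \<in> A" "c' \<in> A" "p \<in> fst c" "p \<in> fst c'"
  shows "jac c' c p (jac c c' p v) = v"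
  using jac_cocycle[of c c' c p] jac_self[of c p] assms by simp

text \<open>The entries are second derivatives of coordinate functions. Geometrically: the constant
  fields of one chart, read in another, still commute.\<close>

lemma jac_symmetric:
  assumes "c \<in> A" "c' \<in> A" "p \<in> fst c" "p \<in> fst c'"
  shows "ddir c (\<lambda>q. jac c c' q v $ i) p w = ddir c (\<lambda>q. jac c c' q w $ i) p v"
proof -
  let ?V = "fst c \<inter> fst c'"
  have V: "chd c ?V" "p \<in> ?V" using assms chd_overlap by auto
  have *: "ddir c (\<lambda>q. jac c c' q v $ i) p w =
      ddir c (\<lambda>q. ddir c (\<lambda>q. complex_of_real (snd c' q $ i)) q v) p w" for v w
    by (rule ddir_cong[OF V(1) _ V(2)]) (use assms in \<open>auto simp: jac_nth\<close>)
  show ?thesis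
    unfolding * by (rule ddir_commute[OF V(1) smooth_in_chart[OF assms(1,2)] V(2)])
qed

end

section \<open>Exterior algebra\<close>

hide_const (open) Finite_Cartesian_Product.transpose

text \<open>Interior multiplication. The algebra of forms below runs by recursion on the argument
  list through it.\<close>

definition con :: "'v \<Rightarrow> ('v list \<Rightarrow> complex) \<Rightarrow> 'v list \<Rightarrow> complex" where
  "con v \<alpha> = (\<lambda>vs. \<alpha> (v # vs))"

lemma con_apply [simp]: "con v \<alpha> vs = \<alpha> (v # vs)" by (simp add: con_def)

lemma linear_iff_complex:
  fixes f :: "complex ^ 'd \<Rightarrow> complex"
  shows "Vector_Spaces.linear (*s) (*) f \<longleftrightarrow> (\<forall>x y. f (x + y) = f x + f y) \<and> (\<forall>c x. f (c *s x) = c * f x)"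
proof -
  have "vector_space ((*s) :: complex \<Rightarrow> complex ^ 'd \<Rightarrow> _)" "vector_space ((*) :: complex \<Rightarrow> _)"
    by (rule vec.vector_space_axioms) (simp add: vector_space_def algebra_simps)
  then show ?thesis unfolding Vector_Spaces.linear_iff by blast
qed

lemma alt_length: "\<alpha> \<in> alt_forms k \<Longrightarrow> length vs \<noteq> k \<Longrightarrow> \<alpha> vs = 0"
  by (auto simp: alt_forms_def)

lemma alt_add: "\<alpha> \<in> alt_forms k \<Longrightarrow> length vs = k \<Longrightarrow> i < k \<Longrightarrow>
    \<alpha> (vs[i := v + w]) = \<alpha> (vs[i := v]) + \<alpha> (vs[i := w])"
  by (auto simp: alt_forms_def linear_iff_complex)

lemma alt_smult: "\<alpha> \<in> alt_forms k \<Longrightarrow> length vs = k \<Longrightarrow> i < k \<Longrightarrow>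
    \<alpha> (vs[i := a *s v]) = a * \<alpha> (vs[i := v])"
  by (auto simp: alt_forms_def linear_iff_complex)

lemma alt_repeat: "\<alpha> \<in> alt_forms k \<Longrightarrow> length vs = k \<Longrightarrow> i < k \<Longrightarrow> j < k \<Longrightarrow> i \<noteq> j \<Longrightarrow> vs ! i = vs ! j \<Longrightarrow> \<alpha> vs = 0"
proof -
  assume a: "\<alpha> \<in> alt_forms k" "length vs = k" "i < k" "j < k" "i \<noteq> j" "vs ! i = vs ! j"
  have *: "\<alpha> vs = 0" if "i < j" "j < k" "vs ! i = vs ! j" for i j
    using a(1,2) that unfolding alt_forms_def mem_Collect_eq by blast
  show ?thesis
  proof (cases "i < j")
    case True then show ?thesis using * a by blast
  next
    case False then show ?thesis using *[of j i] a by simp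
  qed
qed

lemma alt_swap:
  assumes "\<alpha> \<in> alt_forms k" "length vs = k" "i < k" "j < k" "i \<noteq> j"
  shows "\<alpha> (vs[i := vs ! j, j := vs ! i]) = - \<alpha> vs"
proof -
  let ?x = "vs ! i" and ?y = "vs ! j"
  have s: "vs[i := u, j := u'] = vs[j := u', i := u]" for u u' using assms(5) by (rule list_update_swap)
  have r: "\<alpha> (vs[i := u, j := u]) = 0" for u
    using assms by (intro alt_repeat[OF assms(1), of _ i j]) auto
  have "0 = \<alpha> (vs[i := ?x + ?y, j := ?x + ?y])" using r by simp
  also have "\<dots> = \<alpha> (vs[i := ?x + ?y, j := ?x]) + \<alpha> (vs[i := ?x + ?y, j := ?y])"
    using assms by (intro alt_add) auto
  also have "\<dots> = \<alpha> (vs[i := ?x, j := ?x]) + \<alpha> (vs[i := ?y, j := ?x]) + (\<alpha> (vs[i := ?x, j := ?y]) + \<alpha> (vs[i := ?y, j := ?y]))"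
    unfolding s using assms by (intro arg_cong2[where f="(+)"] alt_add) auto
  finally show ?thesis using r[of ?x] r[of ?y] assms by (simp add: eq_neg_iff_add_eq_0)
qed

lemma con_alt:
  assumes "\<alpha> \<in> alt_forms (Suc k)" shows "con v \<alpha> \<in> alt_forms k"
  unfolding alt_forms_def mem_Collect_eq
proof (intro conjI allI impI)
  show "con v \<alpha> vs = 0" if "length vs \<noteq> k" for vs
    using that alt_length[OF assms, of "v # vs"] by simp
  show "Vector_Spaces.linear (*s) (*) (\<lambda>w. con v \<alpha> (vs[i := w]))" if "length vs = k \<and> i < k" for vs i
    using that alt_add[OF assms, of "v # vs" "Suc i"] alt_smult[OF assms, of "v # vs" "Suc i"]
    by (simp add: linear_iff_complex)
  show "con v \<alpha> vs = 0" if "length vs = k \<and> i < j \<and> j < k \<and> vs ! i = vs ! j" for vs i j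
    using that alt_repeat[OF assms, of "v # vs" "Suc i" "Suc j"] by simp
qed

lemma con_alt_0:
  assumes "\<alpha> \<in> alt_forms 0" shows "con v \<alpha> = (\<lambda>_. 0)"
  using alt_length[OF assms] by (auto simp: con_def)

lemma alt_zero: "(\<lambda>_. 0) \<in> alt_forms k"
  by (simp add: alt_forms_def linear_iff_complex)

lemma alt_add_form:
  assumes "\<alpha> \<in> alt_forms k" "\<beta> \<in> alt_forms k" shows "(\<lambda>vs. \<alpha> vs + \<beta> vs) \<in> alt_forms k"
  using assms unfolding alt_forms_def linear_iff_complex by (simp add: add_ac distrib_left)

lemma alt_smult_form:
  assumes "\<alpha> \<in> alt_forms k" shows "(\<lambda>vs. a * \<alpha> vs) \<in> alt_forms k"
  using assms unfolding alt_forms_def linear_iff_complex by (simp add: distrib_left mult_ac)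

section \<open>The wedge product through interior multiplication\<close>

lemma wedge_homogeneous:
  assumes "\<alpha> \<in> alt_forms a"
  shows "wedge \<alpha> \<beta> vs =
     (if a \<le> length vs then
        (\<Sum>\<sigma> | \<sigma> permutes {..<length vs}.
           of_int (sign \<sigma>) * \<alpha> (map (\<lambda>i. vs ! \<sigma> i) [0..<a]) * \<beta> (map (\<lambda>i. vs ! \<sigma> i) [a..<length vs]))
        / (fact a * fact (length vs - a)) else 0)"
proof -
  have "wedge \<alpha> \<beta> vs = (\<Sum>k\<le>length vs. if k = a then (\<Sum>\<sigma> | \<sigma> permutes {..<length vs}.
           of_int (sign \<sigma>) * \<alpha> (map (\<lambda>i. vs ! \<sigma> i) [0..<k]) * \<beta> (map (\<lambda>i. vs ! \<sigma> i) [k..<length vs]))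
        / (fact k * fact (length vs - k)) else 0)"
    unfolding wedge_def by (intro sum.cong) (auto simp: alt_length[OF assms])
  then show ?thesis by (simp add: sum.delta)
qed

lemma wedge_length:
  assumes "\<alpha> \<in> alt_forms a" "\<beta> \<in> alt_forms b" "length vs \<noteq> a + b"
  shows "wedge \<alpha> \<beta> vs = 0"
  using assms(3) by (auto simp: wedge_homogeneous[OF assms(1)] alt_length[OF assms(2)])

definition wterm :: "('v list \<Rightarrow> complex) \<Rightarrow> ('v list \<Rightarrow> complex) \<Rightarrow> nat \<Rightarrow> 'v list \<Rightarrow> (nat \<Rightarrow> nat) \<Rightarrow> complex" where
  "wterm \<alpha> \<beta> a xs \<sigma> = of_int (sign \<sigma>) * \<alpha> (map (\<lambda>i. xs ! \<sigma> i) [0..<a]) * \<beta> (map (\<lambda>i. xs ! \<sigma> i) [a..<length xs])"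

text \<open>A transposition of two positions in the same block flips the sign of the permutation and
  of one factor. Hence a sum over permutations depends only on the block in which the first argument
  lands.\<close>

lemma wterm_swap:
  assumes ab: "\<alpha> \<in> alt_forms a" "\<beta> \<in> alt_forms b" "length xs = a + b"
    and s: "\<sigma> permutes {..<a + b}" and ij: "(i < a \<and> j < a) \<or> (a \<le> i \<and> i < a + b \<and> a \<le> j \<and> j < a + b)"
  shows "wterm \<alpha> \<beta> a xs (\<sigma> \<circ> transpose i j) = wterm \<alpha> \<beta> a xs \<sigma>"
proof (cases "i = j")
  case False
  have p: "permutation \<sigma>" "permutation (transpose i j)"
    using s by (auto intro: permutation_permutes[THEN iffD2] permutation_swap_id)
  have sg: "sign (\<sigma> \<circ> transpose i j) = - sign \<sigma>"
    using False by (simp add: sign_compose[OF p] sign_swap_id)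
  show ?thesis
  proof (cases "i < a \<and> j < a")
    case True
    let ?L = "map (\<lambda>k. xs ! \<sigma> k) [0..<a]"
    have "map (\<lambda>k. xs ! (\<sigma> \<circ> transpose i j) k) [0..<a] = ?L[i := ?L ! j, j := ?L ! i]"
      using True by (intro nth_equalityI) (auto simp: nth_list_update Transposition.transpose_def)
    moreover have "\<alpha> (?L[i := ?L ! j, j := ?L ! i]) = - \<alpha> ?L"
      using True False by (intro alt_swap[OF ab(1)]) auto
    moreover have "map (\<lambda>k. xs ! (\<sigma> \<circ> transpose i j) k) [a..<length xs] = map (\<lambda>k. xs ! \<sigma> k) [a..<length xs]"
      using True by (auto simp: Transposition.transpose_def)
    ultimately show ?thesis unfolding wterm_def sg by (simp del: map_eq_conv)
  next
    case F: False
    let ?L = "map (\<lambda>k. xs ! \<sigma> k) [a..<length xs]"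
    have l: "length ?L = b" using ab by simp
    have n: "?L ! (k - a) = xs ! \<sigma> k" if "a \<le> k" "k < a + b" for k
      using that ab(3) nth_upt[of a "k - a" "a + b"] by simp
    have "map (\<lambda>k. xs ! (\<sigma> \<circ> transpose i j) k) [a..<length xs] = ?L[i - a := ?L ! (j - a), j - a := ?L ! (i - a)]"
    proof (rule nth_equalityI)
      fix k assume k: "k < length (map (\<lambda>k. xs ! (\<sigma> \<circ> transpose i j) k) [a..<length xs])"
      show "map (\<lambda>k. xs ! (\<sigma> \<circ> transpose i j) k) [a..<length xs] ! k = ?L[i - a := ?L ! (j - a), j - a := ?L ! (i - a)] ! k"
        using F ij k ab(3) by (auto simp: nth_list_update Transposition.transpose_def)
    qed simp
    moreover have "\<beta> (?L[i - a := ?L ! (j - a), j - a := ?L ! (i - a)]) = - \<beta> ?L"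
      using F ij False l by (intro alt_swap[OF ab(2)]) auto
    moreover have "map (\<lambda>k. xs ! (\<sigma> \<circ> transpose i j) k) [0..<a] = map (\<lambda>k. xs ! \<sigma> k) [0..<a]"
      using F ij by (auto simp: Transposition.transpose_def)
    ultimately show ?thesis unfolding wterm_def sg by (simp del: map_eq_conv)
  qed
qed simp

text \<open>The part of the sum in which the first argument is placed at position
  \<open>i\<close>.\<close>

definition Tsum :: "('v list \<Rightarrow> complex) \<Rightarrow> ('v list \<Rightarrow> complex) \<Rightarrow> nat \<Rightarrow> 'v list \<Rightarrow> nat \<Rightarrow> complex" where
  "Tsum \<alpha> \<beta> a xs i = (\<Sum>\<sigma> | \<sigma> permutes {..<length xs} \<and> \<sigma> i = 0. wterm \<alpha> \<beta> a xs \<sigma>)"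

lemma Tsum_eq:
  assumes ab: "\<alpha> \<in> alt_forms a" "\<beta> \<in> alt_forms b" "length xs = a + b"
    and ij: "(i < a \<and> j < a) \<or> (a \<le> i \<and> i < a + b \<and> a \<le> j \<and> j < a + b)"
  shows "Tsum \<alpha> \<beta> a xs i = Tsum \<alpha> \<beta> a xs j"
proof -
  have t: "transpose i j permutes {..<a+b}" using ij by (intro permutes_swap_id) auto
  show ?thesis unfolding Tsum_def ab(3)
  proof (rule sum.reindex_bij_witness[of _ "\<lambda>\<sigma>. \<sigma> \<circ> transpose i j" "\<lambda>\<sigma>. \<sigma> \<circ> transpose i j"])
    fix \<sigma> assume s: "\<sigma> \<in> {\<sigma>. \<sigma> permutes {..<a + b} \<and> \<sigma> i = 0}"
    then show "\<sigma> \<circ> transpose i j \<circ> transpose i j = \<sigma>" by (simp add: comp_assoc)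
    show "\<sigma> \<circ> transpose i j \<in> {\<sigma>. \<sigma> permutes {..<a + b} \<and> \<sigma> j = 0}"
      using s permutes_compose[OF t] by auto
    show "wterm \<alpha> \<beta> a xs (\<sigma> \<circ> transpose i j) = wterm \<alpha> \<beta> a xs \<sigma>"
      using wterm_swap[OF ab _ ij] s by simp
  next
    fix \<sigma> assume s: "\<sigma> \<in> {\<sigma>. \<sigma> permutes {..<a + b} \<and> \<sigma> j = 0}"
    then show "\<sigma> \<circ> transpose i j \<circ> transpose i j = \<sigma>" by (simp add: comp_assoc)
    show "\<sigma> \<circ> transpose i j \<in> {\<sigma>. \<sigma> permutes {..<a + b} \<and> \<sigma> i = 0}"
      using s permutes_compose[OF t] by auto
  qed
qed

lemma sum_wterm_Tsum:
  assumes "length xs = Suc M"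
  shows "(\<Sum>\<sigma> | \<sigma> permutes {..<length xs}. wterm \<alpha> \<beta> a xs \<sigma>) = (\<Sum>i<Suc M. Tsum \<alpha> \<beta> a xs i)"
proof -
  let ?P = "{\<sigma>. \<sigma> permutes {..<Suc M}}"
  have f: "finite ?P" by (rule finite_permutations) simp
  \<comment> \<open>Permutations are grouped by the position \<open>inv_into UNIV \<sigma> 0\<close>
    of the first argument.\<close>
  have "(\<Sum>\<sigma>\<in>?P. wterm \<alpha> \<beta> a xs \<sigma>) = (\<Sum>i<Suc M. \<Sum>\<sigma>\<in>{\<sigma> \<in> ?P. inv_into UNIV \<sigma> 0 = i}. wterm \<alpha> \<beta> a xs \<sigma>)"
  proof (rule sum.group[OF f, symmetric])
    have "inv_into UNIV \<sigma> 0 < Suc M" if "\<sigma> permutes {..<Suc M}" for \<sigma>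
      using permutes_in_image[OF permutes_inv[OF that], of 0] by simp
    then show "(\<lambda>\<sigma>. inv_into UNIV \<sigma> 0) ` ?P \<subseteq> {..<Suc M}" by auto
  qed simp
  also have "\<dots> = (\<Sum>i<Suc M. Tsum \<alpha> \<beta> a xs i)"
    unfolding Tsum_def assms
    by (intro sum.cong) (auto simp: permutes_inv_eq permutes_inverses)
  finally show ?thesis by (simp add: assms)
qed

definition lift_perm :: "nat \<Rightarrow> (nat \<Rightarrow> nat) \<Rightarrow> nat \<Rightarrow> nat" where
  "lift_perm M \<tau> = map_permutation {..<M} Suc \<tau>"

lemma lift_perm_props:
  assumes "\<tau> permutes {..<M}"
  shows "lift_perm M \<tau> permutes {..<Suc M}" "lift_perm M \<tau> 0 = 0"
    "\<And>j. j < M \<Longrightarrow> lift_perm M \<tau> (Suc j) = Suc (\<tau> j)" "sign (lift_perm M \<tau>) = sign \<tau>"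
proof -
  have "bij_betw Suc {..<M} {1..<Suc M}"
    by (metis bij_betw_def image_Suc_atLeastLessThan inj_Suc lessThan_atLeast0 One_nat_def)
  then have p: "lift_perm M \<tau> permutes {1..<Suc M}"
    unfolding lift_perm_def by (rule map_permutation_permutes[OF _ assms])
  then show "lift_perm M \<tau> permutes {..<Suc M}" by (rule permutes_subset) auto
  show "lift_perm M \<tau> 0 = 0" using p by (simp add: permutes_def)
  show "lift_perm M \<tau> (Suc j) = Suc (\<tau> j)" if "j < M" for j
    unfolding lift_perm_def by (rule map_permutation_apply) (use that in auto)
  show "sign (lift_perm M \<tau>) = sign \<tau>"
    unfolding lift_perm_def by (rule sign_map_permutation) (use assms in auto)
qed

lemma bij_lift_perm: "bij_betw (lift_perm M) {\<tau>. \<tau> permutes {..<M}} {\<sigma>. \<sigma> permutes {..<Suc M} \<and> \<sigma> 0 = 0}"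
proof (rule bij_betwI')
  fix \<tau> \<tau>' assume t: "\<tau> \<in> {\<tau>. \<tau> permutes {..<M}}" "\<tau>' \<in> {\<tau>. \<tau> permutes {..<M}}"
  show "(lift_perm M \<tau> = lift_perm M \<tau>') = (\<tau> = \<tau>')"
  proof
    assume e: "lift_perm M \<tau> = lift_perm M \<tau>'"
    show "\<tau> = \<tau>'"
    proof
      fix j show "\<tau> j = \<tau>' j"
      proof (cases "j < M")
        case True
        then show ?thesis using lift_perm_props(3)[of \<tau> M j] lift_perm_props(3)[of \<tau>' M j] t e by auto
      next
        case False then show ?thesis using t by (auto simp: permutes_def)
      qed
    qed
  qed simp
next
  fix \<tau> assume "\<tau> \<in> {\<tau>. \<tau> permutes {..<M}}"
  then show "lift_perm M \<tau> \<in> {\<sigma>. \<sigma> permutes {..<Suc M} \<and> \<sigma> 0 = 0}" using lift_perm_props by auto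
next
  fix \<sigma> assume s: "\<sigma> \<in> {\<sigma>. \<sigma> permutes {..<Suc M} \<and> \<sigma> 0 = 0}"
  have s1: "\<sigma> permutes {1..<Suc M}"
    by (rule permutes_superset[of _ "{..<Suc M}"]) (use s in \<open>auto simp: not_le\<close>)
  define \<tau> where "\<tau> = map_permutation {1..<Suc M} (\<lambda>i. i - 1) \<sigma>"
  have b: "bij_betw (\<lambda>i. i - 1) {1..<Suc M} {..<M}"
    by (rule bij_betw_byWitness[of _ Suc]) auto
  have t: "\<tau> permutes {..<M}" unfolding \<tau>_def by (rule map_permutation_permutes[OF b s1])
  have "lift_perm M \<tau> = \<sigma>" unfolding lift_perm_def \<tau>_def
    by (rule map_permutation_compose_inv[OF b s1]) auto
  then show "\<exists>\<tau>\<in>{\<tau>. \<tau> permutes {..<M}}. \<sigma> = lift_perm M \<tau>" using t by auto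
qed

text \<open>The cycle that places the first argument at position a and moves the ones after it
  forward. Its sign is the origin of (-1)^a in the antiderivation rule.\<close>

fun cyc :: "nat \<Rightarrow> nat \<Rightarrow> nat" where
  "cyc 0 = id" | "cyc (Suc a) = cyc a \<circ> transpose a (Suc a)"

lemma cyc_apply: "cyc a j = (if j < a then Suc j else if j = a then 0 else j)"
  by (induction a arbitrary: j) (auto simp: Transposition.transpose_def)

lemma cyc_permutes: "cyc a permutes {..<Suc a}"
proof (induction a)
  case (Suc a)
  have "cyc a permutes {..<Suc (Suc a)}" by (rule permutes_subset[OF Suc]) auto
  show ?case unfolding cyc.simps
    by (rule permutes_compose[OF permutes_swap_id \<open>cyc a permutes {..<Suc (Suc a)}\<close>]) auto
qed (simp add: permutes_id[unfolded id_def])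

lemma cyc_sign: "sign (cyc a) = (-1) ^ a"
proof (induction a)
  case (Suc a)
  have "permutation (cyc a)" using cyc_permutes permutation_permutes by blast
  then show ?case using Suc unfolding cyc.simps
    by (simp add: sign_compose sign_swap_id permutation_swap_id del: comp_apply)
qed simp

lemma map_upt_Suc_shift: "map f [Suc a..<Suc b] = map (\<lambda>i. f (Suc i)) [a..<b]"
  unfolding map_Suc_upt[symmetric] by simp

text \<open>In front, the first argument is the first argument of \<alpha>, and the other positions
  run over all permutations of the remaining arguments.\<close>

lemma Tsum_0:
  assumes "length vs = M" "Suc a \<le> Suc M"
  shows "Tsum \<alpha> \<beta> (Suc a) (v # vs) 0 = (\<Sum>\<tau> | \<tau> permutes {..<M}. wterm (con v \<alpha>) \<beta> a vs \<tau>)"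
proof -
  have "(\<Sum>\<tau> | \<tau> permutes {..<M}. wterm (con v \<alpha>) \<beta> a vs \<tau>) =
        (\<Sum>\<tau> | \<tau> permutes {..<M}. wterm \<alpha> \<beta> (Suc a) (v # vs) (lift_perm M \<tau>))"
  proof (rule sum.cong)
    fix \<tau> assume t: "\<tau> \<in> {\<tau>. \<tau> permutes {..<M}}"
    have "map (\<lambda>i. (v # vs) ! lift_perm M \<tau> i) [0..<Suc a] = v # map (\<lambda>i. vs ! \<tau> i) [0..<a]"
      using t lift_perm_props(2,3)[of \<tau> M] assms by (auto simp: upt_conv_Cons map_upt_Suc_shift simp del: upt_Suc)
    moreover have "map (\<lambda>i. (v # vs) ! lift_perm M \<tau> i) [Suc a..<Suc M] = map (\<lambda>i. vs ! \<tau> i) [a..<M]"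
      using t lift_perm_props(2,3)[of \<tau> M] assms by (auto simp: map_upt_Suc_shift simp del: upt_Suc)
    ultimately show "wterm (con v \<alpha>) \<beta> a vs \<tau> = wterm \<alpha> \<beta> (Suc a) (v # vs) (lift_perm M \<tau>)"
      using t lift_perm_props(4)[of \<tau> M] assms by (simp add: wterm_def del: upt_Suc)
  qed simp
  also have "\<dots> = Tsum \<alpha> \<beta> (Suc a) (v # vs) 0"
    unfolding Tsum_def using sum.reindex_bij_betw[OF bij_lift_perm] assms by simp
  finally show ?thesis by simp
qed

text \<open>Position a is the first slot of \<beta>. Composing with \<open>cyc a\<close> reduces to
  permutations fixing 0, at the cost of the sign (-1)^a.\<close>

lemma Tsum_a:
  assumes "length vs = M" "a \<le> M"
  shows "Tsum \<alpha> \<beta> a (v # vs) a = (-1) ^ a * (\<Sum>\<tau> | \<tau> permutes {..<M}. wterm \<alpha> (con v \<beta>) a vs \<tau>)"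
proof -
  have ca: "cyc a permutes {..<Suc M}" by (rule permutes_subset[OF cyc_permutes]) (use assms in auto)
  have "(-1) ^ a * (\<Sum>\<tau> | \<tau> permutes {..<M}. wterm \<alpha> (con v \<beta>) a vs \<tau>) =
        (\<Sum>\<tau> | \<tau> permutes {..<M}. wterm \<alpha> \<beta> a (v # vs) (lift_perm M \<tau> \<circ> cyc a))"
    unfolding sum_distrib_left
  proof (rule sum.cong)
    fix \<tau> assume t: "\<tau> \<in> {\<tau>. \<tau> permutes {..<M}}"
    have "map (\<lambda>i. (v # vs) ! (lift_perm M \<tau> \<circ> cyc a) i) [0..<a] = map (\<lambda>i. vs ! \<tau> i) [0..<a]"
      using t lift_perm_props(3)[of \<tau> M] assms by (auto simp: cyc_apply)
    moreover have "map (\<lambda>i. (v # vs) ! (lift_perm M \<tau> \<circ> cyc a) i) [a..<Suc M] = v # map (\<lambda>i. vs ! \<tau> i) [a..<M]"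
    proof -
      have "[a..<Suc M] = a # [Suc a..<Suc M]" using assms by (simp add: upt_conv_Cons del: upt_Suc)
      then show ?thesis
        using t lift_perm_props(2,3)[of \<tau> M] assms by (auto simp: cyc_apply map_upt_Suc_shift simp del: upt_Suc)
    qed
    moreover have "sign (lift_perm M \<tau> \<circ> cyc a) = (-1) ^ a * sign \<tau>"
    proof -
      have "permutation (lift_perm M \<tau>)" "permutation (cyc a)"
        using t lift_perm_props(1) cyc_permutes permutation_permutes by blast+
      then show ?thesis using t lift_perm_props(4)[of \<tau> M] by (simp add: sign_compose cyc_sign)
    qed
    ultimately show "(-1) ^ a * wterm \<alpha> (con v \<beta>) a vs \<tau> = wterm \<alpha> \<beta> a (v # vs) (lift_perm M \<tau> \<circ> cyc a)"
      using assms by (simp add: wterm_def del: upt_Suc map_eq_conv)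
  qed simp
  also have "\<dots> = (\<Sum>\<sigma> | \<sigma> permutes {..<Suc M} \<and> \<sigma> 0 = 0. wterm \<alpha> \<beta> a (v # vs) (\<sigma> \<circ> cyc a))"
    using sum.reindex_bij_betw[OF bij_lift_perm, of "\<lambda>\<sigma>. wterm \<alpha> \<beta> a (v # vs) (\<sigma> \<circ> cyc a)"] by simp
  also have "\<dots> = Tsum \<alpha> \<beta> a (v # vs) a"
    unfolding Tsum_def
  proof (rule sum.reindex_bij_witness[of _ "\<lambda>\<sigma>. \<sigma> \<circ> inv_into UNIV (cyc a)" "\<lambda>\<sigma>. \<sigma> \<circ> cyc a"])
    fix \<sigma> assume s: "\<sigma> \<in> {\<sigma>. \<sigma> permutes {..<Suc M} \<and> \<sigma> 0 = 0}"
    show "\<sigma> \<circ> cyc a \<circ> inv_into UNIV (cyc a) = \<sigma>"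
      using permutes_inv_o[OF ca] by (simp add: comp_assoc)
    show "\<sigma> \<circ> cyc a \<in> {\<sigma>. \<sigma> permutes {..<length (v # vs)} \<and> \<sigma> a = 0}"
      using s permutes_compose[OF ca] assms by (auto simp: cyc_apply)
  next
    fix \<sigma> assume s: "\<sigma> \<in> {\<sigma>. \<sigma> permutes {..<length (v # vs)} \<and> \<sigma> a = 0}"
    show "\<sigma> \<circ> inv_into UNIV (cyc a) \<circ> cyc a = \<sigma>"
      using permutes_inv_o[OF ca] by (simp add: comp_assoc)
    have "inv_into UNIV (cyc a) 0 = a" using permutes_inv_eq[OF ca] by (simp add: cyc_apply)
    then show "\<sigma> \<circ> inv_into UNIV (cyc a) \<in> {\<sigma>. \<sigma> permutes {..<Suc M} \<and> \<sigma> 0 = 0}"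
      using s permutes_compose[OF permutes_inv[OF ca]] assms by auto
  qed simp
  finally show ?thesis by simp
qed

lemma wedge_zero_left [simp]: "wedge (\<lambda>_. 0) \<beta> = (\<lambda>_. 0)"
  by (rule ext) (simp add: wedge_def)
lemma wedge_zero_right [simp]: "wedge \<alpha> (\<lambda>_. 0) = (\<lambda>_. 0)"
  by (rule ext) (simp add: wedge_def)

text \<open>Interior multiplication is an antiderivation: the recursive description of the wedge product
  from which all its properties are derived by induction on the argument list.\<close>

theorem wedge_Cons:
  assumes ab: "\<alpha> \<in> alt_forms a" "\<beta> \<in> alt_forms b"
  shows "wedge \<alpha> \<beta> (v # vs) = wedge (con v \<alpha>) \<beta> vs + (-1) ^ a * wedge \<alpha> (con v \<beta>) vs"
proof (cases "Suc (length vs) = a + b")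
  case False
  have "wedge (con v \<alpha>) \<beta> vs = 0"
  proof (cases a)
    case 0 then show ?thesis using con_alt_0 ab by force
  next
    case (Suc a')
    then show ?thesis using wedge_length[OF con_alt ab(2)] ab(1) False by simp
  qed
  moreover have "wedge \<alpha> (con v \<beta>) vs = 0"
  proof (cases b)
    case 0 then show ?thesis using con_alt_0 ab by force
  next
    case (Suc a')
    then show ?thesis using wedge_length[OF ab(1) con_alt] ab(2) False by simp
  qed
  moreover have "wedge \<alpha> \<beta> (v # vs) = 0" using wedge_length[OF ab] False by simp
  ultimately show ?thesis by simp
next
  case True
  let ?xs = "v # vs"
  let ?M = "length vs"
  have lx: "length ?xs = a + b" "length ?xs = Suc ?M" using True by auto
  have w: "wedge \<alpha> \<beta> ?xs = (\<Sum>i<Suc ?M. Tsum \<alpha> \<beta> a ?xs i) / (fact a * fact b)"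
    unfolding wedge_homogeneous[OF ab(1)] sum_wterm_Tsum[OF lx(2), symmetric] using lx(1)
    by (simp add: wterm_def)
  have split: "(\<Sum>i<Suc ?M. Tsum \<alpha> \<beta> a ?xs i) = (\<Sum>i<a. Tsum \<alpha> \<beta> a ?xs i) + (\<Sum>i=a..<a+b. Tsum \<alpha> \<beta> a ?xs i)"
    unfolding True by (metis atLeast0LessThan le_add1 sum.atLeastLessThan_concat zero_le)
  have A: "(\<Sum>i<a. Tsum \<alpha> \<beta> a ?xs i) / (fact a * fact b) = wedge (con v \<alpha>) \<beta> vs"
  proof (cases a)
    case 0 then show ?thesis using con_alt_0 ab by force
  next
    case (Suc a')
    have "(\<Sum>i<a. Tsum \<alpha> \<beta> a ?xs i) = (\<Sum>i<a. Tsum \<alpha> \<beta> a ?xs 0)"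
      by (intro sum.cong refl Tsum_eq[OF ab lx(1)]) auto
    \<comment> \<open>All a summands agree, and the factor a turns 1/a! into 1/(a-1)!, the
      normalization of the product with \<open>con v \<alpha>\<close>.\<close>
    then have e: "(\<Sum>i<a. Tsum \<alpha> \<beta> a ?xs i) = of_nat a * (\<Sum>\<tau> | \<tau> permutes {..<?M}. wterm (con v \<alpha>) \<beta> a' vs \<tau>)"
      using Tsum_0[of vs ?M a' \<alpha> \<beta> v] Suc True by simp
    have "con v \<alpha> \<in> alt_forms a'" using con_alt ab(1) Suc by blast
    from wedge_homogeneous[OF this, of \<beta> vs] show ?thesis
      unfolding e using Suc True by (simp add: wterm_def del: of_nat_Suc)
  qed
  have B: "(\<Sum>i=a..<a+b. Tsum \<alpha> \<beta> a ?xs i) / (fact a * fact b) = (-1) ^ a * wedge \<alpha> (con v \<beta>) vs"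
  proof (cases b)
    case 0 then show ?thesis using con_alt_0 ab by force
  next
    case (Suc b')
    have "(\<Sum>i=a..<a+b. Tsum \<alpha> \<beta> a ?xs i) = (\<Sum>i=a..<a+b. Tsum \<alpha> \<beta> a ?xs a)"
      by (intro sum.cong refl Tsum_eq[OF ab lx(1)]) auto
    then have e: "(\<Sum>i=a..<a+b. Tsum \<alpha> \<beta> a ?xs i) = of_nat b * ((-1) ^ a * (\<Sum>\<tau> | \<tau> permutes {..<?M}. wterm \<alpha> (con v \<beta>) a vs \<tau>))"
      using Tsum_a[of vs ?M a \<alpha> \<beta> v] Suc True by simp
    from wedge_homogeneous[OF ab(1), of "con v \<beta>" vs] show ?thesis
      unfolding e using Suc True by (simp add: wterm_def del: of_nat_Suc)
  qed
  show ?thesis unfolding w split add_divide_distrib A B by simp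
qed

lemma wedge_Nil: "wedge \<alpha> \<beta> [] = \<alpha> [] * \<beta> []"
  by (simp add: wedge_def)

text \<open>A recursive description of alternating forms that matches the antiderivation rule: only
  the first two arguments are inspected, all others are delegated to the contractions.\<close>

lemma alt_SucI:
  fixes F :: "(complex ^ 'd) list \<Rightarrow> complex"
  assumes "F [] = 0" "\<And>v. con v F \<in> alt_forms k"
    "\<And>x y vs. F ((x + y) # vs) = F (x # vs) + F (y # vs)" "\<And>a x vs. F ((a *s x) # vs) = a * F (x # vs)"
    "\<And>v vs. F (v # v # vs) = 0"
  shows "F \<in> alt_forms (Suc k)"
  unfolding alt_forms_def mem_Collect_eq linear_iff_complex
proof (intro conjI allI impI)
  fix vs :: "(complex ^ 'd) list" assume l: "length vs \<noteq> Suc k"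
  show "F vs = 0"
  proof (cases vs)
    case (Cons v ws) then show ?thesis using l alt_length[OF assms(2), of ws v] by simp
  qed (simp add: assms(1))
next
  fix vs :: "(complex ^ 'd) list" and i x y assume l: "length vs = Suc k \<and> i < Suc k"
  then obtain v ws where v: "vs = v # ws" "length ws = k" by (cases vs) auto
  show "F (vs[i := x + y]) = F (vs[i := x]) + F (vs[i := y])"
    using alt_add[OF assms(2), of ws "i - 1" v x y] l v assms(3) by (cases i) auto
next
  fix vs :: "(complex ^ 'd) list" and i a x assume l: "length vs = Suc k \<and> i < Suc k"
  then obtain v ws where v: "vs = v # ws" "length ws = k" by (cases vs) auto
  show "F (vs[i := a *s x]) = a * F (vs[i := x])"
    using alt_smult[OF assms(2), of ws "i - 1" v a x] l v assms(4) by (cases i) auto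
next
  fix vs :: "(complex ^ 'd) list" and i j assume l: "length vs = Suc k \<and> i < j \<and> j < Suc k \<and> vs ! i = vs ! j"
  then obtain v ws where v: "vs = v # ws" "length ws = k" by (cases vs) auto
  \<comment> \<open>Vanishing on a repeated head yields antisymmetry in the first two arguments. It
    brings an argument repeated at a distance under a contraction.\<close>
  have sw: "F (a # b # us) = - F (b # a # us)" for a b us
    using assms(5)[of "a + b" us] assms(3)[of a b "(a + b) # us"]
      alt_add[OF assms(2)[of a], of "a # us" 0 a b] alt_add[OF assms(2)[of b], of "a # us" 0 a b]
      alt_length[OF assms(2)[of a], of "_ # us"] alt_length[OF assms(2)[of b], of "_ # us"] assms(5)
    by (cases "k = Suc (length us)") (auto simp: eq_neg_iff_add_eq_0)
  show "F vs = 0"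
  proof (cases i)
    case (Suc i')
    then show ?thesis using l v alt_repeat[OF assms(2), of ws i' "j - 1" v] by auto
  next
    case 0
    then obtain j' where j: "j = Suc j'" using l by (cases j) auto
    then obtain w us where w: "ws = w # us" using v l by (cases ws) auto
    show ?thesis
    proof (cases j')
      case 0 then show ?thesis using l v w j \<open>i = 0\<close> assms(5) by auto
    next
      case (Suc j'')
      have "con w F (v # us) = 0"
        by (rule alt_repeat[OF assms(2), of _ 0 "Suc j''"]) (use l v w j Suc \<open>i = 0\<close> in auto)
      then show ?thesis using sw[of v w us] v w by simp
    qed
  qed
qed

lemma alt_swap_Cons:
  assumes "\<alpha> \<in> alt_forms k" shows "\<alpha> (v # w # vs) = - \<alpha> (w # v # vs)"
proof (cases "k = Suc (Suc (length vs))")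
  case True
  then show ?thesis using alt_swap[OF assms, of "w # v # vs" 0 1] by auto
next
  case False then show ?thesis using alt_length[OF assms] by auto
qed

lemma alt_repeat_Cons: "\<alpha> \<in> alt_forms k \<Longrightarrow> \<alpha> (v # v # vs) = 0"
  using alt_swap_Cons[of \<alpha> k v v vs] by simp

lemma alt_Cons_add: "\<alpha> \<in> alt_forms k \<Longrightarrow> \<alpha> ((v + w) # vs) = \<alpha> (v # vs) + \<alpha> (w # vs)"
  using alt_add[of \<alpha> k "v # vs" 0 v w] alt_length[of \<alpha> k "_ # vs"]
  by (cases "k = Suc (length vs)") auto

lemma alt_Cons_smult: "\<alpha> \<in> alt_forms k \<Longrightarrow> \<alpha> ((a *s v) # vs) = a * \<alpha> (v # vs)"
  using alt_smult[of \<alpha> k "v # vs" 0 a v] alt_length[of \<alpha> k "_ # vs"]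
  by (cases "k = Suc (length vs)") auto

lemma alt_Cons_zero: "\<alpha> \<in> alt_forms k \<Longrightarrow> \<alpha> (0 # vs) = 0"
  using alt_Cons_smult[of \<alpha> k 0 0 vs] by simp

lemma alt_Cons_sum: "\<alpha> \<in> alt_forms k \<Longrightarrow> \<alpha> ((\<Sum>i\<in>I. f i *s v i) # vs) = (\<Sum>i\<in>I. f i * \<alpha> (v i # vs))"
  by (induction I rule: infinite_finite_induct) (auto simp: alt_Cons_zero alt_Cons_add alt_Cons_smult)

text \<open>Truncated subtraction is harmless: the contraction of a 0-form is zero, and zero is a
  form of every degree.\<close>

lemma con_alt': "\<alpha> \<in> alt_forms k \<Longrightarrow> con v \<alpha> \<in> alt_forms (k - 1)"
  by (cases k) (auto intro: con_alt simp: con_alt_0 alt_zero)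

lemma alt_forms_0_iff: "\<alpha> \<in> alt_forms 0 \<longleftrightarrow> (\<forall>vs. vs \<noteq> [] \<longrightarrow> \<alpha> vs = 0)"
  by (auto simp: alt_forms_def)

lemma con_con: "\<alpha> \<in> alt_forms k \<Longrightarrow> con v (con v \<alpha>) = (\<lambda>_. 0)"
  by (rule ext) (simp add: alt_repeat_Cons)

lemma con_swap: "\<alpha> \<in> alt_forms k \<Longrightarrow> con v (con w \<alpha>) = (\<lambda>vs. - con w (con v \<alpha>) vs)"
  unfolding con_def by (rule ext, rule alt_swap_Cons)

lemma wedge_add_left: "wedge (\<lambda>vs. \<alpha> vs + \<alpha>' vs) \<beta> vs = wedge \<alpha> \<beta> vs + wedge \<alpha>' \<beta> vs"
  unfolding wedge_def sum.distrib[symmetric] add_divide_distrib[symmetric]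
  by (simp add: distrib_left distrib_right)

lemma wedge_add_right: "wedge \<alpha> (\<lambda>vs. \<beta> vs + \<beta>' vs) vs = wedge \<alpha> \<beta> vs + wedge \<alpha> \<beta>' vs"
  unfolding wedge_def sum.distrib[symmetric] add_divide_distrib[symmetric]
  by (simp add: distrib_left distrib_right)

lemma wedge_smult_left: "wedge (\<lambda>vs. a * \<alpha> vs) \<beta> vs = a * wedge \<alpha> \<beta> vs"
  unfolding wedge_def sum_distrib_left by (intro sum.cong refl) (simp add: sum_distrib_left mult_ac)

lemma wedge_smult_right: "wedge \<alpha> (\<lambda>vs. a * \<beta> vs) vs = a * wedge \<alpha> \<beta> vs"
  unfolding wedge_def sum_distrib_left by (intro sum.cong refl) (simp add: sum_distrib_left mult_ac)

lemma wedge_minus_left: "wedge (\<lambda>vs. - \<alpha> vs) \<beta> vs = - wedge \<alpha> \<beta> vs"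
  using wedge_smult_left[of "-1"] by simp

lemma wedge_minus_right: "wedge \<alpha> (\<lambda>vs. - \<beta> vs) vs = - wedge \<alpha> \<beta> vs"
  using wedge_smult_right[of _ "-1"] by simp

lemma wedge_sum_left: "wedge (\<lambda>vs. \<Sum>i\<in>I. \<alpha> i vs) \<beta> vs = (\<Sum>i\<in>I. wedge (\<alpha> i) \<beta> vs)"
  by (induction I rule: infinite_finite_induct) (auto simp: wedge_add_left)

definition vanish :: "'v set \<Rightarrow> ('v list \<Rightarrow> complex) \<Rightarrow> bool" where
  "vanish S \<alpha> \<longleftrightarrow> (\<forall>vs. set vs \<subseteq> S \<longrightarrow> \<alpha> vs = 0)"

text \<open>Permuting arguments does not leave S. Forms on H can thus be handled as ambient forms
  compared on lists from H, without a separate type of forms on a subspace.\<close>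

lemma wedge_cong_on:
  assumes "\<And>vs. set vs \<subseteq> S \<Longrightarrow> \<alpha> vs = \<alpha>' vs" "\<And>vs. set vs \<subseteq> S \<Longrightarrow> \<beta> vs = \<beta>' vs" "set vs \<subseteq> S"
  shows "wedge \<alpha> \<beta> vs = wedge \<alpha>' \<beta>' vs"
proof -
  have *: "set (map (\<lambda>i. vs ! \<sigma> i) [a..<b]) \<subseteq> S" if "\<sigma> permutes {..<length vs}" "b \<le> length vs" for \<sigma> a b
  proof -
    have "vs ! \<sigma> i \<in> set vs" if "i < b" for i
      using permutes_in_image[OF \<open>\<sigma> permutes _\<close>, of i] that \<open>b \<le> _\<close> by auto
    then show ?thesis using assms(3) by auto
  qed
  show ?thesis
    unfolding wedge_def
    by (intro sum.cong refl arg_cong2[where f="(/)"] arg_cong2[where f="(*)"] assms(1,2) *) auto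
qed

lemma wedge_vanish_left:
  assumes "vanish S \<alpha>" shows "vanish S (wedge \<alpha> \<beta>)"
  unfolding vanish_def
proof (intro allI impI)
  fix vs assume s: "set vs \<subseteq> S"
  show "wedge \<alpha> \<beta> vs = 0"
    using wedge_cong_on[of S \<alpha> "\<lambda>_. 0" \<beta> \<beta> vs] assms s by (simp add: vanish_def)
qed

lemma wedge_vanish_right:
  assumes "vanish S \<beta>" shows "vanish S (wedge \<alpha> \<beta>)"
  unfolding vanish_def
proof (intro allI impI)
  fix vs assume s: "set vs \<subseteq> S"
  show "wedge \<alpha> \<beta> vs = 0"
    using wedge_cong_on[of S \<alpha> \<alpha> \<beta> "\<lambda>_. 0" vs] assms s by (simp add: vanish_def)
qed

lemma wedge_pullback: "wedge (\<lambda>vs. \<alpha> (map f vs)) (\<lambda>vs. \<beta> (map f vs)) vs = wedge \<alpha> \<beta> (map f vs)"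
proof -
  have "map (\<lambda>i. f (vs ! \<sigma> i)) [a..<b] = map (\<lambda>i. map f vs ! \<sigma> i) [a..<b]"
    if "\<sigma> permutes {..<length vs}" "b \<le> length vs" for \<sigma> a b
    using permutes_in_image[OF that(1)] that(2) by auto
  then show ?thesis
    unfolding wedge_def length_map map_map comp_def
    by (intro sum.cong refl arg_cong2[where f="(/)"] arg_cong2[where f="(*)"] arg_cong[where f=\<alpha>] arg_cong[where f=\<beta>]) auto
qed

lemma wedge_cnj: "wedge (\<lambda>vs. cnj (\<alpha> vs)) (\<lambda>vs. cnj (\<beta> vs)) vs = cnj (wedge \<alpha> \<beta> vs)"
  unfolding wedge_def by simp

lemma wedge_cnj_pullback:
  "wedge (\<lambda>vs. cnj (\<alpha> (map f vs))) (\<lambda>vs. cnj (\<beta> (map f vs))) vs = cnj (wedge \<alpha> \<beta> (map f vs))"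
  using wedge_pullback[of "\<lambda>vs. cnj (\<alpha> vs)" f "\<lambda>vs. cnj (\<beta> vs)" vs] wedge_cnj[of \<alpha> \<beta>] by simp

lemma con_wedge:
  assumes "\<alpha> \<in> alt_forms a" "\<beta> \<in> alt_forms b"
  shows "con v (wedge \<alpha> \<beta>) = (\<lambda>vs. wedge (con v \<alpha>) \<beta> vs + (-1) ^ a * wedge \<alpha> (con v \<beta>) vs)"
  by (rule ext) (simp add: wedge_Cons[OF assms])

lemma con_add: "con (v + w) \<alpha> = (\<lambda>vs. con v \<alpha> vs + con w \<alpha> vs)" if "\<alpha> \<in> alt_forms k"
  using alt_Cons_add[OF that] by (auto simp: con_def)

lemma con_smult: "con (a *s v) \<alpha> = (\<lambda>vs. a * con v \<alpha> vs)" if "\<alpha> \<in> alt_forms k"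
  using alt_Cons_smult[OF that] by (auto simp: con_def)

declare con_apply [simp del]

section \<open>Algebraic laws of the wedge product\<close>

lemma wedge_alt:
  assumes "\<alpha> \<in> alt_forms a" "\<beta> \<in> alt_forms b"
  shows "wedge \<alpha> \<beta> \<in> alt_forms (a + b)"
  using assms
proof (induction "a + b" arbitrary: a b \<alpha> \<beta>)
  case 0
  then show ?case using wedge_length[OF 0(2,3)] by (auto simp: alt_forms_0_iff)
next
  case (Suc m)
  note ab = Suc.prems
  have l: "wedge (con v \<alpha>) \<beta> \<in> alt_forms m" for v
  proof (cases a)
    case 0 then show ?thesis using ab by (simp add: con_alt_0 alt_zero)
  next
    case (Suc a') then show ?thesis using Suc.hyps(1)[of a' b "con v \<alpha>" \<beta>] Suc.hyps(2) ab con_alt[of \<alpha> a' v] by auto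
  qed
  have r: "wedge \<alpha> (con v \<beta>) \<in> alt_forms m" for v
  proof (cases b)
    case 0 then show ?thesis using ab by (simp add: con_alt_0 alt_zero)
  next
    case (Suc b') then show ?thesis using Suc.hyps(1)[of a b' \<alpha> "con v \<beta>"] Suc.hyps(2) ab con_alt[of \<beta> b' v] by auto
  qed
  have "wedge \<alpha> \<beta> \<in> alt_forms (Suc m)"
  proof (rule alt_SucI)
    show "wedge \<alpha> \<beta> [] = 0" using wedge_length[OF ab, of "[]"] Suc.hyps(2) by (cases a) auto
    show "con v (wedge \<alpha> \<beta>) \<in> alt_forms m" for v
      unfolding con_wedge[OF ab] by (intro alt_add_form alt_smult_form l r)
    show "wedge \<alpha> \<beta> ((x + y) # vs) = wedge \<alpha> \<beta> (x # vs) + wedge \<alpha> \<beta> (y # vs)" for x y vs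
      by (simp add: wedge_Cons[OF ab] con_add[OF ab(1)] con_add[OF ab(2)] wedge_add_left wedge_add_right algebra_simps)
    show "wedge \<alpha> \<beta> ((z *s x) # vs) = z * wedge \<alpha> \<beta> (x # vs)" for z x vs
      by (simp add: wedge_Cons[OF ab] con_smult[OF ab(1)] con_smult[OF ab(2)] wedge_smult_left wedge_smult_right algebra_simps)
    \<comment> \<open>A double contraction kills the outer terms; the two mixed terms carry the
      opposite signs (-1)^a and (-1)^(a-1).\<close>
    show "wedge \<alpha> \<beta> (v # v # vs) = 0" for v vs
    proof (cases a)
      case 0
      then have "con v \<alpha> = (\<lambda>_. 0)" using con_alt_0 ab by blast
      then show ?thesis using 0 con_con[OF ab(2)]
        by (simp add: wedge_Cons[OF ab] wedge_Cons[OF ab(1) con_alt'[OF ab(2)]])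
    next
      case (Suc a')
      then show ?thesis
        using wedge_Cons[OF con_alt'[OF ab(1)] ab(2), of v v vs] wedge_Cons[OF ab(1) con_alt'[OF ab(2)], of v v vs]
        by (simp add: wedge_Cons[OF ab] con_con[OF ab(1)] con_con[OF ab(2)])
    qed
  qed
  then show ?case using Suc.hyps(2) by simp
qed

lemma wedge_assoc:
  assumes "\<alpha> \<in> alt_forms a" "\<beta> \<in> alt_forms b" "\<gamma> \<in> alt_forms c"
  shows "wedge (wedge \<alpha> \<beta>) \<gamma> = wedge \<alpha> (wedge \<beta> \<gamma>)"
proof
  fix vs show "wedge (wedge \<alpha> \<beta>) \<gamma> vs = wedge \<alpha> (wedge \<beta> \<gamma>) vs"
    using assms
  proof (induction vs arbitrary: a b c \<alpha> \<beta> \<gamma>)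
    case Nil then show ?case by (simp add: wedge_Nil)
  next
    case (Cons v vs)
    note A = Cons.prems
    show ?case
      unfolding wedge_Cons[OF wedge_alt[OF A(1,2)] A(3)] wedge_Cons[OF A(1) wedge_alt[OF A(2,3)]]
        con_wedge[OF A(1,2)] con_wedge[OF A(2,3)] wedge_add_left wedge_smult_left wedge_add_right wedge_smult_right
      using Cons.IH[OF con_alt'[OF A(1)] A(2,3)] Cons.IH[OF A(1) con_alt'[OF A(2)] A(3)]
        Cons.IH[OF A(1,2) con_alt'[OF A(3)]]
      by (simp add: power_add algebra_simps)
  qed
qed

lemma wedge_commute:
  assumes "\<alpha> \<in> alt_forms a" "\<beta> \<in> alt_forms b"
  shows "wedge \<alpha> \<beta> vs = (-1) ^ (a * b) * wedge \<beta> \<alpha> vs"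
  using assms
proof (induction vs arbitrary: a b \<alpha> \<beta>)
  case Nil
  then show ?case using alt_length[of \<alpha> a "[]"] alt_length[of \<beta> b "[]"]
    by (cases "a = 0 \<and> b = 0") (auto simp: wedge_Nil)
next
  case (Cons v vs)
  note A = Cons.prems
  have sq: "(-1) ^ m * (-1) ^ m = (1::complex)" for m by (simp add: power_mult_distrib[symmetric])
  have 1: "wedge (con v \<alpha>) \<beta> vs = (-1) ^ (a * b) * (-1) ^ b * wedge \<beta> (con v \<alpha>) vs"
  proof (cases a)
    case 0 then show ?thesis using con_alt_0[of \<alpha> v] A by simp
  next
    case (Suc a')
    then show ?thesis using Cons.IH[OF con_alt'[OF A(1), of v] A(2)] sq[of b] by (simp add: power_add mult_ac)
  qed
  have 2: "(-1) ^ a * wedge \<alpha> (con v \<beta>) vs = (-1) ^ (a * b) * wedge (con v \<beta>) \<alpha> vs"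
  proof (cases b)
    case 0 then show ?thesis using con_alt_0[of \<beta> v] A by simp
  next
    case (Suc b')
    then show ?thesis using Cons.IH[OF A(1) con_alt'[OF A(2), of v]] by (simp add: power_add mult_ac)
  qed
  show ?case unfolding wedge_Cons[OF A] wedge_Cons[OF A(2,1)] 1 2 by (simp add: algebra_simps)
qed

lemma wedge_one_alt: "wedge_one \<in> alt_forms 0"
  by (simp add: alt_forms_0_iff wedge_one_def)

lemma con_wedge_one [simp]: "con v wedge_one = (\<lambda>_. 0)"
  by (auto simp: con_def wedge_one_def)

lemma wedge_one_left: "\<beta> \<in> alt_forms b \<Longrightarrow> wedge wedge_one \<beta> = \<beta>"
proof
  fix vs show "\<beta> \<in> alt_forms b \<Longrightarrow> wedge wedge_one \<beta> vs = \<beta> vs"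
  proof (induction vs arbitrary: \<beta> b)
    case Nil then show ?case by (simp add: wedge_Nil wedge_one_def)
  next
    case (Cons v vs)
    then show ?case using Cons.IH[of "con v \<beta>", OF con_alt'[OF Cons.prems, of v]]
      by (simp add: wedge_Cons[OF wedge_one_alt]) (simp add: con_apply)
  qed
qed

lemma wedge_one_right: "\<beta> \<in> alt_forms b \<Longrightarrow> wedge \<beta> wedge_one = \<beta>"
  using wedge_commute[OF _ wedge_one_alt, of \<beta> b] wedge_one_left[of \<beta> b] by (auto simp: fun_eq_iff)

lemma wedge_power_alt: "\<Omega> \<in> alt_forms 2 \<Longrightarrow> wedge_power \<Omega> m \<in> alt_forms (2 * m)"
proof (induction m)
  case (Suc m)
  then show ?case using wedge_alt[of \<Omega> 2 "wedge_power \<Omega> m" "2 * m"] by simp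
qed (simp add: wedge_one_alt)

lemma wedge_2_commute: "\<Omega> \<in> alt_forms 2 \<Longrightarrow> \<alpha> \<in> alt_forms a \<Longrightarrow> wedge \<Omega> \<alpha> = wedge \<alpha> \<Omega>"
  using wedge_commute[of \<Omega> 2 \<alpha> a] by (auto simp: fun_eq_iff power_mult)

lemma wedge_power_Suc_right:
  assumes "\<Omega> \<in> alt_forms 2" "\<alpha> \<in> alt_forms a"
  shows "wedge \<alpha> (wedge_power \<Omega> (Suc m)) = wedge \<Omega> (wedge \<alpha> (wedge_power \<Omega> m))"
    and "wedge \<alpha> (wedge_power \<Omega> (Suc m)) = wedge (wedge \<alpha> \<Omega>) (wedge_power \<Omega> m)"
  using wedge_assoc[OF assms(2,1) wedge_power_alt[OF assms(1), of m]]
    wedge_assoc[OF assms wedge_power_alt[OF assms(1), of m]] wedge_2_commute[OF assms] by simp_all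

text \<open>On powers of a 2-form interior multiplication obeys the ordinary power rule, because a
  2-form commutes with everything.\<close>

lemma con_wedge_power:
  assumes O: "\<Omega> \<in> alt_forms 2"
  shows "con v (wedge_power \<Omega> (Suc m)) = (\<lambda>vs. of_nat (Suc m) * wedge (con v \<Omega>) (wedge_power \<Omega> m) vs)"
proof (induction m)
  case 0
  have "con v \<Omega> \<in> alt_forms 1" using con_alt[of \<Omega> 1] O by (simp add: numeral_2_eq_2)
  then show ?case by (simp add: con_wedge[OF O wedge_one_alt] wedge_one_right)
next
  case (Suc m)
  have c: "con v \<Omega> \<in> alt_forms 1" using con_alt[of \<Omega> 1] O by (simp add: numeral_2_eq_2)
  have "con v (wedge_power \<Omega> (Suc (Suc m))) = (\<lambda>vs. wedge (con v \<Omega>) (wedge_power \<Omega> (Suc m)) vs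
      + wedge \<Omega> (con v (wedge_power \<Omega> (Suc m))) vs)"
    using con_wedge[OF O wedge_power_alt[OF O, of "Suc m"], of v] by simp
  also have "\<dots> = (\<lambda>vs. of_nat (Suc (Suc m)) * wedge (con v \<Omega>) (wedge_power \<Omega> (Suc m)) vs)"
    unfolding Suc.IH wedge_smult_right using wedge_power_Suc_right(1)[OF O c, of m]
    by (simp add: algebra_simps)
  finally show ?case .
qed

section \<open>Forms determined by a hyperplane and a transversal vector\<close>

lemma alt_vanish_span:
  assumes "\<alpha> \<in> alt_forms k" "vanish B \<alpha>"
  shows "vanish (vec.span B) \<alpha>"
  using assms
proof (induction k arbitrary: \<alpha>)
  case 0
  then show ?case unfolding vanish_def alt_forms_0_iff by (metis empty_set empty_subsetI)
next
  case (Suc k)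
  have *: "\<alpha> (v # ws) = 0" if v: "v \<in> vec.span B" and ws: "set ws \<subseteq> vec.span B" for v ws
    using v
  proof (induction rule: vec.span_induct_alt)
    case base then show ?case using alt_Cons_zero Suc.prems by blast
  next
    case (step a x y)
    have "vanish B (con x \<alpha>)" using step Suc.prems by (auto simp: vanish_def con_apply)
    then have "con x \<alpha> ws = 0" using Suc.IH[OF con_alt[OF Suc.prems(1)]] ws by (simp add: vanish_def)
    then show ?case using step alt_Cons_add[OF Suc.prems(1)] alt_Cons_smult[OF Suc.prems(1)] by (simp add: con_apply)
  qed
  show ?case unfolding vanish_def
  proof (intro allI impI)
    fix vs assume vs: "set vs \<subseteq> vec.span B"
    show "\<alpha> vs = 0"
    proof (cases vs)
      case Nil then show ?thesis using alt_length[OF Suc.prems(1)] by simp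
    next
      case (Cons v ws) then show ?thesis using * vs by simp
    qed
  qed
qed

lemma alt_vanish_insert:
  assumes "\<alpha> \<in> alt_forms k" "vanish S \<alpha>" "vanish S (con X \<alpha>)"
  shows "vanish (insert X S) \<alpha>"
  using assms
proof (induction k arbitrary: \<alpha>)
  case 0
  then show ?case unfolding vanish_def alt_forms_0_iff by (metis empty_set empty_subsetI)
next
  case (Suc k)
  show ?case unfolding vanish_def
  proof (intro allI impI)
    fix vs assume vs: "set vs \<subseteq> insert X S"
    show "\<alpha> vs = 0"
    proof (cases vs)
      case Nil then show ?thesis using alt_length[OF Suc.prems(1)] by simp
    next
      case (Cons v ws)
      have "vanish (insert X S) (con v \<alpha>)"
      proof (rule Suc.IH[OF con_alt[OF Suc.prems(1)]])
        show "vanish S (con v \<alpha>)"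
          using vs Cons Suc.prems by (auto simp: vanish_def con_apply)
        show "vanish S (con X (con v \<alpha>))"
          using vs Cons Suc.prems alt_swap_Cons[OF Suc.prems(1), of v X] con_con[OF Suc.prems(1), of X]
          by (auto simp: vanish_def con_apply)
      qed
      then show ?thesis using Cons vs by (simp add: vanish_def con_apply)
    qed
  qed
qed

text \<open>Every argument is a combination of X and vectors of S, and X can occur at most once.
  With S = H this separates a form into its restriction to H and its contraction with a transversal
  vector.\<close>

lemma alt_eq_zero:
  assumes "\<alpha> \<in> alt_forms k" "vanish S \<alpha>" "vanish S (con X \<alpha>)" "\<And>v. v \<in> vec.span (insert X S)"
  shows "\<alpha> = (\<lambda>_. 0)"
  using alt_vanish_span[OF assms(1) alt_vanish_insert[OF assms(1-3)]] assms(4)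
  by (auto simp: vanish_def fun_eq_iff)

lemma con_one_form:
  assumes "\<theta> \<in> alt_forms 1" shows "con v \<theta> = (\<lambda>vs. \<theta> [v] * wedge_one vs)"
  using alt_length[OF assms] by (auto simp: wedge_one_def fun_eq_iff con_apply)

lemma wedge_one_form_Cons:
  assumes "\<theta> \<in> alt_forms 1" "\<alpha> \<in> alt_forms a"
  shows "wedge \<theta> \<alpha> (v # vs) = \<theta> [v] * \<alpha> vs - wedge \<theta> (con v \<alpha>) vs"
  by (simp add: wedge_Cons[OF assms] con_one_form[OF assms(1)] wedge_smult_left wedge_one_left[OF assms(2)])

lemma one_form_vanish:
  assumes "\<theta> \<in> alt_forms 1" shows "vanish S \<theta> \<longleftrightarrow> (\<forall>v\<in>S. \<theta> [v] = 0)"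
proof
  assume *: "\<forall>v\<in>S. \<theta> [v] = 0"
  show "vanish S \<theta>" unfolding vanish_def
  proof (intro allI impI)
    fix vs assume "set vs \<subseteq> S"
    then show "\<theta> vs = 0" using alt_length[OF assms, of vs] * by (cases "length vs = 1") (auto simp: length_Suc_conv)
  qed
qed (auto simp: vanish_def)

text \<open>Contracting the product with X recovers \<alpha> on S up to the factor \<theta>(X). The
  equations with a factor \<theta> in the definition of Rumin forms thereby become conditions on
  H.\<close>

lemma wedge_one_form_eq_0_iff:
  assumes "\<theta> \<in> alt_forms 1" "\<alpha> \<in> alt_forms a" "\<And>v. v \<in> S \<Longrightarrow> \<theta> [v] = 0" "\<theta> [X] \<noteq> 0"
    "\<And>v. v \<in> vec.span (insert X S)"
  shows "wedge \<theta> \<alpha> = (\<lambda>_. 0) \<longleftrightarrow> vanish S \<alpha>"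
proof
  assume w: "wedge \<theta> \<alpha> = (\<lambda>_. 0)"
  have th: "vanish S (wedge \<theta> (con X \<alpha>))"
    using wedge_vanish_left one_form_vanish[OF assms(1)] assms(3) by blast
  show "vanish S \<alpha>" unfolding vanish_def
  proof (intro allI impI)
    fix vs assume "set vs \<subseteq> S"
    then have "\<theta> [X] * \<alpha> vs = 0"
      using wedge_one_form_Cons[OF assms(1,2), of X vs] w th by (simp add: vanish_def)
    then show "\<alpha> vs = 0" using assms(4) by simp
  qed
next
  assume v: "vanish S \<alpha>"
  show "wedge \<theta> \<alpha> = (\<lambda>_. 0)"
  proof (rule alt_eq_zero[OF wedge_alt[OF assms(1,2)] _ _ assms(5)])
    show "vanish S (wedge \<theta> \<alpha>)" by (rule wedge_vanish_right[OF v])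
    have "vanish S (wedge \<theta> (con X \<alpha>))"
      using wedge_vanish_left one_form_vanish[OF assms(1)] assms(3) by blast
    then show "vanish S (con X (wedge \<theta> \<alpha>))"
      using v by (auto simp: vanish_def wedge_one_form_Cons[OF assms(1,2)] con_apply)
  qed
qed

text \<open>Both sides vanish on S and have the same contraction with X on S, so
  \<open>alt_eq_zero\<close> applies to the difference. With S = H this is division by \<theta> of a
  form vanishing on H.\<close>

lemma alt_factor:
  assumes "\<theta> \<in> alt_forms 1" "\<alpha> \<in> alt_forms (Suc a)" "\<And>v. v \<in> S \<Longrightarrow> \<theta> [v] = 0" "\<theta> [X] = 1"
    "\<And>v. v \<in> vec.span (insert X S)" "vanish S \<alpha>"
  shows "\<alpha> = wedge \<theta> (con X \<alpha>)"
proof -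
  let ?d = "\<lambda>vs. \<alpha> vs + - 1 * wedge \<theta> (con X \<alpha>) vs"
  have w: "wedge \<theta> (con X \<alpha>) \<in> alt_forms (Suc a)" using wedge_alt[OF assms(1) con_alt[OF assms(2)]] by simp
  have "vanish S (wedge \<theta> (con X \<alpha>))"
    using wedge_vanish_left one_form_vanish[OF assms(1)] assms(3) by blast
  then have "?d = (\<lambda>_. 0)"
    using assms(4,6) wedge_one_form_Cons[OF assms(1) con_alt[OF assms(2)], of X X] con_con[OF assms(2), of X]
    by (intro alt_eq_zero[OF alt_add_form[OF assms(2) alt_smult_form[OF w]] _ _ assms(5)])
       (auto simp: vanish_def con_def)
  then show ?thesis by (auto simp: fun_eq_iff)
qed

subsection \<open>Lefschetz maps\<close>

lemma dim_kernel_ge: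
  fixes f :: "complex ^ 'd \<Rightarrow> complex"
  assumes "vec.subspace K" "\<And>x y. f (x + y) = f x + f y" "\<And>a x. f (a *s x) = a * f x"
  shows "vec.subspace {v \<in> K. f v = 0}" "vec.dim K \<le> Suc (vec.dim {v \<in> K. f v = 0})"
proof -
  have f0: "f 0 = 0" using assms(3)[of 0 0] by simp
  let ?K = "{v \<in> K. f v = 0}"
  show "vec.subspace ?K" using assms f0 by (auto simp: vec.subspace_def)
  show "vec.dim K \<le> Suc (vec.dim ?K)"
  proof (cases "\<exists>u\<in>K. f u \<noteq> 0")
    case False
    then have "?K = K" by auto
    then show ?thesis by simp
  next
    case True
    then obtain u where u: "u \<in> K" "f u \<noteq> 0" by auto
    have "K \<subseteq> vec.span (insert u ?K)"
    proof
      fix v assume v: "v \<in> K"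
      let ?w = "v + (- f v / f u) *s u"
      have "?w \<in> K" by (intro vec.subspace_add vec.subspace_scale assms(1) v u(1))
      moreover have "f ?w = 0" unfolding assms(2,3) using u(2) by simp
      ultimately have "?w \<in> ?K" by simp
      then have "?w \<in> vec.span (insert u ?K)" "u \<in> vec.span (insert u ?K)"
        using vec.span_base[of _ "insert u ?K"] by blast+
      then have w: "?w + (f v / f u) *s u \<in> vec.span (insert u ?K)"
        by (rule vec.span_add[OF _ vec.span_scale])
      have "?w + (f v / f u) *s u = v" by (simp add: vec_eq_iff)
      with w show "v \<in> vec.span (insert u ?K)" by metis
    qed
    then have "vec.dim K \<le> vec.dim (insert u ?K)" by (rule vec.dim_mono)
    also have "\<dots> \<le> Suc (vec.dim ?K)" by (simp add: vec.dim_insert)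
    finally show ?thesis .
  qed
qed

text \<open>Each linear functional lowers the dimension by at most one.\<close>

lemma exists_common_kernel:
  fixes f :: "'w \<Rightarrow> complex ^ 'd \<Rightarrow> complex"
  assumes "vec.subspace K" "length L < vec.dim K" "\<And>w x y. f w (x + y) = f w x + f w y" "\<And>w a x. f w (a *s x) = a * f w x"
  shows "\<exists>v\<in>K. v \<noteq> 0 \<and> (\<forall>w\<in>set L. f w v = 0)"
  using assms(1,2)
proof (induction L arbitrary: K)
  case Nil
  have "K \<noteq> {0}"
  proof
    assume "K = {0}" then show False using Nil(2) vec.dim_eq_0[of K] by simp
  qed
  then show ?case using vec.subspace_0[OF Nil(1)] by auto
next
  case (Cons w L)
  note k = dim_kernel_ge[of K "f w", OF Cons.prems(1) assms(3,4)]
  from Cons.IH[OF k(1)] k(2) Cons.prems(2) show ?case by auto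
qed

text \<open>One more pair of arguments for each power: given \<open>vs\<close> on which the m-th
  power is nonzero, take v orthogonal to all of them and a partner w with \<Omega>(v,w) \<noteq>
  0.\<close>

lemma wedge_power_not_vanish:
  fixes \<Omega> :: "(complex ^ 'd) list \<Rightarrow> complex"
  assumes O: "\<Omega> \<in> alt_forms 2" and H: "vec.subspace H" "vec.dim H = 2 * n"
    and nd: "\<And>v. v \<in> H \<Longrightarrow> (\<And>w. w \<in> H \<Longrightarrow> \<Omega> [v, w] = 0) \<Longrightarrow> v = 0" and "m \<le> n"
  shows "\<not> vanish H (wedge_power \<Omega> m)"
  using \<open>m \<le> n\<close>
proof (induction m)
  case 0
  show ?case by (auto simp: vanish_def wedge_one_def intro: exI[of _ "[]"])
next
  case (Suc m)
  have c: "con v \<Omega> \<in> alt_forms 1" for v using con_alt[of \<Omega> 1] O by (simp add: numeral_2_eq_2)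
  from Suc obtain vs where vs: "set vs \<subseteq> H" "wedge_power \<Omega> m vs \<noteq> 0" by (auto simp: vanish_def)
  then have l: "length vs = 2 * m" using alt_length[OF wedge_power_alt[OF O]] by blast
  \<comment> \<open>There are 2m conditions on a space of dimension 2n, and m < n.\<close>
  have "\<exists>v\<in>H. v \<noteq> 0 \<and> (\<forall>w\<in>set vs. \<Omega> [v, w] = 0)"
    by (rule exists_common_kernel[of H vs "\<lambda>w v. \<Omega> [v, w]"])
       (use H l Suc in \<open>auto simp: alt_Cons_add[OF O] alt_Cons_smult[OF O]\<close>)
  then obtain v where v: "v \<in> H" "v \<noteq> 0" "\<And>w. w \<in> set vs \<Longrightarrow> \<Omega> [v, w] = 0" by auto
  then obtain w where w: "w \<in> H" "\<Omega> [v, w] \<noteq> 0" using nd by blast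
  have "vanish (set vs) (con v \<Omega>)" using one_form_vanish[OF c] v by (auto simp: con_apply)
  then have "wedge (con v \<Omega>) (con w (wedge_power \<Omega> m)) vs = 0"
    using wedge_vanish_left[of "set vs" "con v \<Omega>"] by (simp add: vanish_def)
  \<comment> \<open>As \<open>con v \<Omega>\<close> vanishes on \<open>vs\<close>, only the term
    \<Omega>(v,w) \<Omega>^m(vs) survives.\<close>
  then have "wedge (con v \<Omega>) (wedge_power \<Omega> m) (w # vs) \<noteq> 0"
    using wedge_one_form_Cons[OF c wedge_power_alt[OF O], of v m w vs] vs(2) w(2) by (simp add: con_apply)
  then have "wedge_power \<Omega> (Suc m) (v # w # vs) \<noteq> 0"
    using fun_cong[OF con_wedge_power[OF O, of v m], of "w # vs"]
    by (simp add: con_apply del: wedge_power.simps of_nat_Suc)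
  then show ?case unfolding vanish_def using v(1) w(1) vs(1) by (intro notI) (auto simp del: wedge_power.simps)
qed

text \<open>Induction on the degree: if $\alpha\wedge\Omega^m$ vanishes, so does $\iota_v\alpha\wedge\Omega^{m+1}$.\<close>

theorem lefschetz_injective:
  fixes \<Omega> :: "(complex ^ 'd) list \<Rightarrow> complex"
  assumes O: "\<Omega> \<in> alt_forms 2" and H: "vec.subspace H" "vec.dim H = 2 * n"
    and nd: "\<And>v. v \<in> H \<Longrightarrow> (\<And>w. w \<in> H \<Longrightarrow> \<Omega> [v, w] = 0) \<Longrightarrow> v = 0"
    and "\<alpha> \<in> alt_forms k" "k + m \<le> n" "vanish H (wedge \<alpha> (wedge_power \<Omega> m))"
  shows "vanish H \<alpha>"
  using assms(5-)
proof (induction k arbitrary: \<alpha> m)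
  case 0
  have "\<alpha> = (\<lambda>vs. \<alpha> [] * wedge_one vs)"
    using 0(1) by (auto simp: fun_eq_iff alt_forms_0_iff wedge_one_def)
  then have "wedge \<alpha> (wedge_power \<Omega> m) = (\<lambda>vs. \<alpha> [] * wedge_power \<Omega> m vs)"
    using wedge_smult_left[of "\<alpha> []" wedge_one] wedge_one_left[OF wedge_power_alt[OF O]] by (metis ext)
  then have "vanish H (\<lambda>vs. \<alpha> [] * wedge_power \<Omega> m vs)" using 0 by simp
  moreover have "\<not> vanish H (wedge_power \<Omega> m)"
    by (rule wedge_power_not_vanish[OF O H nd]) (use 0 in auto)
  ultimately have "\<alpha> [] = 0" by (auto simp: vanish_def)
  then show ?case using 0(1) by (metis alt_forms_0_iff vanish_def)
next
  case (Suc k)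
  note a = Suc.prems(1)
  note P = wedge_power_alt[OF O]
  have up: "vanish H (wedge \<alpha> (wedge_power \<Omega> (Suc m)))"
    unfolding wedge_power_Suc_right(1)[OF O a] by (rule wedge_vanish_right[OF Suc.prems(3)])
  have *: "vanish H (con v \<alpha>)" if v: "v \<in> H" for v
  proof (rule Suc.IH[OF con_alt[OF a], of "Suc m"])
    have c: "con v \<Omega> \<in> alt_forms 1" using con_alt[of \<Omega> 1] O by (simp add: numeral_2_eq_2)
    \<comment> \<open>The contraction of \<Omega> is moved, up to sign, in front of the product of
      \<alpha> and \<Omega>^m, which vanishes on H by assumption.\<close>
    have "wedge \<alpha> (wedge (con v \<Omega>) (wedge_power \<Omega> m)) = wedge (wedge \<alpha> (con v \<Omega>)) (wedge_power \<Omega> m)"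
      using wedge_assoc[OF a c P] by simp
    also have "wedge \<alpha> (con v \<Omega>) = (\<lambda>vs. (-1) ^ Suc k * wedge (con v \<Omega>) \<alpha> vs)"
      using wedge_commute[OF a c] by (auto simp: fun_eq_iff)
    also have "wedge (\<lambda>vs. (-1) ^ Suc k * wedge (con v \<Omega>) \<alpha> vs) (wedge_power \<Omega> m) =
      (\<lambda>vs. (-1) ^ Suc k * wedge (con v \<Omega>) (wedge \<alpha> (wedge_power \<Omega> m)) vs)"
      unfolding wedge_assoc[OF c a P, symmetric] by (rule ext, rule wedge_smult_left)
    finally have "vanish H (wedge \<alpha> (wedge (con v \<Omega>) (wedge_power \<Omega> m)))"
      using wedge_vanish_right[OF Suc.prems(3), of "con v \<Omega>"] by (simp add: vanish_def)
    then have "vanish H (wedge \<alpha> (con v (wedge_power \<Omega> (Suc m))))"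
      unfolding con_wedge_power[OF O] by (simp add: vanish_def wedge_smult_right del: of_nat_Suc)
    then show "vanish H (wedge (con v \<alpha>) (wedge_power \<Omega> (Suc m)))"
      using up wedge_Cons[OF a P[of "Suc m"], of v] v unfolding vanish_def
      by (metis (no_types, lifting) add_0_right insert_subset list.simps(15) mult_zero_right)
    show "k + Suc m \<le> n" using Suc.prems by simp
  qed
  show ?case unfolding vanish_def
  proof (intro allI impI)
    fix vs assume vs: "set vs \<subseteq> H"
    show "\<alpha> vs = 0"
    proof (cases vs)
      case Nil then show ?thesis using alt_length[OF a] by simp
    next
      case (Cons v ws) then show ?thesis using *[of v] vs by (simp add: vanish_def con_apply)
    qed
  qed
qed

text \<open>Exhibits the contraction of a multiple of \<Omega>^(m+1) as a multiple of \<Omega>^m.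
  From the other factor on the right, solutions of the Lefschetz equation in the next degree are
  assembled.\<close>

lemma con_lefschetz:
  assumes O: "\<Omega> \<in> alt_forms 2" and d: "\<delta> \<in> alt_forms j"
  shows "con v (wedge \<delta> (wedge_power \<Omega> (Suc m))) =
    wedge (\<lambda>vs. wedge (con v \<delta>) \<Omega> vs + (-1) ^ j * of_nat (Suc m) * wedge \<delta> (con v \<Omega>) vs) (wedge_power \<Omega> m)"
proof -
  note P = wedge_power_alt[OF O]
  have c: "con v \<Omega> \<in> alt_forms 1" using con_alt[of \<Omega> 1] O by (simp add: numeral_2_eq_2)
  show ?thesis
    unfolding con_wedge[OF d P] con_wedge_power[OF O] wedge_smult_right
      wedge_power_Suc_right(2)[OF O con_alt'[OF d]] wedge_assoc[OF d c P, symmetric]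
    by (rule ext) (simp add: wedge_add_left wedge_smult_left del: of_nat_Suc)
qed

text \<open>The operator built from a frame of V counts the arguments in V, as in Euler's identity
  for homogeneous polynomials. It counts degrees for V = H, and types for V = T^{1,0} or
  T^{0,1}.\<close>

lemma euler_contraction:
  assumes "\<beta> \<in> alt_forms k" "finite I" "\<And>i. i \<in> I \<Longrightarrow> \<epsilon> i \<in> alt_forms 1"
    and V: "\<And>v. v \<in> V \<Longrightarrow> (\<Sum>i\<in>I. \<epsilon> i [v] *s e i) = v" and W: "\<And>i v. i \<in> I \<Longrightarrow> v \<in> W \<Longrightarrow> \<epsilon> i [v] = 0"
    and "set vs \<subseteq> V \<union> W"
  shows "(\<Sum>i\<in>I. wedge (\<epsilon> i) (con (e i) \<beta>) vs) = of_nat (length (filter (\<lambda>v. v \<in> V) vs)) * \<beta> vs"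
  using assms(1,6)
proof (induction vs arbitrary: k \<beta>)
  case Nil
  have "wedge (\<epsilon> i) (con (e i) \<beta>) [] = 0" if "i \<in> I" for i
    using alt_length[OF assms(3)[OF that]] by (simp add: wedge_Nil)
  then show ?case by simp
next
  case (Cons v vs)
  have "(\<Sum>i\<in>I. wedge (\<epsilon> i) (con (e i) \<beta>) (v # vs)) =
     (\<Sum>i\<in>I. \<epsilon> i [v] * \<beta> (e i # vs)) - (\<Sum>i\<in>I. wedge (\<epsilon> i) (con v (con (e i) \<beta>)) vs)"
    using wedge_one_form_Cons[OF assms(3) con_alt'[OF Cons.prems(1)], of _ _ v vs] by (simp add: sum_subtractf con_apply)
  \<comment> \<open>Contractions anticommute, so the minus sign of
    \<open>wedge_one_form_Cons\<close> is cancelled and the counts add up.\<close>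
  also have "(\<Sum>i\<in>I. wedge (\<epsilon> i) (con v (con (e i) \<beta>)) vs) = - (\<Sum>i\<in>I. wedge (\<epsilon> i) (con (e i) (con v \<beta>)) vs)"
    unfolding con_swap[OF Cons.prems(1), of v] wedge_minus_right by (simp add: sum_negf)
  also have "(\<Sum>i\<in>I. \<epsilon> i [v] * \<beta> (e i # vs)) = \<beta> ((\<Sum>i\<in>I. \<epsilon> i [v] *s e i) # vs)"
    by (rule alt_Cons_sum[OF Cons.prems(1), symmetric])
  also have "\<dots> = (if v \<in> V then \<beta> (v # vs) else 0)"
    using V W Cons.prems by (auto simp: alt_Cons_zero[OF Cons.prems(1)])
  finally show ?case
    using Cons.IH[OF con_alt'[OF Cons.prems(1)], of v] Cons.prems by (simp add: algebra_simps) (simp add: con_apply)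
qed

lemma alt_permute:
  assumes "\<alpha> \<in> alt_forms k" "p permutes {..<N}" "length xs = N" "\<alpha> xs = 0"
  shows "\<alpha> (permute_list p xs) = 0"
  using assms(2) finite_lessThan[of N] assms(3,4)
proof (induction p arbitrary: xs rule: permutes_induct)
  case id then show ?case by simp
next
  case (swap a b p)
  let ?t = "Transposition.transpose a b"
  have p: "p permutes {..<length xs}" using swap by simp
  have "permute_list (?t \<circ> p) xs = permute_list p (permute_list ?t xs)"
    by (rule permute_list_compose[OF p])
  moreover have "permute_list ?t xs = xs[a := xs ! b, b := xs ! a]"
    using swap by (intro nth_equalityI)
      (auto simp: permute_list_def nth_list_update Transposition.transpose_def)
  moreover have "\<alpha> (xs[a := xs ! b, b := xs ! a]) = 0"
    using swap alt_swap[OF assms(1), of xs a b] alt_length[OF assms(1)]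
    by (cases "length xs = k \<and> a \<noteq> b") auto
  ultimately show ?case using swap.IH[of "xs[a := xs ! b, b := xs ! a]"] swap by (simp del: comp_apply)
qed

text \<open>A nonzero value on vectors from a list of length k needs k distinct arguments, hence a
  permutation of the list: top-degree forms are one-dimensional.\<close>

lemma alt_vanish_basis:
  assumes a: "\<alpha> \<in> alt_forms k" and es: "distinct es" "length es = k" "\<alpha> es = 0"
  shows "vanish (vec.span (set es)) \<alpha>"
proof (rule alt_vanish_span[OF a])
  show "vanish (set es) \<alpha>" unfolding vanish_def
  proof (intro allI impI)
    fix vs assume vs: "set vs \<subseteq> set es"
    show "\<alpha> vs = 0"
    proof (cases "length vs = k \<and> distinct vs")
      case True
      then have "set vs = set es"
        using vs es by (metis List.finite_set card_subset_eq distinct_card)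
      then have "mset es = mset vs" using True es by (simp add: set_eq_iff_mset_eq_distinct)
      then obtain p where "p permutes {..<length es}" "permute_list p es = vs"
        using mset_eq_permutation by metis
      then show ?thesis using alt_permute[OF a _ refl es(3)] by blast
    next
      case False
      then consider "length vs \<noteq> k" | i j where "length vs = k" "i < k" "j < k" "i \<noteq> j" "vs ! i = vs ! j"
        unfolding distinct_conv_nth by blast
      then show ?thesis using alt_length[OF a] alt_repeat[OF a] by cases blast+
    qed
  qed
qed

subsection \<open>Types\<close>

definition cnt :: "'v set \<Rightarrow> 'v list \<Rightarrow> nat" where
  "cnt V vs = length (filter (\<lambda>v. v \<in> V) vs)"

lemma cnt_simps [simp]: "cnt V [] = 0" "cnt V (v # vs) = (if v \<in> V then Suc (cnt V vs) else cnt V vs)"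
  by (auto simp: cnt_def)

lemma cnt_le: "cnt V vs \<le> length vs" by (simp add: cnt_def)

text \<open>A test on lists of vectors from V and W only, which avoids the span in
  \<open>Lambda_pq\<close>. The index is an integer because above degree n the relevant type is p -
  1, also for p = 0; then it means vanishing on all such lists.\<close>

definition ptype :: "'v set \<Rightarrow> 'v set \<Rightarrow> int \<Rightarrow> ('v list \<Rightarrow> complex) \<Rightarrow> bool" where
  "ptype V W p \<alpha> \<longleftrightarrow> (\<forall>vs. set vs \<subseteq> V \<union> W \<longrightarrow> int (cnt V vs) \<noteq> p \<longrightarrow> \<alpha> vs = 0)"

lemma ptype_con_left: "ptype V W p \<gamma> \<Longrightarrow> v \<in> V \<Longrightarrow> ptype V W (p - 1) (con v \<gamma>)"
  by (auto simp: ptype_def con_apply)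

lemma ptype_con_right: "ptype V W p \<gamma> \<Longrightarrow> v \<in> W \<Longrightarrow> v \<notin> V \<Longrightarrow> ptype V W p (con v \<gamma>)"
  by (auto simp: ptype_def con_apply)

lemma ptype_wedge_left:
  assumes "\<epsilon> \<in> alt_forms 1" "\<And>w. w \<in> W \<Longrightarrow> \<epsilon> [w] = 0" "\<gamma> \<in> alt_forms g" "ptype V W p \<gamma>"
  shows "ptype V W (p + 1) (wedge \<epsilon> \<gamma>)"
proof -
  have "wedge \<epsilon> \<gamma> vs = 0" if "set vs \<subseteq> V \<union> W" "int (cnt V vs) \<noteq> p + 1" for vs
    using assms(3,4) that
  proof (induction vs arbitrary: g \<gamma> p)
    case Nil then show ?case using alt_length[OF assms(1)] by (simp add: wedge_Nil)
  next
    case (Cons v vs)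
    show ?case
    proof (cases "v \<in> V")
      case True
      then show ?thesis
        using Cons.IH[OF con_alt'[OF Cons.prems(1)] ptype_con_left[OF Cons.prems(2) True]] Cons.prems
        by (auto simp: wedge_one_form_Cons[OF assms(1) Cons.prems(1)] ptype_def)
    next
      case False
      then have w: "v \<in> W" using Cons.prems by auto
      show ?thesis
        using Cons.IH[OF con_alt'[OF Cons.prems(1)] ptype_con_right[OF Cons.prems(2) w False]] Cons.prems False w
        by (auto simp: wedge_one_form_Cons[OF assms(1) Cons.prems(1)] assms(2))
    qed
  qed
  then show ?thesis by (simp add: ptype_def)
qed

lemma ptype_wedge_right:
  assumes "\<epsilon> \<in> alt_forms 1" "\<And>v. v \<in> V \<Longrightarrow> \<epsilon> [v] = 0" "\<gamma> \<in> alt_forms g" "ptype V W p \<gamma>"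
  shows "ptype V W p (wedge \<epsilon> \<gamma>)"
proof -
  have "wedge \<epsilon> \<gamma> vs = 0" if "set vs \<subseteq> V \<union> W" "int (cnt V vs) \<noteq> p" for vs
    using assms(3,4) that
  proof (induction vs arbitrary: g \<gamma> p)
    case Nil then show ?case using alt_length[OF assms(1)] by (simp add: wedge_Nil)
  next
    case (Cons v vs)
    show ?case
    proof (cases "v \<in> V")
      case True
      then show ?thesis
        using Cons.IH[OF con_alt'[OF Cons.prems(1)] ptype_con_left[OF Cons.prems(2) True]] Cons.prems
        by (auto simp: wedge_one_form_Cons[OF assms(1) Cons.prems(1)] assms(2))
    next
      case False
      then have w: "v \<in> W" using Cons.prems by auto
      show ?thesis
        using Cons.IH[OF con_alt'[OF Cons.prems(1)] ptype_con_right[OF Cons.prems(2) w False]] Cons.prems False w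
        by (auto simp: wedge_one_form_Cons[OF assms(1) Cons.prems(1)] ptype_def)
    qed
  qed
  then show ?thesis by (simp add: ptype_def)
qed

lemma module_forms: "module (\<lambda>(a::complex) (\<alpha> :: 'v list \<Rightarrow> complex) vs. a * \<alpha> vs)"
  by unfold_locales (auto simp: algebra_simps)

lemma Lambda_generator:
  fixes V W :: "(complex ^ 'd) set"
  assumes "\<forall>\<alpha>\<in>set as. \<alpha> \<in> alt_forms 1 \<and> (\<forall>w\<in>W. \<alpha> [w] = 0)"
    "\<forall>\<beta>\<in>set bs. \<beta> \<in> alt_forms 1 \<and> (\<forall>v\<in>V. \<beta> [v] = 0)"
  shows "foldr wedge (as @ bs) wedge_one \<in> alt_forms (length as + length bs) \<and>
     ptype V W (int (length as)) (foldr wedge (as @ bs) wedge_one)"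
  using assms(1)
proof (induction as)
  case Nil
  show ?case using assms(2)
  proof (induction bs)
    case Nil then show ?case by (simp add: wedge_one_alt) (simp add: ptype_def wedge_one_def)
  next
    case (Cons b bs)
    then show ?case
      using wedge_alt[of b 1 "foldr wedge bs wedge_one" "length bs"] ptype_wedge_right[of b V _ "length bs" W 0]
      by auto
  qed
next
  case (Cons a as)
  then show ?case
    using wedge_alt[of a 1 "foldr wedge (as @ bs) wedge_one" "length as + length bs"]
      ptype_wedge_left[of a W "foldr wedge (as @ bs) wedge_one" "length as + length bs" V "int (length as)"]
    by (auto simp: add.commute)
qed

lemma Lambda_alt_ptype:
  fixes V W :: "(complex ^ 'd) set"
  assumes "\<eta> \<in> Lambda_pq V W (int p) (int q)"
  shows "\<eta> \<in> alt_forms (p + q)" "ptype V W (int p) \<eta>"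
proof -
  interpret M: module "\<lambda>(a::complex) (\<alpha> :: (complex ^ 'd) list \<Rightarrow> complex) vs. a * \<alpha> vs" by (rule module_forms)
  have "\<eta> \<in> {\<eta>. \<eta> \<in> alt_forms (p + q) \<and> ptype V W (int p) \<eta>}"
  proof (rule M.span_induct[OF assms[unfolded Lambda_pq_def], of "\<lambda>\<eta>. \<eta> \<in> {\<eta>. \<eta> \<in> alt_forms (p + q) \<and> ptype V W (int p) \<eta>}"])
    show "M.subspace {x. x \<in> {\<eta>. \<eta> \<in> alt_forms (p + q) \<and> ptype V W (int p) \<eta>}}"
      unfolding M.subspace_def
      using alt_add_form[of _ "p + q"] alt_smult_form[of _ "p + q"] alt_zero[of "p + q"]
      by (auto simp: ptype_def zero_fun_def plus_fun_def)
  qed (use Lambda_generator in auto)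
  then show "\<eta> \<in> alt_forms (p + q)" "ptype V W (int p) \<eta>" by auto
qed

lemma Lambda_neg:
  assumes "\<eta> \<in> Lambda_pq V W a b" "a < 0" shows "\<eta> = (\<lambda>_. 0)"
proof -
  interpret M: module "\<lambda>(a::complex) (\<alpha> :: (complex ^ 'd) list \<Rightarrow> complex) vs. a * \<alpha> vs" by (rule module_forms)
  have E: "{foldr wedge (as @ bs) wedge_one | as bs.
          int (length as) = a \<and> int (length bs) = b \<and>
          (\<forall>\<alpha>\<in>set as. \<alpha> \<in> alt_forms 1 \<and> (\<forall>w\<in>W. \<alpha> [w] = 0)) \<and>
          (\<forall>\<beta>\<in>set bs. \<beta> \<in> alt_forms 1 \<and> (\<forall>v\<in>V. \<beta> [v] = 0))} = {}" using assms(2) by auto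
  have "\<eta> \<in> M.span {}" using assms(1) unfolding Lambda_pq_def E .
  then show ?thesis by (simp add: zero_fun_def)
qed

lemma Lambda_zero: "(\<lambda>_. 0) \<in> Lambda_pq V W a b"
proof -
  interpret M: module "\<lambda>(a::complex) (\<alpha> :: (complex ^ 'd) list \<Rightarrow> complex) vs. a * \<alpha> vs" by (rule module_forms)
  show ?thesis using M.span_zero unfolding Lambda_pq_def zero_fun_def by blast
qed

lemma Lambda_sum:
  assumes "\<And>i. i \<in> I \<Longrightarrow> f i \<in> Lambda_pq V W a b"
  shows "(\<lambda>vs. \<Sum>i\<in>I. r * f i vs) \<in> Lambda_pq V W a b"
proof -
  interpret M: module "\<lambda>(a::complex) (\<alpha> :: (complex ^ 'd) list \<Rightarrow> complex) vs. a * \<alpha> vs" by (rule module_forms)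
  have "(\<Sum>i\<in>I. (\<lambda>vs. r * f i vs)) \<in> Lambda_pq V W a b"
    using assms unfolding Lambda_pq_def by (intro M.span_sum M.span_scale) auto
  moreover have "(\<Sum>i\<in>I. (\<lambda>vs. r * f i vs)) = (\<lambda>vs. \<Sum>i\<in>I. r * f i vs)"
    by (induction I rule: infinite_finite_induct) (auto simp: fun_eq_iff)
  ultimately show ?thesis by simp
qed

text \<open>Generators list the factors from V* before those from W*. A factor from W* can thus be
  put in front only if no factor from V* is present, whence \<open>a = 0\<close> in the second
  alternative.\<close>

lemma Lambda_wedge:
  fixes V W :: "(complex ^ 'd) set"
  assumes "\<epsilon> \<in> alt_forms 1" "\<eta> \<in> Lambda_pq V W a b"
    and c: "(\<forall>w\<in>W. \<epsilon> [w] = 0) \<and> a' = a + 1 \<and> b' = b \<or> (\<forall>v\<in>V. \<epsilon> [v] = 0) \<and> a = 0 \<and> a' = 0 \<and> b' = b + 1"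
  shows "wedge \<epsilon> \<eta> \<in> Lambda_pq V W a' b'"
proof -
  interpret M: module "\<lambda>(a::complex) (\<alpha> :: (complex ^ 'd) list \<Rightarrow> complex) vs. a * \<alpha> vs" by (rule module_forms)
  show ?thesis
  proof (rule M.span_induct[OF assms(2)[unfolded Lambda_pq_def], of "\<lambda>\<eta>. wedge \<epsilon> \<eta> \<in> Lambda_pq V W a' b'"])
    have "wedge \<epsilon> (x + y) = wedge \<epsilon> x + wedge \<epsilon> y" for x y
      by (rule ext) (simp add: plus_fun_def wedge_add_right)
    moreover have "wedge \<epsilon> (\<lambda>vs. r * x vs) = (\<lambda>vs. r * wedge \<epsilon> x vs)" for r x
      by (rule ext) (rule wedge_smult_right)
    moreover have "wedge \<epsilon> 0 = (\<lambda>_. 0)" unfolding zero_fun_def by (rule wedge_zero_right)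
    ultimately show "M.subspace {x. wedge \<epsilon> x \<in> Lambda_pq V W a' b'}"
      unfolding M.subspace_def
      using Lambda_zero M.span_add M.span_scale unfolding Lambda_pq_def by simp
  next
    fix x assume "x \<in> {foldr wedge (as @ bs) wedge_one | as bs.
          int (length as) = a \<and> int (length bs) = b \<and>
          (\<forall>\<alpha>\<in>set as. \<alpha> \<in> alt_forms 1 \<and> (\<forall>w\<in>W. \<alpha> [w] = 0)) \<and>
          (\<forall>\<beta>\<in>set bs. \<beta> \<in> alt_forms 1 \<and> (\<forall>v\<in>V. \<beta> [v] = 0))}"
    then obtain as bs where x: "x = foldr wedge (as @ bs) wedge_one" "int (length as) = a" "int (length bs) = b"
      "\<forall>\<alpha>\<in>set as. \<alpha> \<in> alt_forms 1 \<and> (\<forall>w\<in>W. \<alpha> [w] = 0)" "\<forall>\<beta>\<in>set bs. \<beta> \<in> alt_forms 1 \<and> (\<forall>v\<in>V. \<beta> [v] = 0)"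
      by auto
    from c show "wedge \<epsilon> x \<in> Lambda_pq V W a' b'"
    proof
      assume "(\<forall>w\<in>W. \<epsilon> [w] = 0) \<and> a' = a + 1 \<and> b' = b"
      note c = this
      show ?thesis unfolding Lambda_pq_def
        by (rule M.span_base, rule CollectI, rule exI[of _ "\<epsilon> # as"], rule exI[of _ bs])
           (use c x assms(1) in auto)
    next
      assume "(\<forall>v\<in>V. \<epsilon> [v] = 0) \<and> a = 0 \<and> a' = 0 \<and> b' = b + 1"
      note c = this
      show ?thesis unfolding Lambda_pq_def
        by (rule M.span_base, rule CollectI, rule exI[of _ "[]"], rule exI[of _ "\<epsilon> # bs"])
           (use c x assms(1) in auto)
    qed
  qed
qed

definition dual_frame :: "(complex ^ 'd::finite) set \<Rightarrow> (complex ^ 'd) set \<Rightarrow> 'i set \<Rightarrow> ('i \<Rightarrow> complex ^ 'd)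
    \<Rightarrow> ('i \<Rightarrow> (complex ^ 'd) list \<Rightarrow> complex) \<Rightarrow> bool" where
  "dual_frame V W I e \<epsilon> \<longleftrightarrow> finite I \<and> (\<forall>i\<in>I. e i \<in> V \<and> \<epsilon> i \<in> alt_forms 1 \<and> (\<forall>w\<in>W. \<epsilon> i [w] = 0)) \<and>
     (\<forall>v\<in>V. (\<Sum>i\<in>I. \<epsilon> i [v] *s e i) = v)"

text \<open>By Euler's formula \<alpha> is 1/p times the sum of the products of the coframe with its
  contractions, which have type (p-1,q). The outer induction removes the factors from V*; at p = 0
  an inner one removes those from W*.\<close>

lemma ptype_imp_Lambda:
  fixes V W :: "(complex ^ 'd) set"
  assumes F: "dual_frame V W I1 e1 \<epsilon>1" "dual_frame W V I2 e2 \<epsilon>2" and VW: "V \<inter> W = {0}"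
    and "\<alpha> \<in> alt_forms (p + q)" "ptype V W (int p) \<alpha>"
  shows "\<exists>\<eta>\<in>Lambda_pq V W (int p) (int q). vanish (V \<union> W) (\<lambda>vs. \<alpha> vs - \<eta> vs)"
  using assms(4,5)
proof (induction p arbitrary: \<alpha>)
  case 0
  then show ?case
  proof (induction q arbitrary: \<alpha>)
    case 0
    interpret M: module "\<lambda>(a::complex) (\<alpha> :: (complex ^ 'd) list \<Rightarrow> complex) vs. a * \<alpha> vs" by (rule module_forms)
    have "wedge_one \<in> Lambda_pq V W 0 0" unfolding Lambda_pq_def by (rule M.span_base) auto
    then have "(\<lambda>vs. \<alpha> [] * wedge_one vs) \<in> Lambda_pq V W 0 0" unfolding Lambda_pq_def by (rule M.span_scale)
    moreover have "vanish (V \<union> W) (\<lambda>vs. \<alpha> vs - \<alpha> [] * wedge_one vs)"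
      using 0(1) by (auto simp: vanish_def wedge_one_def alt_forms_0_iff)
    ultimately show ?case by auto
  next
    case (Suc q)
    have a: "\<alpha> \<in> alt_forms (Suc q)" using Suc.prems by simp
    have "\<exists>\<eta>\<in>Lambda_pq V W (int 0) (int q). vanish (V \<union> W) (\<lambda>vs. con (e2 i) \<alpha> vs - \<eta> vs)" if i: "i \<in> I2" for i
    \<comment> \<open>The zero vector belongs to V as well and would be counted there.\<close>
    proof (cases "e2 i = 0")
      case True
      then have "con (e2 i) \<alpha> = (\<lambda>_. 0)" using alt_Cons_zero[OF a] by (simp add: con_def)
      then show ?thesis using Lambda_zero by (intro bexI[of _ "\<lambda>_. 0"]) (auto simp: vanish_def)
    next
      case False
      have "e2 i \<in> W" using i F by (simp add: dual_frame_def)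
      moreover then have "e2 i \<notin> V" using VW False by blast
      ultimately show ?thesis using Suc.IH[of "con (e2 i) \<alpha>"] con_alt[OF a] ptype_con_right[OF Suc.prems(2)] by auto
    qed
    then obtain \<eta> where \<eta>: "\<And>i. i \<in> I2 \<Longrightarrow> \<eta> i \<in> Lambda_pq V W (int 0) (int q)"
       "\<And>i. i \<in> I2 \<Longrightarrow> vanish (V \<union> W) (\<lambda>vs. con (e2 i) \<alpha> vs - \<eta> i vs)" by metis
    let ?\<eta> = "\<lambda>vs. \<Sum>i\<in>I2. (1 / of_nat (Suc q)) * wedge (\<epsilon>2 i) (\<eta> i) vs"
    have \<eta>L: "?\<eta> \<in> Lambda_pq V W (int 0) (int (Suc q))"
      by (rule Lambda_sum, rule Lambda_wedge[OF _ \<eta>(1)]) (use F in \<open>auto simp: dual_frame_def\<close>)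
    moreover have "\<alpha> vs = ?\<eta> vs" if vs: "set vs \<subseteq> V \<union> W" for vs
    proof (cases "cnt V vs = 0 \<and> length vs = Suc q")
      case False
      then show ?thesis using Suc.prems(2) Lambda_alt_ptype(2)[OF \<eta>L] vs alt_length[OF a] alt_length[OF Lambda_alt_ptype(1)[OF \<eta>L]]
        unfolding ptype_def by auto
    next
      case True
      have v: "v \<in> W" if "v \<in> set vs" for v using True vs that by (auto simp: cnt_def filter_empty_conv)
      then have fw: "filter (\<lambda>v. v \<in> W) vs = vs" by (simp add: filter_id_conv)
      have "(\<Sum>i\<in>I2. wedge (\<epsilon>2 i) (\<eta> i) vs) = (\<Sum>i\<in>I2. wedge (\<epsilon>2 i) (con (e2 i) \<alpha>) vs)"
        by (intro sum.cong refl wedge_cong_on[of "V \<union> W"]) (use \<eta>(2) vs in \<open>auto simp: vanish_def\<close>)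
      also have "\<dots> = of_nat (length (filter (\<lambda>v. v \<in> W) vs)) * \<alpha> vs"
        by (rule euler_contraction[OF a]) (use F v vs in \<open>auto simp: dual_frame_def\<close>)
      finally show ?thesis using True fw by (simp add: sum_divide_distrib[symmetric] del: of_nat_Suc)
    qed
    ultimately show ?case by (auto simp: vanish_def)
  qed
next
  case (Suc p)
  have a: "\<alpha> \<in> alt_forms (Suc (p + q))" using Suc.prems by simp
  have "\<exists>\<eta>\<in>Lambda_pq V W (int p) (int q). vanish (V \<union> W) (\<lambda>vs. con (e1 i) \<alpha> vs - \<eta> vs)" if i: "i \<in> I1" for i
  proof -
    have "e1 i \<in> V" using i F by (simp add: dual_frame_def)
    then show ?thesis using Suc.IH[of "con (e1 i) \<alpha>"] con_alt[OF a] ptype_con_left[OF Suc.prems(2)] by auto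
  qed
  then obtain \<eta> where \<eta>: "\<And>i. i \<in> I1 \<Longrightarrow> \<eta> i \<in> Lambda_pq V W (int p) (int q)"
     "\<And>i. i \<in> I1 \<Longrightarrow> vanish (V \<union> W) (\<lambda>vs. con (e1 i) \<alpha> vs - \<eta> i vs)" by metis
  let ?\<eta> = "\<lambda>vs. \<Sum>i\<in>I1. (1 / of_nat (Suc p)) * wedge (\<epsilon>1 i) (\<eta> i) vs"
  have \<eta>L: "?\<eta> \<in> Lambda_pq V W (int (Suc p)) (int q)"
    by (rule Lambda_sum, rule Lambda_wedge[OF _ \<eta>(1)]) (use F in \<open>auto simp: dual_frame_def\<close>)
  moreover have "\<alpha> vs = ?\<eta> vs" if vs: "set vs \<subseteq> V \<union> W" for vs
  proof (cases "cnt V vs = Suc p")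
    case False
    then have "int (cnt V vs) \<noteq> int (Suc p)" by linarith
    then have "\<alpha> vs = 0" "?\<eta> vs = 0"
      using Suc.prems(2) Lambda_alt_ptype(2)[OF \<eta>L] vs unfolding ptype_def by blast+
    then show ?thesis by simp
  next
    case True
    have "(\<Sum>i\<in>I1. wedge (\<epsilon>1 i) (\<eta> i) vs) = (\<Sum>i\<in>I1. wedge (\<epsilon>1 i) (con (e1 i) \<alpha>) vs)"
      by (intro sum.cong refl wedge_cong_on[of "V \<union> W"]) (use \<eta>(2) vs in \<open>auto simp: vanish_def\<close>)
    also have "\<dots> = of_nat (length (filter (\<lambda>v. v \<in> V) vs)) * \<alpha> vs"
      by (rule euler_contraction[OF a]) (use F vs in \<open>auto simp: dual_frame_def\<close>)
    finally show ?thesis using True by (simp add: cnt_def sum_divide_distrib[symmetric] del: of_nat_Suc)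
  qed
  ultimately show ?case by (auto simp: vanish_def)
qed

text \<open>On lists from V and W this is Euler's formula; multilinearity extends the agreement to
  the span, where the set X lies. In the application X is the complexification of H.\<close>

theorem Lambda_iff_ptype:
  fixes V W :: "(complex ^ 'd) set"
  assumes F: "dual_frame V W I1 e1 \<epsilon>1" "dual_frame W V I2 e2 \<epsilon>2" and VW: "V \<inter> W = {0}"
    and a: "\<alpha> \<in> alt_forms k" and k: "int k = a + b" "0 \<le> b" and X: "V \<union> W \<subseteq> X" "X \<subseteq> vec.span (V \<union> W)"
  shows "(\<exists>\<eta>\<in>Lambda_pq V W a b. \<forall>vs. set vs \<subseteq> X \<longrightarrow> \<alpha> vs = \<eta> vs) \<longleftrightarrow> ptype V W a \<alpha>"
proof
  assume "\<exists>\<eta>\<in>Lambda_pq V W a b. \<forall>vs. set vs \<subseteq> X \<longrightarrow> \<alpha> vs = \<eta> vs"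
  then obtain \<eta> where e: "\<eta> \<in> Lambda_pq V W a b" "\<And>vs. set vs \<subseteq> X \<Longrightarrow> \<alpha> vs = \<eta> vs" by auto
  show "ptype V W a \<alpha>"
  proof (cases "a < 0")
    case True
    then show ?thesis using Lambda_neg[OF e(1)] e(2) X unfolding ptype_def by (metis order_trans)
  next
    case False
    then have "a = int (nat a)" "b = int (nat b)" using k by auto
    then have "ptype V W a \<eta>" using Lambda_alt_ptype(2) e(1) by metis
    then show ?thesis using e(2) X unfolding ptype_def by (metis order_trans)
  qed
next
  assume t: "ptype V W a \<alpha>"
  have "\<exists>\<eta>\<in>Lambda_pq V W a b. \<eta> \<in> alt_forms k \<and> vanish (V \<union> W) (\<lambda>vs. \<alpha> vs - \<eta> vs)"
  proof (cases "a < 0")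
    case True
    then have "vanish (V \<union> W) \<alpha>" using t by (auto simp: vanish_def ptype_def)
    then show ?thesis using Lambda_zero alt_zero by (intro bexI[of _ "\<lambda>_. 0"]) auto
  next
    case False
    then have i: "a = int (nat a)" "b = int (nat b)" and kk: "k = nat a + nat b" using k by auto
    have "\<exists>\<eta>\<in>Lambda_pq V W (int (nat a)) (int (nat b)). vanish (V \<union> W) (\<lambda>vs. \<alpha> vs - \<eta> vs)"
      by (rule ptype_imp_Lambda[OF F VW]) (use a t kk i in auto)
    then show ?thesis using i kk Lambda_alt_ptype(1)[of _ V W "nat a" "nat b"] by auto
  qed
  then obtain \<eta> where e: "\<eta> \<in> Lambda_pq V W a b" "\<eta> \<in> alt_forms k" "vanish (V \<union> W) (\<lambda>vs. \<alpha> vs - \<eta> vs)" by auto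
  have "vanish (vec.span (V \<union> W)) (\<lambda>vs. \<alpha> vs + - 1 * \<eta> vs)"
    by (rule alt_vanish_span[OF alt_add_form[OF a alt_smult_form[OF e(2)]]]) (use e(3) in simp)
  then show "\<exists>\<eta>\<in>Lambda_pq V W a b. \<forall>vs. set vs \<subseteq> X \<longrightarrow> \<alpha> vs = \<eta> vs"
    using e(1) X(2) by (intro bexI[of _ \<eta>]) (auto simp: vanish_def)
qed

lemma alt_scale_pure:
  assumes "\<alpha> \<in> alt_forms k" "set vs \<subseteq> V \<union> W" "\<And>v. v \<in> V \<Longrightarrow> R v = t *s v" "\<And>v. v \<in> W \<Longrightarrow> R v = v"
  shows "\<alpha> (map R vs) = t ^ cnt V vs * \<alpha> vs"
  using assms(1,2)
proof (induction vs arbitrary: \<alpha> k)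
  case (Cons v vs)
  show ?case
  proof (cases "v \<in> V")
    case True
    then show ?thesis
      using Cons.IH[OF con_alt'[OF Cons.prems(1), of v]] Cons.prems alt_Cons_smult[OF Cons.prems(1), of t v]
      by (simp add: con_apply assms(3) mult_ac)
  next
    case False
    then show ?thesis
      using Cons.IH[OF con_alt'[OF Cons.prems(1), of v]] Cons.prems assms(4)
      by (auto simp: con_apply)
  qed
qed simp

text \<open>Orthogonality of the characters of the cyclic group of order N, written with quotients
  to fit the weights t^(-a) of an average.\<close>

lemma sum_roots_unity:
  assumes "N > 0"
  defines "z \<equiv> exp (2 * of_real pi * \<i> * of_nat 1 / of_nat N) :: complex"
  shows "(\<Sum>j<N. (z ^ j) ^ a / (z ^ j) ^ b) = (if a mod N = b mod N then of_nat N else 0)"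
proof -
  have z0: "z \<noteq> 0" by (simp add: z_def)
  define w where "w = z ^ a / z ^ b"
  have "(z ^ j) ^ a / (z ^ j) ^ b = w ^ j" for j
    by (simp add: w_def power_divide power_mult[symmetric] mult.commute)
  then have s: "(\<Sum>j<N. (z ^ j) ^ a / (z ^ j) ^ b) = (\<Sum>j<N. w ^ j)" by simp
  have zp: "z ^ m = exp (2 * of_real pi * \<i> * of_nat m / of_nat N)" for m
    unfolding z_def exp_of_nat_mult[symmetric] by (rule arg_cong[of _ _ exp]) simp
  have zN: "z ^ N = 1" unfolding zp using assms(1) by simp
  have "w ^ N = (z ^ N) ^ a / (z ^ N) ^ b"
    by (simp add: w_def power_divide power_mult[symmetric] mult.commute)
  then have wN: "w ^ N = 1" using zN by simp
  have "w = 1 \<longleftrightarrow> z ^ a = z ^ b" using z0 by (simp add: w_def)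
  also have "\<dots> \<longleftrightarrow> a mod N = b mod N"
    unfolding zp using complex_root_unity_eq[of N a b] assms(1) by simp
  finally show ?thesis
    using s wN geometric_sum[of w N] by auto
qed

section \<open>Differential forms in a chart\<close>

definition dl :: "('m, 'd::finite) chart \<Rightarrow> ('m \<Rightarrow> (complex ^ 'd) list \<Rightarrow> complex) \<Rightarrow> 'm \<Rightarrow> (complex ^ 'd) list \<Rightarrow> complex" where
  "dl c g p vs = (\<Sum>i<length vs. (-1) ^ i * ddir c (\<lambda>q. g q (take i vs @ drop (Suc i) vs)) p (vs ! i))"

lemma ext_d_dl: "ext_d \<omega> c p vs = (if p \<in> fst c then dl c (\<omega> c) p vs else 0)"
  by (simp add: ext_d_def dl_def)

lemma dl_Nil [simp]: "dl c g p [] = 0" by (simp add: dl_def)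

text \<open>Cartan's formula for the constant field v. Together with \<open>wedge_Cons\<close> it
  allows proofs about d by induction on the argument list.\<close>

lemma dl_Cons: "dl c g p (v # vs) = ddir c (\<lambda>q. g q vs) p v - dl c (\<lambda>q. con v (g q)) p vs"
  unfolding dl_def length_Cons sum.lessThan_Suc_shift
  by (simp add: con_apply sum_negf)

lemma alt_pullback:
  assumes "\<alpha> \<in> alt_forms k" "\<And>x y. J (x + y) = J x + J y" "\<And>a x. J (a *s x) = a *s J x"
  shows "(\<lambda>vs. \<alpha> (map J vs)) \<in> alt_forms k"
  unfolding alt_forms_def mem_Collect_eq linear_iff_complex
proof (intro conjI allI impI)
  show "\<alpha> (map J vs) = 0" if "length vs \<noteq> k" for vs using alt_length[OF assms(1)] that by simp
  show "\<alpha> (map J (vs[i := x + y])) = \<alpha> (map J (vs[i := x])) + \<alpha> (map J (vs[i := y]))"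
    if "length vs = k \<and> i < k" for vs i x y
    using alt_add[OF assms(1), of "map J vs" i] that by (simp add: map_update assms(2))
  show "\<alpha> (map J (vs[i := a *s x])) = a * \<alpha> (map J (vs[i := x]))"
    if "length vs = k \<and> i < k" for vs i a x
    using alt_smult[OF assms(1), of "map J vs" i] that by (simp add: map_update assms(3))
  show "\<alpha> (map J vs) = 0" if "length vs = k \<and> i < j \<and> j < k \<and> vs ! i = vs ! j" for vs i j
    using that by (intro alt_repeat[OF assms(1), of _ i j]) auto
qed

lemma alt_cnj_pullback:
  assumes "\<alpha> \<in> alt_forms k"
  shows "(\<lambda>vs. cnj (\<alpha> (map vcnj vs))) \<in> alt_forms k"
  unfolding alt_forms_def mem_Collect_eq linear_iff_complex
proof (intro conjI allI impI)
  show "cnj (\<alpha> (map vcnj vs)) = 0" if "length vs \<noteq> k" for vs using alt_length[OF assms(1)] that by simp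
  show "cnj (\<alpha> (map vcnj (vs[i := x + y]))) = cnj (\<alpha> (map vcnj (vs[i := x]))) + cnj (\<alpha> (map vcnj (vs[i := y])))"
    if "length vs = k \<and> i < k" for vs i x y
    using alt_add[OF assms(1), of "map vcnj vs" i] that by (simp add: map_update vcnj_add)
  show "cnj (\<alpha> (map vcnj (vs[i := a *s x]))) = a * cnj (\<alpha> (map vcnj (vs[i := x])))"
    if "length vs = k \<and> i < k" for vs i a x
    using alt_smult[OF assms(1), of "map vcnj vs" i] that by (simp add: map_update vcnj_smult)
  show "cnj (\<alpha> (map vcnj vs)) = 0" if "length vs = k \<and> i < j \<and> j < k \<and> vs ! i = vs ! j" for vs i j
    using that alt_repeat[OF assms(1), of "map vcnj vs" i j] by auto
qed

lemma alt_move: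
  assumes "\<alpha> \<in> alt_forms k" "i < length ys"
  shows "\<alpha> (u # take i ys @ drop (Suc i) ys) = (-1) ^ i * \<alpha> (ys[i := u])"
  using assms
proof (induction ys arbitrary: i \<alpha> k)
  case (Cons y ys)
  show ?case
  proof (cases i)
    case (Suc j)
    then show ?thesis
      using Cons.IH[OF con_alt'[OF Cons.prems(1), of y], of j] Cons.prems(2)
        alt_swap_Cons[OF Cons.prems(1), of u y "take j ys @ drop (Suc j) ys"]
      by (simp add: con_apply)
  qed simp
qed simp

section \<open>The exterior derivative in one chart\<close>

context smooth_manifold
begin

definition lform :: "('m, 'd) chart \<Rightarrow> 'm set \<Rightarrow> nat \<Rightarrow> ('m \<Rightarrow> (complex ^ 'd) list \<Rightarrow> complex) \<Rightarrow> bool" where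
  "lform c V k g \<longleftrightarrow> chd c V \<and> (\<forall>p\<in>V. g p \<in> alt_forms k) \<and> (\<forall>vs. smooth_in c V (\<lambda>p. g p vs))"

lemma lform_chd: "lform c V k g \<Longrightarrow> chd c V" by (simp add: lform_def)
lemma lform_alt: "lform c V k g \<Longrightarrow> p \<in> V \<Longrightarrow> g p \<in> alt_forms k" by (simp add: lform_def)
lemma lform_smooth: "lform c V k g \<Longrightarrow> smooth_in c V (\<lambda>p. g p vs)" by (simp add: lform_def)

lemma lform_subset: "lform c V k g \<Longrightarrow> open W \<Longrightarrow> W \<subseteq> V \<Longrightarrow> lform c W k g"
  unfolding lform_def using chd_subset smooth_in_subset by blast

lemma lform_cong:
  assumes "lform c V k g" "\<And>p vs. p \<in> V \<Longrightarrow> g p vs = g' p vs" shows "lform c V k g'"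
proof -
  have "g p = g' p" if "p \<in> V" for p using assms(2)[OF that] by blast
  then show ?thesis using assms(1) smooth_in_cong[OF lform_chd[OF assms(1)]] unfolding lform_def by metis
qed

lemma lform_zero: "chd c V \<Longrightarrow> lform c V k (\<lambda>_ _. 0)"
  by (simp add: lform_def alt_zero smooth_in_const)

lemma lform_add: "lform c V k g \<Longrightarrow> lform c V k h \<Longrightarrow> lform c V k (\<lambda>p vs. g p vs + h p vs)"
  by (auto simp: lform_def intro: alt_add_form smooth_in_add)

lemma lform_fmult: "lform c V k g \<Longrightarrow> smooth_in c V f \<Longrightarrow> lform c V k (\<lambda>p vs. f p * g p vs)"
  by (auto simp: lform_def intro: alt_smult_form smooth_in_mult)

lemma lform_smult: "lform c V k g \<Longrightarrow> lform c V k (\<lambda>p vs. a * g p vs)"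
  by (rule lform_fmult[OF _ smooth_in_const])

lemma lform_sum: "chd c V \<Longrightarrow> (\<And>i. i \<in> I \<Longrightarrow> lform c V k (g i)) \<Longrightarrow> lform c V k (\<lambda>p vs. \<Sum>i\<in>I. g i p vs)"
  by (induction I rule: infinite_finite_induct) (auto intro: lform_zero lform_add)

lemma lform_con: "lform c V k g \<Longrightarrow> lform c V (k - 1) (\<lambda>p. con v (g p))"
  unfolding lform_def by (auto intro: con_alt'[simplified] simp: con_apply)

lemma lform_wedge:
  assumes "lform c V a g" "lform c V b h" shows "lform c V (a + b) (\<lambda>p. wedge (g p) (h p))"
proof -
  note ch = lform_chd[OF assms(1)]
  have "smooth_in c V (\<lambda>p. wedge (g p) (h p) vs)" for vs
    unfolding wedge_def divide_inverse
    by (intro smooth_in_sum[OF ch] smooth_in_mult[OF ch] smooth_in_const lform_smooth[OF assms(1)] lform_smooth[OF assms(2)])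
  then show ?thesis using assms wedge_alt unfolding lform_def by blast
qed

lemma lform_wedge_power:
  assumes "lform c V 2 g" shows "lform c V (2 * m) (\<lambda>p. wedge_power (g p) m)"
proof (induction m)
  case 0
  then show ?case using lform_chd[OF assms] by (simp add: lform_def wedge_one_alt smooth_in_const)
next
  case (Suc m)
  then show ?case using lform_wedge[OF assms Suc] by simp
qed

lemma lform_cnj:
  assumes "lform c V k g" shows "lform c V k (\<lambda>p vs. cnj (g p (map vcnj vs)))"
  using assms alt_cnj_pullback smooth_in_cnj[OF lform_chd[OF assms]] unfolding lform_def by blast

text \<open>Unlike in \<open>con\<close>, the contracting vector varies with the point, so
  differentiating the result produces derivatives of the field.\<close>

definition conX :: "('m \<Rightarrow> complex ^ 'd) \<Rightarrow> ('m \<Rightarrow> (complex ^ 'd) list \<Rightarrow> complex) \<Rightarrow> 'm \<Rightarrow> (complex ^ 'd) list \<Rightarrow> complex" where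
  "conX X g p = con (X p) (g p)"

lemma alt_Cons_expand:
  assumes "\<alpha> \<in> alt_forms k" shows "\<alpha> (v # vs) = (\<Sum>i\<in>UNIV. v $ i * \<alpha> (axis i 1 # vs))"
  using alt_Cons_sum[OF assms, where I = UNIV and f = "\<lambda>i. v $ i" and v = "\<lambda>i. axis i 1"] by (simp add: basis_expansion)

lemma lform_conX:
  assumes "lform c V k g" "smooth_in c V X" shows "lform c V (k - 1) (conX X g)"
proof -
  note ch = lform_chd[OF assms(1)]
  have "smooth_in c V (\<lambda>p. \<Sum>i\<in>UNIV. X p $ i * g p (axis i 1 # vs))" for vs
    using assms(2)[unfolded smooth_in_vec_iff[OF ch]] lform_smooth[OF assms(1)]
    by (intro smooth_in_sum[OF ch] smooth_in_mult[OF ch]) auto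
  then have "smooth_in c V (\<lambda>p. conX X g p vs)" for vs
    by (rule smooth_in_cong[OF ch, rotated])
       (simp add: conX_def con_apply alt_Cons_expand[OF lform_alt[OF assms(1)], symmetric])
  then show ?thesis using con_alt' assms(1) unfolding lform_def conX_def by blast
qed

lemma lform_eval:
  assumes "lform c V k g" "\<And>X. X \<in> set Xs \<Longrightarrow> smooth_in c V X"
  shows "smooth_in c V (\<lambda>p. g p (map (\<lambda>X. X p) Xs))"
  using assms
proof (induction Xs arbitrary: g k)
  case Nil then show ?case using lform_smooth by simp
next
  case (Cons X Xs)
  have "smooth_in c V (\<lambda>p. conX X g p (map (\<lambda>X. X p) Xs))"
    by (rule Cons.IH[OF lform_conX[OF Cons.prems(1)]]) (use Cons.prems in auto)
  then show ?case by (simp add: conX_def con_apply)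
qed

lemma dl_cong:
  assumes "chd c V" "\<And>q vs. q \<in> V \<Longrightarrow> g q vs = h q vs" "p \<in> V"
  shows "dl c g p vs = dl c h p vs"
  unfolding dl_def by (intro sum.cong refl arg_cong2[where f="(*)"] ddir_cong[OF assms(1) _ assms(3)] assms(2))

lemma dl_add:
  assumes "lform c V k g" "lform c V k' h" "p \<in> V"
  shows "dl c (\<lambda>q vs. g q vs + h q vs) p vs = dl c g p vs + dl c h p vs"
  unfolding dl_def
  by (simp add: ddir_add[OF lform_chd[OF assms(1)] lform_smooth[OF assms(1)] lform_smooth[OF assms(2)] assms(3)]
      distrib_left sum.distrib)

lemma dl_smult:
  assumes "lform c V k g" "p \<in> V"
  shows "dl c (\<lambda>q vs. a * g q vs) p vs = a * dl c g p vs"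
  unfolding dl_def
  by (simp add: ddir_cmult[OF lform_chd[OF assms(1)] lform_smooth[OF assms(1)] assms(2)]
      sum_distrib_left mult.left_commute)

lemma dl_minus:
  assumes "lform c V k g" "lform c V k' h" "p \<in> V"
  shows "dl c (\<lambda>q vs. g q vs - h q vs) p vs = dl c g p vs - dl c h p vs"
  using dl_add[OF assms(1) lform_smult[OF assms(2), of "-1"] assms(3)] dl_smult[OF assms(2,3), of "-1"] by simp

lemma dl_zero [simp]: "dl c (\<lambda>_ _. 0) p vs = 0"
  by (simp add: dl_def)

lemma lform_ddir:
  assumes "lform c V k g" shows "lform c V k (\<lambda>p vs. ddir c (\<lambda>q. g q vs) p v)"
proof -
  note ch = lform_chd[OF assms]
  have "(\<lambda>vs. ddir c (\<lambda>q. g q vs) p v) \<in> alt_forms k" if p: "p \<in> V" for p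
    unfolding alt_forms_def mem_Collect_eq linear_iff_complex
  proof (intro conjI allI impI)
    show "ddir c (\<lambda>q. g q vs) p v = 0" if "length vs \<noteq> k" for vs
      using ddir_cong[OF ch _ p, of "\<lambda>q. g q vs" "\<lambda>_. 0"] alt_length[OF lform_alt[OF assms]] that by simp
    show "ddir c (\<lambda>q. g q (vs[i := x + y])) p v = ddir c (\<lambda>q. g q (vs[i := x])) p v + ddir c (\<lambda>q. g q (vs[i := y])) p v"
      if "length vs = k \<and> i < k" for vs i x y
      using ddir_cong[OF ch _ p, of "\<lambda>q. g q (vs[i := x + y])" "\<lambda>q. g q (vs[i := x]) + g q (vs[i := y])"]
        alt_add[OF lform_alt[OF assms]] ddir_add[OF ch lform_smooth[OF assms] lform_smooth[OF assms] p] that by simp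
    show "ddir c (\<lambda>q. g q (vs[i := a *s x])) p v = a * ddir c (\<lambda>q. g q (vs[i := x])) p v"
      if "length vs = k \<and> i < k" for vs i a x
      using ddir_cong[OF ch _ p, of "\<lambda>q. g q (vs[i := a *s x])" "\<lambda>q. a * g q (vs[i := x])"]
        alt_smult[OF lform_alt[OF assms]] ddir_cmult[OF ch lform_smooth[OF assms] p] that by simp
    show "ddir c (\<lambda>q. g q vs) p v = 0" if "length vs = k \<and> i < j \<and> j < k \<and> vs ! i = vs ! j" for vs i j
      using ddir_cong[OF ch _ p, of "\<lambda>q. g q vs" "\<lambda>_. 0"] alt_repeat[OF lform_alt[OF assms], of _ vs i j] that by simp
  qed
  then show ?thesis using ch smooth_in_ddir[OF ch lform_smooth[OF assms]] unfolding lform_def by blast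
qed

lemma dl_con_add:
  assumes "lform c V k g" "p \<in> V"
  shows "dl c (\<lambda>q. con (x + y) (g q)) p vs = dl c (\<lambda>q. con x (g q)) p vs + dl c (\<lambda>q. con y (g q)) p vs"
    and "dl c (\<lambda>q. con (a *s x) (g q)) p vs = a * dl c (\<lambda>q. con x (g q)) p vs"
proof -
  note ch = lform_chd[OF assms(1)]
  have "dl c (\<lambda>q. con (x + y) (g q)) p vs = dl c (\<lambda>q vs. con x (g q) vs + con y (g q) vs) p vs"
    by (rule dl_cong[OF ch _ assms(2)]) (simp add: con_add[OF lform_alt[OF assms(1)]])
  then show "dl c (\<lambda>q. con (x + y) (g q)) p vs = dl c (\<lambda>q. con x (g q)) p vs + dl c (\<lambda>q. con y (g q)) p vs"
    using dl_add[OF lform_con[OF assms(1)] lform_con[OF assms(1)] assms(2)] by simp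
  have "dl c (\<lambda>q. con (a *s x) (g q)) p vs = dl c (\<lambda>q vs. a * con x (g q) vs) p vs"
    by (rule dl_cong[OF ch _ assms(2)]) (simp add: con_smult[OF lform_alt[OF assms(1)]])
  then show "dl c (\<lambda>q. con (a *s x) (g q)) p vs = a * dl c (\<lambda>q. con x (g q)) p vs"
    using dl_smult[OF lform_con[OF assms(1)] assms(2)] by simp
qed

lemma con_dl: "con v (dl c g p) = (\<lambda>vs. ddir c (\<lambda>q. g q vs) p v - dl c (\<lambda>q. con v (g q)) p vs)"
  by (rule ext) (simp add: con_apply dl_Cons)

lemma lform_dl:
  assumes "lform c V k g" shows "lform c V (Suc k) (dl c g)"
proof -
  have "dl c g p \<in> alt_forms (Suc k)" if p: "p \<in> V" for p
    using assms
  proof (induction k arbitrary: g)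
    case (0 g)
    note ch = lform_chd[OF 0]
    have z: "dl c (\<lambda>q. con v (g q)) p vs = 0" for v vs
      using dl_cong[OF ch _ p, of "\<lambda>q. con v (g q)" "\<lambda>_ _. 0"] con_alt_0[OF lform_alt[OF 0]] by simp
    show ?case
    proof (rule alt_SucI)
      show "con v (dl c g p) \<in> alt_forms 0" for v
        unfolding con_dl z using lform_alt[OF lform_ddir[OF 0] p] by simp
      show "dl c g p ((x + y) # vs) = dl c g p (x # vs) + dl c g p (y # vs)" for x y vs
        by (simp add: dl_Cons z ddir_add_vec[OF ch lform_smooth[OF 0] p])
      show "dl c g p ((a *s x) # vs) = a * dl c g p (x # vs)" for a x vs
        by (simp add: dl_Cons z ddir_add_vec[OF ch lform_smooth[OF 0] p])
      show "dl c g p (v # v # vs) = 0" for v vs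
        using ddir_cong[OF ch _ p, of "\<lambda>q. g q (v # vs)" "\<lambda>_. 0"] alt_length[OF lform_alt[OF 0]]
        unfolding dl_Cons[of c g p v] z by simp
    qed simp
  next
    case (Suc k g)
    note ch = lform_chd[OF Suc.prems]
    note lc = lform_con[OF Suc.prems, simplified]
    show ?case
    proof (rule alt_SucI)
      show "con v (dl c g p) \<in> alt_forms (Suc k)" for v
        using alt_add_form[OF lform_alt[OF lform_ddir[OF Suc.prems] p] alt_smult_form[OF Suc.IH[OF lc], of "-1"]]
        by (simp add: con_dl)
      show "dl c g p ((x + y) # vs) = dl c g p (x # vs) + dl c g p (y # vs)" for x y vs
        by (simp add: dl_Cons dl_con_add[OF Suc.prems p] ddir_add_vec[OF ch lform_smooth[OF Suc.prems] p])
      show "dl c g p ((a *s x) # vs) = a * dl c g p (x # vs)" for a x vs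
        by (simp add: dl_Cons dl_con_add[OF Suc.prems p] ddir_add_vec[OF ch lform_smooth[OF Suc.prems] p] algebra_simps)
      show "dl c g p (v # v # vs) = 0" for v vs
        using dl_cong[OF ch _ p, of "\<lambda>q. con v (con v (g q))" "\<lambda>_ _. 0"] con_con[OF lform_alt[OF Suc.prems]]
        by (simp add: dl_Cons) (simp add: con_apply)
    qed simp
  qed
  moreover have "smooth_in c V (\<lambda>p. dl c g p vs)" for vs
    unfolding dl_def using lform_chd[OF assms] lform_smooth[OF assms]
    by (intro smooth_in_sum smooth_in_mult smooth_in_const smooth_in_ddir) auto
  ultimately show ?thesis using assms unfolding lform_def by blast
qed

lemma ddir_dl:
  assumes "lform c V k g" "p \<in> V"
  shows "ddir c (\<lambda>q. dl c g q vs) p v = dl c (\<lambda>p vs. ddir c (\<lambda>q. g q vs) p v) p vs"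
proof -
  note ch = lform_chd[OF assms(1)] and sm = lform_smooth[OF assms(1)]
  have "ddir c (\<lambda>q. dl c g q vs) p v =
     (\<Sum>i<length vs. ddir c (\<lambda>q. (-1) ^ i * ddir c (\<lambda>q. g q (take i vs @ drop (Suc i) vs)) q (vs ! i)) p v)"
    unfolding dl_def
    by (intro ddir_sum[OF ch _ assms(2)] smooth_in_mult[OF ch] smooth_in_const smooth_in_ddir[OF ch sm])
  then show ?thesis
    unfolding dl_def
    by (simp add: ddir_cmult[OF ch smooth_in_ddir[OF ch sm] assms(2)] ddir_commute[OF ch sm assms(2), of _ _ v])
qed

text \<open>After \<open>dl_Cons\<close> is used twice, the derivative along v stands once inside
  and once outside of d. The two agree because derivatives along constant vectors commute; the rest
  is the induction hypothesis.\<close>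

theorem dl_dl:
  assumes "lform c V k g" "p \<in> V" shows "dl c (dl c g) p vs = 0"
  using assms(1)
proof (induction vs arbitrary: g k)
  case (Cons v vs)
  have "dl c (\<lambda>q. con v (dl c g q)) p vs = dl c (\<lambda>p vs. ddir c (\<lambda>q. g q vs) p v) p vs - dl c (dl c (\<lambda>q. con v (g q))) p vs"
    unfolding con_dl
    using dl_minus[OF lform_ddir[OF Cons.prems] lform_dl[OF lform_con[OF Cons.prems, of v]] assms(2)] by simp
  then show ?case
    using Cons.IH[OF lform_con[OF Cons.prems]] ddir_dl[OF Cons.prems assms(2)] by (simp add: dl_Cons)
qed simp

lemma ddir_wedge:
  assumes "lform c V a g" "lform c V b h" "p \<in> V"
  shows "ddir c (\<lambda>q. wedge (g q) (h q) vs) p v =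
    wedge (\<lambda>vs. ddir c (\<lambda>q. g q vs) p v) (h p) vs + wedge (g p) (\<lambda>vs. ddir c (\<lambda>q. h q vs) p v) vs"
proof -
  note ch = lform_chd[OF assms(1)] and sm = lform_smooth[OF assms(1)] lform_smooth[OF assms(2)]
  have e: "ddir c (\<lambda>q. (\<Sum>\<sigma>\<in>S. r \<sigma> * g q (x \<sigma>) * h q (y \<sigma>)) / z) p v =
      (\<Sum>\<sigma>\<in>S. r \<sigma> * ddir c (\<lambda>q. g q (x \<sigma>)) p v * h p (y \<sigma>)) / z +
      (\<Sum>\<sigma>\<in>S. r \<sigma> * g p (x \<sigma>) * ddir c (\<lambda>q. h q (y \<sigma>)) p v) / z" for S and r :: "(nat \<Rightarrow> nat) \<Rightarrow> complex" and x y z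
  proof -
    have "ddir c (\<lambda>q. (\<Sum>\<sigma>\<in>S. r \<sigma> * g q (x \<sigma>) * h q (y \<sigma>)) / z) p v =
      ddir c (\<lambda>q. inverse z * (\<Sum>\<sigma>\<in>S. r \<sigma> * (g q (x \<sigma>) * h q (y \<sigma>)))) p v"
      by (simp add: divide_inverse mult_ac)
    also have "\<dots> = inverse z * (\<Sum>\<sigma>\<in>S. r \<sigma> * (ddir c (\<lambda>q. g q (x \<sigma>)) p v * h p (y \<sigma>) + g p (x \<sigma>) * ddir c (\<lambda>q. h q (y \<sigma>)) p v))"
      by (subst ddir_cmult[OF ch _ assms(3)], intro smooth_in_sum[OF ch] smooth_in_mult[OF ch] smooth_in_const sm,
          subst ddir_sum[OF ch _ assms(3)], intro smooth_in_mult[OF ch] smooth_in_const sm)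
         (simp add: ddir_cmult[OF ch smooth_in_mult[OF ch sm] assms(3)] ddir_mult[OF ch sm assms(3)])
    finally show ?thesis by (simp add: divide_inverse sum.distrib algebra_simps)
  qed
  show ?thesis
    unfolding wedge_def sum.distrib[symmetric]
    by (subst ddir_sum[OF ch _ assms(3)], unfold divide_inverse,
        intro smooth_in_sum[OF ch] smooth_in_mult[OF ch] smooth_in_const sm)
       (rule sum.cong[OF refl], rule e[unfolded divide_inverse])
qed

text \<open>Both d and the wedge product satisfy a recursion in the first argument; comparing the
  two leaves only signs to check.\<close>

theorem dl_wedge:
  assumes "lform c V a g" "lform c V b h" "p \<in> V"
  shows "dl c (\<lambda>q. wedge (g q) (h q)) p vs = wedge (dl c g p) (h p) vs + (-1) ^ a * wedge (g p) (dl c h p) vs"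
  using assms(1,2)
proof (induction vs arbitrary: a b g h)
  case (Nil a b g h)
  then show ?case by (simp add: wedge_Nil)
next
  case (Cons v vs)
  note G = Cons.prems(1) and H = Cons.prems(2) and p = assms(3)
  note ch = lform_chd[OF G]
  note cg = lform_con[OF G, of v] and chh = lform_con[OF H, of v]
  have "dl c (\<lambda>q. con v (wedge (g q) (h q))) p vs =
      dl c (\<lambda>q vs. wedge (con v (g q)) (h q) vs + (-1) ^ a * wedge (g q) (con v (h q)) vs) p vs"
    by (rule dl_cong[OF ch _ p]) (simp add: con_wedge[OF lform_alt[OF G] lform_alt[OF H]])
  also have "\<dots> = dl c (\<lambda>q. wedge (con v (g q)) (h q)) p vs + (-1) ^ a * dl c (\<lambda>q. wedge (g q) (con v (h q))) p vs"
    using dl_add[OF lform_wedge[OF cg H] lform_smult[OF lform_wedge[OF G chh]] p]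
      dl_smult[OF lform_wedge[OF G chh] p] by simp
  also have "\<dots> = wedge (dl c (\<lambda>q. con v (g q)) p) (h p) vs + (-1) ^ (a - 1) * wedge (con v (g p)) (dl c h p) vs +
     (-1) ^ a * (wedge (dl c g p) (con v (h p)) vs + (-1) ^ a * wedge (g p) (dl c (\<lambda>q. con v (h q)) p) vs)"
    unfolding Cons.IH[OF cg H] Cons.IH[OF G chh] by simp
  finally have d: "dl c (\<lambda>q. con v (wedge (g q) (h q))) p vs = \<dots>" .
  have dg: "dl c g p \<in> alt_forms (Suc a)" "dl c h p \<in> alt_forms (Suc b)"
    using lform_alt[OF lform_dl[OF G] p] lform_alt[OF lform_dl[OF H] p] by auto
  have R1: "wedge (dl c g p) (h p) (v # vs) = wedge (\<lambda>vs. ddir c (\<lambda>q. g q vs) p v) (h p) vs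
      - wedge (dl c (\<lambda>q. con v (g q)) p) (h p) vs - (-1) ^ a * wedge (dl c g p) (con v (h p)) vs"
    unfolding wedge_Cons[OF dg(1) lform_alt[OF H p]] con_dl
    using wedge_add_left[of "\<lambda>vs. ddir c (\<lambda>q. g q vs) p v" "\<lambda>vs. - dl c (\<lambda>q. con v (g q)) p vs" "h p" vs]
      wedge_minus_left[of "dl c (\<lambda>q. con v (g q)) p" "h p" vs] by simp
  have R2: "wedge (g p) (dl c h p) (v # vs) = wedge (con v (g p)) (dl c h p) vs +
      (-1) ^ a * (wedge (g p) (\<lambda>vs. ddir c (\<lambda>q. h q vs) p v) vs - wedge (g p) (dl c (\<lambda>q. con v (h q)) p) vs)"
    unfolding wedge_Cons[OF lform_alt[OF G p] dg(2)] con_dl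
    using wedge_add_right[of "g p" "\<lambda>vs. ddir c (\<lambda>q. h q vs) p v" "\<lambda>vs. - dl c (\<lambda>q. con v (h q)) p vs" vs]
      wedge_minus_right[of "g p" "dl c (\<lambda>q. con v (h q)) p" vs] by simp
  \<comment> \<open>For a = 0 the truncated exponent would give the wrong sign, but then the
    contraction is zero.\<close>
  have sgn: "(-1) ^ (a - 1) * wedge (con v (g p)) (dl c h p) vs = - ((-1) ^ a * wedge (con v (g p)) (dl c h p) vs)"
    using con_alt_0[of "g p" v] lform_alt[OF G p] by (cases a) auto
  have sq: "(-1) ^ a * ((-1) ^ a * x) = x" for x :: complex
    by (metis (no_types, lifting) left_minus_one_mult_self)
  show ?case
    unfolding dl_Cons[of c "\<lambda>q. wedge (g q) (h q)"] ddir_wedge[OF G H p] d R1 R2 sgn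
    by (simp add: algebra_simps sq)
qed

section \<open>Vector fields, Cartan's formula and naturality of d\<close>

definition dX :: "('m, 'd) chart \<Rightarrow> ('m \<Rightarrow> complex ^ 'd) \<Rightarrow> 'm \<Rightarrow> complex ^ 'd \<Rightarrow> complex ^ 'd" where
  "dX c X p w = (\<chi> j. ddir c (\<lambda>q. X q $ j) p w)"

lemma bracket_dX: "bracket c X Y p = dX c Y p (X p) - dX c X p (Y p)"
  by (simp add: bracket_def dX_def vec_eq_iff)

text \<open>Product rule: one term with the field frozen at p, one with its derivative.\<close>

lemma ddir_conX:
  assumes "lform c V k g" "smooth_in c V X" "p \<in> V"
  shows "ddir c (\<lambda>q. conX X g q vs) p w = ddir c (\<lambda>q. con (X p) (g q) vs) p w + g p (dX c X p w # vs)"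
proof -
  note ch = lform_chd[OF assms(1)] and sm = lform_smooth[OF assms(1)]
  have sX: "smooth_in c V (\<lambda>p. X p $ i)" for i using assms(2) smooth_in_vec_iff[OF ch] by blast
  have "ddir c (\<lambda>q. conX X g q vs) p w = ddir c (\<lambda>q. \<Sum>i\<in>UNIV. X q $ i * g q (axis i 1 # vs)) p w"
    by (rule ddir_cong[OF ch _ assms(3)])
       (simp add: conX_def con_apply alt_Cons_expand[OF lform_alt[OF assms(1)], symmetric])
  also have "\<dots> = (\<Sum>i\<in>UNIV. ddir c (\<lambda>q. X q $ i) p w * g p (axis i 1 # vs) + X p $ i * ddir c (\<lambda>q. g q (axis i 1 # vs)) p w)"
    by (subst ddir_sum[OF ch smooth_in_mult[OF ch sX sm] assms(3)]) (simp add: ddir_mult[OF ch sX sm assms(3)])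
  also have "\<dots> = g p (dX c X p w # vs) + (\<Sum>i\<in>UNIV. X p $ i * ddir c (\<lambda>q. g q (axis i 1 # vs)) p w)"
    using alt_Cons_expand[OF lform_alt[OF assms(1,3)], of "dX c X p w" vs] by (simp add: sum.distrib dX_def)
  also have "(\<Sum>i\<in>UNIV. X p $ i * ddir c (\<lambda>q. g q (axis i 1 # vs)) p w) = ddir c (\<lambda>q. \<Sum>i\<in>UNIV. X p $ i * g q (axis i 1 # vs)) p w"
    by (subst ddir_sum[OF ch smooth_in_mult[OF ch smooth_in_const sm] assms(3)]) (simp add: ddir_cmult[OF ch sm assms(3)])
  also have "\<dots> = ddir c (\<lambda>q. con (X p) (g q) vs) p w"
    by (rule ddir_cong[OF ch _ assms(3)])
       (simp add: con_apply alt_Cons_expand[OF lform_alt[OF assms(1)], symmetric])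
  finally show ?thesis by simp
qed

lemma ddir_eval:
  assumes "lform c V k g" "\<And>X. X \<in> set Xs \<Longrightarrow> smooth_in c V X" "p \<in> V"
  shows "ddir c (\<lambda>q. g q (map (\<lambda>X. X q) Xs)) p w = ddir c (\<lambda>q. g q (map (\<lambda>X. X p) Xs)) p w +
     (\<Sum>i<length Xs. g p ((map (\<lambda>X. X p) Xs)[i := dX c (Xs ! i) p w]))"
  using assms(1,2)
proof (induction Xs arbitrary: g k)
  case (Cons X Xs)
  have X: "smooth_in c V X" using Cons.prems by auto
  have "ddir c (\<lambda>q. g q (map (\<lambda>X. X q) (X # Xs))) p w = ddir c (\<lambda>q. conX X g q (map (\<lambda>X. X q) Xs)) p w"
    by (simp add: conX_def con_apply)
  also have "\<dots> = ddir c (\<lambda>q. conX X g q (map (\<lambda>X. X p) Xs)) p w +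
     (\<Sum>i<length Xs. conX X g p ((map (\<lambda>X. X p) Xs)[i := dX c (Xs ! i) p w]))"
    by (rule Cons.IH[OF lform_conX[OF Cons.prems(1) X]]) (use Cons.prems in auto)
  also have "\<dots> = ddir c (\<lambda>q. con (X p) (g q) (map (\<lambda>X. X p) Xs)) p w + g p (dX c X p w # map (\<lambda>X. X p) Xs) +
     (\<Sum>i<length Xs. g p (X p # (map (\<lambda>X. X p) Xs)[i := dX c (Xs ! i) p w]))"
    unfolding ddir_conX[OF Cons.prems(1) X assms(3)] by (simp add: conX_def con_apply)
  finally show ?case
    by (simp add: con_apply sum.lessThan_Suc_shift del: sum.lessThan_Suc)
qed simp

lemma dl_conX:
  assumes "lform c V k g" "smooth_in c V X" "p \<in> V"
  shows "dl c (conX X g) p vs = dl c (\<lambda>q. con (X p) (g q)) p vs + (\<Sum>i<length vs. g p (vs[i := dX c X p (vs ! i)]))"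
proof -
  have "(-1) ^ i * g p (dX c X p (vs ! i) # take i vs @ drop (Suc i) vs) = g p (vs[i := dX c X p (vs ! i)])"
    if "i < length vs" for i
    using alt_move[OF lform_alt[OF assms(1,3)] that] by simp
  then show ?thesis
    unfolding dl_def ddir_conX[OF assms] by (simp add: distrib_left sum.distrib)
qed

text \<open>Only the first field is split off; the others are handled by the d of the contraction.
  The brackets collect the derivatives of the fields from \<open>ddir_eval\<close> and
  \<open>dl_conX\<close>.\<close>

theorem cartan:
  assumes "lform c V k g" "smooth_in c V X" "\<And>X. X \<in> set Xs \<Longrightarrow> smooth_in c V X" "p \<in> V"
  shows "dl c g p (X p # map (\<lambda>X. X p) Xs) = ddir c (\<lambda>q. g q (map (\<lambda>X. X q) Xs)) p (X p)
    - dl c (conX X g) p (map (\<lambda>X. X p) Xs)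
    - (\<Sum>i<length Xs. g p ((map (\<lambda>X. X p) Xs)[i := bracket c X (Xs ! i) p]))"
proof -
  let ?Y = "map (\<lambda>X. X p) Xs"
  have lin: "g p (?Y[i := a - b]) = g p (?Y[i := a]) - g p (?Y[i := b])" if "i < length Xs" for i a b
  proof (cases "length Xs = k")
    case True
    then show ?thesis
      using alt_add[OF lform_alt[OF assms(1,4)], of ?Y i "a - b" b] that by simp
  next
    case False then show ?thesis using alt_length[OF lform_alt[OF assms(1,4)]] by simp
  qed
  show ?thesis
    unfolding dl_Cons dl_conX[OF assms(1,2,4)] bracket_dX
    using ddir_eval[OF assms(1,3,4), where w = "X p"] by (simp add: lin sum_subtractf)
qed

lemma jac_smooth_field:
  assumes "c \<in> A" "c' \<in> A" "chd c' V" "V \<subseteq> fst c"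
  shows "smooth_in c' V (\<lambda>q. jac c c' q v)"
proof -
  have V: "chd c V" using assms by (auto simp: chd_def)
  have "smooth_in c V (\<lambda>q. jac c c' q v $ i)" for i
    by (rule smooth_in_subset[OF smooth_in_jac[OF assms(1,2)]]) (use assms in \<open>auto simp: chd_def\<close>)
  then show ?thesis using smooth_in_vec_iff[OF V] smooth_in_change[OF assms(3) V] by blast
qed

lemma lform_jac:
  assumes g: "lform c' V k g" and c: "c \<in> A" "V \<subseteq> fst c"
  shows "lform c V k (\<lambda>p vs. g p (map (jac c c' p) vs))"
proof -
  have V: "chd c' V" "chd c V" "c' \<in> A" "V \<subseteq> fst c'" using assms by (auto simp: lform_def chd_def)
  have "smooth_in c' V (\<lambda>p. g p (map (\<lambda>X. X p) (map (\<lambda>v q. jac c c' q v) vs)))" for vs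
    by (rule lform_eval[OF g]) (use jac_smooth_field[OF c(1) V(3,1) c(2)] in auto)
  then have "smooth_in c' V (\<lambda>p. g p (map (jac c c' p) vs))" for vs
    by (simp add: comp_def)
  then have "smooth_in c V (\<lambda>p. g p (map (jac c c' p) vs))" for vs
    by (rule smooth_in_change[OF V(2,1)])
  moreover have "(\<lambda>vs. g p (map (jac c c' p) vs)) \<in> alt_forms k" if "p \<in> V" for p
    by (rule alt_pullback[OF lform_alt[OF g that]]) (use jac_linear[OF c(1) V(3) subsetD[OF c(2) that] subsetD[OF V(4) that]] in auto)
  ultimately show ?thesis using V by (simp add: lform_def)
qed

text \<open>The constant fields of \<open>c\<close>, read in \<open>c'\<close>, have vanishing
  brackets by \<open>jac_symmetric\<close>. Cartan's formula for them is then the recursion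
  \<open>dl_Cons\<close> in the chart \<open>c\<close>.\<close>

theorem dl_jac:
  assumes g: "lform c' V k g" and c: "c \<in> A" "V \<subseteq> fst c" and p: "p \<in> V"
  shows "dl c (\<lambda>p vs. g p (map (jac c c' p) vs)) p vs = dl c' g p (map (jac c c' p) vs)"
  using g
proof (induction vs arbitrary: g k)
  case (Cons v vs)
  have V: "chd c' V" "chd c V" "c' \<in> A" "V \<subseteq> fst c'" using assms by (auto simp: lform_def chd_def)
  let ?X = "\<lambda>v q. jac c c' q v"
  note sX = jac_smooth_field[OF c(1) V(3,1) c(2)]
  have pc: "p \<in> fst c" "p \<in> fst c'" using p c V by auto
  have br: "bracket c' (?X v) (?X w) p = 0" for w
  proof -
    have "ddir c' (\<lambda>q. jac c c' q w $ i) p (jac c c' p v) = ddir c (\<lambda>q. jac c c' q w $ i) p v" for v w i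
      by (rule ddir_chain[OF V(2,1) _ p, symmetric]) (use sX[of w] in \<open>simp add: smooth_in_vec_iff[OF V(1)]\<close>)
    then show ?thesis
      by (simp add: bracket_def vec_eq_iff jac_symmetric[OF c(1) V(3) pc, of w _ v])
  qed
  have m: "map (\<lambda>X. X q) (map ?X vs) = map (jac c c' q) vs" for q by simp
  have ev: "smooth_in c' V (\<lambda>q. g q (map (jac c c' q) vs))"
    using lform_eval[OF Cons.prems, of "map ?X vs"] sX by (auto simp: comp_def)
  have z: "g p ((map (jac c c' p) vs)[i := 0]) = 0" if "i < length vs" for i
    using alt_smult[OF lform_alt[OF Cons.prems p], of "map (jac c c' p) vs" i 0 0] that
      alt_length[OF lform_alt[OF Cons.prems p], of "(map (jac c c' p) vs)[i := 0]"]
    by (cases "length vs = k") auto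
  have "dl c' g p (?X v p # map (\<lambda>X. X p) (map ?X vs)) = ddir c' (\<lambda>q. g q (map (\<lambda>X. X q) (map ?X vs))) p (?X v p)
    - dl c' (conX (?X v) g) p (map (\<lambda>X. X p) (map ?X vs))
    - (\<Sum>i<length (map ?X vs). g p ((map (\<lambda>X. X p) (map ?X vs))[i := bracket c' (?X v) (map ?X vs ! i) p]))"
    by (rule cartan[OF Cons.prems sX _ p]) (use sX in auto)
  also have "\<dots> = ddir c (\<lambda>q. g q (map (jac c c' q) vs)) p v - dl c' (conX (?X v) g) p (map (jac c c' p) vs)"
    unfolding m using br z by (simp add: ddir_chain[OF V(2,1) ev p])
  also have "dl c' (conX (?X v) g) p (map (jac c c' p) vs) = dl c (\<lambda>p vs. conX (?X v) g p (map (jac c c' p) vs)) p vs"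
    by (rule Cons.IH[OF lform_conX[OF Cons.prems sX], symmetric])
  finally show ?case
    unfolding m dl_Cons[of c] by (simp add: conX_def con_def)
qed simp

text \<open>One half of Frobenius' theorem: every term of Cartan's formula evaluates the form, or
  its contraction, on vectors of the distribution. It is applied to T^{0,1}.\<close>

lemma dl_involutive_vanish:
  assumes "lform c V k g" "p \<in> V" and g: "\<And>q. q \<in> V \<Longrightarrow> vanish (D q) (g q)"
    and Xs: "\<And>X. X \<in> set Xs \<Longrightarrow> smooth_in c V X \<and> (\<forall>q\<in>V. X q \<in> D q)"
    and br: "\<And>X Y. X \<in> set Xs \<Longrightarrow> Y \<in> set Xs \<Longrightarrow> bracket c X Y p \<in> D p"
  shows "dl c g p (map (\<lambda>X. X p) Xs) = 0"
  using assms(1) g Xs br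
proof (induction Xs arbitrary: g k)
  case (Cons X Xs)
  note ch = lform_chd[OF Cons.prems(1)]
  have X: "smooth_in c V X" "\<And>q. q \<in> V \<Longrightarrow> X q \<in> D q" using Cons.prems(3)[of X] by auto
  have Y: "\<And>Y. Y \<in> set Xs \<Longrightarrow> smooth_in c V Y \<and> (\<forall>q\<in>V. Y q \<in> D q)" using Cons.prems(3) by auto
  have "ddir c (\<lambda>q. g q (map (\<lambda>X. X q) Xs)) p (X p) = ddir c (\<lambda>_. 0) p (X p)"
  proof (rule ddir_cong[OF ch _ assms(2)])
    fix q assume q: "q \<in> V"
    have "set (map (\<lambda>X. X q) Xs) \<subseteq> D q" using Y q by auto
    then show "g q (map (\<lambda>X. X q) Xs) = 0" using Cons.prems(2)[OF q] unfolding vanish_def by blast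
  qed
  moreover have "dl c (conX X g) p (map (\<lambda>X. X p) Xs) = 0"
  proof (rule Cons.IH[OF lform_conX[OF Cons.prems(1) X(1)] _ Y])
    show "vanish (D q) (conX X g q)" if "q \<in> V" for q
      using Cons.prems(2)[OF that] X(2)[OF that] by (simp add: vanish_def conX_def con_apply)
  qed (use Cons.prems(4) in auto)
  moreover have "g p ((map (\<lambda>X. X p) Xs)[i := bracket c X (Xs ! i) p]) = 0" if "i < length Xs" for i
  proof -
    have "set ((map (\<lambda>X. X p) Xs)[i := bracket c X (Xs ! i) p]) \<subseteq> insert (bracket c X (Xs ! i) p) (set (map (\<lambda>X. X p) Xs))"
      by (rule set_update_subset_insert)
    also have "\<dots> \<subseteq> D p" using Cons.prems(4)[of X "Xs ! i"] that Y assms(2) by auto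
    finally show ?thesis using Cons.prems(2)[OF assms(2)] by (simp add: vanish_def)
  qed
  ultimately show ?case using cartan[OF Cons.prems(1) X(1) _ assms(2), of Xs] Y by simp
qed simp

lemma dl_one_form_bracket:
  assumes "lform c V 1 \<theta>" "p \<in> V" "smooth_in c V X" "smooth_in c V Y"
    "\<And>q. q \<in> V \<Longrightarrow> \<theta> q [X q] = 0" "\<And>q. q \<in> V \<Longrightarrow> \<theta> q [Y q] = 0"
  shows "dl c \<theta> p [X p, Y p] = - \<theta> p [bracket c X Y p]"
proof -
  note ch = lform_chd[OF assms(1)]
  have "ddir c (\<lambda>q. \<theta> q [Y q]) p (X p) = ddir c (\<lambda>_. 0) p (X p)"
    by (rule ddir_cong[OF ch _ assms(2)]) (use assms in auto)
  moreover have "dl c (conX X \<theta>) p [Y p] = dl c (\<lambda>_ _. 0) p [Y p]"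
  proof (rule dl_cong[OF ch _ assms(2)])
    fix q vs assume q: "q \<in> V"
    show "conX X \<theta> q vs = 0"
      using alt_length[OF lform_alt[OF assms(1) q], of "X q # vs"] assms(5)[OF q]
      by (cases vs) (auto simp: conX_def con_apply)
  qed
  ultimately show ?thesis
    using cartan[OF assms(1,3) _ assms(2), of "[Y]"] assms(4) by simp
qed

lemma dl_cnj:
  assumes "lform c V k g" "p \<in> V"
  shows "dl c (\<lambda>p vs. cnj (g p (map vcnj vs))) p vs = cnj (dl c g p (map vcnj vs))"
proof -
  have "ddir c (\<lambda>q. cnj (g q (map vcnj (take i vs @ drop (Suc i) vs)))) p (vs ! i) =
     cnj (ddir c (\<lambda>q. g q (take i (map vcnj vs) @ drop (Suc i) (map vcnj vs))) p (map vcnj vs ! i))" if "i < length vs" for i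
    using ddir_cnj[OF lform_chd[OF assms(1)] lform_smooth[OF assms(1)] assms(2)] that
    by (simp add: take_map drop_map)
  then show ?thesis unfolding dl_def by (simp add: take_map drop_map)
qed

end

section \<open>Global forms\<close>

lemma map_vcnj_vcnj [simp]: "map vcnj (map vcnj vs) = vs" by (simp add: comp_def)

context smooth_manifold
begin

lemma forms_lform:
  assumes "\<omega> \<in> forms A U k" "open U" "c \<in> A" shows "lform c (U \<inter> fst c) k (\<omega> c)"
  using assms chart_open unfolding forms_def lform_def chd_def by blast

lemma forms_lform_UNIV:
  assumes "\<omega> \<in> forms A UNIV k" "c \<in> A" shows "lform c (fst c) k (\<omega> c)"
  using forms_lform[OF assms(1) _ assms(2)] by simp

lemma forms_jac:
  assumes "\<omega> \<in> forms A U k" "c \<in> A" "c' \<in> A" "p \<in> U" "p \<in> fst c" "p \<in> fst c'"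
  shows "\<omega> c p vs = \<omega> c' p (map (jac c c' p) vs)"
  using assms unfolding forms_def by blast

lemma forms_zero_outside:
  assumes "\<omega> \<in> forms A U k" "c \<notin> A \<or> p \<notin> U \<or> p \<notin> fst c" shows "\<omega> c p vs = 0"
proof -
  have "\<omega> c p = 0" using assms unfolding forms_def by blast
  then show ?thesis by simp
qed

lemma forms_alt:
  assumes "\<omega> \<in> forms A U k" "c \<in> A" "p \<in> U" "p \<in> fst c" shows "\<omega> c p \<in> alt_forms k"
  using assms unfolding forms_def by blast

lemma formsI:
  assumes "\<And>c p vs. c \<notin> A \<or> p \<notin> U \<or> p \<notin> fst c \<Longrightarrow> \<omega> c p vs = 0"
    "\<And>c c' p vs. c \<in> A \<Longrightarrow> c' \<in> A \<Longrightarrow> p \<in> U \<Longrightarrow> p \<in> fst c \<Longrightarrow> p \<in> fst c' \<Longrightarrow> \<omega> c p vs = \<omega> c' p (map (jac c c' p) vs)"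
    "\<And>c. c \<in> A \<Longrightarrow> lform c (U \<inter> fst c) k (\<omega> c)"
  shows "\<omega> \<in> forms A U k"
  unfolding forms_def mem_Collect_eq
proof (intro conjI allI ballI impI)
  show "\<omega> c p = 0" if "c \<notin> A \<or> p \<notin> U \<inter> fst c" for c p
    using assms(1)[of c p] that unfolding zero_fun_def by blast
qed (use assms(2,3) in \<open>unfold lform_def, blast\<close>)+

lemma forms_0: "open U \<Longrightarrow> (0 :: ('m, 'd) form) \<in> forms A U k"
  using lform_zero[OF chd_Int[OF chd_fst]] by (intro formsI) (simp_all add: zero_fun_def Int_commute)

lemma forms_add:
  assumes "open U" "\<omega> \<in> forms A U k" "\<eta> \<in> forms A U k" shows "\<omega> + \<eta> \<in> forms A U k"
proof (rule formsI)
  show "(\<omega> + \<eta>) c p vs = (\<omega> + \<eta>) c' p (map (jac c c' p) vs)"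
    if "c \<in> A" "c' \<in> A" "p \<in> U" "p \<in> fst c" "p \<in> fst c'" for c c' p vs
    using forms_jac[OF assms(2) that, of vs] forms_jac[OF assms(3) that, of vs] by simp
  show "lform c (U \<inter> fst c) k ((\<omega> + \<eta>) c)" if "c \<in> A" for c
    using lform_add[OF forms_lform[OF assms(2,1) that] forms_lform[OF assms(3,1) that]] by (simp add: plus_fun_def)
qed (use forms_zero_outside[OF assms(2)] forms_zero_outside[OF assms(3)] in simp)

lemma forms_fscale:
  assumes "open U" "\<omega> \<in> forms A U k" shows "fscale a \<omega> \<in> forms A U k"
proof (rule formsI)
  show "fscale a \<omega> c p vs = fscale a \<omega> c' p (map (jac c c' p) vs)"
    if "c \<in> A" "c' \<in> A" "p \<in> U" "p \<in> fst c" "p \<in> fst c'" for c c' p vs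
    using forms_jac[OF assms(2) that, of vs] by (simp add: fscale_def)
  show "lform c (U \<inter> fst c) k (fscale a \<omega> c)" if "c \<in> A" for c
    using lform_smult[OF forms_lform[OF assms(2,1) that], of a] by (simp add: fscale_def[abs_def])
qed (use forms_zero_outside[OF assms(2)] in \<open>simp add: fscale_def\<close>)

lemma forms_fcnj:
  assumes "open U" "\<omega> \<in> forms A U k" shows "fcnj \<omega> \<in> forms A U k"
proof (rule formsI)
  show "fcnj \<omega> c p vs = fcnj \<omega> c' p (map (jac c c' p) vs)"
    if "c \<in> A" "c' \<in> A" "p \<in> U" "p \<in> fst c" "p \<in> fst c'" for c c' p vs
  proof -
    have "map vcnj (map (jac c c' p) vs) = map (jac c c' p) (map vcnj vs)"
      using jac_vcnj[of c c' p] that by simp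
    then show ?thesis unfolding fcnj_def using forms_jac[OF assms(2) that, of "map vcnj vs"] by metis
  qed
  show "lform c (U \<inter> fst c) k (fcnj \<omega> c)" if "c \<in> A" for c
    using lform_cnj[OF forms_lform[OF assms(2,1) that]] by (simp add: fcnj_def[abs_def])
qed (simp add: fcnj_def forms_zero_outside[OF assms(2)])

lemma ext_d_outside:
  assumes "\<omega> \<in> forms A UNIV k" "c \<notin> A" shows "ext_d \<omega> c p vs = 0"
proof -
  have "\<omega> c = (\<lambda>_ _. 0)" using forms_zero_outside[OF assms(1)] assms(2) by (auto simp: fun_eq_iff)
  then show ?thesis by (simp add: ext_d_dl)
qed

lemma forms_ext_d:
  assumes "\<omega> \<in> forms A UNIV k" shows "ext_d \<omega> \<in> forms A UNIV (Suc k)"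
proof (rule formsI)
  show "ext_d \<omega> c p vs = 0" if "c \<notin> A \<or> p \<notin> UNIV \<or> p \<notin> fst c" for c p vs
  proof (cases "c \<in> A")
    case True
    then show ?thesis using that by (simp add: ext_d_dl)
  qed (rule ext_d_outside[OF assms])
  show "ext_d \<omega> c p vs = ext_d \<omega> c' p (map (jac c c' p) vs)"
    if c: "c \<in> A" "c' \<in> A" "p \<in> UNIV" "p \<in> fst c" "p \<in> fst c'" for c c' p vs
  proof -
    let ?V = "fst c \<inter> fst c'"
    have V: "chd c ?V" "p \<in> ?V" using chd_overlap c by auto
    have l: "lform c' ?V k (\<omega> c')"
      by (rule lform_subset[OF forms_lform_UNIV[OF assms c(2)]]) (use c chart_open in \<open>simp_all add: open_Int\<close>)
    have "dl c (\<omega> c) p vs = dl c (\<lambda>p vs. \<omega> c' p (map (jac c c' p) vs)) p vs"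
      by (rule dl_cong[OF V(1) _ V(2)]) (use forms_jac[OF assms c(1,2)] in auto)
    also have "\<dots> = dl c' (\<omega> c') p (map (jac c c' p) vs)"
      by (rule dl_jac[OF l c(1) _ V(2)]) auto
    finally show ?thesis using c by (simp add: ext_d_dl)
  qed
  show "lform c (UNIV \<inter> fst c) (Suc k) (ext_d \<omega> c)" if "c \<in> A" for c
    by (simp, rule lform_cong[OF lform_dl[OF forms_lform_UNIV[OF assms that]]]) (simp add: ext_d_dl)
qed

lemma form_eqI:
  assumes "\<omega> \<in> forms A U k" "\<eta> \<in> forms A U k"
    "\<And>c p vs. c \<in> A \<Longrightarrow> p \<in> U \<Longrightarrow> p \<in> fst c \<Longrightarrow> \<omega> c p vs = \<eta> c p vs"
  shows "\<omega> = \<eta>"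
proof (intro ext)
  fix c p vs show "\<omega> c p vs = \<eta> c p vs"
    using assms forms_zero_outside by (cases "c \<in> A \<and> p \<in> U \<and> p \<in> fst c") metis+
qed

lemma ext_d_add:
  assumes "\<omega> \<in> forms A UNIV k" "\<eta> \<in> forms A UNIV k"
  shows "ext_d (\<omega> + \<eta>) = ext_d \<omega> + ext_d \<eta>"
proof (rule form_eqI[OF forms_ext_d[OF forms_add[OF open_UNIV assms]]
      forms_add[OF open_UNIV forms_ext_d[OF assms(1)] forms_ext_d[OF assms(2)]]])
  show "ext_d (\<omega> + \<eta>) c p vs = (ext_d \<omega> + ext_d \<eta>) c p vs" if "c \<in> A" "p \<in> fst c" for c p vs
    using dl_add[OF forms_lform_UNIV[OF assms(1)] forms_lform_UNIV[OF assms(2)]] that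
    by (simp add: ext_d_dl plus_fun_def)
qed

lemma ext_d_fscale:
  assumes "\<omega> \<in> forms A UNIV k" shows "ext_d (fscale a \<omega>) = fscale a (ext_d \<omega>)"
proof (rule form_eqI[OF forms_ext_d[OF forms_fscale[OF open_UNIV assms]] forms_fscale[OF open_UNIV forms_ext_d[OF assms]]])
  show "ext_d (fscale a \<omega>) c p vs = fscale a (ext_d \<omega>) c p vs" if "c \<in> A" "p \<in> fst c" for c p vs
    using dl_smult[OF forms_lform_UNIV[OF assms], of c p a vs] that
    by (simp add: ext_d_dl fscale_def[abs_def])
qed

lemma ext_d_fcnj:
  assumes "\<omega> \<in> forms A UNIV k" shows "ext_d (fcnj \<omega>) = fcnj (ext_d \<omega>)"
proof (rule form_eqI[OF forms_ext_d[OF forms_fcnj[OF open_UNIV assms]] forms_fcnj[OF open_UNIV forms_ext_d[OF assms]]])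
  show "ext_d (fcnj \<omega>) c p vs = fcnj (ext_d \<omega>) c p vs" if "c \<in> A" "p \<in> fst c" for c p vs
    using dl_cnj[OF forms_lform_UNIV[OF assms], of c p vs] that
    by (simp add: ext_d_dl fcnj_def[abs_def])
qed

lemma ext_d_ext_d:
  assumes "\<omega> \<in> forms A UNIV k" shows "ext_d (ext_d \<omega>) = 0"
proof (rule form_eqI[OF forms_ext_d[OF forms_ext_d[OF assms]] forms_0[OF open_UNIV]])
  fix c p vs assume c: "c \<in> A" "p \<in> fst c"
  have "dl c (ext_d \<omega> c) p vs = dl c (dl c (\<omega> c)) p vs"
    by (rule dl_cong[OF chd_fst[OF c(1)] _ c(2)]) (simp add: ext_d_dl)
  then show "ext_d (ext_d \<omega>) c p vs = (0 :: ('m, 'd) form) c p vs"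
    using dl_dl[OF forms_lform_UNIV[OF assms c(1)] c(2)] c by (simp add: ext_d_dl)
qed

section \<open>Gluing of local forms\<close>

lemma jac_list_cocycle:
  assumes "c \<in> A" "c' \<in> A" "c'' \<in> A" "p \<in> fst c" "p \<in> fst c'" "p \<in> fst c''"
  shows "map (jac c' c'' p) (map (jac c c' p) vs) = map (jac c c'' p) vs"
  using jac_cocycle[OF assms] by simp

text \<open>The local data are a relation \<open>R\<close> instead of an indexed family, so that the
  chart may vary with the piece and any solution of a local problem may serve. Exact compatibility
  on overlaps replaces a partition of unity.\<close>

theorem forms_glue:
  assumes ex: "\<And>p. \<exists>c V g. p \<in> V \<and> R c V g" and lf: "\<And>c V g. R c V g \<Longrightarrow> lform c V k g"
    and compat: "\<And>c V g c' V' g' q vs. R c V g \<Longrightarrow> R c' V' g' \<Longrightarrow> q \<in> V \<Longrightarrow> q \<in> V' \<Longrightarrow> g q vs = g' q (map (jac c c' q) vs)"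
  shows "\<exists>\<omega>\<in>forms A UNIV k. \<forall>c V g q. R c V g \<longrightarrow> q \<in> V \<longrightarrow> \<omega> c q = g q"
proof -
  obtain cc VV gg where G: "\<And>p. p \<in> VV p" "\<And>p. R (cc p) (VV p) (gg p)" using ex by metis
  have cA: "cc p \<in> A" "VV p \<subseteq> fst (cc p)" "open (VV p)" for p
    using lform_chd[OF lf[OF G(2)]] by (auto simp: chd_def)
  define \<omega> where "\<omega> = (\<lambda>c q vs. if c \<in> A \<and> q \<in> fst c then gg q q (map (jac c (cc q) q) vs) else 0)"
  \<comment> \<open>The value at a point was taken from the piece chosen for that point; by
    compatibility every other piece gives the same value.\<close>
  have key: "\<omega> c q vs = gg p q (map (jac c (cc p) q) vs)" if "c \<in> A" "q \<in> fst c" "q \<in> VV p" for c p q vs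
  proof -
    have q: "q \<in> fst (cc p)" "q \<in> fst (cc q)" using cA(2) G(1) that by auto
    have "gg p q (map (jac c (cc p) q) vs) = gg q q (map (jac (cc p) (cc q) q) (map (jac c (cc p) q) vs))"
      by (rule compat[OF G(2) G(2) that(3) G(1)])
    then show ?thesis
      unfolding jac_list_cocycle[OF that(1) cA(1) cA(1) that(2) q] using that by (simp add: \<omega>_def)
  qed
  have "\<omega> \<in> forms A UNIV k"
  proof (rule formsI)
    show "\<omega> c p vs = \<omega> c' p (map (jac c c' p) vs)" if "c \<in> A" "c' \<in> A" "p \<in> fst c" "p \<in> fst c'" for c c' p vs
    proof -
      have q: "p \<in> fst (cc p)" using cA(2) G(1) by auto
      show ?thesis using that unfolding \<omega>_def jac_list_cocycle[OF that(1,2) cA(1)[of p] that(3,4) q, of vs]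
        by simp
    qed
    show "lform c (UNIV \<inter> fst c) k (\<omega> c)" if c: "c \<in> A" for c
    proof -
      have loc: "lform c (VV p \<inter> fst c) k (\<omega> c)" for p
      proof (rule lform_cong)
        show "lform c (VV p \<inter> fst c) k (\<lambda>q vs. gg p q (map (jac c (cc p) q) vs))"
          by (rule lform_jac[OF lform_subset[OF lf[OF G(2)[of p]]] c]) (use c cA(3) chart_open in \<open>simp_all add: open_Int\<close>)
        show "gg p q (map (jac c (cc p) q) vs) = \<omega> c q vs" if "q \<in> VV p \<inter> fst c" for q vs
          using key[OF c, of q p vs] that by simp
      qed
      have "smooth_in c (fst c) (\<lambda>p. \<omega> c p vs)" for vs
        by (rule smooth_in_local[OF chd_fst[OF c]])
          (metis G(1) IntI cA(3) c chart_open inf.cobounded2 loc lform_smooth open_Int)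
      moreover have "\<omega> c p \<in> alt_forms k" if "p \<in> fst c" for p
        using lform_alt[OF loc[of p], of p] G(1) that by blast
      ultimately show ?thesis using chd_fst[OF c] by (simp add: lform_def)
    qed
  qed (auto simp: \<omega>_def)
  moreover have "\<omega> c q = g q" if R: "R c V g" and q: "q \<in> V" for c V g q
  proof
    fix vs
    have c: "c \<in> A" "q \<in> fst c" using lform_chd[OF lf[OF R]] q by (auto simp: chd_def)
    show "\<omega> c q vs = g q vs"
      using compat[OF R G(2) q G(1)] key[OF c G(1)] by metis
  qed
  ultimately show ?thesis by blast
qed

end

section \<open>CR manifolds: adapted frames and contact forms\<close>

locale cr = smooth_manifold A
  for A :: "('m::{t2_space, second_countable_topology}, 'd::finite) chart set" +
  fixes n :: nat and T :: "('m, 'd) distribution"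
  assumes n1: "n \<ge> 1" and crm: "cr_manifold n A T"
begin

lemma card_d: "CARD('d) = 2 * n + 1" using crm by (simp add: cr_manifold_def)

lemma T_subspace: "c \<in> A \<Longrightarrow> p \<in> fst c \<Longrightarrow> vec.subspace (T c p)"
  and T_dim: "c \<in> A \<Longrightarrow> p \<in> fst c \<Longrightarrow> vec.dim (T c p) = n"
  and T_jac: "c \<in> A \<Longrightarrow> c' \<in> A \<Longrightarrow> p \<in> fst c \<Longrightarrow> p \<in> fst c' \<Longrightarrow> jac c c' p ` T c p = T c' p"
  and T_frame: "c \<in> A \<Longrightarrow> p \<in> fst c \<Longrightarrow> \<exists>V Z. open V \<and> p \<in> V \<and> V \<subseteq> fst c \<and>
        (\<forall>i<n. smooth_in c V (Z i)) \<and> (\<forall>q\<in>V. vec.span ((\<lambda>i. Z i q) ` {..<n}) = T c q)"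
  using crm by (simp_all add: cr_manifold_def smooth_distribution_def)

lemma T_Int: "c \<in> A \<Longrightarrow> p \<in> fst c \<Longrightarrow> T c p \<inter> T01 T c p = {0}"
  using crm by (simp add: cr_manifold_def)

lemma T_involutive:
  assumes "chd c V" "smooth_in c V Z" "smooth_in c V W" "\<And>p. p \<in> V \<Longrightarrow> Z p \<in> T c p \<and> W p \<in> T c p" "p \<in> V"
  shows "bracket c Z W p \<in> T c p"
proof -
  have "\<forall>c\<in>A. \<forall>V Z W. open V \<and> V \<subseteq> fst c \<and> smooth_in c V Z \<and> smooth_in c V W \<and>
        (\<forall>p\<in>V. Z p \<in> T c p \<and> W p \<in> T c p) \<longrightarrow> (\<forall>p\<in>V. bracket c Z W p \<in> T c p)"
    using crm unfolding cr_manifold_def by (elim conjE) assumption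
  moreover have "c \<in> A" "open V \<and> V \<subseteq> fst c" using assms by (simp_all add: chd_def)
  ultimately have "\<forall>p\<in>V. bracket c Z W p \<in> T c p" using assms(2-4) by blast
  then show ?thesis using assms(5) by simp
qed

lemma levi_form:
  assumes "contact_form A T U \<theta>" "c \<in> A" "p \<in> U" "p \<in> fst c" "Z \<in> T c p"
    "\<And>W. W \<in> T c p \<Longrightarrow> levi \<theta> c p Z W = 0"
  shows "Z = 0"
proof -
  have "\<forall>U \<theta>. contact_form A T U \<theta> \<longrightarrow> (\<forall>c\<in>A. \<forall>p\<in>U \<inter> fst c.
        (\<forall>Z\<in>T c p. \<forall>W\<in>T c p. levi \<theta> c p W Z = cnj (levi \<theta> c p Z W)) \<and>
        (\<forall>Z\<in>T c p. (\<forall>W\<in>T c p. levi \<theta> c p Z W = 0) \<longrightarrow> Z = 0))"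
    using crm unfolding cr_manifold_def by (elim conjE) assumption
  then have "(\<forall>Z\<in>T c p. (\<forall>W\<in>T c p. levi \<theta> c p Z W = 0) \<longrightarrow> Z = 0)" using assms(1-4) by blast
  then show ?thesis using assms(5,6) by simp
qed

lemma vcnj_image_subspace:
  assumes "vec.subspace (S :: (complex ^ 'd) set)" shows "vec.subspace (vcnj ` S)"
  unfolding vec.subspace_def
proof (intro conjI ballI allI)
  show "0 \<in> vcnj ` S" using vec.subspace_0[OF assms] by (metis imageI vcnj_0)
  show "x + y \<in> vcnj ` S" if "x \<in> vcnj ` S" "y \<in> vcnj ` S" for x y
    using that vec.subspace_add[OF assms] vcnj_add by (metis (no_types, lifting) imageE imageI)
  show "a *s x \<in> vcnj ` S" if "x \<in> vcnj ` S" for a x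
  proof -
    obtain y where y: "y \<in> S" "x = vcnj y" using \<open>x \<in> vcnj ` S\<close> by blast
    have "vcnj (cnj a *s y) = a *s x" using y by (simp add: vcnj_smult)
    then show ?thesis using y vec.subspace_scale[OF assms] by (metis imageI)
  qed
qed

lemma T01_subspace: "c \<in> A \<Longrightarrow> p \<in> fst c \<Longrightarrow> vec.subspace (T01 T c p)"
  unfolding T01_def using vcnj_image_subspace T_subspace by blast

lemma vcnj_T: "Z \<in> T c p \<longleftrightarrow> vcnj Z \<in> T01 T c p" "Z \<in> T01 T c p \<longleftrightarrow> vcnj Z \<in> T c p"
  unfolding T01_def by (metis imageE imageI vcnj_vcnj)+

lemma HC_iff: "v \<in> HC T c p \<longleftrightarrow> (\<exists>Z\<in>T c p. \<exists>W\<in>T01 T c p. v = Z + W)"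
  unfolding HC_def by blast

lemma vcnj_HC: "v \<in> HC T c p \<Longrightarrow> vcnj v \<in> HC T c p"
  unfolding HC_iff using vcnj_T vcnj_add by (metis add.commute)

lemma HC_subspace: "c \<in> A \<Longrightarrow> p \<in> fst c \<Longrightarrow> vec.subspace (HC T c p)"
  unfolding HC_def using vec.subspace_sums[OF T_subspace T01_subspace, of c p c p] by auto

lemma T_HC:
  assumes "c \<in> A" "p \<in> fst c" shows "T c p \<union> T01 T c p \<subseteq> HC T c p"
proof
  fix v assume "v \<in> T c p \<union> T01 T c p"
  then show "v \<in> HC T c p"
    unfolding HC_iff using vec.subspace_0[OF T_subspace[OF assms]] vec.subspace_0[OF T01_subspace[OF assms]]
    by (elim UnE) (rule bexI[of _ v], rule bexI[of _ 0], simp_all, rule bexI[of _ 0], rule bexI[of _ v], simp_all)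
qed

lemma HC_span: "HC T c p \<subseteq> vec.span (T c p \<union> T01 T c p)"
proof
  fix v assume "v \<in> HC T c p"
  then obtain Z W where "Z \<in> T c p" "W \<in> T01 T c p" "v = Z + W" unfolding HC_iff by blast
  then show "v \<in> vec.span (T c p \<union> T01 T c p)" by (auto intro!: vec.span_add intro: vec.span_base)
qed

lemma T_jac':
  assumes "c \<in> A" "c' \<in> A" "p \<in> fst c" "p \<in> fst c'" "Z \<in> T c p" shows "jac c c' p Z \<in> T c' p"
  unfolding T_jac[OF assms(1-4), symmetric] using assms(5) by (rule imageI)

lemma T01_jac:
  assumes "c \<in> A" "c' \<in> A" "p \<in> fst c" "p \<in> fst c'" "Z \<in> T01 T c p" shows "jac c c' p Z \<in> T01 T c' p"
proof -
  have "jac c c' p (vcnj Z) \<in> T c' p" by (rule T_jac'[OF assms(1-4)]) (use assms(5) vcnj_T in blast)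
  then show ?thesis unfolding vcnj_T(2) jac_vcnj[OF assms(1-4)] .
qed

lemma HC_jac:
  assumes "c \<in> A" "c' \<in> A" "p \<in> fst c" "p \<in> fst c'" "v \<in> HC T c p" shows "jac c c' p v \<in> HC T c' p"
proof -
  obtain Z W where "Z \<in> T c p" "W \<in> T01 T c p" "v = Z + W" using assms(5) unfolding HC_iff by blast
  then show ?thesis
    unfolding HC_iff using T_jac'[OF assms(1-4)] T01_jac[OF assms(1-4)] jac_linear(1)[OF assms(1-4)] by blast
qed

lemma HC_jac_iff:
  assumes "c \<in> A" "c' \<in> A" "p \<in> fst c" "p \<in> fst c'" shows "jac c c' p v \<in> HC T c' p \<longleftrightarrow> v \<in> HC T c p"
  using HC_jac[OF assms, of v] HC_jac[OF assms(2,1,4,3), of "jac c c' p v"] jac_inverse[OF assms] by auto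

lemma T_jac_iff:
  assumes "c \<in> A" "c' \<in> A" "p \<in> fst c" "p \<in> fst c'"
  shows "jac c c' p v \<in> T c' p \<longleftrightarrow> v \<in> T c p" "jac c c' p v \<in> T01 T c' p \<longleftrightarrow> v \<in> T01 T c p"
  using T_jac'[OF assms, of v] T_jac'[OF assms(2,1,4,3), of "jac c c' p v"]
    T01_jac[OF assms, of v] T01_jac[OF assms(2,1,4,3), of "jac c c' p v"] jac_inverse[OF assms] by auto

text \<open>An adapted frame: $F_0,\dots,F_{n-1}$ frame $T^{1,0}$, $F_n,\dots,F_{2n-1}$ are their conjugates and
  $F_{2n}$ is a constant real vector; \<open>\<epsilon>\<close> is the dual coframe.\<close>

definition frame :: "('m, 'd) chart \<Rightarrow> 'm set \<Rightarrow> (nat \<Rightarrow> 'm \<Rightarrow> complex ^ 'd) \<Rightarrow> (nat \<Rightarrow> 'm \<Rightarrow> (complex ^ 'd) list \<Rightarrow> complex) \<Rightarrow> bool" where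
  "frame c V F \<epsilon> \<longleftrightarrow> chd c V \<and> (\<forall>j\<le>2*n. smooth_in c V (F j) \<and> lform c V 1 (\<epsilon> j)) \<and>
     (\<forall>q\<in>V. (\<forall>i\<le>2*n. \<forall>j\<le>2*n. \<epsilon> i q [F j q] = (if i = j then 1 else 0)) \<and>
        (\<forall>v. (\<Sum>j\<le>2*n. \<epsilon> j q [v] *s F j q) = v) \<and>
        T c q = vec.span ((\<lambda>i. F i q) ` {..<n}) \<and> (\<forall>j<n. F (n + j) q = vcnj (F j q)) \<and>
        vcnj (F (2*n) q) = F (2*n) q)"

text \<open>Conjugation is not complex linear, so spanning sets are carried over by hand in both
  directions. As T^{1,0} and T^{0,1} meet in 0, their dimensions add.\<close>

lemma HC_dim_le:
  assumes "c \<in> A" "p \<in> fst c" shows "vec.dim (HC T c p) = 2 * n"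
proof -
  have "vec.dim (T01 T c p) = n"
  proof -
    obtain B where B: "B \<subseteq> T c p" "vec.independent B" "T c p \<subseteq> vec.span B" "card B = n"
      using vec.basis_exists[of "T c p"] T_dim[OF assms] by auto
    have fB: "finite B" using B(2) vec.independent_bound_general by blast
    have sp: "vcnj v \<in> vec.span (vcnj ` S)" if "v \<in> vec.span S" for v and S :: "(complex ^ 'd) set"
      using that
    proof (induction rule: vec.span_induct_alt)
      case base then show ?case by (simp add: vec.span_zero)
    next
      case (step a x y)
      then show ?case unfolding vcnj_add vcnj_smult
        by (intro vec.span_add[OF vec.span_scale]) (auto intro: vec.span_base)
    qed
    have "T01 T c p \<subseteq> vec.span (vcnj ` B)" using sp B(3) unfolding T01_def by blast
    then have le: "vec.dim (T01 T c p) \<le> n"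
      using vec.dim_le_card[of "T01 T c p" "vcnj ` B"] fB card_image_le[OF fB, of vcnj] B(4) by auto
    obtain B' where B': "B' \<subseteq> T01 T c p" "vec.independent B'" "T01 T c p \<subseteq> vec.span B'" "card B' = vec.dim (T01 T c p)"
      using vec.basis_exists[of "T01 T c p"] by auto
    have fB': "finite B'" using B'(2) vec.independent_bound_general by blast
    have "T c p \<subseteq> vec.span (vcnj ` B')"
    proof
      fix v assume "v \<in> T c p"
      then have "vcnj v \<in> vec.span B'" using B'(3) vcnj_T(1) by blast
      then show "v \<in> vec.span (vcnj ` B')" using sp[of "vcnj v" B'] by simp
    qed
    then have "n \<le> vec.dim (T01 T c p)"
      using vec.dim_le_card[of "T c p" "vcnj ` B'"] fB' card_image_le[OF fB', of vcnj] B'(4) T_dim[OF assms] by auto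
    then show ?thesis using le by simp
  qed
  then show ?thesis
    using vec.dim_sums_Int[OF T_subspace[OF assms] T01_subspace[OF assms]] T_Int[OF assms] T_dim[OF assms]
    by (simp add: HC_def)
qed

text \<open>A complex subspace containing all real vectors is everything, but 2n < 2n + 1.\<close>

lemma exists_transversal:
  assumes "c \<in> A" "p \<in> fst c" shows "\<exists>e. cvec e \<notin> HC T c p"
proof (rule ccontr)
  assume "\<nexists>e. cvec e \<notin> HC T c p"
  then have "v \<in> HC T c p" for v
    using vRe_vIm_eq[of v] vec.subspace_add[OF HC_subspace[OF assms]] vec.subspace_scale[OF HC_subspace[OF assms]] by metis
  then have "HC T c p = UNIV" by blast
  then have "CARD('d) = 2 * n" using HC_dim_le[OF assms] by (simp add: card_cart_basis)
  then show False using card_d by simp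
qed

end

section \<open>Smooth dual coframes by Cramer's rule\<close>

definition one_form :: "(complex ^ 'd \<Rightarrow> complex) \<Rightarrow> (complex ^ 'd::finite) list \<Rightarrow> complex" where
  "one_form f vs = (case vs of [v] \<Rightarrow> f v | _ \<Rightarrow> 0)"

lemma one_form_apply [simp]: "one_form f [v] = f v" by (simp add: one_form_def)

lemma one_form_alt:
  fixes f :: "complex ^ 'd \<Rightarrow> complex"
  assumes "\<And>x y. f (x + y) = f x + f y" "\<And>a x. f (a *s x) = a * f x"
  shows "one_form f \<in> alt_forms 1"
  unfolding alt_forms_def mem_Collect_eq linear_iff_complex
proof (intro conjI allI impI)
  show "one_form f vs = 0" if "length vs \<noteq> 1" for vs :: "(complex ^ 'd) list"
    using that by (auto simp: one_form_def split: list.splits)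
  show "one_form f (vs[i := x + y]) = one_form f (vs[i := x]) + one_form f (vs[i := y])"
    if "length vs = 1 \<and> i < 1" for vs i x y
    using that assms by (auto simp: length_Suc_conv)
  show "one_form f (vs[i := a *s x]) = a * one_form f (vs[i := x])" if "length vs = 1 \<and> i < 1" for vs i a x
    using that assms by (auto simp: length_Suc_conv)
qed auto

lemma one_form_linear:
  assumes "\<theta> \<in> alt_forms 1"
  shows "\<theta> [v + w] = \<theta> [v] + \<theta> [w]" "\<theta> [a *s v] = a * \<theta> [v]" "\<theta> [\<Sum>i\<in>I. f i *s u i] = (\<Sum>i\<in>I. f i * \<theta> [u i])"
  using alt_Cons_add[OF assms] alt_Cons_smult[OF assms] alt_Cons_sum[OF assms] by auto

lemma row_expansion:
  fixes M :: "complex ^ 'd ^ 'd"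
  assumes "det M \<noteq> 0" shows "\<exists>x. v = (\<Sum>r\<in>UNIV. x $ r *s row r M)"
proof -
  obtain B where B: "B ** M = mat 1" using assms invertible_det_nz[of M] invertible_left_inverse by blast
  have "v = (v v* B) v* M" unfolding vector_matrix_mul_assoc B by simp
  also have "\<dots> = (\<Sum>r\<in>UNIV. (v v* B) $ r *s row r M)"
    by (simp add: vec_eq_iff vector_matrix_mult_def row_def)
  finally show ?thesis by blast
qed

context smooth_manifold
begin

lemma smooth_in_det:
  fixes M :: "'m \<Rightarrow> complex ^ 'd ^ 'd"
  assumes "chd c V" "\<And>r s. smooth_in c V (\<lambda>q. M q $ r $ s)" shows "smooth_in c V (\<lambda>q. det (M q))"
  unfolding det_def by (intro smooth_in_sum[OF assms(1)] smooth_in_mult[OF assms(1)] smooth_in_prod[OF assms(1)] smooth_in_const assms(2))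

text \<open>Cramer's rule expresses the dual coframe by quotients of determinants of smooth
  functions; the domain shrinks to the open set where the denominator is nonzero.\<close>

lemma dual_coframe:
  fixes F :: "nat \<Rightarrow> 'm \<Rightarrow> complex ^ 'd"
  assumes V: "chd c V" "p \<in> V" and F: "\<And>j. j \<le> m \<Longrightarrow> smooth_in c V (F j)" and m: "CARD('d) = Suc m"
    and sp: "vec.span ((\<lambda>j. F j p) ` {..m}) = UNIV"
  shows "\<exists>W \<epsilon>. open W \<and> p \<in> W \<and> W \<subseteq> V \<and> (\<forall>j\<le>m. lform c W 1 (\<epsilon> j)) \<and>
    (\<forall>q\<in>W. (\<forall>i\<le>m. \<forall>j\<le>m. \<epsilon> i q [F j q] = (if i = j then 1 else 0)) \<and> (\<forall>v. (\<Sum>j\<le>m. \<epsilon> j q [v] *s F j q) = v))"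
proof -
  \<comment> \<open>Determinants are indexed by the type \<open>'d\<close>, frames by the numbers up
    to \<open>m\<close>.\<close>
  obtain b :: "'d \<Rightarrow> nat" where b: "bij_betw b UNIV {..m}"
    using finite_same_card_bij[of "UNIV :: 'd set" "{..m}"] m by auto
  define k where "k = inv_into UNIV b"
  have bm: "b r \<le> m" for r using b by (auto simp: bij_betw_def)
  have kb: "k (b r) = r" for r using b unfolding k_def by (simp add: bij_betw_def)
  have bk: "b (k j) = j" if "j \<le> m" for j using b that unfolding k_def by (auto simp: bij_betw_def f_inv_into_f)
  define M :: "'m \<Rightarrow> complex ^ 'd ^ 'd" where "M q = (\<chi> r. F (b r) q)" for q
  have row: "row r (M q) = F (b r) q" for r q by (simp add: M_def row_def vec_eq_iff)
  have rows: "rows (M q) = (\<lambda>j. F j q) ` {..m}" for q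
  proof -
    have "rows (M q) = (\<lambda>j. F j q) ` (b ` UNIV)" by (auto simp: rows_def row)
    then show ?thesis using b by (simp add: bij_betw_def)
  qed
  have sF: "smooth_in c V (\<lambda>q. F j q $ s)" if "j \<le> m" for j s using F[OF that] smooth_in_vec_iff[OF V(1)] by blast
  have sM: "smooth_in c V (\<lambda>q. det (M q))"
    by (rule smooth_in_det[OF V(1)]) (simp add: M_def sF bm)
  define W where "W = V \<inter> (\<lambda>q. det (M q)) -` (- {0})"
  have W: "open W" "W \<subseteq> V"
    using continuous_open_preimage[OF smooth_in_continuous[OF V(1) sM]] V(1) unfolding W_def chd_def by auto
  have dM: "det (M q) \<noteq> 0" if "q \<in> W" for q using that by (simp add: W_def)
  have pW: "p \<in> W"
  proof -
    have "\<exists>B. B ** M p = mat 1" using matrix_left_invertible_span_rows_gen[of "M p"] sp rows by simp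
    then have "det (M p) \<noteq> 0" using invertible_det_nz[of "M p"] invertible_left_inverse by blast
    then show ?thesis using V by (simp add: W_def)
  qed
  have cW: "chd c W" using chd_subset[OF V(1) W] .
  \<comment> \<open>Row \<open>k j\<close> is replaced by the vector to be expanded, as in Cramer's
    rule.\<close>
  define N where "N j q v = (\<chi> r. if r = k j then v else row r (M q))" for j q and v :: "complex ^ 'd"
  define \<epsilon> where "\<epsilon> j q = one_form (\<lambda>v. det (N j q v) / det (M q))" for j q
  have L: "lform c W 1 (\<epsilon> j)" if j: "j \<le> m" for j
    unfolding lform_def
  proof (intro conjI ballI allI cW)
    show "\<epsilon> j q \<in> alt_forms 1" for q
      unfolding \<epsilon>_def N_def
    proof (rule one_form_alt)
      show "det (\<chi> r. if r = k j then x + y else row r (M q)) / det (M q) =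
         det (\<chi> r. if r = k j then x else row r (M q)) / det (M q) + det (\<chi> r. if r = k j then y else row r (M q)) / det (M q)" for x y
        using det_row_add[of "k j" "\<lambda>_. x" "\<lambda>_. y" "\<lambda>r. row r (M q)"] by (simp add: add_divide_distrib)
      show "det (\<chi> r. if r = k j then a *s x else row r (M q)) / det (M q) =
         a * (det (\<chi> r. if r = k j then x else row r (M q)) / det (M q))" for a x
        using det_row_mul[of "k j" a "\<lambda>_. x" "\<lambda>r. row r (M q)"] by simp
    qed
    show "smooth_in c W (\<lambda>q. \<epsilon> j q vs)" for vs
    proof (cases "\<exists>v. vs = [v]")
      case True
      then obtain v where v: "vs = [v]" by blast
      have "smooth_in c W (\<lambda>q. N j q v $ r $ s)" for r s
        using smooth_in_subset[OF sF[OF bm] W(2)] by (cases "r = k j") (simp_all add: N_def row smooth_in_const)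
      then have "smooth_in c W (\<lambda>q. det (N j q v) / det (M q))"
        by (intro smooth_in_divide[OF cW] smooth_in_det[OF cW] smooth_in_subset[OF sM W(2)] dM)
      then show ?thesis by (simp add: v \<epsilon>_def)
    next
      case False
      then have "\<epsilon> j q vs = 0" for q by (auto simp: \<epsilon>_def one_form_def split: list.splits)
      then show ?thesis by (simp add: smooth_in_const)
    qed
  qed
  have cr: "\<epsilon> j q [\<Sum>r\<in>UNIV. x $ r *s row r (M q)] = x $ k j" if "q \<in> W" for j q x
    using cramer_lemma_transpose[of "k j" x "M q"] dM[OF that] by (simp add: \<epsilon>_def N_def)
  have D: "\<epsilon> i q [F j q] = (if i = j then 1 else 0)" if q: "q \<in> W" and ij: "i \<le> m" "j \<le> m" for i j q
  proof -
    have "(\<Sum>r\<in>UNIV. axis (k j) 1 $ r *s row r (M q)) = (\<Sum>r\<in>UNIV. if r = k j then row r (M q) else 0)"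
      by (rule sum.cong) (auto simp: axis_def)
    also have "\<dots> = F j q" using bk[OF ij(2)] by (simp add: row)
    finally have "\<epsilon> i q [F j q] = axis (k j) 1 $ k i" using cr[OF q, of i "axis (k j) 1"] by simp
    moreover have "k i = k j \<longleftrightarrow> i = j" using bk[OF ij(1)] bk[OF ij(2)] by metis
    ultimately show ?thesis by (simp add: axis_def)
  qed
  have X: "(\<Sum>j\<le>m. \<epsilon> j q [v] *s F j q) = v" if q: "q \<in> W" for q v
  proof -
    obtain x where x: "v = (\<Sum>r\<in>UNIV. x $ r *s row r (M q))" using row_expansion[OF dM[OF q]] by blast
    have cx: "\<epsilon> (b r) q [v] = x $ r" for r using cr[OF q, of "b r" x] unfolding x[symmetric] kb .
    have "(\<Sum>j\<le>m. \<epsilon> j q [v] *s F j q) = (\<Sum>r\<in>UNIV. \<epsilon> (b r) q [v] *s F (b r) q)"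
      by (rule sum.reindex_bij_betw[OF b, symmetric])
    also have "\<dots> = (\<Sum>r\<in>UNIV. x $ r *s row r (M q))"
      by (simp add: cx row)
    finally show ?thesis using x by simp
  qed
  show ?thesis
    by (rule exI[of _ W], rule exI[of _ \<epsilon>], intro conjI allI ballI impI W pW L D X)
qed

end

context cr
begin

theorem frame_exists:
  assumes c: "c \<in> A" "p \<in> fst c" shows "\<exists>V F \<epsilon>. p \<in> V \<and> frame c V F \<epsilon>"
proof -
  obtain V Z where V: "open V" "p \<in> V" "V \<subseteq> fst c" and Z: "\<And>i. i < n \<Longrightarrow> smooth_in c V (Z i)"
    "\<And>q. q \<in> V \<Longrightarrow> vec.span ((\<lambda>i. Z i q) ` {..<n}) = T c q" using T_frame[OF c] by blast
  obtain e where e: "cvec e \<notin> HC T c p" using exists_transversal[OF c] by blast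
  have cV: "chd c V" using V c by (simp add: chd_def)
  \<comment> \<open>The vector \<open>e\<close> is known to be transversal at p only. Being constant
    it is smooth and real; independence near p is provided by the determinant in
    \<open>dual_coframe\<close>.\<close>
  define F where "F j q = (if j < n then Z j q else if j < 2 * n then vcnj (Z (j - n) q) else cvec e)" for j q
  have sF: "smooth_in c V (F j)" if "j \<le> 2 * n" for j
  proof -
    have s: "smooth_in c V (\<lambda>q. Z i q $ r)" if "i < n" for i r using Z(1)[OF that] smooth_in_vec_iff[OF cV] by blast
    have "smooth_in c V (\<lambda>q. F j q $ r)" for r
    proof (cases "j < n")
      case True then show ?thesis using s by (simp add: F_def)
    next
      case False
      then show ?thesis using that s[of "j - n"] smooth_in_cnj[OF cV s[of "j - n" r]]
        by (cases "j < 2 * n") (simp_all add: F_def smooth_in_const)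
    qed
    then show ?thesis using smooth_in_vec_iff[OF cV] by blast
  qed
  have FT: "T c q = vec.span ((\<lambda>i. F i q) ` {..<n})" if "q \<in> V" for q
    using Z(2)[OF that] by (simp add: F_def)
  have sp: "vec.span ((\<lambda>j. F j p) ` {..2 * n}) = UNIV"
  proof -
    let ?S = "vec.span ((\<lambda>j. F j p) ` {..2 * n})"
    have 1: "T c p \<subseteq> ?S" unfolding FT[OF V(2)] by (rule vec.span_mono) auto
    have "vcnj v \<in> ?S" if "v \<in> T c p" for v
      using that unfolding FT[OF V(2)]
    proof (induction rule: vec.span_induct_alt)
      case base then show ?case by (simp add: vec.span_zero)
    next
      case (step a x y)
      then obtain i where i: "i < n" "x = F i p" by auto
      then have "vcnj x = F (n + i) p" by (simp add: F_def)
      then have "vcnj x \<in> ?S" using i by (auto intro!: vec.span_base)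
      then show ?case using step by (simp add: vcnj_add vcnj_smult vec.span_add vec.span_scale)
    qed
    then have 2: "T01 T c p \<subseteq> ?S" unfolding T01_def by blast
    have 3: "cvec e \<in> ?S" by (rule vec.span_base) (auto simp: F_def intro!: image_eqI[of _ _ "2 * n"])
    have "HC T c p \<subseteq> ?S" using HC_span 1 2 by (meson Un_least order_trans vec.span_minimal vec.subspace_span)
    then have "insert (cvec e) (HC T c p) \<subseteq> ?S" using 3 by blast
    then have "vec.dim (insert (cvec e) (HC T c p)) \<le> vec.dim ?S" by (rule vec.dim_subset)
    moreover have "vec.dim (insert (cvec e) (HC T c p)) = 2 * n + 1"
      using e HC_dim_le[OF c] HC_subspace[OF c] by (simp add: vec.dim_insert vec.span_eq_iff[THEN iffD2])
    ultimately have "vec.dim ?S = CARD('d)" using card_d vec.dim_subset_UNIV[of ?S] by (simp add: vec.dimension_def card_cart_basis)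
    then show ?thesis using vec.dim_eq_full[of "(\<lambda>j. F j p) ` {..2 * n}"] by (simp add: vec.dimension_def card_cart_basis)
  qed
  obtain W \<epsilon> where W: "open W" "p \<in> W" "W \<subseteq> V" and E: "\<forall>j\<le>2*n. lform c W 1 (\<epsilon> j)"
    "\<forall>q\<in>W. (\<forall>i\<le>2*n. \<forall>j\<le>2*n. \<epsilon> i q [F j q] = (if i = j then 1 else 0)) \<and> (\<forall>v. (\<Sum>j\<le>2*n. \<epsilon> j q [v] *s F j q) = v)"
    using dual_coframe[OF cV V(2) sF _ sp] card_d by auto
  have "frame c W F \<epsilon>"
    unfolding frame_def
    using E chd_subset[OF cV W(1,3)] smooth_in_subset[OF sF W(3)] FT W(3) by (auto simp: F_def)
  then show ?thesis using W by blast
qed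

context
  fixes c V F \<epsilon> assumes fr: "frame c V F \<epsilon>"
begin

lemma fr_chd: "chd c V" and fr_smooth: "j \<le> 2*n \<Longrightarrow> smooth_in c V (F j)"
  and fr_lform: "j \<le> 2*n \<Longrightarrow> lform c V 1 (\<epsilon> j)"
  and fr_dual: "q \<in> V \<Longrightarrow> i \<le> 2*n \<Longrightarrow> j \<le> 2*n \<Longrightarrow> \<epsilon> i q [F j q] = (if i = j then 1 else 0)"
  and fr_expand: "q \<in> V \<Longrightarrow> (\<Sum>j\<le>2*n. \<epsilon> j q [v] *s F j q) = v"
  and fr_T: "q \<in> V \<Longrightarrow> T c q = vec.span ((\<lambda>i. F i q) ` {..<n})"
  and fr_cnj: "q \<in> V \<Longrightarrow> j < n \<Longrightarrow> F (n + j) q = vcnj (F j q)"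
  and fr_real: "q \<in> V \<Longrightarrow> vcnj (F (2*n) q) = F (2*n) q"
  using fr unfolding frame_def by blast+

lemma fr_chart: "c \<in> A" "q \<in> V \<Longrightarrow> q \<in> fst c"
  using fr_chd by (auto simp: chd_def)

lemma fr_alt: "q \<in> V \<Longrightarrow> j \<le> 2*n \<Longrightarrow> \<epsilon> j q \<in> alt_forms 1"
  using lform_alt[OF fr_lform] by blast

lemma fr_T_iff:
  assumes q: "q \<in> V"
  shows "v \<in> T c q \<longleftrightarrow> (\<forall>j\<le>2*n. n \<le> j \<longrightarrow> \<epsilon> j q [v] = 0)"
proof
  assume "v \<in> T c q"
  then have "\<epsilon> j q [v] = 0" if "j \<le> 2*n" "n \<le> j" for j
    unfolding fr_T[OF q]
  proof (induction rule: vec.span_induct_alt)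
    case base
    then show ?case using one_form_linear(2)[OF fr_alt[OF q that(1)], of 0 0] by simp
  next
    case (step a x y)
    then show ?case using fr_dual[OF q that(1)] that by (auto simp: one_form_linear[OF fr_alt[OF q that(1)]])
  qed
  then show "\<forall>j\<le>2*n. n \<le> j \<longrightarrow> \<epsilon> j q [v] = 0" by blast
next
  assume *: "\<forall>j\<le>2*n. n \<le> j \<longrightarrow> \<epsilon> j q [v] = 0"
  have "(\<Sum>j\<le>2*n. \<epsilon> j q [v] *s F j q) \<in> T c q"
    unfolding fr_T[OF q]
  proof (rule vec.span_sum)
    fix j assume j: "j \<in> {..2*n}"
    show "\<epsilon> j q [v] *s F j q \<in> vec.span ((\<lambda>i. F i q) ` {..<n})"
      using * j by (cases "j < n") (auto intro!: vec.span_scale[OF vec.span_base] simp: vec.span_zero)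
  qed
  then show "v \<in> T c q" by (simp add: fr_expand[OF q])
qed

lemma fr_F_T: "q \<in> V \<Longrightarrow> j < n \<Longrightarrow> F j q \<in> T c q"
  using fr_T by (auto intro: vec.span_base)

lemma fr_F_T01: "q \<in> V \<Longrightarrow> n \<le> j \<Longrightarrow> j < 2*n \<Longrightarrow> F j q \<in> T01 T c q"
  using fr_F_T[of q "j - n"] fr_cnj[of q "j - n"] vcnj_T(1) by auto

lemma fr_F_HC: "q \<in> V \<Longrightarrow> j < 2*n \<Longrightarrow> F j q \<in> HC T c q"
  using fr_F_T[of q j] fr_F_T01[of q j] T_HC[OF fr_chart(1) fr_chart(2)] by (cases "j < n") auto

lemma fr_T_expand: "q \<in> V \<Longrightarrow> v \<in> T c q \<Longrightarrow> v = (\<Sum>j<n. \<epsilon> j q [v] *s F j q)"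
proof -
  assume q: "q \<in> V" and v: "v \<in> T c q"
  have "(\<Sum>j\<le>2*n. \<epsilon> j q [v] *s F j q) = (\<Sum>j<n. \<epsilon> j q [v] *s F j q)"
    by (rule sum.mono_neutral_right) (use v fr_T_iff[OF q] in auto)
  then show ?thesis using fr_expand[OF q, of v] by simp
qed

lemma fr_T01_iff:
  assumes q: "q \<in> V"
  shows "v \<in> T01 T c q \<longleftrightarrow> (\<forall>j\<le>2*n. j < n \<or> j = 2*n \<longrightarrow> \<epsilon> j q [v] = 0)"
proof
  assume "v \<in> T01 T c q"
  then have "vcnj v \<in> T c q" using vcnj_T by blast
  from fr_T_expand[OF q this]
  have "vcnj (vcnj v) = vcnj (\<Sum>j<n. \<epsilon> j q [vcnj v] *s F j q)" by simp
  also have "\<dots> = (\<Sum>j<n. cnj (\<epsilon> j q [vcnj v]) *s F (n + j) q)"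
    using fr_cnj[OF q] by (simp add: vec_eq_iff)
  finally have e: "v = (\<Sum>j<n. cnj (\<epsilon> j q [vcnj v]) *s F (n + j) q)" by simp
  show "\<forall>j\<le>2*n. j < n \<or> j = 2*n \<longrightarrow> \<epsilon> j q [v] = 0"
  proof (intro allI impI)
    fix i assume i: "i \<le> 2*n" "i < n \<or> i = 2*n"
    have "\<epsilon> i q [v] = (\<Sum>j<n. cnj (\<epsilon> j q [vcnj v]) * \<epsilon> i q [F (n + j) q])"
      by (subst e, rule one_form_linear(3)[OF fr_alt[OF q i(1)]])
    also have "\<dots> = 0" by (rule sum.neutral) (use fr_dual[OF q i(1)] i in auto)
    finally show "\<epsilon> i q [v] = 0" .
  qed
next
  assume *: "\<forall>j\<le>2*n. j < n \<or> j = 2*n \<longrightarrow> \<epsilon> j q [v] = 0"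
  have "(\<Sum>j\<le>2*n. \<epsilon> j q [v] *s F j q) \<in> T01 T c q"
  proof (rule vec.subspace_sum[OF T01_subspace[OF fr_chart(1) fr_chart(2)[OF q]]])
    fix j assume j: "j \<in> {..2*n}"
    show "\<epsilon> j q [v] *s F j q \<in> T01 T c q"
    proof (cases "j < n \<or> j = 2*n")
      case True then show ?thesis using * j vec.subspace_0[OF T01_subspace[OF fr_chart(1) fr_chart(2)[OF q]]] by auto
    next
      case False
      then show ?thesis using j vec.subspace_scale[OF T01_subspace[OF fr_chart(1) fr_chart(2)[OF q]] fr_F_T01[OF q]] by auto
    qed
  qed
  then show "v \<in> T01 T c q" by (simp add: fr_expand[OF q])
qed

lemma fr_HC_iff:
  assumes q: "q \<in> V"
  shows "v \<in> HC T c q \<longleftrightarrow> \<epsilon> (2*n) q [v] = 0"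
proof
  assume "v \<in> HC T c q"
  then obtain Z W where "Z \<in> T c q" "W \<in> T01 T c q" "v = Z + W" using HC_iff by blast
  moreover have "\<epsilon> (2*n) q [Z] = 0" using fr_T_iff[OF q, of Z] calculation by simp
  moreover have "\<epsilon> (2*n) q [W] = 0" using fr_T01_iff[OF q, of W] calculation by blast
  ultimately show "\<epsilon> (2*n) q [v] = 0" using one_form_linear(1)[OF fr_alt[OF q]] by simp
next
  assume *: "\<epsilon> (2*n) q [v] = 0"
  have "(\<Sum>j\<le>2*n. \<epsilon> j q [v] *s F j q) \<in> HC T c q"
  proof (rule vec.subspace_sum[OF HC_subspace[OF fr_chart(1) fr_chart(2)[OF q]]])
    fix j assume j: "j \<in> {..2*n}"
    show "\<epsilon> j q [v] *s F j q \<in> HC T c q"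
    proof (cases "j = 2*n")
      case True then show ?thesis using * vec.subspace_0[OF HC_subspace[OF fr_chart(1) fr_chart(2)[OF q]]] by auto
    next
      case False
      then show ?thesis using j vec.subspace_scale[OF HC_subspace[OF fr_chart(1) fr_chart(2)[OF q]] fr_F_HC[OF q]] by auto
    qed
  qed
  then show "v \<in> HC T c q" by (simp add: fr_expand[OF q])
qed

lemma fr_dual_frame:
  assumes q: "q \<in> V"
  shows "dual_frame (T c q) (T01 T c q) {..<n} (\<lambda>j. F j q) (\<lambda>j. \<epsilon> j q)"
    and "dual_frame (T01 T c q) (T c q) {n..<2*n} (\<lambda>j. F j q) (\<lambda>j. \<epsilon> j q)"
proof -
  show "dual_frame (T c q) (T01 T c q) {..<n} (\<lambda>j. F j q) (\<lambda>j. \<epsilon> j q)"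
    unfolding dual_frame_def
    using fr_F_T[OF q] fr_alt[OF q] fr_T01_iff[OF q] fr_T_expand[OF q, symmetric] by auto
  have "(\<Sum>j=n..<2*n. \<epsilon> j q [v] *s F j q) = v" if "v \<in> T01 T c q" for v
  proof -
    have "(\<Sum>j\<le>2*n. \<epsilon> j q [v] *s F j q) = (\<Sum>j=n..<2*n. \<epsilon> j q [v] *s F j q)"
      by (rule sum.mono_neutral_right) (use that fr_T01_iff[OF q] in auto)
    then show ?thesis using fr_expand[OF q, of v] by simp
  qed
  then show "dual_frame (T01 T c q) (T c q) {n..<2*n} (\<lambda>j. F j q) (\<lambda>j. \<epsilon> j q)"
    unfolding dual_frame_def using fr_F_T01[OF q] fr_alt[OF q] fr_T_iff[OF q] by auto
qed

lemma fr_HC_dual: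
  assumes q: "q \<in> V" and v: "v \<in> HC T c q"
  shows "(\<Sum>j<2*n. \<epsilon> j q [v] *s F j q) = v"
proof -
  have "(\<Sum>j\<le>2*n. \<epsilon> j q [v] *s F j q) = (\<Sum>j<2*n. \<epsilon> j q [v] *s F j q)"
    by (rule sum.mono_neutral_right) (use v fr_HC_iff[OF q] in auto)
  then show ?thesis using fr_expand[OF q, of v] by simp
qed

text \<open>Conjugation preserves H and fixes the transversal frame vector, so on the quotient by H
  it is conjugation of the coefficient.\<close>

lemma fr_theta_real:
  assumes q: "q \<in> V" shows "\<epsilon> (2*n) q [vcnj v] = cnj (\<epsilon> (2*n) q [v])"
proof -
  let ?h = "\<Sum>j<2*n. \<epsilon> j q [v] *s F j q"
  have sp: "v = ?h + \<epsilon> (2*n) q [v] *s F (2*n) q"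
    using fr_expand[OF q, of v] by (simp add: lessThan_Suc_atMost[symmetric])
  have "?h \<in> HC T c q"
    by (intro vec.subspace_sum[OF HC_subspace[OF fr_chart(1) fr_chart(2)[OF q]]]
        vec.subspace_scale[OF HC_subspace[OF fr_chart(1) fr_chart(2)[OF q]]] fr_F_HC[OF q]) auto
  then have "\<epsilon> (2*n) q [vcnj ?h] = 0" using vcnj_HC fr_HC_iff[OF q] by blast
  moreover have "vcnj v = vcnj ?h + cnj (\<epsilon> (2*n) q [v]) *s F (2*n) q"
    by (subst sp) (simp add: vcnj_add vcnj_smult fr_real[OF q])
  ultimately show ?thesis
    using fr_dual[OF q, of "2*n" "2*n"] by (simp add: one_form_linear[OF fr_alt[OF q]])
qed

end

end

section \<open>Contact forms and the Levi form\<close>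

context smooth_manifold
begin

lemma ext_d_jac:
  assumes "\<omega> \<in> forms A U k" "open U" and c: "c \<in> A" "c' \<in> A" "p \<in> U" "p \<in> fst c" "p \<in> fst c'"
  shows "ext_d \<omega> c p vs = ext_d \<omega> c' p (map (jac c c' p) vs)"
proof -
  let ?V = "U \<inter> (fst c \<inter> fst c')"
  have V: "chd c ?V" "p \<in> ?V" using chd_Int[OF chd_overlap[OF c(1,2)] assms(2)] c by (simp_all add: Int_commute)
  have l: "lform c' ?V k (\<omega> c')"
    by (rule lform_subset[OF forms_lform[OF assms(1,2) c(2)]]) (use c chart_open assms(2) in \<open>auto simp: open_Int\<close>)
  have "dl c (\<omega> c) p vs = dl c (\<lambda>p vs. \<omega> c' p (map (jac c c' p) vs)) p vs"
  proof (rule dl_cong[OF V(1) _ V(2)])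
    fix q vs assume "q \<in> ?V"
    then show "\<omega> c q vs = \<omega> c' q (map (jac c c' q) vs)" by (intro forms_jac[OF assms(1) c(1,2)]) auto
  qed
  also have "\<dots> = dl c' (\<omega> c') p (map (jac c c' p) vs)"
    by (rule dl_jac[OF l c(1) _ V(2)]) auto
  finally show ?thesis using c by (simp add: ext_d_dl)
qed

text \<open>A coframe is given in one chart, whereas a contact form must be given in all of them;
  the domain stays V.\<close>

definition tform :: "('m, 'd) chart \<Rightarrow> 'm set \<Rightarrow> ('m \<Rightarrow> (complex ^ 'd) list \<Rightarrow> complex) \<Rightarrow> ('m, 'd) form" where
  "tform c V g c' p vs = (if c' \<in> A \<and> p \<in> V \<and> p \<in> fst c' then g p (map (jac c' c p) vs) else 0)"

lemma tform_forms:
  assumes g: "lform c V k g" shows "tform c V g \<in> forms A V k"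
proof (rule formsI)
  have V: "c \<in> A" "V \<subseteq> fst c" "open V" using lform_chd[OF g] by (auto simp: chd_def)
  show "tform c V g c' p vs = tform c V g c'' p (map (jac c' c'' p) vs)"
    if "c' \<in> A" "c'' \<in> A" "p \<in> V" "p \<in> fst c'" "p \<in> fst c''" for c' c'' p vs
    using jac_list_cocycle[OF that(1,2) V(1) that(4,5), of vs] that V(2) unfolding tform_def by (metis subsetD)
  show "lform c' (V \<inter> fst c') k (tform c V g c')" if c': "c' \<in> A" for c'
  proof (rule lform_cong)
    show "lform c' (V \<inter> fst c') k (\<lambda>q vs. g q (map (jac c' c q) vs))"
      by (rule lform_jac[OF lform_subset[OF g] c']) (use c' V chart_open in \<open>simp_all add: open_Int\<close>)
  qed (use c' in \<open>simp add: tform_def\<close>)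
qed (auto simp: tform_def)

lemma tform_chart:
  assumes "lform c V k g" "p \<in> V" shows "tform c V g c p vs = g p vs"
proof -
  have "c \<in> A" "p \<in> fst c" using lform_chd[OF assms(1)] assms(2) by (auto simp: chd_def)
  moreover have "jac c c p = (\<lambda>v. v)" using jac_self calculation by blast
  ultimately show ?thesis using assms(2) by (simp add: tform_def)
qed

end

context cr
begin

lemma contact_facts:
  assumes "contact_form A T U \<theta>"
  shows "open U" "\<theta> \<in> forms A U 1" "\<theta> c p (map vcnj vs) = cnj (\<theta> c p vs)"
    "c \<in> A \<Longrightarrow> p \<in> U \<Longrightarrow> p \<in> fst c \<Longrightarrow> \<theta> c p [cvec v] = 0 \<longleftrightarrow> cvec v \<in> HC T c p"
proof -
  show "open U" "\<theta> \<in> forms A U 1" using assms by (auto simp: contact_form_def)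
  have "fcnj \<theta> c p (map vcnj vs) = \<theta> c p (map vcnj vs)" using assms by (simp add: contact_form_def real_form_def)
  then show "\<theta> c p (map vcnj vs) = cnj (\<theta> c p vs)" by (simp add: fcnj_def comp_def)
  assume "c \<in> A" "p \<in> U" "p \<in> fst c"
  then have "{v. \<theta> c p [cvec v] = 0} = HR T c p" using assms unfolding contact_form_def by blast
  then show "\<theta> c p [cvec v] = 0 \<longleftrightarrow> cvec v \<in> HC T c p" by (auto simp: HR_def)
qed

lemma HC_Re_Im:
  assumes "c \<in> A" "p \<in> fst c"
  shows "v \<in> HC T c p \<longleftrightarrow> cvec (vRe v) \<in> HC T c p \<and> cvec (vIm v) \<in> HC T c p"
proof
  note S = HC_subspace[OF assms]
  assume v: "v \<in> HC T c p"
  note v' = vcnj_HC[OF v]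
  have "(1/2) *s (v + vcnj v) \<in> HC T c p" by (intro vec.subspace_scale[OF S] vec.subspace_add[OF S] v v')
  moreover have "(-\<i>/2) *s (v + (-1) *s vcnj v) \<in> HC T c p"
    by (intro vec.subspace_scale[OF S] vec.subspace_add[OF S] v v')
  moreover have "(1/2) *s (v + vcnj v) = cvec (vRe v)" "(-\<i>/2) *s (v + (-1) *s vcnj v) = cvec (vIm v)"
    by (simp_all add: vec_eq_iff complex_eq_iff)
  ultimately show "cvec (vRe v) \<in> HC T c p \<and> cvec (vIm v) \<in> HC T c p" by simp
next
  assume "cvec (vRe v) \<in> HC T c p \<and> cvec (vIm v) \<in> HC T c p"
  then have "cvec (vRe v) + \<i> *s cvec (vIm v) \<in> HC T c p"
    using HC_subspace[OF assms] by (intro vec.subspace_add vec.subspace_scale) auto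
  then show "v \<in> HC T c p" by (simp add: vRe_vIm_eq[symmetric])
qed

lemma contact_alt:
  assumes "contact_form A T U \<theta>" "c \<in> A" "p \<in> U" "p \<in> fst c" shows "\<theta> c p \<in> alt_forms 1"
  using forms_alt[OF contact_facts(2)[OF assms(1)] assms(2-4)] .

text \<open>The definition prescribes the kernel on real vectors. A real form vanishes on a complex
  vector iff it vanishes on its real and imaginary parts, and H is stable under taking these
  parts.\<close>

lemma contact_HC:
  assumes ct: "contact_form A T U \<theta>" and c: "c \<in> A" "p \<in> U" "p \<in> fst c"
  shows "\<theta> c p [v] = 0 \<longleftrightarrow> v \<in> HC T c p"
proof -
  note a = contact_alt[OF assms]
  have im: "Im (\<theta> c p [cvec w]) = 0" for w
  proof -
    have "cnj (\<theta> c p [cvec w]) = \<theta> c p [cvec w]" using contact_facts(3)[OF ct, of c p "[cvec w]"] by simp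
    then show ?thesis by (simp add: complex_eq_iff)
  qed
  have "\<theta> c p [v] = \<theta> c p [cvec (vRe v)] + \<i> * \<theta> c p [cvec (vIm v)]"
    by (subst vRe_vIm_eq[of v]) (simp add: one_form_linear[OF a])
  then have "\<theta> c p [v] = 0 \<longleftrightarrow> \<theta> c p [cvec (vRe v)] = 0 \<and> \<theta> c p [cvec (vIm v)] = 0"
    using im by (simp add: complex_eq_iff)
  then show ?thesis
    using contact_facts(4)[OF ct c] HC_Re_Im[OF c(1,3), of v] by blast
qed

text \<open>A possible value of d\<theta> at p. The contact form is quantified away, since on H all
  such values agree up to a factor.\<close>

definition levi_at :: "('m, 'd) chart \<Rightarrow> 'm \<Rightarrow> ((complex ^ 'd) list \<Rightarrow> complex) \<Rightarrow> bool" where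
  "levi_at c p \<Omega> \<longleftrightarrow> c \<in> A \<and> p \<in> fst c \<and> (\<exists>U \<theta>. contact_form A T U \<theta> \<and> p \<in> U \<and> \<Omega> = ext_d \<theta> c p)"

lemma contact_lform:
  assumes ct: "contact_form A T U \<theta>" and c: "c \<in> A"
  shows "lform c (U \<inter> fst c) 1 (\<theta> c)"
  using forms_lform[OF contact_facts(2,1)[OF ct] c] .

lemma levi_at_alt:
  assumes "levi_at c p \<Omega>" shows "\<Omega> \<in> alt_forms 2"
proof -
  obtain U \<theta> where o: "contact_form A T U \<theta>" "p \<in> U" "\<Omega> = ext_d \<theta> c p" and c: "c \<in> A" "p \<in> fst c"
    using assms by (auto simp: levi_at_def)
  have "dl c (\<theta> c) p \<in> alt_forms (Suc 1)"
    by (rule lform_alt[OF lform_dl[OF contact_lform[OF o(1) c(1)]]]) (use o c in auto)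
  moreover have "\<Omega> = dl c (\<theta> c) p" using o c by (auto simp: ext_d_dl fun_eq_iff)
  ultimately show ?thesis by (simp add: numeral_2_eq_2)
qed

lemma levi_at_jac:
  assumes "levi_at c p \<Omega>" "c' \<in> A" "p \<in> fst c'"
  shows "\<exists>\<Omega>'. levi_at c' p \<Omega>' \<and> \<Omega> = (\<lambda>vs. \<Omega>' (map (jac c c' p) vs))"
proof -
  obtain U \<theta> where o: "contact_form A T U \<theta>" "p \<in> U" "\<Omega> = ext_d \<theta> c p" and c: "c \<in> A" "p \<in> fst c"
    using assms by (auto simp: levi_at_def)
  have "\<Omega> = (\<lambda>vs. ext_d \<theta> c' p (map (jac c c' p) vs))"
    unfolding o(3) using ext_d_jac[OF contact_facts(2,1)[OF o(1)] c(1) assms(2) o(2) c(2) assms(3)] by (rule ext)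
  then show ?thesis using o assms unfolding levi_at_def by blast
qed

lemma levi_at_real:
  assumes "levi_at c p \<Omega>" shows "\<Omega> (map vcnj vs) = cnj (\<Omega> vs)"
proof -
  obtain U \<theta> where o: "contact_form A T U \<theta>" "p \<in> U" "\<Omega> = ext_d \<theta> c p" and c: "c \<in> A" "p \<in> fst c"
    using assms by (auto simp: levi_at_def)
  have "dl c (\<lambda>p vs. cnj (\<theta> c p (map vcnj vs))) p vs = cnj (dl c (\<theta> c) p (map vcnj vs))"
    by (rule dl_cnj[OF contact_lform[OF o(1) c(1)]]) (use o c in auto)
  moreover have "(\<lambda>p vs. cnj (\<theta> c p (map vcnj vs))) = \<theta> c"
    using contact_facts(3)[OF o(1)] by simp
  ultimately show ?thesis using o c by (simp add: ext_d_dl)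
qed

text \<open>The last coframe element is real and annihilates exactly H. This provides contact forms
  around every point.\<close>

lemma frame_contact:
  assumes fr: "frame c V F \<epsilon>"
  shows "contact_form A T V (tform c V (\<epsilon> (2*n)))"
  unfolding contact_form_def real_form_def
proof (intro conjI ballI)
  note l = fr_lform[OF fr order_refl]
  have V: "c \<in> A" "V \<subseteq> fst c" "open V" using fr_chd[OF fr] by (auto simp: chd_def)
  show "open V" by fact
  show "tform c V (\<epsilon> (2*n)) \<in> forms A V 1" by (rule tform_forms[OF l])
  have cj: "cnj (\<epsilon> (2*n) p (map vcnj vs)) = \<epsilon> (2*n) p vs" if p: "p \<in> V" for p vs
  proof (cases "length vs = 1")
    case True
    then obtain v where "vs = [v]" by (auto simp: length_Suc_conv)
    then show ?thesis using fr_theta_real[OF fr p, of v] by simp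
  next
    case False
    then show ?thesis using alt_length[OF lform_alt[OF l p]] by simp
  qed
  show "fcnj (tform c V (\<epsilon> (2*n))) = tform c V (\<epsilon> (2*n))"
  proof (intro ext)
    fix c' p vs
    show "fcnj (tform c V (\<epsilon> (2*n))) c' p vs = tform c V (\<epsilon> (2*n)) c' p vs"
    proof (cases "c' \<in> A \<and> p \<in> V \<and> p \<in> fst c'")
      case True
      then have "map (jac c' c p) (map vcnj vs) = map vcnj (map (jac c' c p) vs)"
        using jac_vcnj[of c' c p] V by auto
      then show ?thesis using True cj[of p "map (jac c' c p) vs"] unfolding fcnj_def tform_def by (simp del: map_map)
    next
      case False
      then show ?thesis by (auto simp: fcnj_def tform_def)
    qed
  qed
  fix c' p assume c': "c' \<in> A" "p \<in> V \<inter> fst c'"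
  have pc: "p \<in> fst c'" "p \<in> fst c" "p \<in> V" using c' V by auto
  show "{v. tform c V (\<epsilon> (2*n)) c' p [cvec v] = 0} = HR T c' p"
    using c' fr_HC_iff[OF fr pc(3)] HC_jac_iff[OF c'(1) V(1) pc(1,2)] by (auto simp: tform_def HR_def)
qed

lemma frame_levi_at:
  assumes fr: "frame c V F \<epsilon>" and p: "p \<in> V"
  shows "levi_at c p (dl c (\<epsilon> (2*n)) p)"
proof -
  have "dl c (\<epsilon> (2*n)) p = ext_d (tform c V (\<epsilon> (2*n))) c p"
    using dl_cong[OF fr_chd[OF fr] tform_chart[OF fr_lform[OF fr order_refl]] p] fr_chart(2)[OF fr p]
    by (intro ext) (simp add: ext_d_dl)
  then show ?thesis
    unfolding levi_at_def using frame_contact[OF fr] p fr_chart(1)[OF fr] fr_chart(2)[OF fr p] by blast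
qed

lemma contact_exists: "\<exists>U \<theta>. contact_form A T U \<theta> \<and> p \<in> U"
proof -
  obtain c where "c \<in> A" "p \<in> fst c" using chart_cover by blast
  from frame_exists[OF this] frame_contact show ?thesis by blast
qed

lemma levi_at_exists: "c \<in> A \<Longrightarrow> p \<in> fst c \<Longrightarrow> \<exists>\<Omega>. levi_at c p \<Omega>"
  using frame_exists frame_levi_at by blast

text \<open>Extends a vector of H at p to a field with constant coefficients in the frame; the field
  stays in H, and in T^{1,0} or T^{0,1} if v lies there.\<close>

definition hext :: "(nat \<Rightarrow> 'm \<Rightarrow> complex ^ 'd) \<Rightarrow> (nat \<Rightarrow> 'm \<Rightarrow> (complex ^ 'd) list \<Rightarrow> complex) \<Rightarrow> 'm \<Rightarrow> complex ^ 'd \<Rightarrow> 'm \<Rightarrow> complex ^ 'd" where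
  "hext F \<epsilon> p v q = (\<Sum>j<2*n. \<epsilon> j p [v] *s F j q)"

lemma hext_facts:
  assumes fr: "frame c V F \<epsilon>" and p: "p \<in> V" and v: "v \<in> HC T c p"
  shows "smooth_in c V (hext F \<epsilon> p v)" "hext F \<epsilon> p v p = v" "q \<in> V \<Longrightarrow> hext F \<epsilon> p v q \<in> HC T c q"
    "v \<in> T c p \<Longrightarrow> q \<in> V \<Longrightarrow> hext F \<epsilon> p v q \<in> T c q"
    "v \<in> T01 T c p \<Longrightarrow> q \<in> V \<Longrightarrow> hext F \<epsilon> p v q \<in> T01 T c q"
proof -
  note ch = fr_chd[OF fr]
  have "smooth_in c V (\<lambda>q. hext F \<epsilon> p v q $ i)" for i
    using fr_smooth[OF fr] smooth_in_vec_iff[OF ch]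
    by (simp add: hext_def) (intro smooth_in_sum[OF ch] smooth_in_mult[OF ch] smooth_in_const, auto)
  then show "smooth_in c V (hext F \<epsilon> p v)" using smooth_in_vec_iff[OF ch] by blast
  show "hext F \<epsilon> p v p = v" using fr_HC_dual[OF fr p v] by (simp add: hext_def)
  note cq = fr_chart(1)[OF fr] fr_chart(2)[OF fr]
  show "hext F \<epsilon> p v q \<in> HC T c q" if "q \<in> V" for q
    unfolding hext_def by (intro vec.subspace_sum[OF HC_subspace[OF cq(1) cq(2)[OF that]]]
      vec.subspace_scale[OF HC_subspace[OF cq(1) cq(2)[OF that]]] fr_F_HC[OF fr that]) auto
  show "hext F \<epsilon> p v q \<in> T c q" if "v \<in> T c p" "q \<in> V" for q
    unfolding hext_def
  proof (rule vec.subspace_sum[OF T_subspace[OF cq(1) cq(2)[OF that(2)]]])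
    note S = T_subspace[OF cq(1) cq(2)[OF that(2)]]
    fix j assume "j \<in> {..<2*n}"
    then show "\<epsilon> j p [v] *s F j q \<in> T c q"
      using fr_T_iff[OF fr p, of v] that vec.subspace_0[OF S] vec.subspace_scale[OF S fr_F_T[OF fr that(2)]]
      by (cases "j < n") auto
  qed
  show "hext F \<epsilon> p v q \<in> T01 T c q" if "v \<in> T01 T c p" "q \<in> V" for q
    unfolding hext_def
  proof (rule vec.subspace_sum[OF T01_subspace[OF cq(1) cq(2)[OF that(2)]]])
    note S = T01_subspace[OF cq(1) cq(2)[OF that(2)]]
    fix j assume "j \<in> {..<2*n}"
    then show "\<epsilon> j p [v] *s F j q \<in> T01 T c q"
      using fr_T01_iff[OF fr p, of v] that vec.subspace_0[OF S] vec.subspace_scale[OF S fr_F_T01[OF fr that(2)]]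
      by (cases "j < n") auto
  qed
qed

lemma bracket_vcnj:
  assumes ch: "chd c V" and "smooth_in c V Z" "smooth_in c V W" "p \<in> V"
  shows "bracket c (\<lambda>q. vcnj (Z q)) (\<lambda>q. vcnj (W q)) p = vcnj (bracket c Z W p)"
proof -
  have "smooth_in c V (\<lambda>q. Z q $ i)" "smooth_in c V (\<lambda>q. W q $ i)" for i
    using assms smooth_in_vec_iff[OF ch] by blast+
  then show ?thesis
    using ddir_cnj[OF ch _ assms(4)] by (simp add: bracket_def vec_eq_iff)
qed

lemma smooth_in_vcnj:
  fixes Z :: "'m \<Rightarrow> complex ^ 'd"
  shows "chd c V \<Longrightarrow> smooth_in c V Z \<Longrightarrow> smooth_in c V (\<lambda>q. vcnj (Z q))"
  by (simp add: smooth_in_vec_iff smooth_in_cnj)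

lemma T01_involutive:
  assumes ch: "chd c V" and s: "smooth_in c V Z" "smooth_in c V W"
    and "\<And>p. p \<in> V \<Longrightarrow> Z p \<in> T01 T c p \<and> W p \<in> T01 T c p" and p: "p \<in> V"
  shows "bracket c Z W p \<in> T01 T c p"
proof -
  have "bracket c (\<lambda>q. vcnj (Z q)) (\<lambda>q. vcnj (W q)) p \<in> T c p"
    by (rule T_involutive[OF ch smooth_in_vcnj[OF ch s(1)] smooth_in_vcnj[OF ch s(2)] _ p])
       (use assms(4) vcnj_T in blast)
  then show ?thesis unfolding bracket_vcnj[OF ch s p] using vcnj_T by blast
qed

text \<open>\<theta> vanishes on both fields near p, so Cartan's formula leaves only the
  bracket.\<close>

lemma levi_at_bracket:
  assumes ct: "contact_form A T U \<theta>" and fr: "frame c V F \<epsilon>" and p: "p \<in> U" "p \<in> V"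
    and vw: "v \<in> HC T c p" "w \<in> HC T c p"
  shows "ext_d \<theta> c p [v, w] = - \<theta> c p [bracket c (hext F \<epsilon> p v) (hext F \<epsilon> p w) p]"
proof -
  note cq = fr_chart(1)[OF fr] fr_chart(2)[OF fr]
  let ?W = "U \<inter> V"
  have oW: "open ?W" "open V" using contact_facts(1)[OF ct] fr_chd[OF fr] by (auto simp: chd_def)
  have l: "lform c ?W 1 (\<theta> c)"
    by (rule lform_subset[OF contact_lform[OF ct cq(1)] oW(1)]) (use cq in auto)
  note hv = hext_facts[OF fr p(2) vw(1)] and hw = hext_facts[OF fr p(2) vw(2)]
  have "dl c (\<theta> c) p [hext F \<epsilon> p v p, hext F \<epsilon> p w p] = - \<theta> c p [bracket c (hext F \<epsilon> p v) (hext F \<epsilon> p w) p]"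
  proof (rule dl_one_form_bracket[OF l])
    show "p \<in> ?W" using p by simp
    show "smooth_in c ?W (hext F \<epsilon> p v)" "smooth_in c ?W (hext F \<epsilon> p w)"
      using smooth_in_subset[OF hv(1)] smooth_in_subset[OF hw(1)] by auto
    show "\<theta> c q [hext F \<epsilon> p v q] = 0" "\<theta> c q [hext F \<epsilon> p w q] = 0" if "q \<in> ?W" for q
      using contact_HC[OF ct cq(1), of q] that hv(3)[of q] hw(3)[of q] cq(2) by auto
  qed
  then show ?thesis using cq(2)[OF p(2)] hv(2) hw(2) by (simp add: ext_d_dl)
qed

text \<open>Brackets of sections of T^{1,0} stay in T^{1,0}, hence in the kernel of \<theta>;
  likewise for T^{0,1}. So d\<theta> has type (1,1) on H.\<close>

lemma levi_at_isotropic: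
  assumes "levi_at c p \<Omega>"
  shows "Z \<in> T c p \<Longrightarrow> W \<in> T c p \<Longrightarrow> \<Omega> [Z, W] = 0" "Z \<in> T01 T c p \<Longrightarrow> W \<in> T01 T c p \<Longrightarrow> \<Omega> [Z, W] = 0"
proof -
  obtain U \<theta> where o: "contact_form A T U \<theta>" "p \<in> U" "\<Omega> = ext_d \<theta> c p" and c: "c \<in> A" "p \<in> fst c"
    using assms by (auto simp: levi_at_def)
  obtain V F \<epsilon> where fr: "p \<in> V" "frame c V F \<epsilon>" using frame_exists[OF c] by blast
  note H = T_HC[OF c]
  show "\<Omega> [Z, W] = 0" if ZW: "Z \<in> T c p" "W \<in> T c p"
  proof -
    have h: "Z \<in> HC T c p" "W \<in> HC T c p" using ZW H by auto
    have "bracket c (hext F \<epsilon> p Z) (hext F \<epsilon> p W) p \<in> T c p"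
      by (rule T_involutive[OF fr_chd[OF fr(2)] hext_facts(1)[OF fr(2,1) h(1)] hext_facts(1)[OF fr(2,1) h(2)] _ fr(1)])
         (use hext_facts(4)[OF fr(2,1) h(1) ZW(1)] hext_facts(4)[OF fr(2,1) h(2) ZW(2)] in blast)
    then show ?thesis using levi_at_bracket[OF o(1) fr(2) o(2) fr(1) h] contact_HC[OF o(1) c(1) o(2) c(2)] o(3) H by auto
  qed
  show "\<Omega> [Z, W] = 0" if ZW: "Z \<in> T01 T c p" "W \<in> T01 T c p"
  proof -
    have h: "Z \<in> HC T c p" "W \<in> HC T c p" using ZW H by auto
    have "bracket c (hext F \<epsilon> p Z) (hext F \<epsilon> p W) p \<in> T01 T c p"
      by (rule T01_involutive[OF fr_chd[OF fr(2)] hext_facts(1)[OF fr(2,1) h(1)] hext_facts(1)[OF fr(2,1) h(2)] _ fr(1)])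
         (use hext_facts(5)[OF fr(2,1) h(1) ZW(1)] hext_facts(5)[OF fr(2,1) h(2) ZW(2)] in blast)
    then show ?thesis using levi_at_bracket[OF o(1) fr(2) o(2) fr(1) h] contact_HC[OF o(1) c(1) o(2) c(2)] o(3) H by auto
  qed
qed

text \<open>For v = Z + W, pairing with T^{0,1} sees only Z and pairing with T^{1,0} only W.
  Nondegeneracy of the Levi form gives Z = 0, and W = 0 after conjugation.\<close>

lemma levi_at_nondegenerate:
  assumes l: "levi_at c p \<Omega>" and v: "v \<in> HC T c p" "\<And>w. w \<in> HC T c p \<Longrightarrow> \<Omega> [v, w] = 0"
  shows "v = 0"
proof -
  obtain U \<theta> where o: "contact_form A T U \<theta>" "p \<in> U" "\<Omega> = ext_d \<theta> c p" and c: "c \<in> A" "p \<in> fst c"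
    using l by (auto simp: levi_at_def)
  note H = T_HC[OF c] and a = levi_at_alt[OF l]
  obtain Z W where ZW: "Z \<in> T c p" "W \<in> T01 T c p" "v = Z + W" using v(1) HC_iff by blast
  have "Z = 0"
  proof (rule levi_form[OF o(1) c(1) o(2) c(2) ZW(1)])
    fix Y assume "Y \<in> T c p"
    then have y: "vcnj Y \<in> T01 T c p" using vcnj_T by blast
    then have "\<Omega> [v, vcnj Y] = 0" using v(2) H by blast
    then have "\<Omega> [Z, vcnj Y] = 0"
      using levi_at_isotropic(2)[OF l ZW(2) y] by (simp add: ZW(3) alt_Cons_add[OF a])
    then show "levi \<theta> c p Z Y = 0" by (simp add: levi_def o(3))
  qed
  moreover have "vcnj W = 0"
  proof (rule levi_form[OF o(1) c(1) o(2) c(2)])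
    show "vcnj W \<in> T c p" using ZW(2) vcnj_T by blast
    fix Y assume y: "Y \<in> T c p"
    then have "\<Omega> [v, Y] = 0" using v(2) H by blast
    then have "\<Omega> [W, Y] = 0"
      using levi_at_isotropic(1)[OF l ZW(1) y] by (simp add: ZW(3) alt_Cons_add[OF a])
    then have "\<Omega> [vcnj W, vcnj Y] = 0" using levi_at_real[OF l, of "[W, Y]"] by simp
    then show "levi \<theta> c p (vcnj W) Y = 0" by (simp add: levi_def o(3))
  qed
  then have "W = 0" by (metis vcnj_0 vcnj_vcnj)
  ultimately show ?thesis using ZW(3) by simp
qed

lemma HC_transversal_span:
  assumes c: "c \<in> A" "p \<in> fst c" and X: "X \<notin> HC T c p"
  shows "v \<in> vec.span (insert X (HC T c p))"
proof -
  obtain V F \<epsilon> where fr: "p \<in> V" "frame c V F \<epsilon>" using frame_exists[OF c] by blast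
  let ?t = "\<lambda>v. \<epsilon> (2*n) p [v]"
  have "?t X \<noteq> 0" using X fr_HC_iff[OF fr(2,1)] by blast
  then have "v + (- ?t v / ?t X) *s X \<in> HC T c p"
    unfolding fr_HC_iff[OF fr(2,1)] by (simp only: one_form_linear[OF fr_alt[OF fr(2,1)], of "2*n"]) simp
  then have m: "(v + (- ?t v / ?t X) *s X) + (?t v / ?t X) *s X \<in> vec.span (insert X (HC T c p))"
    by (intro vec.span_add[OF _ vec.span_scale] vec.span_base insertI1 insertI2)
  have e: "(v + (- ?t v / ?t X) *s X) + (?t v / ?t X) *s X = v" by (simp add: vec_eq_iff)
  show ?thesis using m unfolding e .
qed

text \<open>Two contact forms have the same kernel at p, hence are proportional there. By the
  bracket formula the same factor relates their derivatives on H, and no derivative of the factor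
  enters.\<close>

lemma levi_at_proportional:
  assumes l: "levi_at c p \<Omega>" "levi_at c p \<Omega>'"
  shows "\<exists>f. f \<noteq> 0 \<and> (\<forall>vs. set vs \<subseteq> HC T c p \<longrightarrow> \<Omega>' vs = f * \<Omega> vs)"
proof -
  obtain U \<theta> where o: "contact_form A T U \<theta>" "p \<in> U" "\<Omega> = ext_d \<theta> c p" and c: "c \<in> A" "p \<in> fst c"
    using l by (auto simp: levi_at_def)
  obtain U' \<theta>' where o': "contact_form A T U' \<theta>'" "p \<in> U'" "\<Omega>' = ext_d \<theta>' c p"
    using l by (auto simp: levi_at_def)
  obtain V F \<epsilon> where fr: "p \<in> V" "frame c V F \<epsilon>" using frame_exists[OF c] by blast
  let ?X = "F (2*n) p"
  have X: "?X \<notin> HC T c p" using fr_HC_iff[OF fr(2,1)] fr_dual[OF fr(2,1)] by simp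
  note a = contact_alt[OF o(1) c(1) o(2) c(2)] and a' = contact_alt[OF o'(1) c(1) o'(2) c(2)]
  note k = contact_HC[OF o(1) c(1) o(2) c(2)] and k' = contact_HC[OF o'(1) c(1) o'(2) c(2)]
  define f where "f = \<theta>' c p [?X] / \<theta> c p [?X]"
  have nz: "\<theta> c p [?X] \<noteq> 0" "f \<noteq> 0" using X k k' by (auto simp: f_def)
  have f: "\<theta>' c p [v] = f * \<theta> c p [v]" for v
  proof -
    let ?w = "v + (- \<theta> c p [v] / \<theta> c p [?X]) *s ?X"
    have "\<theta> c p [?w] = 0" unfolding one_form_linear[OF a] using nz by simp
    then have "\<theta>' c p [?w] = 0" using k k' by blast
    then show ?thesis using nz unfolding one_form_linear[OF a'] f_def by (simp add: field_simps)
  qed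
  have "\<Omega>' vs = f * \<Omega> vs" if vs: "set vs \<subseteq> HC T c p" for vs
  proof (cases "length vs = 2")
    case True
    then obtain v w where vw: "vs = [v, w]" by (auto simp: length_Suc_conv numeral_2_eq_2)
    then show ?thesis
      using levi_at_bracket[OF o(1) fr(2) o(2) fr(1), of v w] levi_at_bracket[OF o'(1) fr(2) o'(2) fr(1), of v w] vs f o(3) o'(3)
      by simp
  next
    case False
    then show ?thesis using alt_length[OF levi_at_alt[OF l(1)]] alt_length[OF levi_at_alt[OF l(2)]] by simp
  qed
  then show ?thesis using nz by blast
qed

text \<open>\<open>reeb\<close> is a definite description, so existence, uniqueness and reality of
  the solution come first. The conclusion says that the Reeb vector is transversal to H, the form in
  which it is used later.\<close>

lemma contact_reeb:
  assumes ct: "contact_form A T U \<theta>" and c: "c \<in> A" "p \<in> U" "p \<in> fst c"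
  shows "\<theta> c p [cvec (reeb \<theta> c p)] = 1"
proof -
  let ?\<Omega> = "ext_d \<theta> c p"
  have l: "levi_at c p ?\<Omega>" using ct c by (auto simp: levi_at_def)
  note a = levi_at_alt[OF l] and ta = contact_alt[OF assms] and tk = contact_HC[OF assms]
  obtain V F \<epsilon> where fr: "p \<in> V" "frame c V F \<epsilon>" using frame_exists[OF c(1,3)] by blast
  have lin2: "?\<Omega> [v, x + y] = ?\<Omega> [v, x] + ?\<Omega> [v, y]" "?\<Omega> [v, z *s x] = z * ?\<Omega> [v, x]" for v x y z
    using one_form_linear[OF con_alt[of ?\<Omega> 1 v]] a by (simp_all add: numeral_2_eq_2 con_apply)
  \<comment> \<open>There are 2n linear conditions on a space of dimension 2n + 1.\<close>
  have "\<exists>v\<in>(UNIV :: (complex ^ 'd) set). v \<noteq> 0 \<and> (\<forall>w\<in>set (map (\<lambda>j. F j p) [0..<2*n]). ?\<Omega> [v, w] = 0)"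
    by (rule exists_common_kernel)
       (use card_d in \<open>auto simp: alt_Cons_add[OF a] alt_Cons_smult[OF a] card_cart_basis\<close>)
  then obtain v where v: "v \<noteq> 0" "\<And>j. j < 2*n \<Longrightarrow> ?\<Omega> [v, F j p] = 0" by auto
  have om0: "?\<Omega> [v, w] = 0" if w: "w \<in> HC T c p" for w
  proof -
    have "?\<Omega> [v, \<Sum>j<m. z j *s F j p] = (\<Sum>j<m. z j * ?\<Omega> [v, F j p])" for z m
    proof (induction m)
      case 0 then show ?case using lin2(2)[of v 0 0] by simp
    qed (simp add: lin2)
    from this[of "\<lambda>j. \<epsilon> j p [w]" "2*n"] show ?thesis using fr_HC_dual[OF fr(2,1) w] v(2) by simp
  qed
  have vH: "v \<notin> HC T c p" using levi_at_nondegenerate[OF l _ om0] v(1) by blast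
  then have tv: "\<theta> c p [v] \<noteq> 0" using tk by blast
  define R where "R = (1 / \<theta> c p [v]) *s v"
  have R1: "\<theta> c p [R] = 1" using tv by (simp add: R_def one_form_linear[OF ta])
  have R2: "?\<Omega> [R, w] = 0" for w
  proof -
    let ?b = "\<theta> c p [w] / \<theta> c p [v]"
    let ?h = "w + (- ?b) *s v"
    have "\<theta> c p [?h] = 0" unfolding one_form_linear[OF ta] using tv by simp
    then have "?\<Omega> [v, ?h] = 0" using om0 tk by blast
    then have "?\<Omega> [v, w] = 0" using alt_repeat_Cons[OF a, of v "[]"] by (simp only: lin2) simp
    then show ?thesis by (simp add: R_def alt_Cons_smult[OF a])
  qed
  have uniq: "R' = R" if "\<theta> c p [R'] = 1" "\<And>w. ?\<Omega> [R', w] = 0" for R'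
  proof -
    have "\<theta> c p [R' + (-1) *s R] = 0" unfolding one_form_linear[OF ta] using that R1 by simp
    then have "R' + (-1) *s R = 0"
      by (intro levi_at_nondegenerate[OF l]) (simp_all only: tk alt_Cons_add[OF a] alt_Cons_smult[OF a] that R2, simp_all)
    then show ?thesis by (simp add: vec_eq_iff)
  qed
  \<comment> \<open>The conjugate satisfies the same equations, so uniqueness makes the complex
    solution real.\<close>
  have "vcnj R = R"
  proof (rule uniq)
    show "\<theta> c p [vcnj R] = 1" using contact_facts(3)[OF ct, of c p "[R]"] R1 by simp
    show "?\<Omega> [vcnj R, w] = 0" for w using levi_at_real[OF l, of "[R, vcnj w]"] R2 by simp
  qed
  then have "cvec (vRe R) = R" by (simp add: vec_eq_iff complex_eq_iff)
  then have "\<theta> c p [cvec (vRe R)] = 1 \<and> (\<forall>w. ?\<Omega> [cvec (vRe R), w] = 0)" using R1 R2 by simp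
  then have "\<theta> c p [cvec (reeb \<theta> c p)] = 1 \<and> (\<forall>w. ?\<Omega> [cvec (reeb \<theta> c p), w] = 0)"
    unfolding reeb_def
  proof (rule theI)
    fix x assume x: "\<theta> c p [cvec x] = 1 \<and> (\<forall>w. ?\<Omega> [cvec x, w] = 0)"
    then have "cvec x = cvec (vRe R)" using uniq \<open>cvec (vRe R) = R\<close> by simp
    then show "x = vRe R" by (simp add: vec_eq_iff)
  qed
  then show ?thesis by blast
qed

end

section \<open>Complex Rumin forms\<close>

lemma wedge_power_scale:
  assumes "\<And>vs. set vs \<subseteq> S \<Longrightarrow> \<Omega>' vs = f * \<Omega> vs" "set vs \<subseteq> S"
  shows "wedge_power \<Omega>' m vs = f ^ m * wedge_power \<Omega> m vs"
  using assms(2)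
proof (induction m arbitrary: vs)
  case (Suc m)
  have "wedge \<Omega>' (wedge_power \<Omega>' m) vs = wedge (\<lambda>vs. f * \<Omega> vs) (\<lambda>vs. f ^ m * wedge_power \<Omega> m vs) vs"
    by (rule wedge_cong_on[of S]) (use assms(1) Suc in auto)
  then show ?case by (simp add: wedge_smult_left wedge_smult_right)
qed simp

lemma wedge_power_pullback: "wedge_power (\<lambda>vs. \<Omega> (map f vs)) m = (\<lambda>vs. wedge_power \<Omega> m (map f vs))"
proof (induction m)
  case (Suc m)
  show ?case unfolding wedge_power.simps Suc by (rule ext) (rule wedge_pullback)
qed (simp add: wedge_one_def fun_eq_iff)

lemma wedge_power_cnj_pullback:
  "wedge_power (\<lambda>vs. cnj (\<Omega> (map f vs))) m = (\<lambda>vs. cnj (wedge_power \<Omega> m (map f vs)))"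
proof (induction m)
  case (Suc m)
  show ?case unfolding wedge_power.simps Suc by (rule ext) (rule wedge_cnj_pullback)
qed (simp add: wedge_one_def fun_eq_iff)

lemma alt_vanish_card:
  assumes a: "\<alpha> \<in> alt_forms k" and B: "finite B" "card B < k" shows "vanish (vec.span B) \<alpha>"
proof (rule alt_vanish_span[OF a])
  show "vanish B \<alpha>" unfolding vanish_def
  proof (intro allI impI)
    fix vs assume vs: "set vs \<subseteq> B"
    have "\<not> (length vs = k \<and> distinct vs)"
      using card_mono[OF B(1) vs] B(2) distinct_card[of vs] by auto
    then consider "length vs \<noteq> k" | i j where "length vs = k" "i < k" "j < k" "i \<noteq> j" "vs ! i = vs ! j"
      unfolding distinct_conv_nth by blast
    then show "\<alpha> vs = 0" using alt_length[OF a] alt_repeat[OF a] by cases blast+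
  qed
qed

lemma alt_forms_big:
  assumes "(\<alpha> :: (complex ^ 'd::finite) list \<Rightarrow> complex) \<in> alt_forms k" "CARD('d) < k" shows "\<alpha> = (\<lambda>_. 0)"
proof -
  have "vec.span (cart_basis :: (complex ^ 'd) set) = UNIV" using vec.span_Basis by blast
  then show ?thesis
    using alt_vanish_card[OF assms(1), of cart_basis] assms(2) by (auto simp: vanish_def card_cart_basis finite_cart_basis)
qed

context cr
begin

text \<open>The conditions defining Rumin forms at a point, on the values \<open>a\<close> of $\omega$ and \<open>b\<close> of $d\omega$.\<close>

definition rumin_at :: "nat \<Rightarrow> ('m, 'd) chart \<Rightarrow> 'm \<Rightarrow> ((complex ^ 'd) list \<Rightarrow> complex) \<Rightarrow> ((complex ^ 'd) list \<Rightarrow> complex) \<Rightarrow> ((complex ^ 'd) list \<Rightarrow> complex) \<Rightarrow> bool" where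
  "rumin_at k c p \<Omega> a b \<longleftrightarrow>
     (if k \<le> n then vanish (HC T c p) (wedge a (wedge_power \<Omega> (n + 1 - k))) \<and> vanish (HC T c p) (wedge b (wedge_power \<Omega> (n - k)))
      else vanish (HC T c p) a \<and> vanish (HC T c p) b)"

lemma wedge_levi_at_vanish:
  assumes "levi_at c p \<Omega>" "levi_at c p \<Omega>'" "vanish (HC T c p) (wedge a (wedge_power \<Omega> m))"
  shows "vanish (HC T c p) (wedge a (wedge_power \<Omega>' m))"
proof -
  obtain f where f: "\<And>vs. set vs \<subseteq> HC T c p \<Longrightarrow> \<Omega>' vs = f * \<Omega> vs"
    using levi_at_proportional[OF assms(1,2)] by blast
  have "wedge a (wedge_power \<Omega>' m) vs = f ^ m * wedge a (wedge_power \<Omega> m) vs" if "set vs \<subseteq> HC T c p" for vs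
  proof -
    have "wedge a (wedge_power \<Omega>' m) vs = wedge a (\<lambda>vs. f ^ m * wedge_power \<Omega> m vs) vs"
      by (rule wedge_cong_on[OF refl _ that]) (rule wedge_power_scale[OF f])
    then show ?thesis by (simp add: wedge_smult_right)
  qed
  then show ?thesis using assms(3) by (simp add: vanish_def)
qed

lemma rumin_at_indep: "levi_at c p \<Omega> \<Longrightarrow> levi_at c p \<Omega>' \<Longrightarrow> rumin_at k c p \<Omega> a b \<Longrightarrow> rumin_at k c p \<Omega>' a b"
  using wedge_levi_at_vanish[of c p \<Omega> \<Omega>' a "n + 1 - k"] wedge_levi_at_vanish[of c p \<Omega> \<Omega>' b "n - k"]
  unfolding rumin_at_def by (cases "k \<le> n") simp_all

lemma rumin_at_add: "rumin_at k c p \<Omega> a b \<Longrightarrow> rumin_at k c p \<Omega> a' b' \<Longrightarrow> rumin_at k c p \<Omega> (\<lambda>vs. a vs + a' vs) (\<lambda>vs. b vs + b' vs)"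
  by (auto simp: rumin_at_def vanish_def wedge_add_left)

lemma rumin_at_smult: "rumin_at k c p \<Omega> a b \<Longrightarrow> rumin_at k c p \<Omega> (\<lambda>vs. z * a vs) (\<lambda>vs. z * b vs)"
  by (auto simp: rumin_at_def vanish_def wedge_smult_left)

lemma vanish_cnj: "vanish (HC T c p) \<alpha> \<Longrightarrow> vanish (HC T c p) (\<lambda>vs. cnj (\<alpha> (map vcnj vs)))"
proof (unfold vanish_def, intro allI impI)
  fix vs assume *: "\<forall>vs. set vs \<subseteq> HC T c p \<longrightarrow> \<alpha> vs = 0" "set vs \<subseteq> HC T c p"
  have "set (map vcnj vs) \<subseteq> HC T c p" using *(2) vcnj_HC[of _ c p] by auto
  then show "cnj (\<alpha> (map vcnj vs)) = 0" using *(1) by simp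
qed

lemma rumin_at_cnj:
  assumes l: "levi_at c p \<Omega>" and "rumin_at k c p \<Omega> a b"
  shows "rumin_at k c p \<Omega> (\<lambda>vs. cnj (a (map vcnj vs))) (\<lambda>vs. cnj (b (map vcnj vs)))"
proof -
  have "\<Omega> = (\<lambda>vs. cnj (\<Omega> (map vcnj vs)))" using levi_at_real[OF l] by simp
  then have "wedge_power \<Omega> m = (\<lambda>vs. cnj (wedge_power \<Omega> m (map vcnj vs)))" for m
    using wedge_power_cnj_pullback[of \<Omega> vcnj m] by simp
  then have "wedge (\<lambda>vs. cnj (e (map vcnj vs))) (wedge_power \<Omega> m) = (\<lambda>vs. cnj (wedge e (wedge_power \<Omega> m) (map vcnj vs)))" for e m
    using wedge_cnj_pullback[of e vcnj "wedge_power \<Omega> m"] by (metis ext)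
  then show ?thesis using assms(2) vanish_cnj unfolding rumin_at_def by (simp split: if_splits)
qed

text \<open>Complex Rumin forms without reference to a choice of contact forms: the conditions are
  imposed on H, for every possible value of d\<theta>.\<close>

definition RC :: "nat \<Rightarrow> ('m, 'd) form set" where
  "RC k = {\<omega> \<in> forms A UNIV k. \<forall>c\<in>A. \<forall>p\<in>fst c. \<forall>\<Omega>. levi_at c p \<Omega> \<longrightarrow> rumin_at k c p \<Omega> (\<omega> c p) (ext_d \<omega> c p)}"

lemma RC_forms: "\<omega> \<in> RC k \<Longrightarrow> \<omega> \<in> forms A UNIV k"
  by (simp add: RC_def)

lemma RC_rumin_at: "\<omega> \<in> RC k \<Longrightarrow> levi_at c p \<Omega> \<Longrightarrow> rumin_at k c p \<Omega> (\<omega> c p) (ext_d \<omega> c p)"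
  unfolding RC_def levi_at_def by blast

lemma RCI:
  assumes "\<omega> \<in> forms A UNIV k" "\<And>c p. c \<in> A \<Longrightarrow> p \<in> fst c \<Longrightarrow> \<exists>\<Omega>. levi_at c p \<Omega> \<and> rumin_at k c p \<Omega> (\<omega> c p) (ext_d \<omega> c p)"
  shows "\<omega> \<in> RC k"
  using assms rumin_at_indep unfolding RC_def by blast

lemma RC_0: "0 \<in> RC k"
proof -
  have "ext_d (0 :: ('m, 'd) form) = 0" by (auto simp: fun_eq_iff ext_d_dl zero_fun_def)
  then show ?thesis
    using forms_0[of UNIV k] by (auto simp: RC_def rumin_at_def zero_fun_def vanish_def)
qed

lemma RC_add:
  assumes "\<omega> \<in> RC k" "\<eta> \<in> RC k" shows "\<omega> + \<eta> \<in> RC k"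
proof -
  have "rumin_at k c p \<Omega> ((\<omega> + \<eta>) c p) (ext_d (\<omega> + \<eta>) c p)" if "levi_at c p \<Omega>" for c p \<Omega>
    using rumin_at_add[OF RC_rumin_at[OF assms(1) that] RC_rumin_at[OF assms(2) that]]
    unfolding ext_d_add[OF RC_forms[OF assms(1)] RC_forms[OF assms(2)]] by (simp add: plus_fun_def)
  then show ?thesis using forms_add[OF open_UNIV RC_forms[OF assms(1)] RC_forms[OF assms(2)]] by (simp add: RC_def)
qed

lemma RC_fscale:
  assumes "\<omega> \<in> RC k" shows "fscale z \<omega> \<in> RC k"
proof -
  have "rumin_at k c p \<Omega> (fscale z \<omega> c p) (ext_d (fscale z \<omega>) c p)" if "levi_at c p \<Omega>" for c p \<Omega>
    using rumin_at_smult[OF RC_rumin_at[OF assms that], of z]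
    unfolding ext_d_fscale[OF RC_forms[OF assms]] by (simp add: fscale_def[abs_def])
  then show ?thesis using forms_fscale[OF open_UNIV RC_forms[OF assms]] by (simp add: RC_def)
qed

lemma RC_fcnj:
  assumes "\<omega> \<in> RC k" shows "fcnj \<omega> \<in> RC k"
proof -
  have "rumin_at k c p \<Omega> (fcnj \<omega> c p) (ext_d (fcnj \<omega>) c p)" if "levi_at c p \<Omega>" for c p \<Omega>
    using rumin_at_cnj[OF that RC_rumin_at[OF assms that]]
    unfolding ext_d_fcnj[OF RC_forms[OF assms]] by (simp add: fcnj_def[abs_def])
  then show ?thesis using forms_fcnj[OF open_UNIV RC_forms[OF assms]] by (simp add: RC_def)
qed

lemma RC_sum: "(\<And>i. i \<in> I \<Longrightarrow> f i \<in> RC k) \<Longrightarrow> (\<Sum>i\<in>I. f i) \<in> RC k"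
  by (induction I rule: infinite_finite_induct) (auto intro: RC_0 RC_add)

lemma fscale_neg1: "- \<omega> = fscale (-1) \<omega>"
  by (simp add: fscale_def[abs_def] fun_Compl_def)

lemma RC_uminus: "\<omega> \<in> RC k \<Longrightarrow> - \<omega> \<in> RC k"
  unfolding fscale_neg1 by (rule RC_fscale)

lemma RC_diff: "\<omega> \<in> RC k \<Longrightarrow> \<eta> \<in> RC k \<Longrightarrow> \<omega> - \<eta> \<in> RC k"
  using RC_add[OF _ RC_uminus, of \<omega> k \<eta>] by simp

lemma wedge_power_0_vanish:
  assumes "\<alpha> \<in> alt_forms k" shows "vanish S (wedge \<alpha> (wedge_power \<Omega> 0)) \<longleftrightarrow> vanish S \<alpha>"
  by (simp add: wedge_one_right[OF assms])

theorem RC_ext_d: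
  assumes "\<omega> \<in> RC k" shows "ext_d \<omega> \<in> RC (Suc k)"
proof -
  note f = RC_forms[OF assms]
  have "rumin_at (Suc k) c p \<Omega> (ext_d \<omega> c p) (ext_d (ext_d \<omega>) c p)" if l: "levi_at c p \<Omega>" for c p \<Omega>
  proof -
    have c: "c \<in> A" "p \<in> fst c" using l by (auto simp: levi_at_def)
    note r = RC_rumin_at[OF assms l]
    have z: "vanish (HC T c p) (wedge (ext_d (ext_d \<omega>) c p) \<beta>)" "vanish (HC T c p) (ext_d (ext_d \<omega>) c p)" for \<beta>
      by (simp_all add: ext_d_ext_d[OF f] zero_fun_def vanish_def)
    show ?thesis
    \<comment> \<open>For k = n the second condition has exponent 0 and says that d\<omega> vanishes
      on H, which is the first condition in degree n + 1. For k < n the exponents n - k and n + 1 -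
      (k + 1) agree.\<close>
    proof (cases "k = n")
      case True
      then have "vanish (HC T c p) (ext_d \<omega> c p)"
        using r wedge_power_0_vanish[OF forms_alt[OF forms_ext_d[OF f] c(1) UNIV_I c(2)]] by (simp add: rumin_at_def)
      then show ?thesis using True z by (simp add: rumin_at_def)
    next
      case False
      then show ?thesis using r z by (auto simp: rumin_at_def)
    qed
  qed
  then show ?thesis using forms_ext_d[OF f] by (simp add: RC_def)
qed

lemma RC_big:
  assumes "2 * n + 1 < k" shows "RC k = {0}"
proof -
  have "\<omega> = 0" if "\<omega> \<in> RC k" for \<omega>
    by (rule form_eqI[OF RC_forms[OF that] forms_0[OF open_UNIV]])
       (use alt_forms_big[OF forms_alt[OF RC_forms[OF that] _ UNIV_I]] assms card_d in auto)
  then show ?thesis using RC_0 by blast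
qed

lemma T_pure_HC:
  assumes "c \<in> A" "p \<in> fst c" "\<alpha> \<in> alt_forms k" "vanish (T c p \<union> T01 T c p) \<alpha>"
  shows "vanish (HC T c p) \<alpha>"
  using alt_vanish_span[OF assms(3,4)] HC_span[of c p] unfolding vanish_def by blast

text \<open>A form vanishing on H is \<theta> times its contraction \<beta>. Differentiating this
  product leaves on H only d\<theta> times \<beta>, without derivatives of \<beta>; the second Rumin
  condition becomes algebraic.\<close>

lemma frame_factor:
  assumes fr: "frame c V F \<epsilon>" and g: "lform c V (Suc k) g" and van: "\<forall>q\<in>V. vanish (HC T c q) (g q)"
  defines "\<beta> \<equiv> conX (F (2*n)) g"
  shows "lform c V k \<beta>" "q \<in> V \<Longrightarrow> g q = wedge (\<epsilon> (2*n) q) (\<beta> q)"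
    "q \<in> V \<Longrightarrow> set vs \<subseteq> HC T c q \<Longrightarrow> dl c g q vs = wedge (dl c (\<epsilon> (2*n)) q) (\<beta> q) vs"
proof -
  note ch = fr_chd[OF fr] and th = fr_lform[OF fr order_refl]
  show b: "lform c V k \<beta>" using lform_conX[OF g fr_smooth[OF fr order_refl]] by (simp add: \<beta>_def)
  have th0: "\<epsilon> (2*n) q [v] = 0" if "q \<in> V" "v \<in> HC T c q" for q v using fr_HC_iff[OF fr that(1)] that(2) by blast
  have X: "\<epsilon> (2*n) q [F (2*n) q] = 1" if "q \<in> V" for q using fr_dual[OF fr that] by simp
  have sp: "v \<in> vec.span (insert (F (2*n) q) (HC T c q))" if "q \<in> V" for q v
    by (rule HC_transversal_span[OF fr_chart(1)[OF fr] fr_chart(2)[OF fr that]]) (use fr_HC_iff[OF fr that] X[OF that] in auto)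
  show fac: "g q = wedge (\<epsilon> (2*n) q) (\<beta> q)" if q: "q \<in> V" for q
    using alt_factor[OF fr_alt[OF fr q order_refl] lform_alt[OF g q] th0[OF q] X[OF q] sp[OF q] bspec[OF van q]]
    by (simp add: \<beta>_def conX_def)
  assume q: "q \<in> V" and vs: "set vs \<subseteq> HC T c q"
  have "dl c g q vs = dl c (\<lambda>q. wedge (\<epsilon> (2*n) q) (\<beta> q)) q vs"
    by (rule dl_cong[OF ch _ q]) (simp add: fac)
  also have "\<dots> = wedge (dl c (\<epsilon> (2*n)) q) (\<beta> q) vs - wedge (\<epsilon> (2*n) q) (dl c \<beta> q) vs"
    using dl_wedge[OF th b q] by simp
  also have "wedge (\<epsilon> (2*n) q) (dl c \<beta> q) vs = 0"
    using wedge_vanish_left[of "HC T c q" "\<epsilon> (2*n) q"] one_form_vanish[OF fr_alt[OF fr q order_refl]] th0[OF q] vs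
    by (simp add: vanish_def)
  finally show "dl c g q vs = wedge (dl c (\<epsilon> (2*n)) q) (\<beta> q) vs" by simp
qed

lemma lform_restrict_frame:
  assumes "frame c V F \<epsilon>" "open W" "W \<subseteq> V" shows "frame c W F \<epsilon>"
  using assms(1) chd_subset[OF _ assms(2,3)] smooth_in_subset[OF _ assms(3)] lform_subset[OF _ assms(2,3)] assms(3)
  unfolding frame_def by blast

text \<open>The form is \<theta> times some \<beta> of degree k - 1, and the second condition says
  that \<beta> times \<Omega>^(n-k+1) vanishes on H. Since (k-1) + (n-k+1) = n, this is just within
  the range of Lefschetz injectivity, so \<beta> vanishes on H.\<close>

theorem rumin_unique_local:
  assumes g: "lform c V k g" and k: "k \<le> n" and van: "\<forall>q\<in>V. vanish (HC T c q) (g q)"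
    and p: "p \<in> V" and l: "levi_at c p \<Omega>" and d: "vanish (HC T c p) (wedge (dl c g p) (wedge_power \<Omega> (n - k)))"
  shows "g p = (\<lambda>_. 0)"
proof (cases k)
  case 0
  then show ?thesis using lform_alt[OF g p] bspec[OF van p] unfolding alt_forms_0_iff vanish_def
    by (metis (no_types, opaque_lifting) empty_set empty_subsetI alt_forms_0_iff)
next
  case (Suc j)
  have c: "c \<in> A" "p \<in> fst c" using lform_chd[OF g] p by (auto simp: chd_def)
  obtain V' F \<epsilon> where fr': "p \<in> V'" "frame c V' F \<epsilon>" using frame_exists[OF c] by blast
  define W where "W = V \<inter> V'"
  have oW: "open W" using lform_chd[OF g] fr_chd[OF fr'(2)] by (auto simp: W_def chd_def)
  have fr: "frame c W F \<epsilon>" by (rule lform_restrict_frame[OF fr'(2) oW]) (simp add: W_def)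
  have pW: "p \<in> W" using p fr' by (simp add: W_def)
  have gW: "lform c W (Suc j) g" using lform_subset[OF g oW] Suc by (simp add: W_def)
  have vW: "\<forall>q\<in>W. vanish (HC T c q) (g q)" using van by (simp add: W_def)
  define \<beta> where "\<beta> = conX (F (2*n)) g"
  note fac = frame_factor[OF fr gW vW, folded \<beta>_def]
  let ?\<Omega> = "dl c (\<epsilon> (2*n)) p"
  have lo: "levi_at c p ?\<Omega>" by (rule frame_levi_at[OF fr pW])
  note O = levi_at_alt[OF lo] and b = lform_alt[OF fac(1) pW]
  have 1: "vanish (HC T c p) (wedge (dl c g p) (wedge_power ?\<Omega> (n - k)))" by (rule wedge_levi_at_vanish[OF l lo d])
  have "wedge (dl c g p) (wedge_power ?\<Omega> (n - k)) vs = wedge (wedge ?\<Omega> (\<beta> p)) (wedge_power ?\<Omega> (n - k)) vs"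
    if "set vs \<subseteq> HC T c p" for vs
    by (rule wedge_cong_on[OF _ refl that]) (rule fac(3)[OF pW])
  then have "vanish (HC T c p) (wedge (wedge (\<beta> p) ?\<Omega>) (wedge_power ?\<Omega> (n - k)))"
    using 1 by (simp add: vanish_def wedge_2_commute[OF O b])
  then have L: "vanish (HC T c p) (wedge (\<beta> p) (wedge_power ?\<Omega> (Suc (n - k))))"
    using wedge_power_Suc_right(2)[OF O b, of "n - k"] by simp
  have "vanish (HC T c p) (\<beta> p)"
  proof (rule lefschetz_injective[OF O HC_subspace[OF c] HC_dim_le[OF c] _ b _ L])
    show "v = 0" if "v \<in> HC T c p" "\<And>w. w \<in> HC T c p \<Longrightarrow> ?\<Omega> [v, w] = 0" for v
      by (rule levi_at_nondegenerate[OF lo that])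
  qed (use Suc k in simp)
  then have "vanish (HC T c p) (con (F (2*n) p) (g p))" by (simp add: \<beta>_def conX_def)
  moreover have "F (2*n) p \<notin> HC T c p" using fr_HC_iff[OF fr pW] fr_dual[OF fr pW] by simp
  ultimately show ?thesis
    using alt_eq_zero[OF lform_alt[OF g p] bspec[OF van p] _ HC_transversal_span[OF c]] by blast
qed

subsection \<open>Independence of the contact forms\<close>

lemma contact_wedge_0:
  assumes ct: "contact_form A T U \<theta>" and c: "c \<in> A" "p \<in> U" "p \<in> fst c" and a: "\<alpha> \<in> alt_forms j"
  shows "wedge (\<theta> c p) \<alpha> = 0 \<longleftrightarrow> vanish (HC T c p) \<alpha>"
proof -
  obtain e where "cvec e \<notin> HC T c p" using exists_transversal[OF c(1,3)] by blast
  then show ?thesis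
    unfolding zero_fun_def
    using wedge_one_form_eq_0_iff[OF contact_alt[OF ct c] a _ _ HC_transversal_span[OF c(1,3)], of "cvec e"]
      contact_HC[OF ct c] by blast
qed

lemma contact_rumin_at:
  assumes ct: "contact_form A T U \<theta>" and c: "c \<in> A" "p \<in> U" "p \<in> fst c"
    and w: "\<omega> \<in> forms A UNIV k"
  shows "rumin_at k c p (ext_d \<theta> c p) (\<omega> c p) (ext_d \<omega> c p) \<longleftrightarrow>
    (if k \<le> n then wedge (\<theta> c p) (wedge (\<omega> c p) (wedge_power (ext_d \<theta> c p) (n + 1 - k))) = 0 \<and>
           wedge (\<theta> c p) (wedge (ext_d \<omega> c p) (wedge_power (ext_d \<theta> c p) (n - k))) = 0
     else wedge (\<theta> c p) (\<omega> c p) = 0 \<and> wedge (\<theta> c p) (ext_d \<omega> c p) = 0)"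
proof -
  have "levi_at c p (ext_d \<theta> c p)" unfolding levi_at_def using ct c by blast
  note P = wedge_power_alt[OF levi_at_alt[OF this]]
  note wa = forms_alt[OF w c(1) UNIV_I c(3)] and da = forms_alt[OF forms_ext_d[OF w] c(1) UNIV_I c(3)]
  show ?thesis
    unfolding rumin_at_def contact_wedge_0[OF ct c wedge_alt[OF wa P]] contact_wedge_0[OF ct c wedge_alt[OF da P]]
      contact_wedge_0[OF ct c wa] contact_wedge_0[OF ct c da]
    by (rule refl)
qed

lemma contact_choiceD:
  assumes "contact_choice A T C"
  shows "(U, \<theta>) \<in> C \<Longrightarrow> contact_form A T U \<theta>" "\<exists>U \<theta>. (U, \<theta>) \<in> C \<and> p \<in> U"
proof -
  have 1: "\<forall>(U, \<theta>)\<in>C. contact_form A T U \<theta>" and 2: "(\<Union>(U, \<theta>)\<in>C. U) = UNIV"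
    using assms unfolding contact_choice_def by (rule conjunct1, rule conjunct2)
  show "(U, \<theta>) \<in> C \<Longrightarrow> contact_form A T U \<theta>" using bspec[OF 1, of "(U, \<theta>)"] by simp
  have "p \<in> (\<Union>(U, \<theta>)\<in>C. U)" unfolding 2 by simp
  then show "\<exists>U \<theta>. (U, \<theta>) \<in> C \<and> p \<in> U" by auto
qed

text \<open>One contact form at each point suffices, because the conditions pass from one value of
  d\<theta> to any other. This is where the choice of contact forms drops out.\<close>

lemma contact_choice_rumin_at:
  fixes \<omega> :: "('m, 'd) form" and C :: "('m set \<times> ('m, 'd) form) set"
  assumes C: "contact_choice A T C"
  shows "(\<forall>(U, \<theta>)\<in>C. \<forall>c\<in>A. \<forall>p\<in>U \<inter> fst c. rumin_at k c p (ext_d \<theta> c p) (\<omega> c p) (ext_d \<omega> c p)) \<longleftrightarrow>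
     (\<forall>c\<in>A. \<forall>p\<in>fst c. \<forall>\<Omega>. levi_at c p \<Omega> \<longrightarrow> rumin_at k c p \<Omega> (\<omega> c p) (ext_d \<omega> c p))"
proof (intro iffI ballI allI impI)
  fix c p \<Omega>
  assume L: "\<forall>(U, \<theta>)\<in>C. \<forall>c\<in>A. \<forall>p\<in>U \<inter> fst c. rumin_at k c p (ext_d \<theta> c p) (\<omega> c p) (ext_d \<omega> c p)"
  assume c: "c \<in> A" "p \<in> fst c" and l: "levi_at c p \<Omega>"
  obtain U \<theta> where U: "(U, \<theta>) \<in> C" "p \<in> U" using contact_choiceD(2)[OF C] by blast
  note ct = contact_choiceD(1)[OF C U(1)]
  have r: "rumin_at k c p (ext_d \<theta> c p) (\<omega> c p) (ext_d \<omega> c p)" using bspec[OF L U(1)] U(2) c by blast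
  have "levi_at c p (ext_d \<theta> c p)" unfolding levi_at_def using ct U c by blast
  then show "rumin_at k c p \<Omega> (\<omega> c p) (ext_d \<omega> c p)" using rumin_at_indep[OF _ l r] by blast
next
  fix x
  assume R: "\<forall>c\<in>A. \<forall>p\<in>fst c. \<forall>\<Omega>. levi_at c p \<Omega> \<longrightarrow> rumin_at k c p \<Omega> (\<omega> c p) (ext_d \<omega> c p)" and x: "x \<in> C"
  obtain U \<theta> where U: "x = (U, \<theta>)" by (cases x)
  have ct: "contact_form A T U \<theta>" by (rule contact_choiceD(1)[OF C]) (use x U in simp)
  have "rumin_at k c p (ext_d \<theta> c p) (\<omega> c p) (ext_d \<omega> c p)" if c: "c \<in> A" "p \<in> U \<inter> fst c" for c p
  proof -
    have "levi_at c p (ext_d \<theta> c p)" unfolding levi_at_def using ct c by blast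
    then show ?thesis using R c by blast
  qed
  then show "case x of (U, \<theta>) \<Rightarrow> \<forall>c\<in>A. \<forall>p\<in>U \<inter> fst c. rumin_at k c p (ext_d \<theta> c p) (\<omega> c p) (ext_d \<omega> c p)"
    unfolding U prod.case by blast
qed

theorem rumin_RC:
  assumes C: "contact_choice A T C"
  shows "rumin n A C k = {\<omega> \<in> RC k. real_form \<omega>}"
proof (cases "k \<le> 2 * n + 1")
  case False
  have "real_form (0 :: ('m, 'd) form)" by (simp add: real_form_def fcnj_def[abs_def] zero_fun_def)
  then show ?thesis using RC_big[of k] False by (auto simp: rumin_def)
next
  case True
  note ct = contact_choiceD(1)[OF C]
  have "\<omega> \<in> rumin n A C k \<longleftrightarrow> \<omega> \<in> forms A UNIV k \<and> real_form \<omega> \<and>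
     (\<forall>(U, \<theta>)\<in>C. \<forall>c\<in>A. \<forall>p\<in>U \<inter> fst c. rumin_at k c p (ext_d \<theta> c p) (\<omega> c p) (ext_d \<omega> c p))" for \<omega>
  proof (cases "\<omega> \<in> forms A UNIV k")
    case w: True
    have "(\<forall>(U, \<theta>)\<in>C. \<forall>c\<in>A. \<forall>p\<in>U \<inter> fst c. rumin_at k c p (ext_d \<theta> c p) (\<omega> c p) (ext_d \<omega> c p)) \<longleftrightarrow>
      (\<forall>(U, \<theta>)\<in>C. \<forall>c\<in>A. \<forall>p\<in>U \<inter> fst c.
       (if k \<le> n then wedge (\<theta> c p) (wedge (\<omega> c p) (wedge_power (ext_d \<theta> c p) (n + 1 - k))) = 0 \<and>
           wedge (\<theta> c p) (wedge (ext_d \<omega> c p) (wedge_power (ext_d \<theta> c p) (n - k))) = 0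
        else wedge (\<theta> c p) (\<omega> c p) = 0 \<and> wedge (\<theta> c p) (ext_d \<omega> c p) = 0))"
    proof (intro ball_cong refl)
      fix x assume x: "x \<in> C"
      obtain U \<theta> where U: "x = (U, \<theta>)" by (cases x)
      show "(case x of (U, \<theta>) \<Rightarrow> \<forall>c\<in>A. \<forall>p\<in>U \<inter> fst c. rumin_at k c p (ext_d \<theta> c p) (\<omega> c p) (ext_d \<omega> c p)) \<longleftrightarrow>
       (case x of (U, \<theta>) \<Rightarrow> \<forall>c\<in>A. \<forall>p\<in>U \<inter> fst c.
       (if k \<le> n then wedge (\<theta> c p) (wedge (\<omega> c p) (wedge_power (ext_d \<theta> c p) (n + 1 - k))) = 0 \<and>
           wedge (\<theta> c p) (wedge (ext_d \<omega> c p) (wedge_power (ext_d \<theta> c p) (n - k))) = 0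
        else wedge (\<theta> c p) (\<omega> c p) = 0 \<and> wedge (\<theta> c p) (ext_d \<omega> c p) = 0))"
        unfolding U prod.case
        by (intro ball_cong refl contact_rumin_at[OF ct _ _ _ w]) (use x U in auto)
    qed
    then show ?thesis
      unfolding rumin_def using w True by (cases "k \<le> n") (simp_all only: if_True if_False mem_Collect_eq simp_thms)
  next
    case False
    then show ?thesis
      unfolding rumin_def using True by (cases "k \<le> n") (simp_all only: if_True if_False mem_Collect_eq simp_thms)
  qed
  then show ?thesis unfolding contact_choice_rumin_at[OF C] RC_def by blast
qed

lemma fRe_fIm: "fRe \<omega> + fscale \<i> (fIm \<omega>) = \<omega>"
  by (simp add: fRe_def fIm_def fscale_def[abs_def] plus_fun_def fun_diff_def fun_eq_iff field_simps)

lemma fcnj_fcnj [simp]: "fcnj (fcnj \<omega>) = \<omega>"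
  by (simp add: fcnj_def[abs_def] comp_def)

lemma fcnj_add: "fcnj (\<omega> + \<eta>) = fcnj \<omega> + fcnj \<eta>"
  and fcnj_diff: "fcnj (\<omega> - \<eta>) = fcnj \<omega> - fcnj \<eta>"
  and fcnj_fscale: "fcnj (fscale z \<omega>) = fscale (cnj z) (fcnj \<omega>)"
  by (simp_all add: fcnj_def[abs_def] fscale_def[abs_def] plus_fun_def fun_diff_def)

lemma real_fRe: "real_form (fRe \<omega>)" and real_fIm: "real_form (fIm \<omega>)"
  unfolding real_form_def fRe_def fIm_def fcnj_fscale fcnj_add fcnj_diff fcnj_fcnj
  by (simp_all add: fscale_def[abs_def] plus_fun_def fun_diff_def fun_eq_iff field_simps)

lemma RC_fRe: "\<omega> \<in> RC k \<Longrightarrow> fRe \<omega> \<in> RC k" and RC_fIm: "\<omega> \<in> RC k \<Longrightarrow> fIm \<omega> \<in> RC k"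
  unfolding fRe_def fIm_def by (intro RC_fscale RC_add RC_diff RC_fcnj; assumption)+

theorem ruminC_RC:
  assumes C: "contact_choice A T C" shows "ruminC n A C k = RC k"
proof
  show "ruminC n A C k \<subseteq> RC k"
    unfolding ruminC_def rumin_RC[OF C] by (auto intro: RC_add RC_fscale)
  show "RC k \<subseteq> ruminC n A C k"
  proof
    fix \<omega> assume "\<omega> \<in> RC k"
    then show "\<omega> \<in> ruminC n A C k"
      unfolding ruminC_def rumin_RC[OF C] using fRe_fIm[of \<omega>, symmetric] real_fRe real_fIm RC_fRe RC_fIm by blast
  qed
qed

section \<open>Lifting symbols to Rumin forms\<close>

text \<open>On H this map does not depend on the frame; only the transversal vector that it fixes
  does.\<close>

definition Rt :: "(nat \<Rightarrow> 'm \<Rightarrow> complex ^ 'd) \<Rightarrow> (nat \<Rightarrow> 'm \<Rightarrow> (complex ^ 'd) list \<Rightarrow> complex) \<Rightarrow> complex \<Rightarrow> 'm \<Rightarrow> complex ^ 'd \<Rightarrow> complex ^ 'd" where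
  "Rt F \<epsilon> t q v = (\<Sum>j\<le>2*n. ((if j < n then t else 1) * \<epsilon> j q [v]) *s F j q)"

context
  fixes c V F \<epsilon> assumes fr: "frame c V F \<epsilon>"
begin

lemma Rt_linear:
  assumes q: "q \<in> V"
  shows "Rt F \<epsilon> t q (v + w) = Rt F \<epsilon> t q v + Rt F \<epsilon> t q w" "Rt F \<epsilon> t q (a *s v) = a *s Rt F \<epsilon> t q v"
proof -
  show "Rt F \<epsilon> t q (v + w) = Rt F \<epsilon> t q v + Rt F \<epsilon> t q w"
    unfolding Rt_def sum.distrib[symmetric]
    by (intro sum.cong refl) (simp add: one_form_linear[OF fr_alt[OF fr q]] algebra_simps vec_eq_iff)
  show "Rt F \<epsilon> t q (a *s v) = a *s Rt F \<epsilon> t q v"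
    unfolding Rt_def vec.scale_sum_right
    by (intro sum.cong refl) (simp add: one_form_linear[OF fr_alt[OF fr q]] algebra_simps vec_eq_iff)
qed

lemma Rt_T:
  assumes q: "q \<in> V"
  shows "v \<in> T c q \<Longrightarrow> Rt F \<epsilon> t q v = t *s v" "v \<in> T01 T c q \<Longrightarrow> Rt F \<epsilon> t q v = v"
proof -
  show "Rt F \<epsilon> t q v = t *s v" if v: "v \<in> T c q"
  proof -
    have "Rt F \<epsilon> t q v = (\<Sum>j\<le>2*n. t *s (\<epsilon> j q [v] *s F j q))"
      unfolding Rt_def by (intro sum.cong refl) (use fr_T_iff[OF fr q, of v] v in auto)
    then show ?thesis using fr_expand[OF fr q, of v] by (simp only: vec.scale_sum_right[symmetric])
  qed
  show "Rt F \<epsilon> t q v = v" if v: "v \<in> T01 T c q"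
  proof -
    have "Rt F \<epsilon> t q v = (\<Sum>j\<le>2*n. \<epsilon> j q [v] *s F j q)"
      unfolding Rt_def by (intro sum.cong refl) (use fr_T01_iff[OF fr q, of v] v in auto)
    then show ?thesis using fr_expand[OF fr q, of v] by simp
  qed
qed

lemma Rt_theta:
  assumes q: "q \<in> V" shows "\<epsilon> (2*n) q [Rt F \<epsilon> t q v] = \<epsilon> (2*n) q [v]"
proof -
  have "\<epsilon> (2*n) q [Rt F \<epsilon> t q v] = (\<Sum>j\<le>2*n. ((if j < n then t else 1) * \<epsilon> j q [v]) * \<epsilon> (2*n) q [F j q])"
    unfolding Rt_def by (rule one_form_linear(3)[OF fr_alt[OF fr q order_refl]])
  also have "\<dots> = (\<Sum>j\<le>2*n. if j = 2*n then \<epsilon> (2*n) q [v] else 0)"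
    by (intro sum.cong refl) (use fr_dual[OF fr q, of "2*n"] n1 in auto)
  finally show ?thesis by simp
qed

lemma Rt_HC: "q \<in> V \<Longrightarrow> v \<in> HC T c q \<Longrightarrow> Rt F \<epsilon> t q v \<in> HC T c q"
  using fr_HC_iff[OF fr] Rt_theta by auto

lemma Rt_list_HC: "q \<in> V \<Longrightarrow> set vs \<subseteq> HC T c q \<Longrightarrow> set (map (Rt F \<epsilon> t q) vs) \<subseteq> HC T c q"
  using Rt_HC by auto

lemma lform_Rt:
  assumes g: "lform c V k g" shows "lform c V k (\<lambda>q vs. g q (map (Rt F \<epsilon> t q) vs))"
proof -
  note ch = fr_chd[OF fr]
  have s: "smooth_in c V (\<lambda>q. Rt F \<epsilon> t q v)" for v
  proof -
    have sF: "smooth_in c V (\<lambda>q. F j q $ i)" if "j \<le> 2*n" for i j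
      using fr_smooth[OF fr that] smooth_in_vec_iff[OF ch] by blast
    have "smooth_in c V (\<lambda>q. Rt F \<epsilon> t q v $ i)" for i
      unfolding Rt_def sum_component vector_smult_component
      by (intro smooth_in_sum[OF ch] smooth_in_mult[OF ch] smooth_in_const lform_smooth[OF fr_lform[OF fr]] sF) auto
    then show ?thesis using smooth_in_vec_iff[OF ch] by blast
  qed
  have "smooth_in c V (\<lambda>p. g p (map (\<lambda>X. X p) (map (\<lambda>v q. Rt F \<epsilon> t q v) vs)))" for vs
    by (rule lform_eval[OF g]) (use s in auto)
  then have "smooth_in c V (\<lambda>p. g p (map (Rt F \<epsilon> t p) vs))" for vs
    by (simp add: comp_def)
  moreover have "(\<lambda>vs. g q (map (Rt F \<epsilon> t q) vs)) \<in> alt_forms k" if q: "q \<in> V" for q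
    by (rule alt_pullback[OF lform_alt[OF g q] Rt_linear[OF q]])
  ultimately show ?thesis using ch by (simp add: lform_def)
qed

lemma Rt_pure:
  assumes "q \<in> V" "\<alpha> \<in> alt_forms k" "set vs \<subseteq> T c q \<union> T01 T c q"
  shows "\<alpha> (map (Rt F \<epsilon> t q) vs) = t ^ cnt (T c q) vs * \<alpha> vs"
  by (rule alt_scale_pure[OF assms(2,3)]) (use Rt_T[OF assms(1)] in auto)

text \<open>By \<open>levi_at_isotropic\<close> only mixed pairs have a nonzero value, and they
  contain exactly one vector of T^{1,0}.\<close>

lemma Rt_levi_at:
  assumes q: "q \<in> V" and l: "levi_at c q \<Omega>" and vs: "set vs \<subseteq> HC T c q"
  shows "\<Omega> (map (Rt F \<epsilon> t q) vs) = t * \<Omega> vs"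
proof -
  note a = levi_at_alt[OF l] and c = fr_chart(1)[OF fr] fr_chart(2)[OF fr q]
  let ?\<gamma> = "\<lambda>vs. \<Omega> (map (Rt F \<epsilon> t q) vs) + (- t) * \<Omega> vs"
  have "vanish (HC T c q) ?\<gamma>"
  proof (rule T_pure_HC[OF c])
    show "?\<gamma> \<in> alt_forms 2" by (intro alt_add_form alt_smult_form alt_pullback[OF a Rt_linear[OF q]] a)
    show "vanish (T c q \<union> T01 T c q) ?\<gamma>" unfolding vanish_def
    proof (intro allI impI)
      fix vs assume vs: "set vs \<subseteq> T c q \<union> T01 T c q"
      show "?\<gamma> vs = 0"
      proof (cases "length vs = 2")
        case True
        then obtain v w where vw: "vs = [v, w]" by (auto simp: length_Suc_conv numeral_2_eq_2)
        show ?thesis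
          unfolding Rt_pure[OF q a vs] unfolding vw
          using levi_at_isotropic[OF l, of v w] vs vw by (cases "v \<in> T c q"; cases "w \<in> T c q") auto
      qed (simp add: alt_length[OF a])
    qed
  qed
  then show ?thesis using vs by (simp add: vanish_def)
qed

lemma lform_Omega: "lform c V 2 (dl c (\<epsilon> (2*n)))"
  using lform_dl[OF fr_lform[OF fr order_refl]] by (simp add: numeral_2_eq_2)

lemma lform_con_wedge:
  assumes d: "lform c V j \<delta>" and O: "lform c V 2 \<Omega>" and X: "smooth_in c V X"
  shows "lform c V (Suc j) (\<lambda>q. wedge (conX X \<delta> q) (\<Omega> q))"
proof (cases j)
  case 0
  show ?thesis
    by (rule lform_cong[OF lform_zero[OF lform_chd[OF d]]])
       (use con_alt_0[of "\<delta> _"] lform_alt[OF d] 0 in \<open>simp add: conX_def\<close>)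
next
  case (Suc i)
  then show ?thesis using lform_wedge[OF lform_conX[OF d X] O] by simp
qed

text \<open>Induction on the codegree: the equation is solved for $\epsilon_i\wedge\beta$ by $\delta_i$, and the sum of
  the contractions of $\delta_i\wedge\Omega^{n-j}$ with $F_i$ is a multiple of $\beta$ by Euler's formula.\<close>

theorem lefschetz_smooth:
  assumes "j \<le> n" "lform c V (2*n - j) \<beta>"
  shows "\<exists>\<alpha>. lform c V j \<alpha> \<and> (\<forall>q\<in>V. \<forall>vs. set vs \<subseteq> HC T c q \<longrightarrow>
     wedge (\<alpha> q) (wedge_power (dl c (\<epsilon> (2*n)) q) (n - j)) vs = \<beta> q vs)"
  using assms
proof (induction j arbitrary: \<beta>)
  let ?\<Omega> = "\<lambda>q. dl c (\<epsilon> (2*n)) q"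
  note ch = fr_chd[OF fr]
  case 0
  \<comment> \<open>In degree 2n all forms on H are multiples of \<Omega>^n, so the solution is a
    quotient of values on the frame; it is smooth because the denominator has no zeros.\<close>
  let ?e = "\<lambda>q. map (\<lambda>i. F i q) [0..<2*n]"
  have O: "?\<Omega> q \<in> alt_forms 2" if "q \<in> V" for q using lform_alt[OF lform_Omega that] .
  note P = lform_wedge_power[OF lform_Omega, of n]
  have ev: "smooth_in c V (\<lambda>q. g q (?e q))" if "lform c V k g" for k g
  proof -
    have "smooth_in c V (\<lambda>q. g q (map (\<lambda>X. X q) (map F [0..<2*n])))"
      by (rule lform_eval[OF that]) (use fr_smooth[OF fr] in auto)
    then show ?thesis by (simp add: comp_def)
  qed
  have ed: "distinct (?e q)" if q: "q \<in> V" for q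
  proof -
    have "inj_on (\<lambda>i. F i q) {0..<2*n}"
    proof (rule inj_onI)
      fix i j assume ij: "i \<in> {0..<2*n}" "j \<in> {0..<2*n}" "F i q = F j q"
      then show "i = j" using fr_dual[OF fr q, of i j] fr_dual[OF fr q, of i i] by (auto split: if_splits)
    qed
    then show ?thesis by (simp add: distinct_map)
  qed
  have sp: "HC T c q \<subseteq> vec.span (set (?e q))" if q: "q \<in> V" for q
  proof
    fix v assume "v \<in> HC T c q"
    then have "v = (\<Sum>j<2*n. \<epsilon> j q [v] *s F j q)" using fr_HC_dual[OF fr q] by simp
    also have "\<dots> \<in> vec.span (set (?e q))" by (intro vec.span_sum vec.span_scale vec.span_base) auto
    finally show "v \<in> vec.span (set (?e q))" .
  qed
  have nz: "wedge_power (?\<Omega> q) n (?e q) \<noteq> 0" if q: "q \<in> V" for q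
  proof
    assume "wedge_power (?\<Omega> q) n (?e q) = 0"
    then have "vanish (HC T c q) (wedge_power (?\<Omega> q) n)"
      using alt_vanish_basis[OF lform_alt[OF P q] ed[OF q]] sp[OF q] by (auto simp: vanish_def)
    moreover have "\<not> vanish (HC T c q) (wedge_power (?\<Omega> q) n)"
      by (rule wedge_power_not_vanish[OF O[OF q] HC_subspace[OF fr_chart(1)[OF fr] fr_chart(2)[OF fr q]]
        HC_dim_le[OF fr_chart(1)[OF fr] fr_chart(2)[OF fr q]] levi_at_nondegenerate[OF frame_levi_at[OF fr q]]]) auto
    ultimately show False by blast
  qed
  let ?f = "\<lambda>q. \<beta> q (?e q) / wedge_power (?\<Omega> q) n (?e q)"
  have b: "lform c V (2*n) \<beta>" using 0 by simp
  have "smooth_in c V ?f" by (rule smooth_in_divide[OF ch ev[OF b] ev[OF P] nz])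
  then have l: "lform c V 0 (\<lambda>q vs. ?f q * wedge_one vs)"
    by (intro lform_fmult) (simp_all add: lform_def ch wedge_one_alt smooth_in_const)
  have "wedge (\<lambda>vs. ?f q * wedge_one vs) (wedge_power (?\<Omega> q) n) vs = \<beta> q vs"
    if q: "q \<in> V" and vs: "set vs \<subseteq> HC T c q" for q vs
  proof -
    have "vanish (vec.span (set (?e q))) (\<lambda>vs. ?f q * wedge_power (?\<Omega> q) n vs + (-1) * \<beta> q vs)"
      by (rule alt_vanish_basis[OF alt_add_form[OF alt_smult_form[OF lform_alt[OF P q]] alt_smult_form[OF lform_alt[OF b q]]] ed[OF q]])
         (use nz[OF q] in auto)
    then show ?thesis
      unfolding wedge_smult_left wedge_one_left[OF lform_alt[OF P q]]
      using vs sp[OF q] by (simp add: vanish_def)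
  qed
  then show ?case using l by (intro exI[of _ "\<lambda>q vs. ?f q * wedge_one vs"]) simp
next
  let ?\<Omega> = "\<lambda>q. dl c (\<epsilon> (2*n)) q"
  note ch = fr_chd[OF fr]
  case (Suc j)
  have O: "?\<Omega> q \<in> alt_forms 2" if "q \<in> V" for q using lform_alt[OF lform_Omega that] .
  have "\<exists>\<delta>. lform c V j \<delta> \<and> (\<forall>q\<in>V. \<forall>vs. set vs \<subseteq> HC T c q \<longrightarrow>
     wedge (\<delta> q) (wedge_power (?\<Omega> q) (n - j)) vs = wedge (\<epsilon> i q) (\<beta> q) vs)" if i: "i < 2*n" for i
  proof (rule Suc.IH)
    show "lform c V (2*n - j) (\<lambda>q. wedge (\<epsilon> i q) (\<beta> q))"
      using lform_wedge[OF fr_lform[OF fr, of i] Suc.prems(2)] i Suc.prems(1) by (simp add: Suc_diff_le[symmetric])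
  qed (use Suc.prems in simp)
  then obtain \<delta> where d: "\<And>i. i < 2*n \<Longrightarrow> lform c V j (\<delta> i)"
    "\<And>i q vs. i < 2*n \<Longrightarrow> q \<in> V \<Longrightarrow> set vs \<subseteq> HC T c q \<Longrightarrow>
       wedge (\<delta> i q) (wedge_power (?\<Omega> q) (n - j)) vs = wedge (\<epsilon> i q) (\<beta> q) vs" by metis
  obtain m where m: "n - j = Suc m" "n - Suc j = m" using Suc.prems(1) by (metis Suc_diff_Suc Suc_le_lessD)
  \<comment> \<open>The form in parentheses is the one that \<open>con_lefschetz\<close> yields on
    contracting the equation for \<delta>_i with F_i; the factor 1/(j+1) is fixed by the count at
    the end.\<close>
  define \<alpha> where "\<alpha> q vs = (\<Sum>i<2*n. (1 / of_nat (Suc j)) * (wedge (conX (F i) (\<delta> i) q) (?\<Omega> q) vs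
     + (-1) ^ j * of_nat (Suc m) * wedge (\<delta> i q) (conX (F i) ?\<Omega> q) vs))" for q vs
  have "lform c V (Suc j) \<alpha>"
    unfolding \<alpha>_def
  proof (intro lform_sum[OF ch] lform_smult lform_add)
    fix i assume "i \<in> {..<2*n}"
    then have i: "i < 2*n" "smooth_in c V (F i)" using fr_smooth[OF fr] by auto
    show "lform c V (Suc j) (\<lambda>q. wedge (conX (F i) (\<delta> i) q) (?\<Omega> q))"
      by (rule lform_con_wedge[OF d(1)[OF i(1)] lform_Omega i(2)])
    show "lform c V (Suc j) (\<lambda>q. wedge (\<delta> i q) (conX (F i) ?\<Omega> q))"
      using lform_wedge[OF d(1)[OF i(1)] lform_conX[OF lform_Omega i(2)]] by simp
  qed
  moreover have "wedge (\<alpha> q) (wedge_power (?\<Omega> q) (n - Suc j)) vs = \<beta> q vs"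
    if q: "q \<in> V" and vs: "set vs \<subseteq> HC T c q" for q vs
  proof -
    note b = lform_alt[OF Suc.prems(2) q]
    have "wedge (\<alpha> q) (wedge_power (?\<Omega> q) (n - Suc j)) vs =
      (\<Sum>i<2*n. (1 / of_nat (Suc j)) * wedge (\<lambda>vs. wedge (con (F i q) (\<delta> i q)) (?\<Omega> q) vs
         + (-1) ^ j * of_nat (Suc m) * wedge (\<delta> i q) (con (F i q) (?\<Omega> q)) vs) (wedge_power (?\<Omega> q) m) vs)"
      unfolding m(2) \<alpha>_def conX_def wedge_sum_left wedge_smult_left ..
    also have "\<dots> = (\<Sum>i<2*n. (1 / of_nat (Suc j)) * (\<beta> q vs - wedge (\<epsilon> i q) (con (F i q) (\<beta> q)) vs))"
    proof (intro sum.cong refl arg_cong2[where f = "(*)"])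
      fix i assume "i \<in> {..<2*n}"
      then have i: "i < 2*n" by simp
      have "wedge (\<lambda>vs. wedge (con (F i q) (\<delta> i q)) (?\<Omega> q) vs
         + (-1) ^ j * of_nat (Suc m) * wedge (\<delta> i q) (con (F i q) (?\<Omega> q)) vs) (wedge_power (?\<Omega> q) m) vs =
         con (F i q) (wedge (\<delta> i q) (wedge_power (?\<Omega> q) (Suc m))) vs"
        by (rule fun_cong[OF con_lefschetz[OF O[OF q] lform_alt[OF d(1)[OF i] q], symmetric]])
      also have "\<dots> = wedge (\<epsilon> i q) (\<beta> q) (F i q # vs)"
        using d(2)[OF i q, of "F i q # vs"] vs fr_F_HC[OF fr q i] m by (simp add: con_apply del: wedge_power.simps)
      also have "\<dots> = \<beta> q vs - wedge (\<epsilon> i q) (con (F i q) (\<beta> q)) vs"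
        using wedge_one_form_Cons[OF fr_alt[OF fr q] b, of i "F i q" vs] fr_dual[OF fr q, of i i] i by simp
      finally show "wedge (\<lambda>vs. wedge (con (F i q) (\<delta> i q)) (?\<Omega> q) vs
         + (-1) ^ j * of_nat (Suc m) * wedge (\<delta> i q) (con (F i q) (?\<Omega> q)) vs) (wedge_power (?\<Omega> q) m) vs =
         \<beta> q vs - wedge (\<epsilon> i q) (con (F i q) (\<beta> q)) vs" .
    qed
    also have "\<dots> = (1 / of_nat (Suc j)) * (of_nat (2*n) * \<beta> q vs - (\<Sum>i<2*n. wedge (\<epsilon> i q) (con (F i q) (\<beta> q)) vs))"
      by (simp add: sum_distrib_left[symmetric] sum_divide_distrib[symmetric] sum_subtractf)
    also have "(\<Sum>i<2*n. wedge (\<epsilon> i q) (con (F i q) (\<beta> q)) vs) = of_nat (length (filter (\<lambda>v. v \<in> HC T c q) vs)) * \<beta> q vs"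
      by (rule euler_contraction[OF b, where W = "{}"])
         (use fr_alt[OF fr q] fr_HC_dual[OF fr q] vs in auto)
    also have "filter (\<lambda>v. v \<in> HC T c q) vs = vs" using vs by (simp add: filter_id_conv subset_iff)
    finally have w: "wedge (\<alpha> q) (wedge_power (?\<Omega> q) (n - Suc j)) vs =
        (1 / of_nat (Suc j)) * (of_nat (2*n) * \<beta> q vs - of_nat (length vs) * \<beta> q vs)" .
    show ?thesis
    proof (cases "length vs = 2*n - Suc j")
      case True
      \<comment> \<open>Each of the 2n contractions contributes one \<beta>, and Euler's formula
        subtracts one per argument: 2n - (2n - j - 1) = j + 1.\<close>
      then have "of_nat (2*n) - of_nat (length vs) = (of_nat (Suc j) :: complex)"
        using Suc.prems(1) by (simp add: of_nat_diff)
      then have "of_nat (2*n) * \<beta> q vs - of_nat (length vs) * \<beta> q vs = of_nat (Suc j) * \<beta> q vs"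
        by (metis left_diff_distrib)
      then show ?thesis unfolding w by (simp del: of_nat_Suc)
    next
      case False
      then show ?thesis unfolding w using alt_length[OF b] by simp
    qed
  qed
  ultimately show ?case by blast
qed

end

text \<open>\<open>symbol_rel k c q h \<alpha> \<alpha>'\<close>: the symbol of \<open>\<alpha>'\<close> arises from that of \<open>\<alpha>\<close> by multiplying the component
  with \<open>m\<close> arguments in $T^{1,0}$ by \<open>h m\<close>, where the symbol is the restriction to $H$ if \<open>k \<le> n\<close>
  and that of the contraction with a transversal vector otherwise.\<close>

definition symbol_rel :: "nat \<Rightarrow> ('m, 'd) chart \<Rightarrow> 'm \<Rightarrow> (nat \<Rightarrow> complex) \<Rightarrow> ((complex ^ 'd) list \<Rightarrow> complex) \<Rightarrow> ((complex ^ 'd) list \<Rightarrow> complex) \<Rightarrow> bool" where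
  "symbol_rel k c q h \<alpha> \<alpha>' \<longleftrightarrow> (\<forall>vs. set vs \<subseteq> T c q \<union> T01 T c q \<longrightarrow>
     (if k \<le> n then \<alpha>' vs = h (cnt (T c q) vs) * \<alpha> vs
      else \<forall>X. \<alpha>' (X # vs) = h (cnt (T c q) vs) * \<alpha> (X # vs)))"

lemma symbol_rel_linear:
  assumes "\<And>i. i \<in> I \<Longrightarrow> symbol_rel k c q (h i) \<alpha> (\<beta> i)"
  shows "symbol_rel k c q (\<lambda>m. \<Sum>i\<in>I. w i * h i m) \<alpha> (\<lambda>vs. \<Sum>i\<in>I. w i * \<beta> i vs)"
  using assms unfolding symbol_rel_def by (auto simp: sum_distrib_right mult.assoc intro!: sum.cong)

lemma symbol_rel_minus:
  assumes "symbol_rel k c q h \<alpha> \<beta>" "symbol_rel k c q h \<alpha> \<gamma>"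
  shows "symbol_rel k c q (\<lambda>_. 0) \<alpha> (\<lambda>vs. \<beta> vs + (-1) * \<gamma> vs)"
  using assms unfolding symbol_rel_def by auto

definition local_rumin :: "nat \<Rightarrow> ('m, 'd) chart \<Rightarrow> 'm set \<Rightarrow> ('m \<Rightarrow> (complex ^ 'd) list \<Rightarrow> complex) \<Rightarrow> bool" where
  "local_rumin k c V g \<longleftrightarrow> lform c V k g \<and> (\<forall>q\<in>V. \<exists>\<Omega>. levi_at c q \<Omega> \<and> rumin_at k c q \<Omega> (g q) (dl c g q))"

lemma local_ruminD: "local_rumin k c V g \<Longrightarrow> lform c V k g" "local_rumin k c V g \<Longrightarrow> q \<in> V \<Longrightarrow> levi_at c q \<Omega> \<Longrightarrow> rumin_at k c q \<Omega> (g q) (dl c g q)"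
  using rumin_at_indep unfolding local_rumin_def by blast+

text \<open>For k \<le> n this is the Lefschetz argument, which uses the vanishing near p. Above n,
  the form and its contraction with a transversal vector both vanish on H, and algebra at p
  suffices.\<close>

lemma local_rumin_zero:
  assumes L: "local_rumin k c V d" and z: "\<forall>q\<in>V. symbol_rel k c q (\<lambda>_. 0) (\<alpha> q) (d q)" and p: "p \<in> V"
  shows "d p = (\<lambda>_. 0)"
proof -
  note l = local_ruminD(1)[OF L]
  have c: "c \<in> A" "\<And>q. q \<in> V \<Longrightarrow> q \<in> fst c" using lform_chd[OF l] by (auto simp: chd_def)
  obtain \<Omega> where O: "levi_at c p \<Omega>" using levi_at_exists[OF c(1) c(2)[OF p]] by blast
  note r = local_ruminD(2)[OF L p O]
  show ?thesis
  proof (cases "k \<le> n")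
    case True
    have "vanish (HC T c q) (d q)" if q: "q \<in> V" for q
      by (rule T_pure_HC[OF c(1) c(2)[OF q] lform_alt[OF l q]])
         (use bspec[OF z q] True in \<open>simp add: symbol_rel_def vanish_def\<close>)
    then show ?thesis using rumin_unique_local[OF l True _ p O] r True by (simp add: rumin_at_def)
  next
    case False
    obtain e where e: "cvec e \<notin> HC T c p" using exists_transversal[OF c(1) c(2)[OF p]] by blast
    have "vanish (HC T c p) (con (cvec e) (d p))"
      by (rule T_pure_HC[OF c(1) c(2)[OF p] con_alt'[OF lform_alt[OF l p]]])
         (use bspec[OF z p] False in \<open>simp add: symbol_rel_def vanish_def con_apply\<close>)
    then show ?thesis
      using alt_eq_zero[OF lform_alt[OF l p] _ _ HC_transversal_span[OF c(1) c(2)[OF p] e]] r False by (simp add: rumin_at_def)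
  qed
qed

lemma local_rumin_unique:
  assumes L: "local_rumin k c V g" "local_rumin k c V g'"
    and z: "\<forall>q\<in>V. symbol_rel k c q h (\<alpha> q) (g q)" "\<forall>q\<in>V. symbol_rel k c q h (\<alpha> q) (g' q)" and p: "p \<in> V"
  shows "g p vs = g' p vs"
proof -
  note l = local_ruminD(1)[OF L(1)] local_ruminD(1)[OF L(2)]
  let ?d = "\<lambda>q vs. g q vs + (-1) * g' q vs"
  have "local_rumin k c V ?d" unfolding local_rumin_def
  proof (intro conjI ballI)
    show "lform c V k ?d" by (intro lform_add lform_smult l)
    fix q assume q: "q \<in> V"
    then have "c \<in> A" "q \<in> fst c" using lform_chd[OF l(1)] by (auto simp: chd_def)
    then obtain \<Omega> where O: "levi_at c q \<Omega>" using levi_at_exists by blast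
    have "dl c ?d q = (\<lambda>vs. dl c g q vs + (-1) * dl c g' q vs)"
      by (rule ext, rule trans[OF dl_add[OF l(1) lform_smult[OF l(2)] q]]) (unfold dl_smult[OF l(2) q], rule refl)
    then show "\<exists>\<Omega>. levi_at c q \<Omega> \<and> rumin_at k c q \<Omega> (?d q) (dl c ?d q)"
      using rumin_at_add[OF local_ruminD(2)[OF L(1) q O] rumin_at_smult[OF local_ruminD(2)[OF L(2) q O], of "-1"]] O by auto
  qed
  from local_rumin_zero[OF this _ p, of \<alpha>] symbol_rel_minus z have "?d p = (\<lambda>_. 0)" by blast
  from fun_cong[OF this, of vs] show ?thesis by simp
qed

lemma rumin_at_jac:
  assumes c: "c \<in> A" "c' \<in> A" "p \<in> fst c" "p \<in> fst c'" and r: "rumin_at k c' p \<Omega> a b"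
  shows "rumin_at k c p (\<lambda>vs. \<Omega> (map (jac c c' p) vs)) (\<lambda>vs. a (map (jac c c' p) vs)) (\<lambda>vs. b (map (jac c c' p) vs))"
proof -
  have v: "vanish (HC T c p) (\<lambda>vs. e (map (jac c c' p) vs))" if "vanish (HC T c' p) e" for e
    unfolding vanish_def
  proof (intro allI impI)
    fix vs assume "set vs \<subseteq> HC T c p"
    then have "set (map (jac c c' p) vs) \<subseteq> HC T c' p" using HC_jac[OF c] by auto
    then show "e (map (jac c c' p) vs) = 0" using that unfolding vanish_def by blast
  qed
  have "vanish (HC T c p) (wedge (\<lambda>vs. e (map (jac c c' p) vs)) (wedge_power (\<lambda>vs. \<Omega> (map (jac c c' p) vs)) m))"
    if "vanish (HC T c' p) (wedge e (wedge_power \<Omega> m))" for e m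
    using v[OF that] unfolding wedge_power_pullback wedge_pullback by simp
  then show ?thesis using r v unfolding rumin_at_def by (simp split: if_splits)
qed

lemma levi_at_jac':
  assumes l: "levi_at c' p \<Omega>" and c: "c \<in> A" "p \<in> fst c" shows "levi_at c p (\<lambda>vs. \<Omega> (map (jac c c' p) vs))"
proof -
  have c': "c' \<in> A" "p \<in> fst c'" using l by (auto simp: levi_at_def)
  obtain \<Omega>' where O: "levi_at c p \<Omega>'" "\<Omega> = (\<lambda>vs. \<Omega>' (map (jac c' c p) vs))" using levi_at_jac[OF assms] by blast
  have "map (jac c' c p) (map (jac c c' p) vs) = vs" for vs
    using jac_inverse[OF c(1) c'(1) c(2) c'(2)] by (simp add: map_idI)
  then show ?thesis using O by (simp del: map_map)
qed

lemma local_rumin_jac: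
  assumes L: "local_rumin k c' V g" and c: "c \<in> A" "V \<subseteq> fst c"
  shows "local_rumin k c V (\<lambda>q vs. g q (map (jac c c' q) vs))"
  unfolding local_rumin_def
proof (intro conjI ballI)
  note l = local_ruminD(1)[OF L]
  have c': "c' \<in> A" "\<And>q. q \<in> V \<Longrightarrow> q \<in> fst c'" using lform_chd[OF l] by (auto simp: chd_def)
  show "lform c V k (\<lambda>q vs. g q (map (jac c c' q) vs))" by (rule lform_jac[OF l c])
  fix q assume q: "q \<in> V"
  have qc: "q \<in> fst c" using q c by blast
  obtain \<Omega> where O: "levi_at c' q \<Omega>" using levi_at_exists[OF c'(1) c'(2)[OF q]] by blast
  have "dl c (\<lambda>q vs. g q (map (jac c c' q) vs)) q = (\<lambda>vs. dl c' g q (map (jac c c' q) vs))"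
    by (rule ext) (rule dl_jac[OF l c q])
  then show "\<exists>\<Omega>. levi_at c q \<Omega> \<and> rumin_at k c q \<Omega> (\<lambda>vs. g q (map (jac c c' q) vs)) (dl c (\<lambda>q vs. g q (map (jac c c' q) vs)) q)"
    using rumin_at_jac[OF c(1) c'(1) qc c'(2)[OF q] local_ruminD(2)[OF L q O]] levi_at_jac'[OF O c(1) qc] by auto
qed

lemma cnt_jac:
  assumes "c \<in> A" "c' \<in> A" "p \<in> fst c" "p \<in> fst c'" shows "cnt (T c' p) (map (jac c c' p) vs) = cnt (T c p) vs"
  by (induction vs) (simp_all add: T_jac_iff[OF assms])

lemma symbol_rel_jac:
  assumes c: "c \<in> A" "c' \<in> A" "p \<in> fst c" "p \<in> fst c'" and r: "symbol_rel k c' p h \<alpha> \<beta>"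
  shows "symbol_rel k c p h (\<lambda>vs. \<alpha> (map (jac c c' p) vs)) (\<lambda>vs. \<beta> (map (jac c c' p) vs))"
proof -
  have "set (map (jac c c' p) vs) \<subseteq> T c' p \<union> T01 T c' p" if "set vs \<subseteq> T c p \<union> T01 T c p" for vs
    using that T_jac_iff[OF c] by auto
  from r[unfolded symbol_rel_def, rule_format, OF this] show ?thesis
    unfolding symbol_rel_def cnt_jac[OF c] by (simp split: if_splits)
qed

lemma local_rumin_subset: "local_rumin k c V g \<Longrightarrow> open W \<Longrightarrow> W \<subseteq> V \<Longrightarrow> local_rumin k c W g"
  unfolding local_rumin_def using lform_subset by blast

lemma RC_local_rumin: "\<omega> \<in> RC k \<Longrightarrow> c \<in> A \<Longrightarrow> local_rumin k c (fst c) (\<omega> c)"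
proof -
  assume w: "\<omega> \<in> RC k" and c: "c \<in> A"
  have e: "ext_d \<omega> c q = dl c (\<omega> c) q" if "q \<in> fst c" for q using that by (auto simp: ext_d_dl fun_eq_iff)
  have "\<exists>\<Omega>. levi_at c q \<Omega> \<and> rumin_at k c q \<Omega> (\<omega> c q) (dl c (\<omega> c) q)" if q: "q \<in> fst c" for q
    using levi_at_exists[OF c q] RC_rumin_at[OF w, of c q] unfolding e[OF q] by blast
  then show ?thesis using forms_lform_UNIV[OF RC_forms[OF w] c] by (simp add: local_rumin_def)
qed

text \<open>Local solutions are unique, hence they patch.\<close>

theorem RC_glue:
  assumes w: "\<omega> \<in> RC k"
    and ex: "\<And>c q. c \<in> A \<Longrightarrow> q \<in> fst c \<Longrightarrow> \<exists>V g. q \<in> V \<and> local_rumin k c V g \<and> (\<forall>q\<in>V. symbol_rel k c q h (\<omega> c q) (g q))"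
  shows "\<exists>\<omega>'\<in>RC k. \<forall>c\<in>A. \<forall>q\<in>fst c. symbol_rel k c q h (\<omega> c q) (\<omega>' c q)"
proof -
  define R where "R c V g \<longleftrightarrow> local_rumin k c V g \<and> (\<forall>q\<in>V. symbol_rel k c q h (\<omega> c q) (g q))" for c V g
  have "\<exists>\<omega>'\<in>forms A UNIV k. \<forall>c V g q. R c V g \<longrightarrow> q \<in> V \<longrightarrow> \<omega>' c q = g q"
  proof (rule forms_glue)
    show "\<exists>c V g. p \<in> V \<and> R c V g" for p using chart_cover[of p] ex unfolding R_def by blast
    show "lform c V k g" if "R c V g" for c V g using that local_ruminD(1) by (simp add: R_def)
    fix c V g c' V' g' q vs assume R: "R c V g" "R c' V' g'" and q: "q \<in> V" "q \<in> V'"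
    have L: "local_rumin k c V g" "local_rumin k c' V' g'" using R by (simp_all add: R_def)
    have c: "c \<in> A" "open V" "V \<subseteq> fst c" "c' \<in> A" "open V'" "V' \<subseteq> fst c'"
      using lform_chd[OF local_ruminD(1)[OF L(1)]] lform_chd[OF local_ruminD(1)[OF L(2)]] by (auto simp: chd_def)
    let ?W = "V \<inter> V'"
    have o: "open ?W" using c by (simp add: open_Int)
    \<comment> \<open>The second solution is carried to the chart of the first; there both have the
      symbol prescribed by \<omega>.\<close>
    have "local_rumin k c ?W (\<lambda>q vs. g' q (map (jac c c' q) vs))"
      by (rule local_rumin_jac[OF local_rumin_subset[OF L(2) o] c(1)]) (use c in auto)
    moreover have "symbol_rel k c q h (\<omega> c q) (\<lambda>vs. g' q (map (jac c c' q) vs))" if q: "q \<in> ?W" for q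
    proof -
      have cc: "c \<in> A" "c' \<in> A" "q \<in> fst c" "q \<in> fst c'" using c q by auto
      have s: "symbol_rel k c' q h (\<omega> c' q) (g' q)" using R(2) q by (simp add: R_def)
      have "\<omega> c q = (\<lambda>vs. \<omega> c' q (map (jac c c' q) vs))"
        by (rule ext) (rule forms_jac[OF RC_forms[OF w] cc(1,2) UNIV_I cc(3,4)])
      then show ?thesis using symbol_rel_jac[OF cc s] by simp
    qed
    ultimately show "g q vs = g' q (map (jac c c' q) vs)"
      by (intro local_rumin_unique[OF local_rumin_subset[OF L(1) o] _ _ _ IntI[OF q], where h = h and \<alpha> = "\<omega> c"])
         (use R(1) in \<open>simp_all add: R_def\<close>)
  qed
  then obtain \<omega>' where w': "\<omega>' \<in> forms A UNIV k" "\<And>c V g q. R c V g \<Longrightarrow> q \<in> V \<Longrightarrow> \<omega>' c q = g q" by blast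
  have *: "\<exists>V g. q \<in> V \<and> R c V g" if "c \<in> A" "q \<in> fst c" for c q using ex[OF that] by (simp add: R_def)
  have "\<omega>' \<in> RC k"
  proof (rule RCI[OF w'(1)])
    fix c p assume c: "c \<in> A" "p \<in> fst c"
    obtain V g where V: "p \<in> V" "R c V g" using *[OF c] by blast
    have L: "local_rumin k c V g" using V(2) by (simp add: R_def)
    have "ext_d \<omega>' c p = dl c g p"
      using dl_cong[OF lform_chd[OF local_ruminD(1)[OF L]] _ V(1), of "\<omega>' c" g] w'(2)[OF V(2)] c by (auto simp: ext_d_dl fun_eq_iff)
    then show "\<exists>\<Omega>. levi_at c p \<Omega> \<and> rumin_at k c p \<Omega> (\<omega>' c p) (ext_d \<omega>' c p)"
      using L V(1) unfolding local_rumin_def w'(2)[OF V(2) V(1)] by simp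
  qed
  moreover have "symbol_rel k c q h (\<omega> c q) (\<omega>' c q)" if c: "c \<in> A" "q \<in> fst c" for c q
  proof -
    obtain V g where V: "q \<in> V" "R c V g" using *[OF c] by blast
    then show ?thesis using w'(2)[OF V(2) V(1)] by (simp add: R_def)
  qed
  ultimately show ?thesis by blast
qed

section \<open>Lifting rescaled symbols over a frame\<close>

context
  fixes c V F \<epsilon> assumes fr: "frame c V F \<epsilon>"
begin

text \<open>Since \<Omega> is multiplied by t on H, its m-th power absorbs t^m; the first Rumin
  condition for the rescaled form thus becomes the pullback of the original one.\<close>

lemma Rt_wedge:
  assumes q: "q \<in> V" and vs: "set vs \<subseteq> HC T c q" and l: "levi_at c q \<Omega>"
  shows "t ^ m * wedge (\<lambda>vs. a (map (Rt F \<epsilon> t q) vs)) (wedge_power \<Omega> m) vs = wedge a (wedge_power \<Omega> m) (map (Rt F \<epsilon> t q) vs)"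
proof -
  have "wedge (\<lambda>vs. a (map (Rt F \<epsilon> t q) vs)) (\<lambda>vs. t ^ m * wedge_power \<Omega> m vs) vs =
     wedge (\<lambda>vs. a (map (Rt F \<epsilon> t q) vs)) (wedge_power (\<lambda>vs. \<Omega> (map (Rt F \<epsilon> t q) vs)) m) vs"
    by (rule wedge_cong_on[OF refl _ vs])
       (rule wedge_power_scale[symmetric], rule Rt_levi_at[OF fr q l])
  then show ?thesis unfolding wedge_smult_right wedge_power_pullback wedge_pullback .
qed

text \<open>The pullback \<open>g1\<close> has the right symbol and satisfies the first Rumin
  condition, but it may violate the second, because the rescaling varies with the point. Adding
  \<theta> times \<tau> keeps both properties and adds \<Omega> times \<tau> to the derivative on H;
  so \<tau> must solve a Lefschetz equation.\<close>

lemma lift_low: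
  assumes g: "local_rumin k c V g" and k: "0 < k" "k \<le> n" and t: "t \<noteq> 0"
  shows "\<exists>g'. local_rumin k c V g' \<and> (\<forall>q\<in>V. symbol_rel k c q (\<lambda>m. t ^ m) (g q) (g' q))"
proof -
  let ?\<theta> = "\<epsilon> (2*n)" and ?R = "\<lambda>q. map (Rt F \<epsilon> t q)"
  let ?\<Omega> = "\<lambda>q. dl c ?\<theta> q"
  define g1 where "g1 q vs = g q (?R q vs)" for q vs
  note gl = local_ruminD(1)[OF g] and th = fr_lform[OF fr order_refl]
  have g1: "lform c V k g1" unfolding g1_def by (rule lform_Rt[OF fr gl])
  obtain j where j: "k = Suc j" using k by (cases k) auto
  \<comment> \<open>Degree bookkeeping: \<tau> has degree j = k - 1 and is to be multiplied by
    \<Omega>^(n-j), where n - j = n - k + 1; the right-hand side has degree (k + 1) + 2(n - k) = 2n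
    - j.\<close>
  have "lform c V (2*n - j) (\<lambda>q vs. (-1) * wedge (dl c g1 q) (wedge_power (?\<Omega> q) (n - k)) vs)"
  proof -
    have "Suc k + 2 * (n - k) = 2*n - j" using j k by simp
    then show ?thesis
      using lform_smult[OF lform_wedge[OF lform_dl[OF g1] lform_wedge_power[OF lform_Omega[OF fr], of "n - k"]], of "-1"] by simp
  qed
  from lefschetz_smooth[OF fr _ this] obtain \<tau> where ta: "lform c V j \<tau>"
    "\<And>q vs. q \<in> V \<Longrightarrow> set vs \<subseteq> HC T c q \<Longrightarrow> wedge (\<tau> q) (wedge_power (?\<Omega> q) (n - j)) vs =
       (-1) * wedge (dl c g1 q) (wedge_power (?\<Omega> q) (n - k)) vs" using j k by auto
  define g' where "g' q vs = g1 q vs + wedge (?\<theta> q) (\<tau> q) vs" for q vs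
  note tt = lform_wedge[OF th ta(1)]
  have g': "lform c V k g'" unfolding g'_def using lform_add[OF g1] tt j by simp
  have th0: "vanish (HC T c q) (?\<theta> q)" if q: "q \<in> V" for q
    using one_form_vanish[OF fr_alt[OF fr q order_refl]] fr_HC_iff[OF fr q] by blast
  have on: "g' q vs = g1 q vs" if "q \<in> V" "set vs \<subseteq> HC T c q" for q vs
    using wedge_vanish_left[OF th0[OF that(1)]] that(2) by (simp add: g'_def vanish_def)
  have "rumin_at k c q (?\<Omega> q) (g' q) (dl c g' q)" if q: "q \<in> V" for q
  proof -
    note l = frame_levi_at[OF fr q]
    note O = levi_at_alt[OF l]
    have 1: "vanish (HC T c q) (wedge (g' q) (wedge_power (?\<Omega> q) (n + 1 - k)))" unfolding vanish_def
    proof (intro allI impI)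
      fix vs assume vs: "set vs \<subseteq> HC T c q"
      have "wedge (g' q) (wedge_power (?\<Omega> q) (n + 1 - k)) vs = wedge (g1 q) (wedge_power (?\<Omega> q) (n + 1 - k)) vs"
        by (rule wedge_cong_on[OF on[OF q] refl vs])
      moreover have "t ^ (n + 1 - k) * wedge (g1 q) (wedge_power (?\<Omega> q) (n + 1 - k)) vs = 0"
        unfolding g1_def Rt_wedge[OF q vs l]
        using local_ruminD(2)[OF g q l] k Rt_list_HC[OF fr q vs] unfolding rumin_at_def vanish_def by auto
      ultimately show "wedge (g' q) (wedge_power (?\<Omega> q) (n + 1 - k)) vs = 0" using t by simp
    qed
    have "vanish (HC T c q) (wedge (dl c g' q) (wedge_power (?\<Omega> q) (n - k)))" unfolding vanish_def
    proof (intro allI impI)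
      fix vs assume vs: "set vs \<subseteq> HC T c q"
      have dg: "dl c g' q ws = dl c g1 q ws + wedge (\<tau> q) (?\<Omega> q) ws" if ws: "set ws \<subseteq> HC T c q" for ws
      proof -
        have "dl c g' q ws = dl c g1 q ws + (wedge (?\<Omega> q) (\<tau> q) ws - wedge (?\<theta> q) (dl c \<tau> q) ws)"
          unfolding g'_def using dl_add[OF g1 tt q, of ws] dl_wedge[OF th ta(1) q, of ws] by simp
        then show ?thesis
          using wedge_vanish_left[OF th0[OF q], of "dl c \<tau> q"] ws wedge_2_commute[OF O lform_alt[OF ta(1) q]]
          by (simp add: vanish_def)
      qed
      have "wedge (dl c g' q) (wedge_power (?\<Omega> q) (n - k)) vs =
        wedge (\<lambda>ws. dl c g1 q ws + wedge (\<tau> q) (?\<Omega> q) ws) (wedge_power (?\<Omega> q) (n - k)) vs"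
        by (rule wedge_cong_on[OF dg refl vs])
      also have "\<dots> = wedge (dl c g1 q) (wedge_power (?\<Omega> q) (n - k)) vs + wedge (\<tau> q) (wedge_power (?\<Omega> q) (Suc (n - k))) vs"
        unfolding wedge_add_left wedge_power_Suc_right(2)[OF O lform_alt[OF ta(1) q]] ..
      also have "Suc (n - k) = n - j" using j k by simp
      finally show "wedge (dl c g' q) (wedge_power (?\<Omega> q) (n - k)) vs = 0" using ta(2)[OF q vs] by simp
    qed
    then show ?thesis using 1 k by (simp add: rumin_at_def)
  qed
  then have "local_rumin k c V g'" unfolding local_rumin_def using g' frame_levi_at[OF fr] by blast
  moreover have "symbol_rel k c q (\<lambda>m. t ^ m) (g q) (g' q)" if q: "q \<in> V" for q
  proof -
    have "g' q vs = t ^ cnt (T c q) vs * g q vs" if vs: "set vs \<subseteq> T c q \<union> T01 T c q" for vs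
      using on[OF q order_trans[OF vs T_HC[OF fr_chart(1)[OF fr] fr_chart(2)[OF fr q]]]]
        Rt_pure[OF fr q lform_alt[OF gl q] vs] by (simp add: g1_def)
    then show ?thesis using k by (simp add: symbol_rel_def)
  qed
  ultimately show ?thesis by blast
qed

text \<open>No correction is necessary: on H the derivative of a form vanishing there is \<Omega>
  times its contraction, and the rescaling acts on \<Omega> by t. So t times the new derivative is
  the pullback of the old one, which is zero on H.\<close>

lemma lift_high:
  assumes g: "local_rumin k c V g" and k: "n < k" and t: "t \<noteq> 0"
  shows "\<exists>g'. local_rumin k c V g' \<and> (\<forall>q\<in>V. symbol_rel k c q (\<lambda>m. t ^ m) (g q) (g' q))"
proof -
  let ?\<theta> = "\<epsilon> (2*n)" and ?R = "\<lambda>q. map (Rt F \<epsilon> t q)"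
  let ?\<Omega> = "\<lambda>q. dl c ?\<theta> q"
  define g1 where "g1 q vs = g q (?R q vs)" for q vs
  obtain j where j: "k = Suc j" using k by (cases k) auto
  have gl: "lform c V (Suc j) g" using local_ruminD(1)[OF g] j by simp
  have g1: "lform c V (Suc j) g1" unfolding g1_def by (rule lform_Rt[OF fr gl])
  have gv: "vanish (HC T c q) (g q)" "vanish (HC T c q) (dl c g q)" if q: "q \<in> V" for q
    using local_ruminD(2)[OF g q frame_levi_at[OF fr q]] k by (simp_all add: rumin_at_def)
  have g1v: "vanish (HC T c q) (g1 q)" if q: "q \<in> V" for q
    using gv(1)[OF q] Rt_list_HC[OF fr q] unfolding vanish_def g1_def by blast
  \<comment> \<open>The rescaling preserves \<theta>, so it moves X by a vector of H only, and the
    form vanishes on H.\<close>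
  have swap: "g q (Rt F \<epsilon> t q X # vs) = g q (X # vs)" if q: "q \<in> V" and vs: "set vs \<subseteq> HC T c q" for q X vs
  proof -
    have "?\<theta> q [Rt F \<epsilon> t q X + (-1) *s X] = 0"
      unfolding one_form_linear(1,2)[OF fr_alt[OF fr q order_refl]] Rt_theta[OF fr q] by simp
    then have "Rt F \<epsilon> t q X + (-1) *s X \<in> HC T c q" using fr_HC_iff[OF fr q] by blast
    then have "g q ((Rt F \<epsilon> t q X + (-1) *s X) # vs) = 0" using gv(1)[OF q] vs by (simp add: vanish_def)
    then show ?thesis unfolding alt_Cons_add[OF lform_alt[OF gl q]] alt_Cons_smult[OF lform_alt[OF gl q]] by simp
  qed
  note fac = frame_factor[OF fr gl] and fac1 = frame_factor[OF fr g1]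
  have "vanish (HC T c q) (dl c g1 q)" if q: "q \<in> V" for q unfolding vanish_def
  proof (intro allI impI)
    fix vs assume vs: "set vs \<subseteq> HC T c q"
    note l = frame_levi_at[OF fr q]
    note O = levi_at_alt[OF l]
    let ?\<beta> = "conX (F (2*n)) g" and ?\<beta>1 = "conX (F (2*n)) g1"
    have b: "?\<beta> q \<in> alt_forms j" "?\<beta>1 q \<in> alt_forms j" using lform_alt[OF fac(1) q] lform_alt[OF fac1(1) q] gv g1v by blast+
    have "dl c g1 q vs = wedge (?\<Omega> q) (?\<beta>1 q) vs" by (rule fac1(3)[OF _ q vs]) (use g1v in blast)
    also have "\<dots> = wedge (?\<beta>1 q) (wedge_power (?\<Omega> q) 1) vs"
      using wedge_2_commute[OF O b(2)] by (simp add: wedge_one_right[OF O])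
    also have "\<dots> = wedge (\<lambda>vs. ?\<beta> q (?R q vs)) (wedge_power (?\<Omega> q) 1) vs"
      by (rule wedge_cong_on[OF _ refl vs])
         (use swap[OF q Rt_list_HC[OF fr q]] in \<open>simp add: conX_def con_apply g1_def\<close>)
    finally have "t * dl c g1 q vs = wedge (?\<beta> q) (wedge_power (?\<Omega> q) 1) (?R q vs)"
      using Rt_wedge[OF q vs l, of t 1 "?\<beta> q"] by simp
    also have "\<dots> = wedge (?\<Omega> q) (?\<beta> q) (?R q vs)"
      using wedge_2_commute[OF O b(1)] by (simp add: wedge_one_right[OF O])
    also have "\<dots> = dl c g q (?R q vs)"
      by (rule fac(3)[OF _ q Rt_list_HC[OF fr q vs], symmetric]) (use gv in blast)
    also have "\<dots> = 0" using gv(2)[OF q] Rt_list_HC[OF fr q vs] unfolding vanish_def by blast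
    finally show "dl c g1 q vs = 0" using t by simp
  qed
  then have "rumin_at k c q \<Omega> (g1 q) (dl c g1 q)" if "q \<in> V" for q \<Omega> using g1v that k by (simp add: rumin_at_def)
  then have "local_rumin k c V g1" unfolding local_rumin_def using g1 frame_levi_at[OF fr] j by blast
  moreover have "symbol_rel k c q (\<lambda>m. t ^ m) (g q) (g1 q)" if q: "q \<in> V" for q
  proof -
    have "g1 q (X # vs) = t ^ cnt (T c q) vs * g q (X # vs)" if vs: "set vs \<subseteq> T c q \<union> T01 T c q" for X vs
    proof -
      have "g1 q (X # vs) = con X (g q) (?R q vs)"
        using swap[OF q Rt_list_HC[OF fr q order_trans[OF vs T_HC[OF fr_chart(1)[OF fr] fr_chart(2)[OF fr q]]]]]
        by (simp add: g1_def con_apply)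
      then show ?thesis using Rt_pure[OF fr q con_alt'[OF lform_alt[OF gl q]] vs] by (simp add: con_apply)
    qed
    then show ?thesis using k by (simp add: symbol_rel_def)
  qed
  ultimately show ?thesis by blast
qed

lemma lift_local:
  assumes g: "local_rumin k c V g" and t: "t \<noteq> 0"
  shows "\<exists>g'. local_rumin k c V g' \<and> (\<forall>q\<in>V. symbol_rel k c q (\<lambda>m. t ^ m) (g q) (g' q))"
proof -
  consider "k = 0" | "0 < k" "k \<le> n" | "n < k" by linarith
  then show ?thesis
  proof cases
    case 1
    have "symbol_rel k c q (\<lambda>m. t ^ m) (g q) (g q)" if "q \<in> V" for q
    proof -
      have "g q vs = t ^ cnt (T c q) vs * g q vs" for vs
        using alt_length[OF lform_alt[OF local_ruminD(1)[OF g] that], of vs] 1 by (cases vs) auto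
      then show ?thesis using 1 by (simp add: symbol_rel_def)
    qed
    then show ?thesis using g by blast
  qed (use lift_low[OF g _ _ t] lift_high[OF g _ t] in blast)+
qed

end

theorem RC_lift:
  assumes w: "\<omega> \<in> RC k" and t: "t \<noteq> 0"
  shows "\<exists>\<omega>'\<in>RC k. \<forall>c\<in>A. \<forall>q\<in>fst c. symbol_rel k c q (\<lambda>m. t ^ m) (\<omega> c q) (\<omega>' c q)"
proof (rule RC_glue[OF w])
  fix c q assume c: "c \<in> A" "q \<in> fst c"
  obtain V F \<epsilon> where fr: "q \<in> V" "frame c V F \<epsilon>" using frame_exists[OF c] by blast
  have "open V" "V \<subseteq> fst c" using fr_chd[OF fr(2)] by (auto simp: chd_def)
  from lift_local[OF fr(2) local_rumin_subset[OF RC_local_rumin[OF w c(1)] this] t] fr(1)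
  show "\<exists>V g. q \<in> V \<and> local_rumin k c V g \<and> (\<forall>q\<in>V. symbol_rel k c q (\<lambda>m. t ^ m) (\<omega> c q) (g q))" by blast
qed

end

section \<open>The bigraded components\<close>

lemma sum_form_apply: "(\<Sum>i\<in>I. f i) c q vs = (\<Sum>i\<in>I. f i c q vs)" for f :: "'i \<Rightarrow> ('m, 'd::finite) form"
  by (induction I rule: infinite_finite_induct) simp_all

text \<open>B collects independent vectors of S already used as arguments, so contraction with them
  gives zero. A further argument from S either depends on B, and the value vanishes, or enlarges B,
  which ends when the dimension of S is exceeded.\<close>

lemma alt_count_vanish_aux:
  assumes S: "vec.subspace S" "vec.dim S \<le> n"
    and a: "\<alpha> \<in> alt_forms k" and B: "B \<subseteq> S" "vec.independent B" "\<forall>b\<in>B. con b \<alpha> = (\<lambda>_. 0)" "n < card B + cnt S vs"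
  shows "\<alpha> vs = 0"
  using a B
proof (induction vs arbitrary: \<alpha> B k)
  case Nil
  then have "card B \<le> vec.dim S" by (intro vec.independent_card_le_dim) auto
  then show ?case using Nil.prems(5) S(2) by simp
next
  case (Cons v vs)
  note ca = con_alt'[OF Cons.prems(1)]
  have k: "con b (con v \<alpha>) = (\<lambda>_. 0)" if "b \<in> B" for b
    unfolding con_swap[OF Cons.prems(1), of b] using Cons.prems(4) that by (simp add: con_apply fun_eq_iff)
  have "con v \<alpha> vs = 0"
  proof (cases "v \<in> S")
    case False
    then show ?thesis using Cons.IH[OF ca Cons.prems(2,3)] k Cons.prems(5) by simp
  next
    case vS: True
    show ?thesis
    proof (cases "v \<in> vec.span B")
      case True
      then obtain t r where t: "t \<subseteq> B" "v = (\<Sum>b\<in>t. r b *s b)" unfolding vec.span_explicit by blast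
      have "\<alpha> (b # vs) = 0" if "b \<in> t" for b using Cons.prems(4) that t(1) by (metis con_apply subsetD)
      then show ?thesis using alt_Cons_sum[OF Cons.prems(1), of r "\<lambda>b. b" t vs] t(2) by (simp add: con_apply)
    next
      case False
      have fB: "finite B" using vec.independent_bound_general[OF Cons.prems(3)] by blast
      have vB: "v \<notin> B" using False vec.span_base by blast
      show ?thesis
      proof (rule Cons.IH[OF ca, of "insert v B"])
        show "vec.independent (insert v B)" by (rule vec.independent_insertI[OF False Cons.prems(3)])
        show "\<forall>b\<in>insert v B. con b (con v \<alpha>) = (\<lambda>_. 0)" using k con_con[OF Cons.prems(1)] by simp
        show "n < card (insert v B) + cnt S vs" using Cons.prems(5) vS vB fB by simp
      qed (use vS Cons.prems(2) in auto)
    qed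
  qed
  then show ?case by (simp add: con_apply)
qed

lemma alt_count_vanish:
  assumes "vec.subspace S" "\<alpha> \<in> alt_forms k" "vec.dim S < cnt S vs" shows "\<alpha> vs = 0"
  by (rule alt_count_vanish_aux[OF assms(1) order_refl assms(2), of "{}"]) (use assms(3) vec.independent_empty in auto)

context cr
begin

text \<open>Above degree \<open>n\<close> the contraction with the transversal vector has lowered the first type index by one.\<close>

definition type_coeff :: "nat \<Rightarrow> nat \<Rightarrow> nat \<Rightarrow> complex" where
  "type_coeff k a m = (if (if k \<le> n then m else Suc m) = a then 1 else 0)"

text \<open>A count is at most the number of arguments that it ranges over, k or k - 1. This matters
  because the roots of unity of a fixed order separate only finitely many counts.\<close>

lemma symbol_rel_cong:
  assumes "\<alpha> \<in> alt_forms k" "\<And>m. m + (if k \<le> n then 0 else 1) \<le> k \<Longrightarrow> h m = h' m" "symbol_rel k c q h \<alpha> \<beta>"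
  shows "symbol_rel k c q h' \<alpha> \<beta>"
proof -
  have 1: "h (cnt (T c q) vs) * \<alpha> vs = h' (cnt (T c q) vs) * \<alpha> vs" if "k \<le> n" for vs
    using alt_length[OF assms(1), of vs] assms(2)[of "cnt (T c q) vs"] cnt_le[of "T c q" vs] that by (cases "length vs = k") auto
  have 2: "h (cnt (T c q) vs) * \<alpha> (X # vs) = h' (cnt (T c q) vs) * \<alpha> (X # vs)" if "\<not> k \<le> n" for X vs
    using alt_length[OF assms(1), of "X # vs"] assms(2)[of "cnt (T c q) vs"] cnt_le[of "T c q" vs] that by (cases "length (X # vs) = k") auto
  show ?thesis using assms(3) unfolding symbol_rel_def by (auto simp: 1 2)
qed

text \<open>The type indices up to k are distinct modulo N = k + 1, so the average over the N-th
  roots of unity t with weight t^(-a) keeps one of them and cancels the others.\<close>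

theorem RC_component:
  assumes w: "\<omega> \<in> RC k" and a: "a \<le> k"
  shows "\<exists>\<omega>'\<in>RC k. \<forall>c\<in>A. \<forall>q\<in>fst c. symbol_rel k c q (type_coeff k a) (\<omega> c q) (\<omega>' c q)"
proof -
  define N where "N = Suc k"
  have N0: "of_nat N \<noteq> (0 :: complex)" unfolding N_def by (simp del: of_nat_Suc)
  define z where "z = exp (2 * of_real pi * \<i> * of_nat 1 / of_nat N :: complex)"
  \<comment> \<open>Above degree n the count is one less than the type index; the shift makes up for
    it.\<close>
  define s :: nat where "s = (if k \<le> n then 0 else 1)"
  have z0: "z ^ j \<noteq> 0" for j by (simp add: z_def)
  have "\<forall>j. \<exists>\<omega>'\<in>RC k. \<forall>c\<in>A. \<forall>q\<in>fst c. symbol_rel k c q (\<lambda>m. (z ^ j) ^ m) (\<omega> c q) (\<omega>' c q)"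
    using RC_lift[OF w z0] by blast
  then obtain f where f: "\<And>j. f j \<in> RC k" "\<And>j c q. c \<in> A \<Longrightarrow> q \<in> fst c \<Longrightarrow> symbol_rel k c q (\<lambda>m. (z ^ j) ^ m) (\<omega> c q) (f j c q)"
    by metis
  define w where "w j = (z ^ j) ^ s / (z ^ j) ^ a / of_nat N" for j
  let ?\<eta> = "\<Sum>j<N. fscale (w j) (f j)"
  have "symbol_rel k c q (type_coeff k a) (\<omega> c q) (?\<eta> c q)" if c: "c \<in> A" "q \<in> fst c" for c q
  proof (rule symbol_rel_cong[OF forms_alt[OF RC_forms[OF assms(1)] c(1) UNIV_I c(2)]])
    have "?\<eta> c q = (\<lambda>vs. \<Sum>j<N. w j * f j c q vs)" by (rule ext) (simp add: sum_form_apply fscale_def)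
    then show "symbol_rel k c q (\<lambda>m. \<Sum>j<N. w j * (z ^ j) ^ m) (\<omega> c q) (?\<eta> c q)"
      using symbol_rel_linear[of "{..<N}" k c q "\<lambda>j m. (z ^ j) ^ m" "\<omega> c q" "\<lambda>j. f j c q" w] f(2)[OF c] by simp
    fix m assume m: "m + (if k \<le> n then 0 else 1) \<le> k"
    have "(\<Sum>j<N. w j * (z ^ j) ^ m) = (\<Sum>j<N. (z ^ j) ^ (m + s) / (z ^ j) ^ a) / of_nat N"
      unfolding w_def sum_divide_distrib by (intro sum.cong refl) (simp add: power_add)
    also have "(\<Sum>j<N. (z ^ j) ^ (m + s) / (z ^ j) ^ a) = (if (m + s) mod N = a mod N then of_nat N else 0)"
      unfolding z_def by (rule sum_roots_unity) (simp add: N_def)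
    also have "(m + s) mod N = a mod N \<longleftrightarrow> m + s = a" using m a by (simp add: N_def s_def)
    finally show "(\<Sum>j<N. w j * (z ^ j) ^ m) = type_coeff k a m" using N0 by (simp add: type_coeff_def s_def)
  qed
  moreover have "?\<eta> \<in> RC k" by (intro RC_sum RC_fscale f(1))
  ultimately show ?thesis by blast
qed

text \<open>Uniqueness of lifts; identities between components are checked on symbols through
  it.\<close>

lemma RC_eqI:
  assumes w: "\<omega> \<in> RC k" "\<eta> \<in> RC k"
    and s: "\<And>c q. c \<in> A \<Longrightarrow> q \<in> fst c \<Longrightarrow> symbol_rel k c q h (\<alpha> c q) (\<omega> c q)" "\<And>c q. c \<in> A \<Longrightarrow> q \<in> fst c \<Longrightarrow> symbol_rel k c q h (\<alpha> c q) (\<eta> c q)"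
  shows "\<omega> = \<eta>"
proof (rule form_eqI[OF RC_forms[OF w(1)] RC_forms[OF w(2)]])
  fix c p vs assume c: "c \<in> A" "p \<in> fst c"
  show "\<omega> c p vs = \<eta> c p vs"
    by (rule local_rumin_unique[OF RC_local_rumin[OF w(1) c(1)] RC_local_rumin[OF w(2) c(1)] _ _ c(2), of h "\<alpha> c"]) (use s c(1) in blast)+
qed

definition component :: "nat \<Rightarrow> nat \<Rightarrow> ('m, 'd) form \<Rightarrow> ('m, 'd) form" where
  "component k a \<omega> = (SOME \<eta>. \<eta> \<in> RC k \<and> (\<forall>c\<in>A. \<forall>q\<in>fst c. symbol_rel k c q (type_coeff k a) (\<omega> c q) (\<eta> c q)))"

lemma component_props:
  assumes "\<omega> \<in> RC k" "a \<le> k"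
  shows "component k a \<omega> \<in> RC k" "c \<in> A \<Longrightarrow> q \<in> fst c \<Longrightarrow> symbol_rel k c q (type_coeff k a) (\<omega> c q) (component k a \<omega> c q)"
proof -
  have "\<exists>\<eta>. \<eta> \<in> RC k \<and> (\<forall>c\<in>A. \<forall>q\<in>fst c. symbol_rel k c q (type_coeff k a) (\<omega> c q) (\<eta> c q))"
    using RC_component[OF assms] by blast
  from someI_ex[OF this, folded component_def]
  show "component k a \<omega> \<in> RC k" "c \<in> A \<Longrightarrow> q \<in> fst c \<Longrightarrow> symbol_rel k c q (type_coeff k a) (\<omega> c q) (component k a \<omega> c q)" by blast+
qed

lemma component_eqI:
  assumes "\<omega> \<in> RC k" "a \<le> k" "\<eta> \<in> RC k" "\<And>c q. c \<in> A \<Longrightarrow> q \<in> fst c \<Longrightarrow> symbol_rel k c q (type_coeff k a) (\<omega> c q) (\<eta> c q)"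
  shows "component k a \<omega> = \<eta>"
  by (rule RC_eqI[OF component_props(1)[OF assms(1,2)] assms(3) component_props(2)[OF assms(1,2)] assms(4)])

definition typed :: "nat \<Rightarrow> nat \<Rightarrow> ('m, 'd) form \<Rightarrow> bool" where
  "typed k a \<omega> \<longleftrightarrow> (\<forall>c\<in>A. \<forall>q\<in>fst c. symbol_rel k c q (type_coeff k a) (\<omega> c q) (\<omega> c q))"

lemma symbol_rel_decompose:
  assumes "symbol_rel k c q h \<alpha> \<beta>" "symbol_rel k c q (\<lambda>m. h' m * h m) \<alpha> \<gamma>" shows "symbol_rel k c q h' \<beta> \<gamma>"
  using assms unfolding symbol_rel_def by (simp split: if_splits)

lemma type_coeff_idem: "(\<lambda>m. type_coeff k a m * type_coeff k a m) = type_coeff k a"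
  by (simp add: type_coeff_def fun_eq_iff)

lemma typed_component: "\<omega> \<in> RC k \<Longrightarrow> a \<le> k \<Longrightarrow> typed k a (component k a \<omega>)"
  unfolding typed_def using symbol_rel_decompose[OF component_props(2) , of \<omega> k a _ _ "type_coeff k a" "component k a \<omega> _ _"] component_props(2)[of \<omega> k a]
  by (simp add: type_coeff_idem)

lemma component_typed: "\<omega> \<in> RC k \<Longrightarrow> a \<le> k \<Longrightarrow> typed k a \<omega> \<Longrightarrow> component k a \<omega> = \<omega>"
  by (rule component_eqI) (simp_all add: typed_def)

lemma typed_iff: "\<omega> \<in> RC k \<Longrightarrow> a \<le> k \<Longrightarrow> typed k a \<omega> \<longleftrightarrow> component k a \<omega> = \<omega>"
  using component_typed typed_component by metis

lemma component_add:
  assumes "\<omega> \<in> RC k" "\<eta> \<in> RC k" "a \<le> k" shows "component k a (\<omega> + \<eta>) = component k a \<omega> + component k a \<eta>"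
proof (rule component_eqI[OF RC_add[OF assms(1,2)] assms(3) RC_add])
  fix c q assume c: "c \<in> A" "q \<in> fst c"
  show "symbol_rel k c q (type_coeff k a) ((\<omega> + \<eta>) c q) ((component k a \<omega> + component k a \<eta>) c q)"
    using component_props(2)[OF assms(1,3) c] component_props(2)[OF assms(2,3) c] unfolding symbol_rel_def by (simp add: algebra_simps split: if_splits)
qed (use component_props(1) assms in auto)

lemma component_fscale:
  assumes "\<omega> \<in> RC k" "a \<le> k" shows "component k a (fscale z \<omega>) = fscale z (component k a \<omega>)"
proof (rule component_eqI[OF RC_fscale[OF assms(1)] assms(2) RC_fscale])
  fix c q assume c: "c \<in> A" "q \<in> fst c"
  show "symbol_rel k c q (type_coeff k a) (fscale z \<omega> c q) (fscale z (component k a \<omega>) c q)"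
    using component_props(2)[OF assms c] unfolding symbol_rel_def by (simp add: fscale_def split: if_splits)
qed (use component_props(1) assms in auto)

text \<open>For every count that occurs, the coefficients \<open>type_coeff k a\<close> add up to 1
  over a \<le> k.\<close>

lemma component_sum:
  assumes w: "\<omega> \<in> RC k" shows "(\<Sum>a\<le>k. component k a \<omega>) = \<omega>"
proof (rule RC_eqI[OF RC_sum w, where h = "\<lambda>_. 1" and \<alpha> = \<omega>])
  show "component k a \<omega> \<in> RC k" if "a \<in> {..k}" for a using component_props(1)[OF w] that by simp
  fix c q assume c: "c \<in> A" "q \<in> fst c"
  show "symbol_rel k c q (\<lambda>_. 1) (\<omega> c q) (\<omega> c q)" by (simp add: symbol_rel_def)
  show "symbol_rel k c q (\<lambda>_. 1) (\<omega> c q) ((\<Sum>a\<le>k. component k a \<omega>) c q)"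
  proof (rule symbol_rel_cong[OF forms_alt[OF RC_forms[OF w] c(1) UNIV_I c(2)]])
    have "(\<Sum>a\<le>k. component k a \<omega>) c q = (\<lambda>vs. \<Sum>a\<le>k. 1 * component k a \<omega> c q vs)"
      by (rule ext) (simp add: sum_form_apply)
    then show "symbol_rel k c q (\<lambda>m. \<Sum>a\<le>k. 1 * type_coeff k a m) (\<omega> c q) ((\<Sum>a\<le>k. component k a \<omega>) c q)"
      using symbol_rel_linear[of "{..k}" k c q "type_coeff k" "\<omega> c q" "\<lambda>a. component k a \<omega> c q" "\<lambda>_. 1"] component_props(2)[OF w _ c] by simp
  qed (simp add: type_coeff_def split: if_splits)
qed

text \<open>Summands of other types have zero coefficient. The resulting uniqueness of the
  decomposition is what the definite description in \<open>proj_pq\<close> requires.\<close>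

lemma component_of_sum:
  assumes f: "\<And>a. a \<le> k \<Longrightarrow> f a \<in> RC k \<and> typed k a (f a)" and p: "p \<le> k"
  shows "component k p (\<Sum>a\<le>k. f a) = f p"
proof (rule component_eqI[OF RC_sum p])
  show "f a \<in> RC k" if "a \<in> {..k}" for a using f that by simp
  show "f p \<in> RC k" using f p by blast
  fix c q assume c: "c \<in> A" "q \<in> fst c"
  have s: "symbol_rel k c q (type_coeff k a) (f a c q) (f a c q)" if "a \<le> k" for a using f[OF that] c by (simp add: typed_def)
  have h: "type_coeff k a m * type_coeff k p m = (if a = p then type_coeff k p m else 0)" for a m by (auto simp: type_coeff_def)
  show "symbol_rel k c q (type_coeff k p) ((\<Sum>a\<le>k. f a) c q) (f p c q)"
  proof (cases "k \<le> n")
    case True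
    have "f p c q vs = type_coeff k p (cnt (T c q) vs) * (\<Sum>a\<le>k. f a c q vs)" if vs: "set vs \<subseteq> T c q \<union> T01 T c q" for vs
    proof -
      have e: "f a c q vs = type_coeff k a (cnt (T c q) vs) * f a c q vs" if "a \<le> k" for a
        using s[OF that] vs True by (simp add: symbol_rel_def)
      have "type_coeff k p (cnt (T c q) vs) * (\<Sum>a\<le>k. f a c q vs) = (\<Sum>a\<le>k. (type_coeff k a (cnt (T c q) vs) * type_coeff k p (cnt (T c q) vs)) * f a c q vs)"
        unfolding sum_distrib_left by (intro sum.cong refl, subst e) (simp_all add: mult_ac)
      also have "\<dots> = (\<Sum>a\<le>k. if a = p then f p c q vs else 0)"
        unfolding h using e[OF p] by (intro sum.cong refl) auto
      finally show ?thesis using p by simp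
    qed
    then show ?thesis using True by (simp add: symbol_rel_def sum_form_apply)
  next
    case False
    have "f p c q (X # vs) = type_coeff k p (cnt (T c q) vs) * (\<Sum>a\<le>k. f a c q (X # vs))" if vs: "set vs \<subseteq> T c q \<union> T01 T c q" for X vs
    proof -
      have e: "f a c q (X # vs) = type_coeff k a (cnt (T c q) vs) * f a c q (X # vs)" if "a \<le> k" for a
        using s[OF that, unfolded symbol_rel_def, rule_format, OF vs] False by (simp only: if_False)
      have "type_coeff k p (cnt (T c q) vs) * (\<Sum>a\<le>k. f a c q (X # vs)) = (\<Sum>a\<le>k. (type_coeff k a (cnt (T c q) vs) * type_coeff k p (cnt (T c q) vs)) * f a c q (X # vs))"
        unfolding sum_distrib_left by (intro sum.cong refl, subst e) (simp_all add: mult_ac)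
      also have "\<dots> = (\<Sum>a\<le>k. if a = p then f p c q (X # vs) else 0)"
        unfolding h using e[OF p] by (intro sum.cong refl) auto
      finally show ?thesis using p by simp
    qed
    then show ?thesis using False by (simp add: symbol_rel_def sum_form_apply)
  qed
qed

lemma symbol_relD:
  assumes "symbol_rel k c q h \<alpha> \<beta>" "set vs \<subseteq> T c q \<union> T01 T c q"
  shows "k \<le> n \<Longrightarrow> \<beta> vs = h (cnt (T c q) vs) * \<alpha> vs" "n < k \<Longrightarrow> \<beta> (X # vs) = h (cnt (T c q) vs) * \<alpha> (X # vs)"
  using assms(1)[unfolded symbol_rel_def, rule_format, OF assms(2)] by (simp_all only: if_True if_False not_le[symmetric] simp_thms)

section \<open>Comparison with the given bigrading\<close>

lemma T01_dim: assumes "c \<in> A" "p \<in> fst c" shows "vec.dim (T01 T c p) = n"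
  using vec.dim_sums_Int[OF T_subspace[OF assms] T01_subspace[OF assms]] T_Int[OF assms] T_dim[OF assms] HC_dim_le[OF assms]
  by (simp add: HC_def)

lemma frame_Lambda:
  assumes c: "c \<in> A" "q \<in> fst c" and a: "\<alpha> \<in> alt_forms k" and k: "int k = a + b" "0 \<le> b"
  shows "has_type T c q a b \<alpha> \<longleftrightarrow> ptype (T c q) (T01 T c q) a \<alpha>"
proof -
  obtain V F \<epsilon> where fr: "q \<in> V" "frame c V F \<epsilon>" using frame_exists[OF c] by blast
  show ?thesis unfolding has_type_def
    by (rule Lambda_iff_ptype[OF fr_dual_frame[OF fr(2,1)] T_Int[OF c] a k T_HC[OF c] HC_span])
qed

text \<open>The form vanishes on H, so its contraction on H depends only on Y modulo H, where X
  spans. Types can therefore be tested with any transversal vector in place of a Reeb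
  vector.\<close>

lemma RC_high_transversal:
  assumes w: "\<omega> \<in> RC k" and k: "n < k" and c: "c \<in> A" "q \<in> fst c" and X: "X \<notin> HC T c q"
  shows "\<exists>s. \<forall>vs. set vs \<subseteq> HC T c q \<longrightarrow> \<omega> c q (Y # vs) = s * \<omega> c q (X # vs)"
proof -
  note a = forms_alt[OF RC_forms[OF w] c(1) UNIV_I c(2)]
  obtain s where "Y - s *s X \<in> vec.span (HC T c q)"
    using HC_transversal_span[OF c X, of Y] unfolding vec.span_insert by blast
  then have Y: "Y + (- s) *s X \<in> HC T c q" using vec.span_eq_iff[THEN iffD2, OF HC_subspace[OF c]] by simp
  obtain \<Omega> where l: "levi_at c q \<Omega>" using levi_at_exists[OF c] by blast
  have van: "vanish (HC T c q) (\<omega> c q)" using RC_rumin_at[OF w l] k by (simp add: rumin_at_def)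
  have "\<omega> c q (Y # vs) = s * \<omega> c q (X # vs)" if vs: "set vs \<subseteq> HC T c q" for vs
  proof -
    have "\<omega> c q ((Y + (- s) *s X) # vs) = 0" using van Y vs by (simp add: vanish_def)
    then show ?thesis unfolding alt_Cons_add[OF a] alt_Cons_smult[OF a] by simp
  qed
  then show ?thesis by blast
qed

lemma symbol_rel_type_coeff_low:
  assumes "k \<le> n" shows "symbol_rel k c q (type_coeff k a) \<alpha> \<alpha> \<longleftrightarrow> ptype (T c q) (T01 T c q) (int a) \<alpha>"
  using assms unfolding symbol_rel_def ptype_def type_coeff_def by auto

lemma symbol_rel_type_coeff_high:
  assumes w: "\<omega> \<in> RC k" and k: "n < k" and c: "c \<in> A" "q \<in> fst c" and X: "X \<notin> HC T c q"
  shows "symbol_rel k c q (type_coeff k a) (\<omega> c q) (\<omega> c q) \<longleftrightarrow> ptype (T c q) (T01 T c q) (int a - 1) (\<lambda>vs. \<omega> c q (X # vs))"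
proof
  show "ptype (T c q) (T01 T c q) (int a - 1) (\<lambda>vs. \<omega> c q (X # vs))" if "symbol_rel k c q (type_coeff k a) (\<omega> c q) (\<omega> c q)"
    using that k unfolding symbol_rel_def ptype_def type_coeff_def by auto
  assume p: "ptype (T c q) (T01 T c q) (int a - 1) (\<lambda>vs. \<omega> c q (X # vs))"
  have "\<omega> c q (Y # vs) = type_coeff k a (cnt (T c q) vs) * \<omega> c q (Y # vs)" if vs: "set vs \<subseteq> T c q \<union> T01 T c q" for vs Y
  proof -
    obtain s where "\<omega> c q (Y # vs) = s * \<omega> c q (X # vs)"
      using RC_high_transversal[OF w k c X] order_trans[OF vs T_HC[OF c]] by blast
    moreover have "Suc (cnt (T c q) vs) \<noteq> a \<Longrightarrow> \<omega> c q (X # vs) = 0"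
      using p vs unfolding ptype_def by auto
    ultimately show ?thesis using k by (auto simp: type_coeff_def)
  qed
  then show "symbol_rel k c q (type_coeff k a) (\<omega> c q) (\<omega> c q)" using k by (simp add: symbol_rel_def)
qed

text \<open>Besides the transversal argument, a nonzero value allows at most n arguments from
  T^{1,0} and at most n from T^{0,1}. This matches the convention that R^{p,q} is zero for p > n + 1
  or q > n.\<close>

lemma typed_out_of_range:
  assumes w: "\<omega> \<in> RC k" and a: "a \<le> k" "n + 1 < a \<or> n < k - a" and t: "typed k a \<omega>"
  shows "\<omega> = 0"
proof (rule RC_eqI[OF w RC_0, where h = "\<lambda>_. 0" and \<alpha> = \<omega>])
  have k: "n < k" using a by linarith
  fix c q assume c: "c \<in> A" "q \<in> fst c"
  note alt = forms_alt[OF RC_forms[OF w] c(1) UNIV_I c(2)]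
  have "\<omega> c q (X # vs) = 0" if vs: "set vs \<subseteq> T c q \<union> T01 T c q" for X vs
  proof (rule ccontr)
    assume nz: "\<omega> c q (X # vs) \<noteq> 0"
    note ca = con_alt'[OF alt, of X]
    have "\<omega> c q (X # vs) = type_coeff k a (cnt (T c q) vs) * \<omega> c q (X # vs)"
      using t c unfolding typed_def by (intro symbol_relD(2)[OF _ vs k]) blast
    then have ct: "Suc (cnt (T c q) vs) = a" using nz k by (simp add: type_coeff_def split: if_splits)
    have len: "Suc (length vs) = k" using nz alt_length[OF alt, of "X # vs"] by auto
    have "cnt (T c q) vs \<le> n"
      using alt_count_vanish[OF T_subspace[OF c] ca, of vs] nz T_dim[OF c] T01_dim[OF c] by (force simp: con_apply)
    moreover have "cnt (T01 T c q) vs \<le> n"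
      using alt_count_vanish[OF T01_subspace[OF c] ca, of vs] nz T_dim[OF c] T01_dim[OF c] by (force simp: con_apply)
    moreover have "length vs \<le> cnt (T c q) vs + cnt (T01 T c q) vs"
      using vs by (induction vs) auto
    ultimately show False using a ct len by linarith
  qed
  then show "symbol_rel k c q (\<lambda>_. 0) (\<omega> c q) (\<omega> c q)" using k by (simp add: symbol_rel_def)
  show "symbol_rel k c q (\<lambda>_. 0) (\<omega> c q) ((0 :: ('m, 'd) form) c q)" by (simp add: symbol_rel_def)
qed

theorem rumin_pq_typed:
  assumes C: "contact_choice A T C" and a: "a \<le> k"
  shows "rumin_pq n A T C a (k - a) = {\<omega> \<in> RC k. typed k a \<omega>}"
proof (cases "a \<le> n + 1 \<and> k - a \<le> n")
  case False
  then have "typed k a \<omega> \<Longrightarrow> \<omega> \<in> RC k \<Longrightarrow> \<omega> = 0" for \<omega> using typed_out_of_range[of \<omega> k a] a by auto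
  moreover have "typed k a 0" by (simp add: typed_def symbol_rel_def)
  ultimately show ?thesis using False RC_0 by (auto simp: rumin_pq_def)
next
  case True
  have ka: "a + (k - a) = k" "int k = int a + int (k - a)" using a by simp_all
  show ?thesis
  proof (cases "k \<le> n")
    case k: True
    have "(\<forall>c\<in>A. \<forall>x\<in>fst c. has_type T c x (int a) (int (k - a)) (\<omega> c x)) \<longleftrightarrow> typed k a \<omega>" if w: "\<omega> \<in> RC k" for \<omega>
      unfolding typed_def
      by (intro ball_cong refl)
         (use frame_Lambda[OF _ _ forms_alt[OF RC_forms[OF w] _ UNIV_I] ka(2)] symbol_rel_type_coeff_low[OF k] in simp)
    then show ?thesis using True k by (auto simp: rumin_pq_def ka(1) ruminC_RC[OF C])
  next
    case k: False
    have "(\<forall>(U, \<theta>)\<in>C. \<forall>c\<in>A. \<forall>x\<in>U \<inter> fst c.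
        has_type T c x (int a - 1) (int (k - a)) (\<lambda>vs. \<omega> c x (cvec (reeb \<theta> c x) # vs))) \<longleftrightarrow> typed k a \<omega>" (is "?L \<longleftrightarrow> _")
      if w: "\<omega> \<in> RC k" for \<omega>
    proof -
      have e: "has_type T c x (int a - 1) (int (k - a)) (\<lambda>vs. \<omega> c x (cvec (reeb \<theta> c x) # vs)) \<longleftrightarrow>
          symbol_rel k c x (type_coeff k a) (\<omega> c x) (\<omega> c x)" if U: "(U, \<theta>) \<in> C" "x \<in> U" and c: "c \<in> A" "x \<in> fst c" for U \<theta> c x
      proof -
        note ct = contact_choiceD(1)[OF C U(1)]
        have X: "cvec (reeb \<theta> c x) \<notin> HC T c x"
          using contact_reeb[OF ct c(1) U(2) c(2)] contact_HC[OF ct c(1) U(2) c(2), of "cvec (reeb \<theta> c x)"] by simp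
        have al: "(\<lambda>vs. \<omega> c x (cvec (reeb \<theta> c x) # vs)) \<in> alt_forms (k - 1)"
          using con_alt'[OF forms_alt[OF RC_forms[OF w] c(1) UNIV_I c(2)], of "cvec (reeb \<theta> c x)"] by (simp add: con_def)
        have i: "int (k - 1) = (int a - 1) + int (k - a)" using a k by linarith
        have kn: "n < k" using k by simp
        show ?thesis unfolding symbol_rel_type_coeff_high[OF w kn c X] by (rule frame_Lambda[OF c al i]) simp
      qed
      show ?thesis
      proof
        assume L: ?L
        show "typed k a \<omega>" unfolding typed_def
        proof (intro ballI)
          fix c x assume c: "c \<in> A" "x \<in> fst c"
          obtain U \<theta> where U: "(U, \<theta>) \<in> C" "x \<in> U" using contact_choiceD(2)[OF C] by blast
          have "has_type T c x (int a - 1) (int (k - a)) (\<lambda>vs. \<omega> c x (cvec (reeb \<theta> c x) # vs))"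
            using bspec[OF L U(1)] c U(2) by simp
          then show "symbol_rel k c x (type_coeff k a) (\<omega> c x) (\<omega> c x)" unfolding e[OF U c] .
        qed
      next
        assume t: "typed k a \<omega>"
        show ?L
        proof
          fix y assume y: "y \<in> C"
          obtain U \<theta> where U: "y = (U, \<theta>)" by (cases y)
          have UC: "(U, \<theta>) \<in> C" using y U by simp
          have "has_type T c x (int a - 1) (int (k - a)) (\<lambda>vs. \<omega> c x (cvec (reeb \<theta> c x) # vs))"
            if c: "c \<in> A" "x \<in> U \<inter> fst c" for c x
            using e[OF UC _ c(1), of x] t c unfolding typed_def by blast
          then show "case y of (U, \<theta>) \<Rightarrow> \<forall>c\<in>A. \<forall>x\<in>U \<inter> fst c.
            has_type T c x (int a - 1) (int (k - a)) (\<lambda>vs. \<omega> c x (cvec (reeb \<theta> c x) # vs))" unfolding U prod.case by blast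
        qed
      qed
    qed
    then show ?thesis
      unfolding rumin_pq_def ka(1) ruminC_RC[OF C] if_P[OF True] if_not_P[OF k]
      by (intro Collect_cong conj_cong refl)
  qed
qed

theorem proj_component:
  assumes C: "contact_choice A T C" and p: "p \<le> k" and w: "\<omega> \<in> RC k"
  shows "proj_pq n A T C p (k - p) \<omega> = component k p \<omega>"
proof -
  have k: "p + (k - p) = k" using p by simp
  show ?thesis unfolding proj_pq_def k
  proof (rule the_equality)
    show "\<exists>f. (\<forall>a\<le>k. f a \<in> rumin_pq n A T C a (k - a)) \<and> \<omega> = (\<Sum>a\<le>k. f a) \<and> component k p \<omega> = f p"
      using component_sum[OF w] component_props(1)[OF w] typed_component[OF w]
      by (intro exI[of _ "\<lambda>a. component k a \<omega>"]) (simp add: rumin_pq_typed[OF C])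
    fix \<eta> assume "\<exists>f. (\<forall>a\<le>k. f a \<in> rumin_pq n A T C a (k - a)) \<and> \<omega> = (\<Sum>a\<le>k. f a) \<and> \<eta> = f p"
    then obtain f where f: "\<forall>a\<le>k. f a \<in> rumin_pq n A T C a (k - a)" "\<omega> = (\<Sum>a\<le>k. f a)" "\<eta> = f p" by blast
    show "\<eta> = component k p \<omega>"
      unfolding f(2,3) by (rule component_of_sum[OF _ p, symmetric]) (use f(1) rumin_pq_typed[OF C] in auto)
  qed
qed

section \<open>The projection to R^{0,k}\<close>

definition P0 :: "nat \<Rightarrow> ('m, 'd) form \<Rightarrow> ('m, 'd) form" where
  "P0 k = component k 0"

lemma P0_RC: "\<omega> \<in> RC k \<Longrightarrow> P0 k \<omega> \<in> RC k"
  and P0_add: "\<omega> \<in> RC k \<Longrightarrow> \<eta> \<in> RC k \<Longrightarrow> P0 k (\<omega> + \<eta>) = P0 k \<omega> + P0 k \<eta>"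
  and P0_fscale: "\<omega> \<in> RC k \<Longrightarrow> P0 k (fscale z \<omega>) = fscale z (P0 k \<omega>)"
  and P0_idem: "\<omega> \<in> RC k \<Longrightarrow> P0 k (P0 k \<omega>) = P0 k \<omega>"
  and P0_proj: "contact_choice A T C \<Longrightarrow> \<omega> \<in> RC k \<Longrightarrow> proj_pq n A T C 0 k \<omega> = P0 k \<omega>"
  and P0_rumin: "contact_choice A T C \<Longrightarrow> rumin_pq n A T C 0 k = {\<omega> \<in> RC k. P0 k \<omega> = \<omega>}"
  unfolding P0_def
  using component_props(1) component_add component_fscale component_typed typed_component typed_iff proj_component[of C 0 k \<omega>]
    rumin_pq_typed[of C 0 k] by auto

lemma alt_zero_mem: "\<alpha> \<in> alt_forms k \<Longrightarrow> 0 \<in> set vs \<Longrightarrow> \<alpha> vs = 0"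
proof (induction vs arbitrary: \<alpha> k)
  case (Cons v vs)
  show ?case
  proof (cases "v = 0")
    case False
    then show ?thesis using Cons.IH[OF con_alt'[OF Cons.prems(1), of v]] Cons.prems(2) by (simp add: con_apply)
  qed (use alt_Cons_zero[OF Cons.prems(1)] in simp)
qed simp

lemma cnt_0_T01:
  assumes "set vs \<subseteq> T c q \<union> T01 T c q" "cnt (T c q) vs = 0" shows "set vs \<subseteq> T01 T c q"
  using assms by (induction vs) (auto split: if_splits)

lemma cnt_T01:
  assumes c: "c \<in> A" "q \<in> fst c" and vs: "set vs \<subseteq> T01 T c q" "0 \<notin> set vs" shows "cnt (T c q) vs = 0"
  using vs T_Int[OF c] by (induction vs) auto

text \<open>For k \<le> n the (0,k) part of the symbol is the restriction to T^{0,1}. Above n there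
  is no such part: the type index is one more than a count, hence never 0.\<close>

lemma P0_eq_0_iff:
  assumes w: "\<omega> \<in> RC k"
  shows "P0 k \<omega> = 0 \<longleftrightarrow> (k \<le> n \<longrightarrow> (\<forall>c\<in>A. \<forall>q\<in>fst c. vanish (T01 T c q) (\<omega> c q)))" (is "_ \<longleftrightarrow> ?R")
proof
  assume P: "P0 k \<omega> = 0"
  show ?R unfolding vanish_def
  proof (intro impI ballI allI)
    fix c q vs assume k: "k \<le> n" and c: "c \<in> A" "q \<in> fst c" and vs: "set vs \<subseteq> T01 T c q"
    have s: "symbol_rel k c q (type_coeff k 0) (\<omega> c q) (P0 k \<omega> c q)" using component_props(2)[OF w _ c] by (simp add: P0_def)
    show "\<omega> c q vs = 0"
    \<comment> \<open>The zero vector also belongs to T^{1,0} and would spoil the count.\<close>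
    proof (cases "0 \<in> set vs")
      case True
      then show ?thesis using alt_zero_mem[OF forms_alt[OF RC_forms[OF w] c(1) UNIV_I c(2)]] by blast
    next
      case False
      have "set vs \<subseteq> T c q \<union> T01 T c q" using vs by blast
      from symbol_relD(1)[OF s this k] show ?thesis using k by (simp add: P type_coeff_def cnt_T01[OF c vs False])
    qed
  qed
next
  assume R: ?R
  show "P0 k \<omega> = 0" unfolding P0_def
  proof (rule component_eqI[OF w _ RC_0])
    fix c q assume c: "c \<in> A" "q \<in> fst c"
    show "symbol_rel k c q (type_coeff k 0) (\<omega> c q) ((0 :: ('m, 'd) form) c q)"
    proof (cases "k \<le> n")
      case True
      have "type_coeff k 0 (cnt (T c q) vs) * \<omega> c q vs = 0" if "set vs \<subseteq> T c q \<union> T01 T c q" for vs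
        using R True c cnt_0_T01[OF that] by (auto simp: type_coeff_def vanish_def)
      then show ?thesis using True by (simp add: symbol_rel_def)
    qed (simp add: symbol_rel_def type_coeff_def)
  qed simp
qed

lemma P0_high: "\<omega> \<in> RC k \<Longrightarrow> n < k \<Longrightarrow> P0 k \<omega> = 0"
  using P0_eq_0_iff by simp

text \<open>This is the integrability of $T^{0,1}$.\<close>

theorem P0_ext_d:
  assumes w: "\<omega> \<in> RC k" and P: "P0 k \<omega> = 0" shows "P0 (Suc k) (ext_d \<omega>) = 0"
  unfolding P0_eq_0_iff[OF RC_ext_d[OF w]]
proof (intro impI ballI)
  fix c q assume k: "Suc k \<le> n" and c: "c \<in> A" "q \<in> fst c"
  have v: "vanish (T01 T c q) (\<omega> c q)" if "q \<in> fst c" for q using P k c(1) that unfolding P0_eq_0_iff[OF w] by simp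
  obtain V F \<epsilon> where fr: "q \<in> V" "frame c V F \<epsilon>" using frame_exists[OF c] by blast
  have V: "open V" "V \<subseteq> fst c" "chd c V" using fr_chd[OF fr(2)] by (auto simp: chd_def)
  have l: "lform c V k (\<omega> c)" by (rule lform_subset[OF forms_lform_UNIV[OF RC_forms[OF w] c(1)] V(1,2)])
  show "vanish (T01 T c q) (ext_d \<omega> c q)" unfolding vanish_def
  proof (intro allI impI)
    fix vs assume vs: "set vs \<subseteq> T01 T c q"
    \<comment> \<open>The arguments are extended to sections of T^{0,1}; the form vanishes along
      these throughout V, as Cartan's formula requires.\<close>
    let ?X = "hext F \<epsilon> q"
    have Xs: "smooth_in c V (?X v)" "?X v q = v" "\<And>r. r \<in> V \<Longrightarrow> ?X v r \<in> T01 T c r" if "v \<in> set vs" for v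
      using hext_facts[OF fr(2,1), of v] that vs T_HC[OF c] by blast+
    have "dl c (\<omega> c) q (map (\<lambda>X. X q) (map ?X vs)) = 0"
    proof (rule dl_involutive_vanish[OF l fr(1), of "T01 T c"])
      show "vanish (T01 T c r) (\<omega> c r)" if "r \<in> V" for r using v V(2) that by blast
      show "smooth_in c V X \<and> (\<forall>q\<in>V. X q \<in> T01 T c q)" if "X \<in> set (map ?X vs)" for X
        using that Xs by auto
      show "bracket c X Y q \<in> T01 T c q" if "X \<in> set (map ?X vs)" "Y \<in> set (map ?X vs)" for X Y
        by (rule T01_involutive[OF V(3) _ _ _ fr(1)]) (use that Xs in auto)
    qed
    also have "map (\<lambda>X. X q) (map ?X vs) = vs" using Xs(2) by (simp add: map_idI)
    finally show "ext_d \<omega> c q vs = 0" using c by (simp add: ext_d_dl)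
  qed
qed

lemma component_high_conj:
  assumes w: "\<omega> \<in> RC k" and k: "0 < k" "k \<le> n" and c: "c \<in> A" "q \<in> fst c" and vs: "set vs \<subseteq> T c q"
    and P: "P0 k (fcnj \<omega>) = 0"
  shows "\<omega> c q vs = 0"
proof -
  have "set (map vcnj vs) \<subseteq> T01 T c q" using vs vcnj_T(1)[of _ c q] by auto
  then have "fcnj \<omega> c q (map vcnj vs) = 0"
    using P k c unfolding P0_eq_0_iff[OF RC_fcnj[OF w]] vanish_def by blast
  then show ?thesis by (simp add: fcnj_def del: map_map)
qed

text \<open>On T^{0,1} the conjugate form takes the conjugates of the values of \<omega> on T^{1,0}.
  There all k > 0 arguments count, so a form of type (0,k) gives zero.\<close>

theorem P0_fcnj:
  assumes w: "\<omega> \<in> RC k" and k: "0 < k" and t: "P0 k \<omega> = \<omega>" shows "P0 k (fcnj \<omega>) = 0"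
  unfolding P0_eq_0_iff[OF RC_fcnj[OF w]] vanish_def
proof (intro impI ballI allI)
  fix c q vs assume kn: "k \<le> n" and c: "c \<in> A" "q \<in> fst c" and vs: "set vs \<subseteq> T01 T c q"
  note alt = forms_alt[OF RC_forms[OF w] c(1) UNIV_I c(2)]
  have T: "set (map vcnj vs) \<subseteq> T c q" using vs vcnj_T(2)[of _ c q] by auto
  have "symbol_rel k c q (type_coeff k 0) (\<omega> c q) (\<omega> c q)" using component_props(2)[OF w _ c, of 0] t by (simp add: P0_def)
  then have e: "\<omega> c q (map vcnj vs) = type_coeff k 0 (cnt (T c q) (map vcnj vs)) * \<omega> c q (map vcnj vs)"
    by (rule symbol_relD(1)[OF _ _ kn]) (use T in blast)
  have "cnt (T c q) (map vcnj vs) = length vs" using T by (simp add: cnt_def filter_id_conv subset_iff)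
  then show "fcnj \<omega> c q vs = 0"
    using e alt_length[OF alt, of "map vcnj vs"] k kn by (cases "length vs = k") (simp_all add: fcnj_def type_coeff_def)
qed

text \<open>A single argument from the two spaces lies in T^{1,0} or in T^{0,1}, and reality carries
  the vanishing from one to the other. By n \<ge> 1 degree 1 is in the range where symbols are
  restrictions to H.\<close>

theorem real_P0_1:
  assumes w: "\<omega> \<in> RC 1" and r: "real_form \<omega>" and P: "P0 1 \<omega> = 0" shows "\<omega> = 0"
proof (rule RC_eqI[OF w RC_0, where h = "\<lambda>_. 0" and \<alpha> = \<omega>])
  fix c q assume c: "c \<in> A" "q \<in> fst c"
  note alt = forms_alt[OF RC_forms[OF w] c(1) UNIV_I c(2)]
  show "symbol_rel 1 c q (\<lambda>_. 0) (\<omega> c q) ((0 :: ('m, 'd) form) c q)" by (simp add: symbol_rel_def)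
  have "\<omega> c q vs = 0" if vs: "set vs \<subseteq> T c q \<union> T01 T c q" for vs
  proof (cases "length vs = 1")
    case True
    then have "set vs \<subseteq> T c q \<or> set vs \<subseteq> T01 T c q" using vs by (auto simp: length_Suc_conv)
    then show ?thesis
    proof
      assume "set vs \<subseteq> T c q"
      then show ?thesis using component_high_conj[OF w _ _ c] r P n1 by (simp add: real_form_def)
    next
      assume "set vs \<subseteq> T01 T c q"
      then show ?thesis using P n1 c unfolding P0_eq_0_iff[OF w] vanish_def by blast
    qed
  qed (use alt_length[OF alt] in simp)
  then show "symbol_rel 1 c q (\<lambda>_. 0) (\<omega> c q) (\<omega> c q)" using n1 by (simp add: symbol_rel_def)
qed

lemma P0_0: "\<omega> \<in> RC 0 \<Longrightarrow> P0 0 \<omega> = \<omega>"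
  using component_sum[of \<omega> 0] by (simp add: P0_def)

text \<open>For k < n the sum in the definition omits the two extreme types (0,k+1) and (k+1,0). For
  a real form these are conjugate, so P alone detects both. For k \<ge> n the condition on P is
  automatic.\<close>

theorem crp_P0:
  assumes C: "contact_choice A T C" and k: "1 \<le> k"
  shows "crp n A T C k = {\<omega> \<in> RC (Suc k). real_form \<omega> \<and> P0 (Suc k) \<omega> = 0}"
proof -
  consider "k < n" | "n \<le> k" "k \<le> 2 * n" | "2 * n < k" by linarith
  then show ?thesis
  proof cases
    case 2
    then show ?thesis using k P0_high[of _ "Suc k"] by (auto simp: crp_def rumin_RC[OF C])
  next
    case 3
    have "real_form (0 :: ('m, 'd) form)" by (simp add: real_form_def fcnj_def[abs_def] zero_fun_def)
    then show ?thesis using 3 k RC_big[of "Suc k"] P0_high[OF RC_0, of "Suc k"] by (auto simp: crp_def)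
  next
    case 1
    have rp: "rumin_pq n A T C j (k + 1 - j) = {\<omega> \<in> RC (Suc k). typed (Suc k) j \<omega>}" if "j \<in> {1..k}" for j
      using rumin_pq_typed[OF C, of j "Suc k"] that by simp
    have "\<omega> \<in> RC (Suc k) \<and> P0 (Suc k) \<omega> = 0" if f: "\<forall>j\<in>{1..k}. f j \<in> RC (Suc k) \<and> typed (Suc k) j (f j)" and w: "\<omega> = (\<Sum>j=1..k. f j)" for f \<omega>
    proof -
      define g where "g a = (if a \<in> {1..k} then f a else 0)" for a
      have g: "g a \<in> RC (Suc k) \<and> typed (Suc k) a (g a)" for a
        using f RC_0 by (simp add: g_def typed_def symbol_rel_def)
      have e: "\<omega> = (\<Sum>a\<le>Suc k. g a)" unfolding w g_def by (rule sum.mono_neutral_cong_left) auto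
      show ?thesis unfolding P0_def e using component_of_sum[of "Suc k" g 0] g RC_sum[of "{..Suc k}" g] by (auto simp: g_def)
    qed
    moreover have "\<exists>f. (\<forall>j\<in>{1..k}. f j \<in> RC (Suc k) \<and> typed (Suc k) j (f j)) \<and> \<omega> = (\<Sum>j=1..k. f j)"
      if w: "\<omega> \<in> RC (Suc k)" "real_form \<omega>" "P0 (Suc k) \<omega> = 0" for \<omega>
    proof (intro exI conjI ballI)
      show "component (Suc k) j \<omega> \<in> RC (Suc k)" "typed (Suc k) j (component (Suc k) j \<omega>)" if "j \<in> {1..k}" for j
        using that component_props(1)[OF w(1)] typed_component[OF w(1)] by auto
      have "component (Suc k) (Suc k) \<omega> = 0"
      proof (rule component_eqI[OF w(1) order_refl RC_0])
        fix c q assume c: "c \<in> A" "q \<in> fst c"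
        note alt = forms_alt[OF RC_forms[OF w(1)] c(1) UNIV_I c(2)]
        have "type_coeff (Suc k) (Suc k) (cnt (T c q) vs) * \<omega> c q vs = 0" if vs: "set vs \<subseteq> T c q \<union> T01 T c q" for vs
        proof (cases "length vs = Suc k \<and> cnt (T c q) vs = Suc k")
          case True
          then have "set vs \<subseteq> T c q"
            unfolding cnt_def by (metis filter_id_conv length_filter_less less_irrefl subset_code(1))
          then show ?thesis using component_high_conj[OF w(1) _ _ c] w(2,3) 1 by (simp add: real_form_def)
        next
          case False
          then show ?thesis using alt_length[OF alt, of vs] 1 by (auto simp: type_coeff_def)
        qed
        then show "symbol_rel (Suc k) c q (type_coeff (Suc k) (Suc k)) (\<omega> c q) ((0 :: ('m, 'd) form) c q)"
          using 1 by (simp add: symbol_rel_def)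
      qed
      moreover have "component (Suc k) 0 \<omega> = 0" using w(3) by (simp add: P0_def)
      ultimately have "(\<Sum>a\<le>Suc k. component (Suc k) a \<omega>) = (\<Sum>j=1..k. component (Suc k) j \<omega>)"
        by (intro sum.mono_neutral_right) (auto simp: le_Suc_eq not_less_eq_eq)
      then show "\<omega> = (\<Sum>j=1..k. component (Suc k) j \<omega>)" using component_sum[OF w(1)] by simp
    qed
    ultimately show ?thesis using 1 k rp unfolding crp_def by auto
  qed
qed

end

section \<open>Maps between quotients\<close>

definition add_subgroup :: "'f::ab_group_add set \<Rightarrow> bool" where
  "add_subgroup Z \<longleftrightarrow> 0 \<in> Z \<and> (\<forall>x\<in>Z. \<forall>y\<in>Z. x - y \<in> Z)"

lemma add_subgroupD:
  assumes "add_subgroup Z"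
  shows "0 \<in> Z" "x \<in> Z \<Longrightarrow> y \<in> Z \<Longrightarrow> x - y \<in> Z" "x \<in> Z \<Longrightarrow> - x \<in> Z" "x \<in> Z \<Longrightarrow> y \<in> Z \<Longrightarrow> x + y \<in> Z"
proof -
  have *: "0 \<in> Z" "\<And>x y. x \<in> Z \<Longrightarrow> y \<in> Z \<Longrightarrow> x - y \<in> Z" using assms by (auto simp: add_subgroup_def)
  show "0 \<in> Z" "x \<in> Z \<Longrightarrow> y \<in> Z \<Longrightarrow> x - y \<in> Z" "x \<in> Z \<Longrightarrow> - x \<in> Z" "x \<in> Z \<Longrightarrow> y \<in> Z \<Longrightarrow> x + y \<in> Z"
    using * *(2)[of 0 x] *(2)[of x "- y"] *(2)[of 0 y] by auto
qed

lemma add_group_simps [simp]: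
  "carrier (add_group Z) = Z" "x \<otimes>\<^bsub>add_group Z\<^esub> y = x + y" "\<one>\<^bsub>add_group Z\<^esub> = 0"
  by (simp_all add: add_group_def)

lemma add_group_comm_group:
  assumes "add_subgroup Z" shows "comm_group (add_group Z)"
proof (rule comm_groupI)
  show "\<exists>y\<in>carrier (add_group Z). y \<otimes>\<^bsub>add_group Z\<^esub> x = \<one>\<^bsub>add_group Z\<^esub>" if "x \<in> carrier (add_group Z)" for x
    using that add_subgroupD[OF assms] by (intro bexI[of _ "- x"]) simp_all
qed (use add_subgroupD[OF assms] in \<open>simp_all add: add_ac\<close>)

lemma add_group_normal:
  assumes "add_subgroup Z" "add_subgroup B" "B \<subseteq> Z" shows "B \<lhd> add_group Z"
proof -
  interpret G: comm_group "add_group Z" by (rule add_group_comm_group[OF assms(1)])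
  have "subgroup B (add_group Z)"
  proof (rule G.subgroupI)
    show "inv\<^bsub>add_group Z\<^esub> a \<in> B" if "a \<in> B" for a
    proof -
      have "inv\<^bsub>add_group Z\<^esub> a = - a"
        using that assms(3) add_subgroupD[OF assms(1)] by (intro G.inv_equality) auto
      then show ?thesis using that add_subgroupD[OF assms(2)] by simp
    qed
  qed (use add_subgroupD[OF assms(2)] assms(3) in auto)
  then show ?thesis by (rule G.subgroup_imp_normal)
qed

lemma cls_conv: "cls B \<omega> = (\<lambda>b. b + \<omega>) ` B"
  by (auto simp: cls_def r_coset_def)

lemma cls_eq_iff:
  assumes B: "add_subgroup B" shows "cls B x = cls B y \<longleftrightarrow> x - y \<in> B"
proof
  assume "cls B x = cls B y"
  moreover have "x \<in> cls B x" unfolding cls_conv using add_subgroupD(1)[OF B] by (intro image_eqI[of _ _ 0]) auto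
  ultimately obtain b where "b \<in> B" "x = b + y" unfolding cls_conv by blast
  then show "x - y \<in> B" by simp
next
  assume d: "x - y \<in> B"
  show "cls B x = cls B y"
  proof
    show "cls B x \<subseteq> cls B y" unfolding cls_conv
    proof safe
      fix b assume "b \<in> B"
      then have "b + (x - y) \<in> B" using add_subgroupD[OF B] d by blast
      then show "b + x \<in> (\<lambda>b. b + y) ` B" by (intro image_eqI[of _ _ "b + (x - y)"]) simp_all
    qed
    show "cls B y \<subseteq> cls B x" unfolding cls_conv
    proof safe
      fix b assume "b \<in> B"
      then have "b - (x - y) \<in> B" using add_subgroupD[OF B] d by blast
      then show "b + y \<in> (\<lambda>b. b + x) ` B" by (intro image_eqI[of _ _ "b - (x - y)"]) simp_all
    qed
  qed
qed

lemma cohomology_carrier: "carrier (cohomology Z B) = cls B ` Z"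
  by (auto simp: cohomology_def FactGroup_def RCOSETS_def cls_conv r_coset_def)

lemma cohomology_one: "\<one>\<^bsub>cohomology Z B\<^esub> = cls B 0"
  by (simp add: cohomology_def FactGroup_def cls_conv)

lemma cohomology_group:
  "add_subgroup Z \<Longrightarrow> add_subgroup B \<Longrightarrow> B \<subseteq> Z \<Longrightarrow> group (cohomology Z B)"
  unfolding cohomology_def by (intro normal.factorgroup_is_group add_group_normal)

lemma cohomology_mult:
  assumes "add_subgroup Z" "add_subgroup B" "B \<subseteq> Z" "x \<in> Z" "y \<in> Z"
  shows "cls B x \<otimes>\<^bsub>cohomology Z B\<^esub> cls B y = cls B (x + y)"
proof -
  have "B #>\<^bsub>add_group Z\<^esub> x = cls B x" for x by (simp add: cls_conv r_coset_def UNION_singleton_eq_range)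
  then show ?thesis
    using normal.rcos_sum[OF add_group_normal[OF assms(1-3)], of x y] assms(4,5) by (simp add: cohomology_def FactGroup_def)
qed

locale quotient_map =
  fixes Z B Z' B' :: "'f::ab_group_add set" and f :: "'f \<Rightarrow> 'f"
  assumes Z: "add_subgroup Z" "add_subgroup B" "B \<subseteq> Z" and Z': "add_subgroup Z'" "add_subgroup B'" "B' \<subseteq> Z'"
    and f_add: "\<And>x y. x \<in> Z \<Longrightarrow> y \<in> Z \<Longrightarrow> f (x + y) = f x + f y"
    and f_Z: "f ` Z \<subseteq> Z'" and f_B: "f ` B \<subseteq> B'"
begin

lemma induced_cls:
  assumes "\<omega> \<in> Z" shows "induced B' f (cls B \<omega>) = cls B' (f \<omega>)"
proof -
  have "cls B' (f (b + \<omega>)) = cls B' (f \<omega>)" if "b \<in> B" for b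
  proof -
    have "b \<in> Z" "f b \<in> B'" using that Z(3) f_B by auto
    then show ?thesis using f_add[of b \<omega>] assms by (simp add: cls_eq_iff[OF Z'(2)])
  qed
  then have "(\<lambda>\<omega>. cls B' (f \<omega>)) ` cls B \<omega> = {cls B' (f \<omega>)}"
    using add_subgroupD(1)[OF Z(2)] unfolding cls_conv image_image by force
  then show ?thesis by (simp add: induced_def)
qed

lemma induced_hom: "induced B' f \<in> hom (cohomology Z B) (cohomology Z' B')"
proof (rule homI)
  show "induced B' f X \<in> carrier (cohomology Z' B')" if "X \<in> carrier (cohomology Z B)" for X
    using that f_Z unfolding cohomology_carrier by (auto simp: induced_cls)
  fix X Y assume "X \<in> carrier (cohomology Z B)" "Y \<in> carrier (cohomology Z B)"
  then obtain x y where xy: "x \<in> Z" "X = cls B x" "y \<in> Z" "Y = cls B y" unfolding cohomology_carrier by blast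
  then show "induced B' f (X \<otimes>\<^bsub>cohomology Z B\<^esub> Y) = induced B' f X \<otimes>\<^bsub>cohomology Z' B'\<^esub> induced B' f Y"
    using f_Z add_subgroupD(4)[OF Z(1)] by (simp add: cohomology_mult[OF Z] cohomology_mult[OF Z'] induced_cls f_add image_subset_iff)
qed

lemma induced_group_hom: "group_hom (cohomology Z B) (cohomology Z' B') (induced B' f)"
  by (intro group_hom.intro group_hom_axioms.intro cohomology_group Z Z' induced_hom)

lemma induced_kernel: "kernel (cohomology Z B) (cohomology Z' B') (induced B' f) = cls B ` {\<omega> \<in> Z. f \<omega> \<in> B'}"
proof -
  have "induced B' f (cls B \<omega>) = \<one>\<^bsub>cohomology Z' B'\<^esub> \<longleftrightarrow> f \<omega> \<in> B'" if "\<omega> \<in> Z" for \<omega>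
    using that by (simp add: induced_cls cohomology_one cls_eq_iff[OF Z'(2)])
  then show ?thesis unfolding kernel_def cohomology_carrier by auto
qed

lemma induced_image: "induced B' f ` carrier (cohomology Z B) = cls B' ` f ` Z"
  by (auto simp: cohomology_carrier induced_cls image_image)

end

text \<open>Exactness at a quotient becomes two statements on representatives: the composite lands
  in coboundaries, and an element of the kernel differs from an image by a coboundary. The chase is
  organized in such pairs.\<close>

lemma quotient_exact:
  assumes g: "quotient_map Z0 B0 Z B g" and f: "quotient_map Z B Z' B' f"
    and 0: "\<And>\<omega>. \<omega> \<in> Z0 \<Longrightarrow> f (g \<omega>) \<in> B'"
    and ex: "\<And>\<omega>. \<omega> \<in> Z \<Longrightarrow> f \<omega> \<in> B' \<Longrightarrow> \<exists>\<eta>\<in>Z0. \<omega> - g \<eta> \<in> B"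
  shows "kernel (cohomology Z B) (cohomology Z' B') (induced B' f) = induced B g ` carrier (cohomology Z0 B0)"
  unfolding quotient_map.induced_kernel[OF f] quotient_map.induced_image[OF g]
proof safe
  fix \<omega> assume "\<omega> \<in> Z" "f \<omega> \<in> B'"
  then obtain \<eta> where "\<eta> \<in> Z0" "\<omega> - g \<eta> \<in> B" using ex by blast
  then show "cls B \<omega> \<in> cls B ` g ` Z0" using cls_eq_iff[OF quotient_map.Z(2)[OF f]] by blast
next
  fix \<eta> assume "\<eta> \<in> Z0"
  then show "cls B (g \<eta>) \<in> cls B ` {\<omega> \<in> Z. f \<omega> \<in> B'}" using 0 quotient_map.f_Z[OF g] by blast
qed

text \<open>The maps of the theorem contain definite descriptions and are compared with choice-free
  versions on cocycles only; as classes consist of cocycles, this suffices.\<close>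

lemma induced_cong:
  assumes "X \<in> carrier (cohomology Z B)" "add_subgroup Z" "B \<subseteq> Z" "\<And>\<omega>. \<omega> \<in> Z \<Longrightarrow> f \<omega> = g \<omega>"
  shows "induced B' f X = induced B' g X"
proof -
  have "X \<subseteq> Z" using assms(1,3) add_subgroupD(4)[OF assms(2)] unfolding cohomology_carrier cls_conv by auto
  then have "(\<lambda>\<omega>. cls B' (f \<omega>)) ` X = (\<lambda>\<omega>. cls B' (g \<omega>)) ` X" using assms(4) by (intro image_cong) auto
  then show ?thesis by (simp add: induced_def)
qed

lemma module_fscale_real: "module (\<lambda>r :: real. fscale (of_real r) :: ('m, 'd::finite) form \<Rightarrow> ('m, 'd) form)"
  by unfold_locales (simp_all add: fscale_def[abs_def] plus_fun_def algebra_simps)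

lemma real_subspace_iff:
  "real_subspace Z \<longleftrightarrow> 0 \<in> Z \<and> (\<forall>x\<in>Z. \<forall>y\<in>Z. x + y \<in> Z) \<and> (\<forall>r. \<forall>x\<in>Z. fscale (of_real r) x \<in> Z)"
proof -
  interpret module "\<lambda>r :: real. fscale (of_real r) :: ('m, 'd::finite) form \<Rightarrow> ('m, 'd) form"
    by (rule module_fscale_real)
  show ?thesis unfolding real_subspace_def subspace_def by blast
qed

lemma real_subspace_add_subgroup:
  assumes "real_subspace Z" shows "add_subgroup Z"
proof -
  have s: "0 \<in> Z" "\<And>x y. x \<in> Z \<Longrightarrow> y \<in> Z \<Longrightarrow> x + y \<in> Z" "\<And>r x. x \<in> Z \<Longrightarrow> fscale (of_real r) x \<in> Z"
    using assms unfolding real_subspace_iff by blast+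
  have "x - y = x + fscale (of_real (-1)) y" for x y :: "('a, 'b) form"
    by (simp add: fscale_def[abs_def] plus_fun_def fun_diff_def)
  then show ?thesis using s unfolding add_subgroup_def by metis
qed

lemma induces_linear_map_quotient_map: "induces_linear_map Z B Z' B' f \<Longrightarrow> quotient_map Z B Z' B' f"
  unfolding induces_linear_map_def by unfold_locales (auto intro: real_subspace_add_subgroup)

section \<open>The long exact sequence\<close>

lemmas form_arith = fun_eq_iff fscale_def fRe_def fIm_def

context cr
begin

lemmas d_add = ext_d_add[OF RC_forms RC_forms] and d_fscale = ext_d_fscale[OF RC_forms]
  and d_fcnj = ext_d_fcnj[OF RC_forms] and d_d = ext_d_ext_d[OF RC_forms]

lemma d_uminus: "\<omega> \<in> RC k \<Longrightarrow> ext_d (- \<omega>) = - ext_d \<omega>"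
  unfolding fscale_neg1 by (rule d_fscale)

lemma d_diff: "\<omega> \<in> RC k \<Longrightarrow> \<eta> \<in> RC k \<Longrightarrow> ext_d (\<omega> - \<eta>) = ext_d \<omega> - ext_d \<eta>"
  using d_add[of \<omega> k "- \<eta>"] RC_uminus[of \<eta> k] d_uminus[of \<eta> k] by simp

lemma fscale_simps [simp]:
  "fscale z 0 = 0" "fscale 0 \<omega> = 0" "fscale 1 \<omega> = \<omega>" "fscale a (fscale b \<omega>) = fscale (a * b) \<omega>"
  by (simp_all add: form_arith)

lemma d_0 [simp]: "ext_d (0 :: ('m, 'd) form) = 0"
  using d_fscale[OF RC_0, where a = 0] by simp

lemma d_fRe: "\<omega> \<in> RC k \<Longrightarrow> ext_d (fRe \<omega>) = fRe (ext_d \<omega>)"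
  and d_fIm: "\<omega> \<in> RC k \<Longrightarrow> ext_d (fIm \<omega>) = fIm (ext_d \<omega>)"
  by (simp_all add: fRe_def fIm_def d_fscale[OF RC_add[OF _ RC_fcnj]] d_fscale[OF RC_diff[OF _ RC_fcnj]]
      d_add[OF _ RC_fcnj] d_diff[OF _ RC_fcnj] d_fcnj)

lemma P0_zero [simp]: "P0 k 0 = 0"
  using P0_fscale[OF RC_0, where z = 0] by simp

lemma P0_uminus: "\<omega> \<in> RC k \<Longrightarrow> P0 k (- \<omega>) = - P0 k \<omega>"
  unfolding fscale_neg1 by (rule P0_fscale)

lemma P0_diff: "\<omega> \<in> RC k \<Longrightarrow> \<eta> \<in> RC k \<Longrightarrow> P0 k (\<omega> - \<eta>) = P0 k \<omega> - P0 k \<eta>"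
  using P0_add[of \<omega> k "- \<eta>"] RC_uminus[of \<eta> k] P0_uminus[of \<eta> k] by simp

text \<open>\<omega> - P\<omega> is killed by P, hence so is its derivative after P. In particular
  the operator P d on R^{0,k} squares to zero.\<close>

lemma P0_d_P0:
  assumes "\<omega> \<in> RC k" shows "P0 (Suc k) (ext_d (P0 k \<omega>)) = P0 (Suc k) (ext_d \<omega>)"
proof -
  note p = P0_RC[OF assms]
  have "P0 k (\<omega> - P0 k \<omega>) = 0" using P0_diff[OF assms p] P0_idem[OF assms] by simp
  then have "P0 (Suc k) (ext_d (\<omega> - P0 k \<omega>)) = 0" by (rule P0_ext_d[OF RC_diff[OF assms p]])
  then show ?thesis unfolding d_diff[OF assms p] P0_diff[OF RC_ext_d[OF assms] RC_ext_d[OF p]] by simp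
qed

lemma P0_fcnj_P0: "\<omega> \<in> RC k \<Longrightarrow> 0 < k \<Longrightarrow> P0 k (fcnj (P0 k \<omega>)) = 0"
  using P0_fcnj[OF P0_RC] P0_idem by blast

lemma P0_fcnj_d:
  assumes "\<eta> \<in> RC k" "0 < k" "P0 k \<eta> = \<eta>" shows "P0 (Suc k) (fcnj (ext_d \<eta>)) = 0"
  using P0_ext_d[OF RC_fcnj[OF assms(1)] P0_fcnj[OF assms]] d_fcnj[OF assms(1)] by simp

lemma P0_fIm: "\<eta> \<in> RC k \<Longrightarrow> P0 k (fcnj \<eta>) = 0 \<Longrightarrow> P0 k (fIm \<eta>) = fscale (1 / (2 * \<i>)) (P0 k \<eta>)"
  and P0_fRe: "\<eta> \<in> RC k \<Longrightarrow> P0 k (fcnj \<eta>) = 0 \<Longrightarrow> P0 k (fRe \<eta>) = fscale (1 / 2) (P0 k \<eta>)"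
  by (simp_all add: fIm_def fRe_def P0_fscale[OF RC_diff[OF _ RC_fcnj]] P0_fscale[OF RC_add[OF _ RC_fcnj]]
      P0_diff[OF _ RC_fcnj] P0_add[OF _ RC_fcnj])

lemma real_0: "real_form (0 :: ('m, 'd) form)"
  and real_add: "real_form \<omega> \<Longrightarrow> real_form \<eta> \<Longrightarrow> real_form (\<omega> + \<eta> :: ('m, 'd) form)"
  and real_diff: "real_form \<omega> \<Longrightarrow> real_form \<eta> \<Longrightarrow> real_form (\<omega> - \<eta>)"
  and real_uminus: "real_form \<omega> \<Longrightarrow> real_form (- \<omega>)"
  and real_fscale: "real_form \<omega> \<Longrightarrow> real_form (fscale (of_real r) \<omega>)"
  unfolding real_form_def fcnj_add fcnj_diff fcnj_fscale fscale_neg1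
  by (simp_all add: fcnj_def[abs_def] zero_fun_def)

lemma real_fscale_numeral: "real_form \<omega> \<Longrightarrow> real_form (fscale (numeral r) \<omega> :: ('m, 'd) form)"
  using real_fscale[of \<omega> "numeral r"] by simp

lemma real_d: "\<omega> \<in> RC k \<Longrightarrow> real_form \<omega> \<Longrightarrow> real_form (ext_d \<omega>)"
  using d_fcnj[of \<omega> k] by (simp add: real_form_def)

text \<open>Subtracting 2 Re P\<omega> removes the (0,k) part together with its conjugate. For k
  \<ge> 2 the remainder is an element of S^{k-1}.\<close>

lemma P0_remainder:
  assumes w: "\<omega> \<in> RC k" "real_form \<omega>" and k: "0 < k"
  defines "\<rho> \<equiv> \<omega> - fscale 2 (fRe (P0 k \<omega>))"
  shows "\<rho> \<in> RC k" "real_form \<rho>" "P0 k \<rho> = 0"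
proof -
  note p = P0_RC[OF w(1)]
  show "\<rho> \<in> RC k" unfolding \<rho>_def by (intro RC_diff RC_fscale RC_fRe w p)
  show "real_form \<rho>" unfolding \<rho>_def by (intro real_diff real_fscale_numeral real_fRe w)
  have "P0 k (fscale 2 (fRe (P0 k \<omega>))) = P0 k \<omega>"
    using P0_fscale[OF RC_fRe[OF p], of 2] P0_fRe[OF p P0_fcnj_P0[OF w(1) k]] P0_idem[OF w(1)]
    by simp
  then show "P0 k \<rho> = 0" unfolding \<rho>_def by (simp add: P0_diff[OF w(1) RC_fscale[OF RC_fRe[OF p]]])
qed

lemma real_1_form:
  assumes w: "\<omega> \<in> RC 1" "real_form \<omega>" shows "\<omega> = P0 1 \<omega> + fcnj (P0 1 \<omega>)"
proof -
  have "\<omega> - fscale 2 (fRe (P0 1 \<omega>)) = 0"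
    by (rule real_P0_1) (use P0_remainder[OF w] in simp_all)
  moreover have "fscale 2 (fRe (P0 1 \<omega>)) = P0 1 \<omega> + fcnj (P0 1 \<omega>)" by (simp add: form_arith)
  ultimately show ?thesis by simp
qed

text \<open>With p = P du, closedness of du = p + conj p makes dp purely imaginary. Hence \<i> dp =
  - d Im p: the second-order operator on functions is d of a real 1-form, which is the
  representative of the connecting map in degree 0.\<close>

lemma du_facts:
  assumes u: "u \<in> RC 0" "real_form u"
  defines "p \<equiv> P0 1 (ext_d u)"
  shows "p \<in> RC 1" "P0 1 p = p" "P0 1 (fcnj p) = 0" "ext_d u = p + fcnj p" "fcnj (ext_d p) = - ext_d p"
    "fscale \<i> (ext_d p) = ext_d (- fIm p)"
proof -
  have du: "ext_d u \<in> RC 1" "real_form (ext_d u)" using RC_ext_d[OF u(1)] real_d[OF u] by simp_all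
  show p: "p \<in> RC 1" "P0 1 p = p" "P0 1 (fcnj p) = 0" unfolding p_def
    using P0_RC[OF du(1)] P0_idem[OF du(1)] P0_fcnj_P0[OF du(1)] by simp_all
  show e: "ext_d u = p + fcnj p" unfolding p_def by (rule real_1_form[OF du])
  have "ext_d p + fcnj (ext_d p) = 0"
    using arg_cong[OF e, of ext_d] d_d[OF u(1)] d_add[OF p(1) RC_fcnj[OF p(1)]] d_fcnj[OF p(1)] by simp
  then show c: "fcnj (ext_d p) = - ext_d p" by (metis add.inverse_unique)
  have "ext_d (- fIm p) = - fIm (ext_d p)" using d_uminus[OF RC_fIm[OF p(1)]] d_fIm[OF p(1)] by simp
  also have "\<dots> = fscale \<i> (ext_d p)" unfolding fIm_def c by (simp add: form_arith field_simps)
  finally show "fscale \<i> (ext_d p) = ext_d (- fIm p)" ..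
qed

text \<open>Cocycles, coboundaries and morphisms without reference to contact forms; the letters R, D, S refer to
  $\mathscr R^\bullet$, $\mathscr R^{0,\bullet}$ and $\mathscr S^\bullet$.\<close>

definition ZR :: "nat \<Rightarrow> ('m, 'd) form set" where "ZR k = {\<omega> \<in> RC k. real_form \<omega> \<and> ext_d \<omega> = 0}"
definition BR :: "nat \<Rightarrow> ('m, 'd) form set" where
  "BR k = (case k of 0 \<Rightarrow> {0} | Suc j \<Rightarrow> ext_d ` {\<omega> \<in> RC j. real_form \<omega>})"
definition ZD :: "nat \<Rightarrow> ('m, 'd) form set" where "ZD k = {\<omega> \<in> RC k. P0 k \<omega> = \<omega> \<and> P0 (Suc k) (ext_d \<omega>) = 0}"
definition BD :: "nat \<Rightarrow> ('m, 'd) form set" where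
  "BD k = (case k of 0 \<Rightarrow> {0} | Suc j \<Rightarrow> (\<lambda>\<omega>. P0 (Suc j) (ext_d \<omega>)) ` {\<omega> \<in> RC j. P0 j \<omega> = \<omega>})"
definition SS :: "nat \<Rightarrow> ('m, 'd) form set" where
  "SS k = (if k = 0 then {\<omega> \<in> RC 0. real_form \<omega>} else {\<omega> \<in> RC (Suc k). real_form \<omega> \<and> P0 (Suc k) \<omega> = 0})"
definition DS :: "nat \<Rightarrow> ('m, 'd) form \<Rightarrow> ('m, 'd) form" where
  "DS k \<omega> = (if k = 0 then fscale \<i> (ext_d (P0 1 (ext_d \<omega>))) else ext_d \<omega>)"
definition ZS :: "nat \<Rightarrow> ('m, 'd) form set" where "ZS k = {\<omega> \<in> SS k. DS k \<omega> = 0}"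
definition BS :: "nat \<Rightarrow> ('m, 'd) form set" where
  "BS k = (case k of 0 \<Rightarrow> {0} | Suc j \<Rightarrow> DS j ` SS j)"
definition r1 :: "nat \<Rightarrow> ('m, 'd) form \<Rightarrow> ('m, 'd) form" where "r1 k \<omega> = fscale \<i> (P0 k \<omega>)"
definition r3 :: "nat \<Rightarrow> ('m, 'd) form \<Rightarrow> ('m, 'd) form" where
  "r3 k \<omega> = (if k = 0 then - fIm (P0 1 (ext_d \<omega>)) else \<omega>)"

lemma real_subspace_image:
  assumes S: "real_subspace S" and f: "\<And>x y. x \<in> S \<Longrightarrow> y \<in> S \<Longrightarrow> f (x + y) = f x + f y"
    "\<And>r x. x \<in> S \<Longrightarrow> f (fscale (of_real r) x) = fscale (of_real r) (f x)"
  shows "real_subspace (f ` S)"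
proof -
  have s: "0 \<in> S" "\<And>x y. x \<in> S \<Longrightarrow> y \<in> S \<Longrightarrow> x + y \<in> S" "\<And>r x. x \<in> S \<Longrightarrow> fscale (of_real r) x \<in> S"
    using S unfolding real_subspace_iff by blast+
  have "f 0 = 0" using f(2)[OF s(1), of 0] by (simp add: form_arith zero_fun_def)
  show ?thesis unfolding real_subspace_iff
  proof (intro conjI ballI allI)
    show "0 \<in> f ` S" using s(1) \<open>f 0 = 0\<close> by (intro image_eqI[of _ _ 0]) simp_all
    fix y z assume "y \<in> f ` S" "z \<in> f ` S"
    then obtain a b where "a \<in> S" "b \<in> S" "y = f a" "z = f b" by blast
    then show "y + z \<in> f ` S" using f(1) s(2) by (intro image_eqI[of _ _ "a + b"]) simp_all
  next
    fix r y assume "y \<in> f ` S"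
    then obtain a where "a \<in> S" "y = f a" by blast
    then show "fscale (of_real r) y \<in> f ` S" using f(2) s(3) by (intro image_eqI[of _ _ "fscale (of_real r) a"]) simp_all
  qed
qed

lemma real_subspace_Z:
  "real_subspace {\<omega> \<in> RC k. real_form \<omega>}" "real_subspace (ZR k)" "real_subspace {\<omega> \<in> RC k. P0 k \<omega> = \<omega>}"
  "real_subspace (ZD k)" "real_subspace {\<omega> \<in> RC k. real_form \<omega> \<and> P0 k \<omega> = 0}"
  unfolding real_subspace_iff ZR_def ZD_def
  by (auto intro: RC_0 RC_add RC_fscale real_0 real_add real_fscale
      simp: d_add d_fscale P0_add P0_fscale RC_ext_d)

lemma SS_subspace: "real_subspace (SS k)"
  using real_subspace_Z by (simp add: SS_def)

lemma SS_RC: "\<omega> \<in> SS k \<Longrightarrow> \<omega> \<in> RC (if k = 0 then 0 else Suc k)"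
  by (simp add: SS_def split: if_splits)

lemma dPd_add: "\<omega> \<in> RC k \<Longrightarrow> \<eta> \<in> RC k \<Longrightarrow> P0 (Suc k) (ext_d (\<omega> + \<eta>)) = P0 (Suc k) (ext_d \<omega>) + P0 (Suc k) (ext_d \<eta>)"
  and dPd_fscale: "\<omega> \<in> RC k \<Longrightarrow> P0 (Suc k) (ext_d (fscale z \<omega>)) = fscale z (P0 (Suc k) (ext_d \<omega>))"
  by (simp_all add: d_add d_fscale P0_add P0_fscale RC_ext_d)

lemma fscale_add: "fscale a (\<omega> + \<eta>) = fscale a \<omega> + fscale a \<eta>"
  and fscale_neg: "fscale a (- \<omega>) = - fscale a \<omega>"
  by (simp_all add: form_arith algebra_simps)

lemma fIm_add: "fIm (\<omega> + \<eta>) = fIm \<omega> + fIm \<eta>"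
  and fRe_add: "fRe (\<omega> + \<eta>) = fRe \<omega> + fRe \<eta>"
  and fIm_fscale: "fIm (fscale (of_real r) \<omega>) = fscale (of_real r) (fIm \<omega>)"
  and fRe_fscale: "fRe (fscale (of_real r) \<omega>) = fscale (of_real r) (fRe \<omega>)"
  unfolding fIm_def fRe_def fcnj_add fcnj_fscale by (simp_all add: fscale_def[abs_def] fun_eq_iff field_simps)

lemma DS_linear:
  assumes "\<omega> \<in> SS k" shows "\<eta> \<in> SS k \<Longrightarrow> DS k (\<omega> + \<eta>) = DS k \<omega> + DS k \<eta>" "DS k (fscale (of_real r) \<omega>) = fscale (of_real r) (DS k \<omega>)"
proof -
  have P: "P0 1 (ext_d \<omega>) \<in> RC 1" if "\<omega> \<in> RC 0" for \<omega> using P0_RC[OF RC_ext_d[OF that]] by simp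
  show "\<eta> \<in> SS k \<Longrightarrow> DS k (\<omega> + \<eta>) = DS k \<omega> + DS k \<eta>"
    using SS_RC[OF assms] SS_RC[of \<eta> k] dPd_add[of \<omega> 0 \<eta>] d_add[OF P P, of \<omega> \<eta>]
    by (auto simp: DS_def d_add fscale_add)
  show "DS k (fscale (of_real r) \<omega>) = fscale (of_real r) (DS k \<omega>)"
    using SS_RC[OF assms] dPd_fscale[of \<omega> 0] d_fscale[OF P, of \<omega>]
    by (auto simp: DS_def d_fscale mult.commute)
qed

lemma real_subspace_B: "real_subspace (BR k)" "real_subspace (BD k)" "real_subspace (BS k)" "real_subspace (ZS k)"
proof -
  have 0: "real_subspace {0 :: ('m, 'd) form}" by (simp add: real_subspace_iff)
  have "real_subspace (ext_d ` {\<omega> \<in> RC j. real_form \<omega>})" for j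
    by (rule real_subspace_image[OF real_subspace_Z(1)]) (auto intro: d_add d_fscale)
  then show "real_subspace (BR k)" using 0 by (simp add: BR_def split: nat.split)
  have "real_subspace ((\<lambda>\<omega>. P0 (Suc j) (ext_d \<omega>)) ` {\<omega> \<in> RC j. P0 j \<omega> = \<omega>})" for j
    by (rule real_subspace_image[OF real_subspace_Z(3)]) (simp_all add: dPd_add dPd_fscale)
  then show "real_subspace (BD k)" using 0 by (simp add: BD_def split: nat.split)
  have "real_subspace (DS j ` SS j)" for j
    by (rule real_subspace_image[OF SS_subspace DS_linear])
  then show "real_subspace (BS k)" using 0 by (simp add: BS_def split: nat.split)
  show "real_subspace (ZS k)"
    using SS_subspace[of k] DS_linear[of _ k] unfolding real_subspace_iff ZS_def
    by (auto simp: DS_def)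
qed

lemma DS_0:
  assumes "u \<in> SS 0" shows "DS 0 u = ext_d (- fIm (P0 1 (ext_d u)))" "- fIm (P0 1 (ext_d u)) \<in> RC 1" "real_form (- fIm (P0 1 (ext_d u)))"
proof -
  have u: "u \<in> RC 0" "real_form u" using assms by (simp_all add: SS_def)
  note f = du_facts[OF u]
  show "DS 0 u = ext_d (- fIm (P0 1 (ext_d u)))" using f(6) by (simp add: DS_def)
  show "- fIm (P0 1 (ext_d u)) \<in> RC 1" by (intro RC_uminus RC_fIm f)
  show "real_form (- fIm (P0 1 (ext_d u)))" by (intro real_uminus real_fIm)
qed

lemma B_subset_Z: "BR k \<subseteq> ZR k" "BD k \<subseteq> ZD k" "BS k \<subseteq> ZS k"
proof -
  show "BR k \<subseteq> ZR k"
    using RC_0 real_0 by (auto simp: BR_def ZR_def d_d RC_ext_d real_d split: nat.split)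
  show "BD k \<subseteq> ZD k"
    using RC_0 by (auto simp: BD_def ZD_def P0_RC RC_ext_d P0_idem P0_d_P0 d_d split: nat.split)
  have "DS j \<sigma> \<in> ZS (Suc j)" if s: "\<sigma> \<in> SS j" for j \<sigma>
  proof (cases j)
    case 0
    note f = DS_0[OF s[unfolded 0]]
    have u: "\<sigma> \<in> RC 0" using s 0 by (simp add: SS_def)
    have "DS 0 \<sigma> \<in> RC 2" "real_form (DS 0 \<sigma>)" "ext_d (DS 0 \<sigma>) = 0"
      unfolding f(1) using RC_ext_d[OF f(2)] real_d[OF f(2,3)] d_d[OF f(2)] by (simp_all add: numeral_2_eq_2)
    moreover have "P0 2 (DS 0 \<sigma>) = 0"
    proof -
      have p: "P0 1 (ext_d \<sigma>) \<in> RC 1" using P0_RC[OF RC_ext_d[OF u]] by simp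
      have "P0 2 (ext_d (P0 1 (ext_d \<sigma>))) = 0"
        using P0_d_P0[OF RC_ext_d[OF u]] d_d[OF u] by (simp add: numeral_2_eq_2)
      then show ?thesis using P0_fscale[OF RC_ext_d[OF p]] by (simp add: DS_def numeral_2_eq_2)
    qed
    ultimately show ?thesis unfolding 0 by (simp add: ZS_def SS_def DS_def[of "Suc 0"] numeral_2_eq_2)
  next
    case (Suc i)
    then have s: "\<sigma> \<in> RC (Suc j)" "real_form \<sigma>" "P0 (Suc j) \<sigma> = 0" using s by (simp_all add: SS_def)
    show ?thesis using Suc RC_ext_d[OF s(1)] real_d[OF s(1,2)] P0_ext_d[OF s(1,3)] d_d[OF s(1)]
      by (simp add: ZS_def SS_def DS_def)
  qed
  moreover have "0 \<in> ZS 0" using RC_0 real_0 by (simp add: ZS_def SS_def DS_def)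
  ultimately show "BS k \<subseteq> ZS k" by (auto simp: BS_def split: nat.split)
qed

section \<open>The three maps on cocycles and coboundaries\<close>

lemma r1_induces: "induces_linear_map (ZR k) (BR k) (ZD k) (BD k) (r1 k)"
proof -
  have "r1 k ` ZR k \<subseteq> ZD k"
    by (auto simp: r1_def ZR_def ZD_def RC_fscale P0_RC P0_fscale P0_idem dPd_fscale P0_d_P0)
  moreover have "r1 k ` BR k \<subseteq> BD k"
  proof (cases k)
    case (Suc j)
    \<comment> \<open>The primitive is \<i> P\<sigma>, because P d P = P d.\<close>
    have "r1 (Suc j) (ext_d \<sigma>) \<in> BD (Suc j)" if "\<sigma> \<in> RC j" for \<sigma>
      unfolding BD_def using that
      by (auto intro!: image_eqI[of _ _ "fscale \<i> (P0 j \<sigma>)"] simp: r1_def RC_fscale P0_RC P0_fscale P0_idem dPd_fscale P0_d_P0)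
    then show ?thesis using Suc by (auto simp: BR_def)
  qed (simp add: BR_def BD_def r1_def)
  ultimately show ?thesis
    using real_subspace_Z(2,4) real_subspace_B(1,2) B_subset_Z(1,2) unfolding induces_linear_map_def
    by (auto simp: r1_def ZR_def P0_add P0_fscale fscale_add mult.commute)
qed

text \<open>For \<open>\<eta> = u + \<i> v\<close> with $\bar\partial_b\eta=0$ one has \<open>Pdu = - \<i> Pdv\<close>; since both
  \<open>dPdu\<close> and \<open>dPdv\<close> are purely imaginary, \<open>dPdu = 0\<close>.\<close>

lemma CR_function:
  assumes e: "\<eta> \<in> ZD 0"
  shows "fRe \<eta> \<in> ZS 0" "- fIm (P0 1 (ext_d (fRe \<eta>))) = ext_d (fscale (1/2) (fIm \<eta>))"
proof -
  let ?u = "fRe \<eta>" and ?v = "fIm \<eta>"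
  have e: "\<eta> \<in> RC 0" "P0 1 (ext_d \<eta>) = 0" using e by (simp_all add: ZD_def)
  have u: "?u \<in> RC 0" "real_form ?u" and v: "?v \<in> RC 0" "real_form ?v"
    using RC_fRe[OF e(1)] RC_fIm[OF e(1)] real_fRe real_fIm by blast+
  let ?p = "P0 1 (ext_d ?u)" and ?q = "P0 1 (ext_d ?v)"
  note fu = du_facts[OF u] and fv = du_facts[OF v]
  have "P0 1 (ext_d (?u + fscale \<i> ?v)) = ?p + fscale \<i> ?q"
    using dPd_add[OF u(1) RC_fscale[OF v(1)]] dPd_fscale[OF v(1)] by simp
  then have "?p + fscale \<i> ?q = 0" using e(2) by (simp add: fRe_fIm)
  then have pq: "?p = fscale (- \<i>) ?q" by (simp add: form_arith eq_neg_iff_add_eq_0)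
  have X: "ext_d ?p = fscale (- \<i>) (ext_d ?q)" using d_fscale[OF fv(1), of "- \<i>"] pq by simp
  have "fcnj (ext_d ?p) = ext_d ?p" using fv(5) unfolding X fcnj_fscale by (simp add: form_arith)
  then have "ext_d ?p = - ext_d ?p" using fu(5) by simp
  then have "ext_d ?p = 0" by (simp add: fun_eq_iff)
  then show "?u \<in> ZS 0" using u by (simp add: ZS_def SS_def DS_def)
  \<comment> \<open>As p = - \<i> q, minus the imaginary part of p is half of q + conj q = dv; hence
    the factor 1/2 in the primitive.\<close>
  have "- fIm ?p = fscale (1/2) (?q + fcnj ?q)" unfolding pq fIm_def fcnj_fscale by (simp add: form_arith field_simps)
  then show "- fIm ?p = ext_d (fscale (1/2) ?v)"
    by (rule trans) (unfold fv(4)[symmetric] d_fscale[OF v(1)], rule refl)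
qed

lemma r2_induces: "induces_linear_map (ZD k) (BD k) (ZS k) (BS k) (rep2 k)"
proof -
  have "rep2 k ` ZD k \<subseteq> ZS k"
  proof (cases k)
    case 0
    then show ?thesis using CR_function(1) by (auto simp: rep2_def)
  next
    case (Suc j)
    have "rep2 k \<eta> \<in> ZS k" if "\<eta> \<in> ZD k" for \<eta>
    proof -
      have e: "\<eta> \<in> RC k" "P0 k \<eta> = \<eta>" "P0 (Suc k) (ext_d \<eta>) = 0" using that by (simp_all add: ZD_def)
      note d = RC_ext_d[OF e(1)]
      have "P0 (Suc k) (- fIm (ext_d \<eta>)) = 0"
        using P0_uminus[OF RC_fIm[OF d]] P0_fIm[OF d P0_fcnj_d[OF e(1) _ e(2)]] e(3) Suc by simp
      moreover have "ext_d (- fIm (ext_d \<eta>)) = 0"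
        using d_uminus[OF RC_fIm[OF d]] d_fIm[OF d] d_d[OF e(1)] by (simp add: fIm_def fcnj_def[abs_def] form_arith)
      moreover have "- fIm (ext_d \<eta>) \<in> RC (Suc k)" "real_form (- fIm (ext_d \<eta>))"
        by (intro RC_uminus RC_fIm d real_uminus real_fIm)+
      ultimately show ?thesis using Suc by (simp add: rep2_def ZS_def SS_def DS_def)
    qed
    then show ?thesis by blast
  qed
  moreover have "rep2 k ` BD k \<subseteq> BS k"
  proof (cases k)
    case 0
    then show ?thesis by (simp add: BD_def BS_def rep2_def fRe_def fcnj_def[abs_def] form_arith)
  next
    case (Suc j)
    have "- fIm (ext_d (P0 k (ext_d \<eta>))) \<in> DS j ` SS j" if e: "\<eta> \<in> RC j" "P0 j \<eta> = \<eta>" for \<eta>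
    proof (cases j)
      case 0
      \<comment> \<open>For \<eta> = u + \<i> v both dPdu and dPdv are purely imaginary, so the
        imaginary part of dPd\<eta> sees only u and equals - D u.\<close>
      let ?u = "fRe \<eta>" and ?v = "fIm \<eta>"
      have e0: "\<eta> \<in> RC 0" using e 0 by simp
      have u: "?u \<in> RC 0" "real_form ?u" and v: "?v \<in> RC 0" "real_form ?v"
        using RC_fRe[OF e0] RC_fIm[OF e0] real_fRe real_fIm by blast+
      let ?p = "P0 1 (ext_d ?u)" and ?q = "P0 1 (ext_d ?v)"
      note fu = du_facts[OF u] and fv = du_facts[OF v]
      have "P0 1 (ext_d (?u + fscale \<i> ?v)) = ?p + fscale \<i> ?q"
        using dPd_add[OF u(1) RC_fscale[OF v(1)]] dPd_fscale[OF v(1)] by simp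
      then have "P0 k (ext_d \<eta>) = ?p + fscale \<i> ?q" using Suc 0 by (simp add: fRe_fIm)
      then have "ext_d (P0 k (ext_d \<eta>)) = ext_d ?p + fscale \<i> (ext_d ?q)"
        using d_add[OF fu(1) RC_fscale[OF fv(1)]] d_fscale[OF fv(1)] by simp
      then have "- fIm (ext_d (P0 k (ext_d \<eta>))) = DS 0 ?u"
        using fu(5) fv(5) by (simp add: DS_def fIm_def fcnj_add fcnj_fscale) (simp add: form_arith field_simps)
      then show ?thesis using u 0 by (auto simp: SS_def)
    next
      case (Suc i)
      \<comment> \<open>Subtracting P d\<eta> puts the form into S^j, and dd\<eta> = 0 leaves - Im d
        P d\<eta> as its derivative.\<close>
      let ?\<mu> = "fIm (ext_d \<eta> - P0 k (ext_d \<eta>))"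
      have d: "ext_d \<eta> \<in> RC k" using RC_ext_d[OF e(1)] \<open>k = Suc j\<close> by simp
      note p = P0_RC[OF d] and dp = RC_diff[OF d P0_RC[OF d]]
      have "P0 k (fcnj (ext_d \<eta> - P0 k (ext_d \<eta>))) = 0"
        using P0_diff[OF RC_fcnj[OF d] RC_fcnj[OF p]] P0_fcnj_d[OF e(1) _ e(2)] P0_fcnj_P0[OF d] Suc \<open>k = Suc j\<close>
        by (simp add: fcnj_diff)
      then have "P0 k ?\<mu> = 0" using P0_fIm[OF dp] P0_diff[OF d p] P0_idem[OF d] by simp
      then have "?\<mu> \<in> SS j" using RC_fIm[OF dp] real_fIm Suc \<open>k = Suc j\<close> by (simp add: SS_def)
      moreover have "DS j ?\<mu> = - fIm (ext_d (P0 k (ext_d \<eta>)))"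
        using d_fIm[OF dp] d_diff[OF d p] d_d[OF e(1)] Suc by (simp add: DS_def fIm_def fcnj_diff fcnj_fscale)
           (simp add: form_arith fcnj_def field_simps)
      ultimately show ?thesis by (metis image_eqI)
    qed
    then show ?thesis using Suc by (auto simp: BD_def BS_def rep2_def)
  qed
  moreover have "rep2 k (\<omega> + \<eta>) = rep2 k \<omega> + rep2 k \<eta>" "rep2 k (fscale (of_real r) \<omega>) = fscale (of_real r) (rep2 k \<omega>)"
    if "\<omega> \<in> RC k" "\<eta> \<in> RC k" for \<omega> \<eta> r
    using d_add[OF that] d_fscale[OF that(1)]
    by (simp_all add: rep2_def fRe_add fIm_add fRe_fscale fIm_fscale fscale_neg)
  ultimately show ?thesis
    using real_subspace_Z(4) real_subspace_B(2-4) B_subset_Z(2,3) unfolding induces_linear_map_def by (auto simp: ZD_def)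
qed

lemma r3_induces: "induces_linear_map (ZS k) (BS k) (ZR (Suc k)) (BR (Suc k)) (r3 k)"
proof -
  have "r3 k ` ZS k \<subseteq> ZR (Suc k)"
    using DS_0 by (cases k) (auto simp: ZS_def ZR_def r3_def DS_def SS_def)
  moreover have "r3 k ` BS k \<subseteq> BR (Suc k)"
  proof (cases k)
    case 0
    have "r3 0 0 = 0" by (simp add: r3_def fIm_def fcnj_def[abs_def] form_arith)
    moreover have "0 \<in> BR (Suc 0)" using real_subspace_B(1) real_subspace_iff by blast
    ultimately show ?thesis using 0 by (simp add: BS_def)
  next
    case (Suc j)
    \<comment> \<open>For j = 0 the primitive is the real 1-form of \<open>DS_0\<close>, for j > 0
      it is \<sigma> itself.\<close>
    have "DS j \<sigma> \<in> ext_d ` {\<omega> \<in> RC (Suc j). real_form \<omega>}" if "\<sigma> \<in> SS j" for \<sigma>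
      using that DS_0[of \<sigma>] by (cases j) (auto simp: SS_def DS_def)
    then show ?thesis using Suc by (auto simp: BS_def BR_def r3_def)
  qed
  moreover have "r3 k (\<omega> + \<eta>) = r3 k \<omega> + r3 k \<eta>" "r3 k (fscale (of_real r) \<omega>) = fscale (of_real r) (r3 k \<omega>)"
    if "\<omega> \<in> SS k" "\<eta> \<in> SS k" for \<omega> \<eta> r
    using dPd_add[of \<omega> 0 \<eta>] dPd_fscale[of \<omega> 0] SS_RC[OF that(1)] SS_RC[OF that(2)]
    by (cases k; simp add: r3_def fIm_add fIm_fscale fscale_neg)+
  ultimately show ?thesis
    using real_subspace_Z(2) real_subspace_B(1,3,4) B_subset_Z(1,3) unfolding induces_linear_map_def by (auto simp: ZS_def)
qed

text \<open>The difference is d of the remainder \<omega> - 2 Re P\<omega>. In degree 1 that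
  remainder is zero, in higher degree it lies in S^{k-1}; so d\<omega> and 2 Re dP\<omega> agree
  modulo coboundaries of the pluriharmonic complex.\<close>

lemma d_remainder:
  assumes w: "\<omega> \<in> RC k" "real_form \<omega>" and k: "0 < k"
  shows "ext_d \<omega> - fscale 2 (fRe (ext_d (P0 k \<omega>))) \<in> BS k"
proof -
  let ?\<rho> = "\<omega> - fscale 2 (fRe (P0 k \<omega>))"
  note r = P0_remainder[OF w k] and p = P0_RC[OF w(1)]
  obtain j where j: "k = Suc j" using k by (cases k) auto
  have "ext_d ?\<rho> \<in> BS k"
  proof (cases j)
    case 0
    then have "?\<rho> = 0" using real_P0_1[of ?\<rho>] r j by simp
    then show ?thesis using real_subspace_B(3)[of k] by (simp add: real_subspace_iff)
  next
    case (Suc i)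
    then have "?\<rho> \<in> SS j" "DS j ?\<rho> = ext_d ?\<rho>" using r j by (simp_all add: SS_def DS_def)
    then show ?thesis using j by (simp add: BS_def) (metis image_eqI)
  qed
  moreover have "ext_d ?\<rho> = ext_d \<omega> - fscale 2 (fRe (ext_d (P0 k \<omega>)))"
    using d_diff[OF w(1) RC_fscale[OF RC_fRe[OF p]]] d_fscale[OF RC_fRe[OF p]] d_fRe[OF p] by simp
  ultimately show ?thesis by simp
qed

section \<open>Exactness on representatives\<close>

lemma subspace_scale: "real_subspace S \<Longrightarrow> x \<in> S \<Longrightarrow> fscale (of_real r) x \<in> S"
  by (simp add: real_subspace_iff)

lemma fIm_i: "fIm (fscale \<i> \<omega>) = fRe \<omega>"
  unfolding fIm_def fRe_def fcnj_fscale by (simp add: fscale_def[abs_def] fun_eq_iff field_simps)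

lemma fIm_diff: "fIm (\<omega> - \<eta>) = fIm \<omega> - fIm \<eta>"
  unfolding fIm_def fcnj_diff by (simp add: fscale_def[abs_def] fun_eq_iff field_simps)

text \<open>In positive degree the composite is - Re dP\<omega>, half the expression of
  \<open>d_remainder\<close> since d\<omega> = 0. In degree 0 it is Re(\<i> \<omega>) = 0.\<close>

lemma exact_dolb_1:
  assumes w: "\<omega> \<in> ZR k" shows "rep2 k (r1 k \<omega>) \<in> BS k"
proof (cases "k = 0")
  case True
  then have "\<omega> \<in> RC 0" "fcnj \<omega> = \<omega>" using w by (simp_all add: ZR_def real_form_def)
  then have "rep2 k (r1 k \<omega>) = 0"
    using True by (simp add: rep2_def r1_def P0_0 fRe_def fcnj_fscale) (simp add: form_arith)
  then show ?thesis using real_subspace_B(3)[of k] by (simp add: real_subspace_iff)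
next
  case False
  have w: "\<omega> \<in> RC k" "real_form \<omega>" "ext_d \<omega> = 0" using w by (simp_all add: ZR_def)
  note p = P0_RC[OF w(1)]
  have "rep2 k (r1 k \<omega>) = fscale (of_real (1/2)) (ext_d \<omega> - fscale 2 (fRe (ext_d (P0 k \<omega>))))"
    using False d_fscale[OF p, of \<i>] w(3) by (simp add: rep2_def r1_def fIm_i fscale_neg)
  also have "\<dots> \<in> BS k"
    by (rule subspace_scale[OF real_subspace_B(3) d_remainder[OF w(1,2)]]) (use False in simp)
  finally show ?thesis .
qed

text \<open>Coboundaries in S^k come from nothing, from the second-order operator and from d, for k
  = 0, k = 1 and k \<ge> 2; hence three cases.\<close>

lemma exact_dolb_2:
  assumes e: "\<eta> \<in> ZD k" and b: "rep2 k \<eta> \<in> BS k" shows "\<exists>\<omega>\<in>ZR k. \<eta> - r1 k \<omega> \<in> BD k"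
proof -
  have e: "\<eta> \<in> RC k" "P0 k \<eta> = \<eta>" "P0 (Suc k) (ext_d \<eta>) = 0" using e by (simp_all add: ZD_def)
  have B0: "0 \<in> BD k" using real_subspace_B(2)[of k] by (simp add: real_subspace_iff)
  consider "k = 0" | "k = Suc 0" | j where "k = Suc (Suc j)" by (cases k; cases "k - 1") auto
  then show ?thesis
  proof cases
    case 1
    \<comment> \<open>Here \<eta> = \<i> v with v real, and P dv = 0 forces dv = 0 because dv is a
      real 1-form.\<close>
    let ?v = "fIm \<eta>"
    have "fRe \<eta> = 0" using b 1 by (simp add: rep2_def BS_def)
    then have ev: "\<eta> = fscale \<i> ?v" using fRe_fIm[of \<eta>] by simp
    have e0: "\<eta> \<in> RC 0" using e 1 by simp
    note v = RC_fIm[OF e0] real_fIm[of \<eta>]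
    have "fscale \<i> (P0 1 (ext_d ?v)) = 0" using dPd_fscale[OF v(1), of \<i>] ev e(3) 1 by simp
    then have "fscale (- \<i>) (fscale \<i> (P0 1 (ext_d ?v))) = 0" by simp
    then have "P0 1 (ext_d ?v) = 0" by simp
    then have "ext_d ?v = 0" using real_P0_1 RC_ext_d[OF v(1)] real_d[OF v] by simp
    then have "?v \<in> ZR k" using v 1 by (simp add: ZR_def)
    moreover have "r1 k ?v = \<eta>" using P0_0[OF v(1)] 1 ev by (simp add: r1_def)
    ultimately show ?thesis using B0 by (intro bexI[of _ ?v]) simp_all
  next
    case 2
    then obtain u where u: "u \<in> SS 0" "- fIm (ext_d \<eta>) = DS 0 u" using b by (auto simp: BS_def rep2_def)
    have u0: "u \<in> RC 0" "real_form u" using u(1) by (simp_all add: SS_def)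
    note f = du_facts[OF u0]
    let ?p = "P0 1 (ext_d u)"
    \<comment> \<open>Subtracting the coboundary P du makes the imaginary part closed. As P Im \<xi>
      = \<xi> / (2\<i>), the map sends 2 Im \<xi> to \<xi>.\<close>
    let ?\<xi> = "\<eta> - ?p"
    have e1: "\<eta> \<in> RC 1" "P0 1 \<eta> = \<eta>" using e 2 by simp_all
    note x = RC_diff[OF e1(1) f(1)]
    have Px: "P0 1 ?\<xi> = ?\<xi>" using P0_diff[OF e1(1) f(1)] f(2) e1(2) by simp
    have "- fIm (ext_d \<eta>) = - fIm (ext_d ?p)"
      unfolding u(2) DS_0(1)[OF u(1)] using d_uminus[OF RC_fIm[OF f(1)]] d_fIm[OF f(1)] by simp
    then have eq: "fIm (ext_d \<eta>) = fIm (ext_d ?p)" by (metis neg_equal_iff_equal)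
    have "ext_d (fscale 2 (fIm ?\<xi>)) = 0"
      by (subst d_fscale[OF RC_fIm[OF x]], subst d_fIm[OF x], subst d_diff[OF e1(1) f(1)]) (simp add: fIm_diff eq)
    moreover have "fscale 2 (fIm ?\<xi>) \<in> RC k" "real_form (fscale 2 (fIm ?\<xi>))"
      using RC_fscale[OF RC_fIm[OF x]] 2 real_fscale_numeral[OF real_fIm] by simp_all
    ultimately have "fscale 2 (fIm ?\<xi>) \<in> ZR k" by (simp add: ZR_def)
    moreover have "r1 k (fscale 2 (fIm ?\<xi>)) = ?\<xi>"
      using P0_fscale[OF RC_fIm[OF x], of 2] P0_fIm[OF x P0_fcnj[OF x _ Px]] Px 2 by (simp add: r1_def)
    moreover have "?p \<in> BD k" using u0 2 P0_0[OF u0(1)] by (auto simp: BD_def)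
    ultimately show ?thesis by (intro bexI[of _ "fscale 2 (fIm ?\<xi>)"]) simp_all
  next
    case 3
    then obtain \<sigma> where s: "\<sigma> \<in> SS (Suc j)" "- fIm (ext_d \<eta>) = DS (Suc j) \<sigma>" using b by (auto simp: BS_def rep2_def)
    have s': "\<sigma> \<in> RC k" "real_form \<sigma>" "P0 k \<sigma> = 0" using s(1) 3 by (simp_all add: SS_def)
    have ds: "ext_d \<sigma> = - fIm (ext_d \<eta>)" using s(2) by (simp add: DS_def)
    note i = RC_fIm[OF e(1)]
    \<comment> \<open>\<sigma> cancels the derivative of Im \<eta> and is invisible to P, so the
      factor 2 again recovers \<eta>.\<close>
    let ?\<omega> = "fscale 2 (fIm \<eta> + \<sigma>)"
    have "ext_d ?\<omega> = 0"
      using d_fscale[OF RC_add[OF i s'(1)], of 2] d_add[OF i s'(1)] d_fIm[OF e(1)] ds by simp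
    moreover have "?\<omega> \<in> RC k" "real_form ?\<omega>"
      using RC_fscale[OF RC_add[OF i s'(1)]] real_fscale_numeral[OF real_add[OF real_fIm s'(2)]] by blast+
    ultimately have "?\<omega> \<in> ZR k" by (simp add: ZR_def)
    moreover have "r1 k ?\<omega> = \<eta>"
      using P0_fscale[OF RC_add[OF i s'(1)], of 2] P0_add[OF i s'(1)] P0_fIm[OF e(1) P0_fcnj[OF e(1) _ e(2)]] e(2) s'(3) 3
      by (simp add: r1_def)
    ultimately show ?thesis using B0 by (intro bexI[of _ ?\<omega>]) simp_all
  qed
qed

text \<open>In positive degree - Im d\<eta> is d of the real form - Im \<eta>, which is admissible
  in the Rumin complex. In degree 0 the primitive comes from \<open>CR_function\<close>.\<close>

lemma exact_crp_1:
  assumes e: "\<eta> \<in> ZD k" shows "r3 k (rep2 k \<eta>) \<in> BR (Suc k)"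
proof (cases "k = 0")
  case True
  then have e0: "\<eta> \<in> ZD 0" "\<eta> \<in> RC 0" using e by (simp_all add: ZD_def)
  have "fscale (of_real (1/2)) (fIm \<eta>) \<in> RC 0" "real_form (fscale (of_real (1/2)) (fIm \<eta>))"
    by (intro RC_fscale RC_fIm e0 real_fscale real_fIm)+
  then show ?thesis using CR_function(2)[OF e0(1)] True by (auto simp: r3_def rep2_def BR_def)
next
  case False
  have "\<eta> \<in> RC k" using e by (simp add: ZD_def)
  then have "- fIm (ext_d \<eta>) = ext_d (- fIm \<eta>)" "- fIm \<eta> \<in> RC k" "real_form (- fIm \<eta>)"
    using d_uminus[OF RC_fIm] d_fIm RC_uminus[OF RC_fIm] real_uminus[OF real_fIm] by metis+
  then show ?thesis using False by (auto simp: r3_def rep2_def BR_def)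
qed

lemma exact_crp_2:
  assumes w: "\<omega> \<in> ZS k" and b: "r3 k \<omega> \<in> BR (Suc k)" shows "\<exists>\<eta>\<in>ZD k. \<omega> - rep2 k \<eta> \<in> BS k"
proof (cases "k = 0")
  case True
  then have u: "\<omega> \<in> RC 0" "real_form \<omega>" using w by (simp_all add: ZS_def SS_def)
  note f = du_facts[OF u]
  let ?p = "P0 1 (ext_d \<omega>)"
  obtain v where v: "v \<in> RC 0" "real_form v" "- fIm ?p = ext_d v" using b True by (auto simp: r3_def BR_def)
  \<comment> \<open>From dv = - Im p one gets P dv = - p / (2\<i>), so 2\<i> v is the multiple of v
    that cancels p; being imaginary it does not change the real part.\<close>
  let ?\<eta> = "\<omega> + fscale (2 * \<i>) v"
  have e: "?\<eta> \<in> RC 0" by (intro RC_add RC_fscale u v)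
  have "P0 1 (ext_d v) = - fscale (1 / (2 * \<i>)) ?p"
    using P0_uminus[OF RC_fIm[OF f(1)]] P0_fIm[OF f(1,3)] f(2) v(3) by simp
  moreover have "P0 1 (ext_d ?\<eta>) = ?p + fscale (2 * \<i>) (P0 1 (ext_d v))"
    using dPd_add[OF u(1) RC_fscale[OF v(1)]] dPd_fscale[OF v(1)] by simp
  ultimately have "P0 1 (ext_d ?\<eta>) = 0" by (simp add: fscale_neg)
  then have "?\<eta> \<in> ZD k" using e P0_0[OF e] True by (simp add: ZD_def)
  moreover have "rep2 k ?\<eta> = \<omega>"
    using u(2) v(2) True by (simp add: rep2_def fRe_def fcnj_add fcnj_fscale real_form_def) (simp add: form_arith)
  ultimately show ?thesis using True by (intro bexI[of _ ?\<eta>]) (simp_all add: BS_def)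
next
  case False
  then have w: "\<omega> \<in> RC (Suc k)" "P0 (Suc k) \<omega> = 0" using w by (simp_all add: ZS_def SS_def)
  obtain \<sigma> where s: "\<sigma> \<in> RC k" "real_form \<sigma>" "\<omega> = ext_d \<sigma>" using b False by (auto simp: r3_def BR_def)
  note p = P0_RC[OF s(1)]
  \<comment> \<open>The factor makes - Im d\<eta> = 2 Re dP\<sigma>, which agrees with d\<sigma>
    modulo coboundaries by \<open>d_remainder\<close>.\<close>
  let ?\<eta> = "fscale (- 2 * \<i>) (P0 k \<sigma>)"
  have "?\<eta> \<in> ZD k"
    using RC_fscale[OF p, of "- 2 * \<i>"] P0_fscale[OF p, of "- 2 * \<i>"] P0_idem[OF s(1)] dPd_fscale[OF p, of "- 2 * \<i>"]
      P0_d_P0[OF s(1)] w(2) s(3) by (simp add: ZD_def)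
  moreover have "rep2 k ?\<eta> = fscale 2 (fRe (ext_d (P0 k \<sigma>)))"
    using d_fscale[OF p, of "- 2 * \<i>"] False by (simp add: rep2_def fIm_def fRe_def fcnj_fscale) (simp add: form_arith field_simps)
  ultimately show ?thesis using d_remainder[OF s(1,2)] False s(3) by (intro bexI[of _ ?\<eta>]) simp_all
qed

text \<open>For k > 0 elements of S^k have no (0,k+1) part. For k = 0 the composite is - p / 2 = P
  d(- u / 2) with p = P du, a coboundary.\<close>

lemma exact_rumin_1:
  assumes w: "\<omega> \<in> ZS k" shows "r1 (Suc k) (r3 k \<omega>) \<in> BD (Suc k)"
proof (cases "k = 0")
  case True
  then have u: "\<omega> \<in> RC 0" "real_form \<omega>" using w by (simp_all add: ZS_def SS_def)
  note f = du_facts[OF u]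
  let ?p = "P0 1 (ext_d \<omega>)"
  have "r1 (Suc k) (r3 k \<omega>) = fscale (- 1 / 2) ?p"
    using P0_uminus[OF RC_fIm[OF f(1)]] P0_fIm[OF f(1,3)] f(2) True by (simp add: r1_def r3_def) (simp add: form_arith)
  also have "\<dots> = P0 1 (ext_d (fscale (- 1 / 2) \<omega>))" using dPd_fscale[OF u(1), of "- 1 / 2"] by simp
  finally show ?thesis
    using True RC_fscale[OF u(1), of "- 1 / 2"] P0_0[OF RC_fscale[OF u(1)], of "- 1 / 2"] by (auto simp: BD_def)
next
  case False
  then have "r1 (Suc k) (r3 k \<omega>) = 0" using w by (simp add: r1_def r3_def ZS_def SS_def)
  then show ?thesis using real_subspace_B(2)[of "Suc k"] by (simp add: real_subspace_iff)
qed

lemma exact_rumin_2: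
  assumes w: "\<omega> \<in> ZR (Suc k)" and b: "r1 (Suc k) \<omega> \<in> BD (Suc k)" shows "\<exists>\<sigma>\<in>ZS k. \<omega> - r3 k \<sigma> \<in> BR (Suc k)"
proof -
  have w: "\<omega> \<in> RC (Suc k)" "real_form \<omega>" "ext_d \<omega> = 0" using w by (simp_all add: ZR_def)
  obtain \<eta> where e: "\<eta> \<in> RC k" "P0 k \<eta> = \<eta>" "fscale \<i> (P0 (Suc k) \<omega>) = P0 (Suc k) (ext_d \<eta>)"
    using b by (auto simp: BD_def r1_def)
  have Pw: "P0 (Suc k) \<omega> = fscale (- \<i>) (P0 (Suc k) (ext_d \<eta>))" unfolding e(3)[symmetric] by simp
  note i = RC_fIm[OF e(1)]
  show ?thesis
  proof (cases "k = 0")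
    case True
    let ?a = "fRe \<eta>" and ?b = "fIm \<eta>"
    have e0: "\<eta> \<in> RC 0" using e True by simp
    have a: "?a \<in> RC 0" "real_form ?a" and bb: "?b \<in> RC 0" "real_form ?b"
      using RC_fRe[OF e0] RC_fIm[OF e0] real_fRe real_fIm by blast+
    let ?p = "P0 1 (ext_d ?a)" and ?q = "P0 1 (ext_d ?b)"
    note fa = du_facts[OF a] and fb = du_facts[OF bb]
    have w1: "\<omega> \<in> RC 1" using w True by simp
    have db: "ext_d ?b \<in> RC 1" "real_form (ext_d ?b)" using RC_ext_d[OF bb(1)] real_d[OF bb] by simp_all
    have "P0 1 (ext_d (?a + fscale \<i> ?b)) = ?p + fscale \<i> ?q"
      using dPd_add[OF a(1) RC_fscale[OF bb(1)]] dPd_fscale[OF bb(1)] by simp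
    then have "P0 1 \<omega> = fscale (- \<i>) ?p + ?q" using Pw True by (simp add: fRe_fIm fscale_add)
    then have P: "P0 1 (\<omega> - ext_d ?b) = fscale (- \<i>) ?p" using P0_diff[OF w1 db(1)] by simp
    have "\<omega> - ext_d ?b = fscale (- \<i>) ?p + fcnj (fscale (- \<i>) ?p)"
      using real_1_form[OF RC_diff[OF w1 db(1)] real_diff[OF w(2) db(2)]] unfolding P .
    also have "\<dots> = fscale 2 (fIm ?p)"
      unfolding fIm_def fcnj_fscale by (simp add: fscale_def[abs_def] fun_eq_iff field_simps)
    finally have D: "\<omega> - ext_d ?b = fscale 2 (fIm ?p)" .
    \<comment> \<open>After subtraction of d Im \<eta>, the form \<omega> becomes 2 Im p with p = P
      d Re \<eta>; since \<open>r3\<close> sends Re \<eta> to - Im p, the factor is - 2.\<close>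
    let ?\<sigma> = "fscale (- 2) ?a"
    have s: "?\<sigma> \<in> RC 0" "real_form ?\<sigma>" using RC_fscale[OF a(1)] real_fscale[OF a(2), of "- 2"] by simp_all
    have Ps: "P0 1 (ext_d ?\<sigma>) = fscale (- 2) ?p" using dPd_fscale[OF a(1), of "- 2"] by simp
    have r: "r3 k ?\<sigma> = fscale 2 (fIm ?p)"
      using Ps fIm_fscale[of "- 2" ?p] True by (simp add: r3_def) (simp add: form_arith)
    \<comment> \<open>On functions D is d after \<open>r3\<close>, and the value of
      \<open>r3\<close> here is the closed form \<omega> - d Im \<eta>.\<close>
    have "DS 0 ?\<sigma> = ext_d (- fIm (P0 1 (ext_d ?\<sigma>)))" by (rule DS_0(1)) (use s in \<open>simp add: SS_def\<close>)
    also have "\<dots> = ext_d (r3 k ?\<sigma>)" using True by (simp add: r3_def)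
    also have "\<dots> = ext_d (\<omega> - ext_d ?b)" unfolding r D ..
    also have "\<dots> = 0" using d_diff[OF w1 db(1)] w(3) d_d[OF bb(1)] by simp
    finally have "?\<sigma> \<in> ZS k" using s True by (simp add: ZS_def SS_def)
    moreover have "\<omega> - r3 k ?\<sigma> = ext_d ?b" unfolding r D[symmetric] by simp
    then have "\<omega> - r3 k ?\<sigma> \<in> BR (Suc k)" using bb True by (auto simp: BR_def)
    ultimately show ?thesis by blast
  next
    case False
    \<comment> \<open>From P d Im \<eta> = P d\<eta> / (2\<i>) and \<i> P\<omega> = P d\<eta>, the
      derivative of 2 Im \<eta> has the same image under P as \<omega>.\<close>
    let ?\<tau> = "fscale 2 (fIm \<eta>)"
    let ?\<sigma> = "\<omega> - ext_d ?\<tau>"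
    have t: "?\<tau> \<in> RC k" "real_form ?\<tau>" using RC_fscale[OF i] real_fscale_numeral[OF real_fIm] by blast+
    note dt = RC_ext_d[OF t(1)]
    have s: "?\<sigma> \<in> RC (Suc k)" "real_form ?\<sigma>" using RC_diff[OF w(1) dt] real_diff[OF w(2) real_d[OF t]] by blast+
    note de = RC_ext_d[OF e(1)]
    have "P0 (Suc k) (ext_d ?\<tau>) = fscale 2 (P0 (Suc k) (fIm (ext_d \<eta>)))"
      using dPd_fscale[OF i, of 2] d_fIm[OF e(1)] by simp
    also have "P0 (Suc k) (fIm (ext_d \<eta>)) = fscale (1 / (2 * \<i>)) (P0 (Suc k) (ext_d \<eta>))"
      by (rule P0_fIm[OF de P0_fcnj_d[OF e(1) _ e(2)]]) (use False in simp)
    finally have "P0 (Suc k) (ext_d ?\<tau>) = P0 (Suc k) \<omega>" unfolding Pw by simp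
    then have "P0 (Suc k) ?\<sigma> = 0" using P0_diff[OF w(1) dt] by simp
    moreover have "ext_d ?\<sigma> = 0" using d_diff[OF w(1) dt] w(3) d_d[OF t(1)] by simp
    ultimately have "?\<sigma> \<in> ZS k" using s False by (simp add: ZS_def SS_def DS_def)
    moreover have "\<omega> - r3 k ?\<sigma> = ext_d ?\<tau>" using False by (simp add: r3_def)
    ultimately show ?thesis using t by (intro bexI[of _ ?\<sigma>]) (auto simp: BR_def)
  qed
qed

lemma induces_linear_map_cong:
  assumes f: "induces_linear_map Z B Z' B' f" and fg: "\<And>\<omega>. \<omega> \<in> Z \<Longrightarrow> f \<omega> = g \<omega>"
  shows "induces_linear_map Z B Z' B' g"
proof -
  have "real_subspace Z" "B \<subseteq> Z" using f by (simp_all add: induces_linear_map_def)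
  then have c: "\<And>x y. x \<in> Z \<Longrightarrow> y \<in> Z \<Longrightarrow> x + y \<in> Z" "\<And>r x. x \<in> Z \<Longrightarrow> fscale (of_real r) x \<in> Z" "B \<subseteq> Z"
    unfolding real_subspace_iff by blast+
  have "f ` Z = g ` Z" "f ` B = g ` B" using fg c(3) by (auto intro!: image_cong)
  then show ?thesis using f c fg unfolding induces_linear_map_def by simp
qed

section \<open>From a choice of contact forms to the choice-free spaces\<close>

context
  fixes C assumes C: "contact_choice A T C"
begin

lemma proj_d: "\<omega> \<in> RC k \<Longrightarrow> proj_pq n A T C 0 (Suc k) (ext_d \<omega>) = P0 (Suc k) (ext_d \<omega>)"
  by (rule P0_proj[OF C RC_ext_d])

lemma rumin_sets: "rumin_Z n A C k = ZR k" "rumin_B n A C k = BR k"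
  by (auto simp: rumin_Z_def rumin_B_def ZR_def BR_def rumin_RC[OF C] split: nat.split)

lemma dolb_sets: "dolb_Z n A T C 0 k = ZD k" "dolb_B n A T C 0 k = BD k"
proof -
  show "dolb_Z n A T C 0 k = ZD k"
    unfolding dolb_Z_def ZD_def P0_rumin[OF C] dbar_def by (auto simp: proj_d)
  show "dolb_B n A T C 0 k = BD k"
    unfolding dolb_B_def BD_def P0_rumin[OF C] dbar_def
    by (cases k) (auto simp: proj_d intro!: image_cong)
qed

lemma crp_SS: "crp n A T C k = SS k"
  using crp_P0[OF C, of k] by (cases "k = 0") (simp_all add: SS_def crp_def rumin_RC[OF C])

lemma crp_d_DS: "\<omega> \<in> SS k \<Longrightarrow> crp_d n A T C k \<omega> = DS k \<omega>"
  using proj_d[of \<omega> 0] by (simp add: crp_d_def DS_def SS_def dbar_def split: if_splits)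

lemma crp_sets: "crp_Z n A T C k = ZS k" "crp_B n A T C k = BS k"
proof -
  show "crp_Z n A T C k = ZS k" unfolding crp_Z_def ZS_def crp_SS using crp_d_DS by auto
  have "crp_d n A T C j ` SS j = DS j ` SS j" for j by (intro image_cong refl crp_d_DS)
  then show "crp_B n A T C k = BS k" unfolding crp_B_def BS_def crp_SS by (simp split: nat.split)
qed

lemma rep1_r1: "\<omega> \<in> RC k \<Longrightarrow> rep1 n A T C k \<omega> = r1 k \<omega>"
  by (simp add: rep1_def r1_def P0_proj[OF C])

lemma rep3_r3: "\<omega> \<in> SS k \<Longrightarrow> rep3 n A T C k \<omega> = r3 k \<omega>"
  using proj_d[of \<omega> 0] by (simp add: rep3_def r3_def SS_def dbar_def split: if_splits)

text \<open>None of the right-hand sides mentions \<open>C\<close>; the independence of the choice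
  is read off from these equations.\<close>

lemmas choice_free = rumin_sets dolb_sets crp_sets

lemma rep_induces:
  "induces_linear_map (ZR k) (BR k) (ZD k) (BD k) (rep1 n A T C k)"
  "induces_linear_map (ZS k) (BS k) (ZR (Suc k)) (BR (Suc k)) (rep3 n A T C k)"
  using induces_linear_map_cong[OF r1_induces, of k] induces_linear_map_cong[OF r3_induces, of k] rep1_r1 rep3_r3
  by (auto simp: ZR_def ZS_def)

text \<open>In degree 0 the projection is the identity and the coboundaries are zero, so the map is
  multiplication by \<i>, which is injective.\<close>

theorem exact_start:
  "exact_seq ([H_dolb n A T C 0 0, H_rumin n A C 0, singleton_group {0}],
           [mor1 n A T C 0, \<lambda>_. \<one>\<^bsub>H_rumin n A C 0\<^esub>])"
proof -
  note q = induces_linear_map_quotient_map[OF rep_induces(1)[of 0]]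
  interpret quotient_map "ZR 0" "BR 0" "ZD 0" "BD 0" "rep1 n A T C 0" by (rule q)
  interpret G: group "cohomology (ZR 0) (BR 0)" by (rule cohomology_group[OF Z])
  have "\<omega> = 0" if "\<omega> \<in> ZR 0" "rep1 n A T C 0 \<omega> \<in> BD 0" for \<omega>
  proof -
    have w: "\<omega> \<in> RC 0" using that(1) by (simp add: ZR_def)
    then have "fscale \<i> \<omega> = 0" using that(2) by (simp add: rep1_r1 r1_def P0_0 BD_def)
    then have "fscale (- \<i>) (fscale \<i> \<omega>) = 0" by simp
    then show ?thesis by simp
  qed
  moreover have "0 \<in> ZR 0" "rep1 n A T C 0 0 \<in> BD 0"
    using add_subgroupD(1)[OF Z(1)] RC_0 by (simp_all add: rep1_r1 r1_def BD_def)
  ultimately have "{\<omega> \<in> ZR 0. rep1 n A T C 0 \<omega> \<in> BD 0} = {0}" by blast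
  then have "kernel (cohomology (ZR 0) (BR 0)) (cohomology (ZD 0) (BD 0)) (mor1 n A T C 0) = {\<one>\<^bsub>cohomology (ZR 0) (BR 0)\<^esub>}"
    using induced_kernel by (simp add: mor1_def choice_free cohomology_one)
  moreover have "group_hom (singleton_group {0}) (cohomology (ZR 0) (BR 0)) (\<lambda>_. \<one>\<^bsub>cohomology (ZR 0) (BR 0)\<^esub>)"
    by (intro group_hom.intro group_hom_axioms.intro G.group_axioms) (auto simp: hom_def)
  ultimately show ?thesis
    using induced_hom cohomology_group[OF Z'] by (simp add: H_dolb_def H_rumin_def choice_free mor1_def)
qed

text \<open>Exactness holds at the three inner groups. Consecutive segments share the map from real
  to (0,k+1) cohomology in degree k + 1, and so join to the long sequence.\<close>

theorem exact_step:
  "exact_seq ([H_dolb n A T C 0 (k + 1), H_rumin n A C (k + 1), H_crp n A T C k,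
            H_dolb n A T C 0 k, H_rumin n A C k],
           [mor1 n A T C (k + 1), mor3 n A T C k, mor2 n A T C k, mor1 n A T C k])"
proof -
  note q1 = induces_linear_map_quotient_map[OF rep_induces(1)]
    and q2 = induces_linear_map_quotient_map[OF r2_induces]
    and q3 = induces_linear_map_quotient_map[OF rep_induces(2)]
  have RZ: "\<omega> \<in> ZR j \<Longrightarrow> rep1 n A T C j \<omega> = r1 j \<omega>" and SZ: "\<omega> \<in> ZS j \<Longrightarrow> rep3 n A T C j \<omega> = r3 j \<omega>" for \<omega> j
    using rep1_r1 rep3_r3 by (simp_all add: ZR_def ZS_def)
  have Z3: "r3 k \<omega> \<in> ZR (Suc k)" if "\<omega> \<in> ZS k" for \<omega>
    using quotient_map.f_Z[OF q3] SZ that by auto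
  have Z2: "rep2 k \<eta> \<in> ZS k" if "\<eta> \<in> ZD k" for \<eta> using quotient_map.f_Z[OF q2] that by auto
  have 1: "kernel (cohomology (ZD k) (BD k)) (cohomology (ZS k) (BS k)) (induced (BS k) (rep2 k)) =
      induced (BD k) (rep1 n A T C k) ` carrier (cohomology (ZR k) (BR k))"
    by (rule quotient_exact[OF q1 q2]) (use exact_dolb_1 exact_dolb_2 RZ in \<open>simp_all\<close>)
  have 2: "kernel (cohomology (ZS k) (BS k)) (cohomology (ZR (Suc k)) (BR (Suc k))) (induced (BR (Suc k)) (rep3 n A T C k)) =
      induced (BS k) (rep2 k) ` carrier (cohomology (ZD k) (BD k))"
    by (rule quotient_exact[OF q2 q3]) (use exact_crp_1 exact_crp_2 SZ Z2 in \<open>simp_all\<close>)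
  have 3: "kernel (cohomology (ZR (Suc k)) (BR (Suc k))) (cohomology (ZD (Suc k)) (BD (Suc k))) (induced (BD (Suc k)) (rep1 n A T C (Suc k))) =
      induced (BR (Suc k)) (rep3 n A T C k) ` carrier (cohomology (ZS k) (BS k))"
    by (rule quotient_exact[OF q3 q1]) (use exact_rumin_1 exact_rumin_2 SZ RZ Z3 in \<open>simp_all\<close>)
  note g = quotient_map.induced_group_hom[OF q1] quotient_map.induced_hom[OF q1] quotient_map.induced_hom[OF q2] quotient_map.induced_hom[OF q3]
    and grp = cohomology_group[OF quotient_map.Z'[OF q1]] cohomology_group[OF quotient_map.Z'[OF q2]] cohomology_group[OF quotient_map.Z'[OF q3]]
  show ?thesis
    using g grp 1 2 3 by (simp add: H_dolb_def H_rumin_def H_crp_def choice_free mor1_def mor2_def mor3_def)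
qed

end

lemma contact_choice_all: "contact_choice A T {(U, \<theta>). contact_form A T U \<theta>}"
  unfolding contact_choice_def using contact_exists by auto

end

theorem theorem7p5:
  fixes n :: nat
    and A :: "('m::{t2_space, second_countable_topology}, 'd::finite) chart set"
    and T :: "('m, 'd) distribution"
  assumes "n \<ge> 1" and "cr_manifold n A T"
  shows
    "(\<exists>C. contact_choice A T C) \<and>
     (\<forall>C. contact_choice A T C \<longrightarrow>
        (\<forall>k. induces_linear_map (rumin_Z n A C k) (rumin_B n A C k)
                (dolb_Z n A T C 0 k) (dolb_B n A T C 0 k) (rep1 n A T C k) \<and>
             induces_linear_map (dolb_Z n A T C 0 k) (dolb_B n A T C 0 k)
                (crp_Z n A T C k) (crp_B n A T C k) (rep2 k) \<and>
             induces_linear_map (crp_Z n A T C k) (crp_B n A T C k)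
                (rumin_Z n A C (k + 1)) (rumin_B n A C (k + 1)) (rep3 n A T C k)) \<and>
        exact_seq
          ([H_dolb n A T C 0 0, H_rumin n A C 0, singleton_group {0}],
           [mor1 n A T C 0, \<lambda>_. \<one>\<^bsub>H_rumin n A C 0\<^esub>]) \<and>
        (\<forall>k. exact_seq
          ([H_dolb n A T C 0 (k + 1), H_rumin n A C (k + 1), H_crp n A T C k,
            H_dolb n A T C 0 k, H_rumin n A C k],
           [mor1 n A T C (k + 1), mor3 n A T C k, mor2 n A T C k, mor1 n A T C k]))) \<and>
     (\<forall>C C'. contact_choice A T C \<and> contact_choice A T C' \<longrightarrow>
        (\<forall>k. H_rumin n A C k = H_rumin n A C' k \<and>
             H_dolb n A T C 0 k = H_dolb n A T C' 0 k \<and>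
             H_crp n A T C k = H_crp n A T C' k \<and>
             (\<forall>X\<in>carrier (H_rumin n A C k). mor1 n A T C k X = mor1 n A T C' k X) \<and>
             (\<forall>X\<in>carrier (H_dolb n A T C 0 k). mor2 n A T C k X = mor2 n A T C' k X) \<and>
             (\<forall>X\<in>carrier (H_crp n A T C k). mor3 n A T C k X = mor3 n A T C' k X)))"
proof -
  have "smooth_atlas A" using assms(2) by (simp only: cr_manifold_def)
  then interpret cr A n T
    by (intro cr.intro smooth_manifold.intro cr_axioms.intro assms)
  show ?thesis
  proof (intro conjI allI impI ballI)
    show "\<exists>C. contact_choice A T C" using contact_choice_all by blast
  next
    fix C k assume C: "contact_choice A T C"
    show "induces_linear_map (rumin_Z n A C k) (rumin_B n A C k) (dolb_Z n A T C 0 k) (dolb_B n A T C 0 k) (rep1 n A T C k)"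
      unfolding choice_free[OF C] by (rule rep_induces[OF C])
    show "induces_linear_map (dolb_Z n A T C 0 k) (dolb_B n A T C 0 k) (crp_Z n A T C k) (crp_B n A T C k) (rep2 k)"
      unfolding choice_free[OF C] by (rule r2_induces)
    show "induces_linear_map (crp_Z n A T C k) (crp_B n A T C k) (rumin_Z n A C (k + 1)) (rumin_B n A C (k + 1)) (rep3 n A T C k)"
      unfolding choice_free[OF C] using rep_induces(2)[OF C] by simp
  next
    fix C assume C: "contact_choice A T C"
    show "exact_seq ([H_dolb n A T C 0 0, H_rumin n A C 0, singleton_group {0}],
             [mor1 n A T C 0, \<lambda>_. \<one>\<^bsub>H_rumin n A C 0\<^esub>])" by (rule exact_start[OF C])
  next
    fix C k assume C: "contact_choice A T C"
    show "exact_seq ([H_dolb n A T C 0 (k + 1), H_rumin n A C (k + 1), H_crp n A T C k, H_dolb n A T C 0 k, H_rumin n A C k],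
             [mor1 n A T C (k + 1), mor3 n A T C k, mor2 n A T C k, mor1 n A T C k])" by (rule exact_step[OF C])
  next
    fix C C' k assume CC: "contact_choice A T C \<and> contact_choice A T C'"
    then have C: "contact_choice A T C" and C': "contact_choice A T C'" by blast+
    show "H_rumin n A C k = H_rumin n A C' k" "H_dolb n A T C 0 k = H_dolb n A T C' 0 k" "H_crp n A T C k = H_crp n A T C' k"
      by (simp_all add: H_rumin_def H_dolb_def H_crp_def choice_free[OF C] choice_free[OF C'])
    show "mor2 n A T C k X = mor2 n A T C' k X" for X by (simp add: mor2_def choice_free[OF C] choice_free[OF C'])
    \<comment> \<open>On cocycles both versions reduce to the same \<open>r1\<close>; off the
      carrier the definite descriptions could take different values.\<close>
    show "mor1 n A T C k X = mor1 n A T C' k X" if "X \<in> carrier (H_rumin n A C k)" for X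
      unfolding mor1_def choice_free[OF C] choice_free[OF C']
      by (rule induced_cong[of X "ZR k" "BR k"])
         (use that real_subspace_add_subgroup[OF real_subspace_Z(2)] B_subset_Z(1) rep1_r1[OF C] rep1_r1[OF C']
           in \<open>simp_all add: H_rumin_def choice_free[OF C] ZR_def\<close>)
    show "mor3 n A T C k X = mor3 n A T C' k X" if "X \<in> carrier (H_crp n A T C k)" for X
      unfolding mor3_def choice_free[OF C] choice_free[OF C']
      by (rule induced_cong[of X "ZS k" "BS k"])
         (use that real_subspace_add_subgroup[OF real_subspace_B(4)] B_subset_Z(3) rep3_r3[OF C] rep3_r3[OF C']
           in \<open>simp_all add: H_crp_def choice_free[OF C] ZS_def\<close>)
  qed
qed

end
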